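(* Let $k$ be a commutative ring and $\mathbf{a}$ an essentially small $k$-linear category. Let $\mathcal{T}$ be a $k$-linear Grothendieck topology and $\mathcal{S}$ a $k$-linear Grothendieck pretopology on $\mathbf{a}$. (i) The classes of sequences $\mathrm{pre}(\mathcal{T})$ and $\mathrm{pre}'(\mathcal{T})$ are pretopologies. (ii) The covering system $\mathrm{top}(\mathcal{S})$ is a topology. (iii) We have $\mathrm{top}(\mathrm{pre}'(\mathcal{T}))=\mathcal{T}=\mathrm{top}(\mathrm{pre}(\mathcal{T}))$. (iv) The operations $\mathrm{pre}'$ and $\mathrm{top}$ are order (inclusion) preserving. (v) For a family of pretopologies $\{\mathcal{S}_i\,|\,i\in I\}$ on $\mathbf{a}$, set $\mathcal{T}_i=\mathrm{top}(\mathcal{S}_i)$. Then $\bigvee_{i\in I}\mathcal{T}_i=\mathrm{top}(\bigcup_{i\in I}\mathcal{S}_i)$, so in particular $$\bigvee_{i\in I}\mathcal{T}_i=\mathrm{top}\Big(\bigcup_{i\in I}\mathrm{pre}(\mathcal{T}_i)\Big).$$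
   Context: All functors between $k$-linear categories are $k$-linear. $\mathsf{PSh}\,\mathbf{a}$ is the category of $k$-linear functors $\mathbf{a}^{op}\to\mathsf{Mod}_k$, with Yoneda embedding $\mathtt{Y}$. A sieve on $A$ is a $k$-linear subfunctor $R\subset\mathbf{a}(-,A)$; for $f:B\to A$, $f^{-1}R$ is the sieve on $B$ of all $g$ with $f\circ g\in R$. A covering system $\mathcal{T}$ assigns to each $A\in\mathbf{a}$ a set $\mathcal{T}(A)$ of sieves on $A$; covering systems are ordered by inclusion ($\mathcal{T}\subset\mathcal{T}'$ iff $\mathcal{T}(A)\subset\mathcal{T}'(A)$ for all $A$). A ($k$-linear Grothendieck) topology is a covering system with: (T1) $\mathbf{a}(-,A)\in\mathcal{T}(A)$; (T2) $R\in\mathcal{T}(A)$ and $f:B\to A$ imply $f^{-1}R\in\mathcal{T}(B)$; (T3) if $S$ is a sieve on $A$ and $R\in\mathcal{T}(A)$ with $f^{-1}S\in\mathcal{T}(B)$ for all $B$ and $f\in R(B)$, then $S\in\mathcal{T}(A)$. Intersections of topologies are topologies, and $\bigvee_i\mathcal{T}_i$ is the smallest topology containing all $\mathcal{T}_i$. $\mathsf{Sh}(\mathbf{a},\mathcal{T})\subset\mathsf{PSh}\,\mathbf{a}$ is the full subcategory of $F$ with $F(A)\to\mathrm{Nat}(R,F)$ an isomorphism for all $A$, $R\in\mathcal{T}(A)$; the inclusion has an exact left adjoint $\mathtt{S}$, and $\mathtt{Z}=\mathtt{S}\circ\mathtt{Y}:\mathbf{a}\to\mathsf{Sh}(\mathbf{a},\mathcal{T})$.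 Formal morphisms: for set-indexed families of objects of $\mathbf{a}$, a formal morphism $f:\amalg_\alpha A_\alpha\to\amalg_\beta B_\beta$ is an element of $\prod_\alpha\bigoplus_\beta\mathbf{a}(A_\alpha,B_\beta)$ (equivalently a morphism $\bigoplus_\alpha\mathtt{Y}(A_\alpha)\to\bigoplus_\beta\mathtt{Y}(B_\beta)$ in $\mathsf{PSh}\,\mathbf{a}$), composed accordingly. For $v=(v_\alpha):\amalg_\alpha V_\alpha\to A$, $R_v$ is the sieve on $A$ generated by all $v_\alpha$. A (formal) sequence is a pair of formal morphisms $\amalg_\gamma Z_\gamma\xrightarrow{p}\amalg_\beta Y_\beta\xrightarrow{q}X$ with $X\in\mathbf{a}$, $q\circ p=0$. For a class $\mathcal{S}$ of sequences, $\mathcal{C}o(\mathcal{S})=\mathcal{C}o^1(\mathcal{S})$ is the class of right-hand morphisms $q$; $\mathcal{C}o^0(\mathcal{S})$ is the class of identity morphisms in $\mathbf{a}$; for $i>1$, $\mathcal{C}o^i(\mathcal{S})$ consists of all $(v_\alpha\circ w(\alpha)_\delta):\amalg_\alpha\amalg_{\delta\in D(\alpha)}W_\delta(\alpha)\to X$ with $v:\amalg_\alpha V_\alpha\to X$ in $\mathcal{C}o^{i-1}(\mathcal{S})$ and, for each $\alpha$, $w(\alpha):\amalg_{\delta\in D(\alpha)}W_\delta(\alpha)\to V_\alpha$ in $\mathcal{C}o(\mathcal{S})$. Set $\widetilde{\mathcal{C}o}(\mathcal{S})=\bigcup_{i\in\mathbb{N}}\mathcal{C}o^i(\mathcal{S})$;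 a subscript $X$ means target $X$. A ($k$-linear Grothendieck) pretopology is a class $\mathcal{S}$ of sequences such that: (PTa) for each $q:\amalg_\beta Y_\beta\to X$ in $\mathcal{C}o(\mathcal{S})$ and $f:A\to X$ in $\mathbf{a}$ there exist $q':\amalg_\delta C_\delta\to A$ in $\widetilde{\mathcal{C}o}_A(\mathcal{S})$ and a formal morphism $f':\amalg_\delta C_\delta\to\amalg_\beta Y_\beta$ with $q\circ f'=f\circ q'$; (PTb) for each sequence $(p,q)$ in $\mathcal{S}$ and $f:A\to\amalg_\beta Y_\beta$ with $A\in\mathbf{a}$, $q\circ f=0$, there exist $q':\amalg_\alpha B_\alpha\to A$ in $\widetilde{\mathcal{C}o}_A(\mathcal{S})$ and $f':\amalg_\alpha B_\alpha\to\amalg_\gamma Z_\gamma$ with $p\circ f'=f\circ q'$. Pretopologies are ordered by inclusion, and the union of a family of pretopologies is a pretopology. $\mathrm{top}(\mathcal{S})$ is the covering system of all sieves $R\subset\mathbf{a}(-,X)$ containing $R_r$ for some $r\in\widetilde{\mathcal{C}o}_X(\mathcal{S})$. $\mathrm{pre}'(\mathcal{T})$ is the class of all sequences for which $\bigoplus_\gamma\mathtt{Y}(Z_\gamma)\to\bigoplus_\beta\mathtt{Y}(Y_\beta)\to\mathtt{Y}(X)$ is exact at the middle term in $\mathsf{PSh}\,\mathbf{a}$ and the image of the right-hand morphism is in $\mathcal{T}(X)$. $\mathrm{pre}(\mathcal{T})$ is the class of all sequences for which $\bigoplus_\gamma\mathtt{Z}(Z_\gamma)\to\bigoplus_\beta\mathtt{Z}(Y_\beta)\to\mathtt{Z}(X)\to0$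 is exact in $\mathsf{Sh}(\mathbf{a},\mathcal{T})$.
   Formalization: In (ii) and (v), top(S) is defined with composites of right-hand morphisms along arbitrary well-founded trees instead of the uniform-depth composites in Co~(S), since (ii) and (v) fail for the latter; (iii) and (iv) are proved for both versions of top. *)

theory Defs
  imports "HOL-Algebra.Module" "HOL-Library.FuncSet" "HOL-Library.Equipollence"
begin

section \<open>Linear categories\<close>

text \<open>The ring operations \<open>mult\<close> and \<open>one\<close> that the record type of modules inherits carry no
  meaning for a module; they are never used below.\<close>

definition mod_hom ::
  "'k ring \<Rightarrow> ('k, 'v) module \<Rightarrow> ('k, 'w) module \<Rightarrow> ('v \<Rightarrow> 'w) set" where
  "mod_hom k M N = {h \<in> carrier M \<rightarrow> carrier N.
     (\<forall>x\<in>carrier M. \<forall>y\<in>carrier M. h (x \<oplus>\<^bsub>M\<^esub> y) = h x \<oplus>\<^bsub>N\<^esub> h y) \<and>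
     (\<forall>r\<in>carrier k. \<forall>x\<in>carrier M. h (r \<odot>\<^bsub>M\<^esub> x) = r \<odot>\<^bsub>N\<^esub> h x)}"

text \<open>\<open>Cmp a A B C g f\<close> is the composite of \<open>f : A \<rightarrow> B\<close> and \<open>g : B \<rightarrow> C\<close>. As composition is
  indexed by objects, hom-modules need not be disjoint.\<close>

record ('k, 'o, 'm) lincat =
  Obj :: "'o set"
  Hom :: "'o \<Rightarrow> 'o \<Rightarrow> ('k, 'm) module"
  Cmp :: "'o \<Rightarrow> 'o \<Rightarrow> 'o \<Rightarrow> 'm \<Rightarrow> 'm \<Rightarrow> 'm"
  Idt :: "'o \<Rightarrow> 'm"

abbreviation arr :: "('k, 'o, 'm) lincat \<Rightarrow> 'o \<Rightarrow> 'o \<Rightarrow> 'm set" where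
  "arr a A B \<equiv> carrier (Hom a A B)"

locale linear_category = cring k for k :: "'k ring" +
  fixes a :: "('k, 'o, 'm) lincat"
  assumes hom_module: "\<lbrakk>A \<in> Obj a; B \<in> Obj a\<rbrakk> \<Longrightarrow> module k (Hom a A B)"
    and id_closed: "A \<in> Obj a \<Longrightarrow> Idt a A \<in> arr a A A"
    and comp_linear_right: "\<lbrakk>A \<in> Obj a; B \<in> Obj a; C \<in> Obj a; g \<in> arr a B C\<rbrakk>
      \<Longrightarrow> (\<lambda>f. Cmp a A B C g f) \<in> mod_hom k (Hom a A B) (Hom a A C)"
    and comp_linear_left: "\<lbrakk>A \<in> Obj a; B \<in> Obj a; C \<in> Obj a; f \<in> arr a A B\<rbrakk>
      \<Longrightarrow> (\<lambda>g. Cmp a A B C g f) \<in> mod_hom k (Hom a B C) (Hom a A C)"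
    and id_left: "\<lbrakk>A \<in> Obj a; B \<in> Obj a; f \<in> arr a A B\<rbrakk> \<Longrightarrow> Cmp a A B B (Idt a B) f = f"
    and id_right: "\<lbrakk>A \<in> Obj a; B \<in> Obj a; f \<in> arr a A B\<rbrakk> \<Longrightarrow> Cmp a A A B f (Idt a A) = f"
    and comp_assoc: "\<lbrakk>A \<in> Obj a; B \<in> Obj a; C \<in> Obj a; D \<in> Obj a;
        f \<in> arr a A B; g \<in> arr a B C; h \<in> arr a C D\<rbrakk>
      \<Longrightarrow> Cmp a A C D h (Cmp a A B C g f) = Cmp a A B D (Cmp a B C D h g) f"

definition iso_obj :: "('k, 'o, 'm) lincat \<Rightarrow> 'o \<Rightarrow> 'o \<Rightarrow> bool" where
  "iso_obj a A B \<longleftrightarrow> (\<exists>f\<in>arr a A B. \<exists>g\<in>arr a B A.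
     Cmp a A B A g f = Idt a A \<and> Cmp a B A B f g = Idt a B)"

text \<open>Smallness is measured by a type \<open>'i\<close>: a set is small if it injects into \<open>'i\<close>. The same type
  supplies the index sets of the families below.\<close>

definition essentially_small :: "'i itself \<Rightarrow> ('k, 'o, 'm) lincat \<Rightarrow> bool" where
  "essentially_small _ a \<longleftrightarrow>
     (\<forall>A\<in>Obj a. \<forall>B\<in>Obj a. arr a A B \<lesssim> (UNIV :: 'i set)) \<and>
     (\<exists>Ob0 \<subseteq> Obj a. Ob0 \<lesssim> (UNIV :: 'i set) \<and> (\<forall>A\<in>Obj a. \<exists>B\<in>Ob0. iso_obj a A B))"


section \<open>Presheaves\<close>

text \<open>\<open>Res F A B f : F(A) \<rightarrow> F(B)\<close> is the action of \<open>f : B \<rightarrow> A\<close>.\<close>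

record ('k, 'o, 'm, 'v) psh =
  Val :: "'o \<Rightarrow> ('k, 'v) module"
  Res :: "'o \<Rightarrow> 'o \<Rightarrow> 'm \<Rightarrow> 'v \<Rightarrow> 'v"

definition presheaf :: "'k ring \<Rightarrow> ('k, 'o, 'm) lincat \<Rightarrow> ('k, 'o, 'm, 'v) psh \<Rightarrow> bool" where
  "presheaf k a F \<longleftrightarrow>
     (\<forall>A\<in>Obj a. module k (Val F A)) \<and>
     (\<forall>A\<in>Obj a. \<forall>B\<in>Obj a. \<forall>f\<in>arr a B A. Res F A B f \<in> mod_hom k (Val F A) (Val F B)) \<and>
     (\<forall>A\<in>Obj a. \<forall>x\<in>carrier (Val F A). Res F A A (Idt a A) x = x) \<and>
     (\<forall>A\<in>Obj a. \<forall>B\<in>Obj a. \<forall>C\<in>Obj a. \<forall>f\<in>arr a B A. \<forall>g\<in>arr a C B. \<forall>x\<in>carrier (Val F A).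
        Res F A C (Cmp a C B A f g) x = Res F B C g (Res F A B f x)) \<and>
     (\<forall>A\<in>Obj a. \<forall>B\<in>Obj a. \<forall>x\<in>carrier (Val F A).
        (\<lambda>f. Res F A B f x) \<in> mod_hom k (Hom a B A) (Val F B))"

definition yoneda :: "('k, 'o, 'm) lincat \<Rightarrow> 'o \<Rightarrow> ('k, 'o, 'm, 'm) psh" where
  "yoneda a A = \<lparr>Val = (\<lambda>B. Hom a B A), Res = (\<lambda>B C f g. Cmp a C B A g f)\<rparr>"

definition nat_trans :: "'k ring \<Rightarrow> ('k, 'o, 'm) lincat \<Rightarrow> ('k, 'o, 'm, 'v) psh
    \<Rightarrow> ('k, 'o, 'm, 'w) psh \<Rightarrow> ('o \<Rightarrow> 'v \<Rightarrow> 'w) \<Rightarrow> bool" where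
  "nat_trans k a F G \<phi> \<longleftrightarrow>
     (\<forall>A\<in>Obj a. \<phi> A \<in> mod_hom k (Val F A) (Val G A)) \<and>
     (\<forall>A\<in>Obj a. \<forall>B\<in>Obj a. \<forall>f\<in>arr a B A. \<forall>x\<in>carrier (Val F A).
        \<phi> B (Res F A B f x) = Res G A B f (\<phi> A x))"

text \<open>A subfunctor is given by its values, which are required to be empty outside \<open>Obj a\<close> so that
  subfunctors can be compared as functions.\<close>

definition subfunctor :: "'k ring \<Rightarrow> ('k, 'o, 'm) lincat \<Rightarrow> ('k, 'o, 'm, 'v) psh
    \<Rightarrow> ('o \<Rightarrow> 'v set) \<Rightarrow> bool" where
  "subfunctor k a F H \<longleftrightarrow>
     (\<forall>A\<in>Obj a. submodule (H A) k (Val F A)) \<and>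
     (\<forall>A\<in>Obj a. \<forall>B\<in>Obj a. \<forall>f\<in>arr a B A. \<forall>x\<in>H A. Res F A B f x \<in> H B) \<and>
     (\<forall>A. A \<notin> Obj a \<longrightarrow> H A = {})"

definition sub_psh :: "('k, 'o, 'm, 'v) psh \<Rightarrow> ('o \<Rightarrow> 'v set) \<Rightarrow> ('k, 'o, 'm, 'v) psh" where
  "sub_psh F H = F\<lparr>Val := (\<lambda>A. (Val F A)\<lparr>carrier := H A\<rparr>)\<rparr>"

definition psh_all :: "('k, 'o, 'm) lincat \<Rightarrow> ('k, 'o, 'm, 'v) psh \<Rightarrow> 'o \<Rightarrow> 'v set" where
  "psh_all a F = (\<lambda>A. if A \<in> Obj a then carrier (Val F A) else {})"

definition psh_image :: "('k, 'o, 'm) lincat \<Rightarrow> ('k, 'o, 'm, 'v) psh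
    \<Rightarrow> ('o \<Rightarrow> 'v \<Rightarrow> 'w) \<Rightarrow> 'o \<Rightarrow> 'w set" where
  "psh_image a F \<phi> = (\<lambda>A. \<phi> A ` psh_all a F A)"

definition psh_kernel :: "('k, 'o, 'm) lincat \<Rightarrow> ('k, 'o, 'm, 'v) psh \<Rightarrow> ('k, 'o, 'm, 'w) psh
    \<Rightarrow> ('o \<Rightarrow> 'v \<Rightarrow> 'w) \<Rightarrow> 'o \<Rightarrow> 'v set" where
  "psh_kernel a F G \<phi> = (\<lambda>A. {x \<in> psh_all a F A. \<phi> A x = \<zero>\<^bsub>Val G A\<^esub>})"

definition dsum :: "'i set \<Rightarrow> ('i \<Rightarrow> ('k, 'v) module) \<Rightarrow> ('k, 'i \<Rightarrow> 'v) module" where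
  "dsum I M = \<lparr>carrier = {x \<in> (\<Pi>\<^sub>E i\<in>I. carrier (M i)). finite {i \<in> I. x i \<noteq> \<zero>\<^bsub>M i\<^esub>}},
     mult = undefined, one = undefined,
     zero = (\<lambda>i\<in>I. \<zero>\<^bsub>M i\<^esub>),
     add = (\<lambda>x y. \<lambda>i\<in>I. x i \<oplus>\<^bsub>M i\<^esub> y i),
     smult = (\<lambda>r x. \<lambda>i\<in>I. r \<odot>\<^bsub>M i\<^esub> x i)\<rparr>"

definition psum :: "'i set \<Rightarrow> ('i \<Rightarrow> ('k, 'o, 'm, 'v) psh) \<Rightarrow> ('k, 'o, 'm, 'i \<Rightarrow> 'v) psh" where
  "psum I F = \<lparr>Val = (\<lambda>A. dsum I (\<lambda>i. Val (F i) A)),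
     Res = (\<lambda>A B f x. \<lambda>i\<in>I. Res (F i) A B f (x i))\<rparr>"

text \<open>The morphism \<open>\<Oplus>\<^sub>i F\<^sub>i \<rightarrow> G\<close> with components \<open>\<phi> i : F\<^sub>i \<rightarrow> G\<close>, and the morphism
  \<open>\<Oplus>\<^sub>i F\<^sub>i \<rightarrow> \<Oplus>\<^sub>j G\<^sub>j\<close> with matrix \<open>\<Phi> i j : F\<^sub>i \<rightarrow> G\<^sub>j\<close>.\<close>

definition copair :: "'i set \<Rightarrow> ('i \<Rightarrow> ('k, 'o, 'm, 'v) psh) \<Rightarrow> ('k, 'o, 'm, 'w) psh
    \<Rightarrow> ('i \<Rightarrow> 'o \<Rightarrow> 'v \<Rightarrow> 'w) \<Rightarrow> 'o \<Rightarrow> ('i \<Rightarrow> 'v) \<Rightarrow> 'w" where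
  "copair I F G \<phi> = (\<lambda>A x. \<Oplus>\<^bsub>Val G A\<^esub>i\<in>{i \<in> I. x i \<noteq> \<zero>\<^bsub>Val (F i) A\<^esub>}. \<phi> i A (x i))"

definition matrix_map :: "'i set \<Rightarrow> ('i \<Rightarrow> ('k, 'o, 'm, 'v) psh)
    \<Rightarrow> 'j set \<Rightarrow> ('j \<Rightarrow> ('k, 'o, 'm, 'w) psh)
    \<Rightarrow> ('i \<Rightarrow> 'j \<Rightarrow> 'o \<Rightarrow> 'v \<Rightarrow> 'w) \<Rightarrow> 'o \<Rightarrow> ('i \<Rightarrow> 'v) \<Rightarrow> 'j \<Rightarrow> 'w" where
  "matrix_map I F J G \<Phi> = (\<lambda>A x. \<lambda>j\<in>J. copair I F (G j) (\<lambda>i. \<Phi> i j) A x)"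


section \<open>Topologies and sheaves\<close>

type_synonym ('o, 'm) sieve = "'o \<Rightarrow> 'm set"
type_synonym ('o, 'm) cov = "'o \<Rightarrow> ('o, 'm) sieve set"

definition sieve :: "'k ring \<Rightarrow> ('k, 'o, 'm) lincat \<Rightarrow> 'o \<Rightarrow> ('o, 'm) sieve \<Rightarrow> bool" where
  "sieve k a A R \<longleftrightarrow> subfunctor k a (yoneda a A) R"

abbreviation max_sieve :: "('k, 'o, 'm) lincat \<Rightarrow> 'o \<Rightarrow> ('o, 'm) sieve" where
  "max_sieve a A \<equiv> psh_all a (yoneda a A)"

text \<open>\<open>pull a A R B f\<close> is \<open>f\<^sup>-\<^sup>1R\<close> for a sieve \<open>R\<close> on \<open>A\<close> and \<open>f : B \<rightarrow> A\<close>.\<close>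

definition pull :: "('k, 'o, 'm) lincat \<Rightarrow> 'o \<Rightarrow> ('o, 'm) sieve \<Rightarrow> 'o \<Rightarrow> 'm \<Rightarrow> ('o, 'm) sieve" where
  "pull a A R B f = (\<lambda>C. {g \<in> max_sieve a B C. Cmp a C B A f g \<in> R C})"

definition covering_system :: "'k ring \<Rightarrow> ('k, 'o, 'm) lincat \<Rightarrow> ('o, 'm) cov \<Rightarrow> bool" where
  "covering_system k a T \<longleftrightarrow>
     (\<forall>A\<in>Obj a. \<forall>R\<in>T A. sieve k a A R) \<and> (\<forall>A. A \<notin> Obj a \<longrightarrow> T A = {})"

definition topology :: "'k ring \<Rightarrow> ('k, 'o, 'm) lincat \<Rightarrow> ('o, 'm) cov \<Rightarrow> bool" where
  "topology k a T \<longleftrightarrow> covering_system k a T \<and>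
     (\<forall>A\<in>Obj a. max_sieve a A \<in> T A) \<and>
     (\<forall>A\<in>Obj a. \<forall>B\<in>Obj a. \<forall>R\<in>T A. \<forall>f\<in>arr a B A. pull a A R B f \<in> T B) \<and>
     (\<forall>A\<in>Obj a. \<forall>S R. sieve k a A S \<and> R \<in> T A \<and> (\<forall>B\<in>Obj a. \<forall>f\<in>R B. pull a A S B f \<in> T B)
        \<longrightarrow> S \<in> T A)"

definition top_join :: "'k ring \<Rightarrow> ('k, 'o, 'm) lincat \<Rightarrow> 'j set \<Rightarrow> ('j \<Rightarrow> ('o, 'm) cov)
    \<Rightarrow> ('o, 'm) cov" where
  "top_join k a I T = (LEAST J. topology k a J \<and> (\<forall>i\<in>I. T i \<le> J))"

definition sheaf :: "'k ring \<Rightarrow> ('k, 'o, 'm) lincat \<Rightarrow> ('o, 'm) cov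
    \<Rightarrow> ('k, 'o, 'm, 'v) psh \<Rightarrow> bool" where
  "sheaf k a T F \<longleftrightarrow> presheaf k a F \<and>
     (\<forall>A\<in>Obj a. \<forall>R\<in>T A. \<forall>s. nat_trans k a (sub_psh (yoneda a A) R) F s \<longrightarrow>
        (\<exists>!x. x \<in> carrier (Val F A) \<and> (\<forall>B\<in>Obj a. \<forall>f\<in>R B. s B f = Res F A B f x)))"


subsection \<open>Sheafification\<close>

text \<open>Sheafification is the twofold application of the plus construction
  \<open>F\<^sup>+(A) = colim Nat(R, F)\<close>, the filtered colimit over all \<open>R \<in> T(A)\<close>. Its elements are
  classes of pairs \<open>(R, s)\<close> with \<open>s : R \<rightarrow> F\<close>, two pairs being identified if they agree on a
  covering sieve contained in both domains. The unions below only choose representatives.\<close>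

type_synonym ('o, 'm, 'v) germ = "('o, 'm) sieve \<times> ('o \<Rightarrow> 'm \<Rightarrow> 'v)"

definition germs :: "'k ring \<Rightarrow> ('k, 'o, 'm) lincat \<Rightarrow> ('o, 'm) cov
    \<Rightarrow> ('k, 'o, 'm, 'v) psh \<Rightarrow> 'o \<Rightarrow> ('o, 'm, 'v) germ set" where
  "germs k a T F A = {(R, s). R \<in> T A \<and> nat_trans k a (sub_psh (yoneda a A) R) F s}"

definition germ_rel :: "'k ring \<Rightarrow> ('k, 'o, 'm) lincat \<Rightarrow> ('o, 'm) cov
    \<Rightarrow> ('k, 'o, 'm, 'v) psh \<Rightarrow> 'o \<Rightarrow> ('o, 'm, 'v) germ rel" where
  "germ_rel k a T F A = {((R, s), (Q, t)).
     (R, s) \<in> germs k a T F A \<and> (Q, t) \<in> germs k a T F A \<and>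
     (\<exists>P\<in>T A. P \<le> R \<and> P \<le> Q \<and> (\<forall>B\<in>Obj a. \<forall>f\<in>P B. s B f = t B f))}"

definition plus :: "'k ring \<Rightarrow> ('k, 'o, 'm) lincat \<Rightarrow> ('o, 'm) cov
    \<Rightarrow> ('k, 'o, 'm, 'v) psh \<Rightarrow> ('k, 'o, 'm, ('o, 'm, 'v) germ set) psh" where
  "plus k a T F = \<lparr>
     Val = (\<lambda>A. \<lparr>carrier = germs k a T F A // germ_rel k a T F A,
       mult = undefined, one = undefined,
       zero = germ_rel k a T F A `` {(max_sieve a A, \<lambda>B f. \<zero>\<^bsub>Val F B\<^esub>)},
       add = (\<lambda>c d. \<Union>(R, s)\<in>c. \<Union>(Q, t)\<in>d.
         germ_rel k a T F A `` {(inf R Q, \<lambda>B f. s B f \<oplus>\<^bsub>Val F B\<^esub> t B f)}),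
       smult = (\<lambda>r c. \<Union>(R, s)\<in>c.
         germ_rel k a T F A `` {(R, \<lambda>B f. r \<odot>\<^bsub>Val F B\<^esub> s B f)})\<rparr>),
     Res = (\<lambda>A B f c. \<Union>(R, s)\<in>c.
       germ_rel k a T F B `` {(pull a A R B f, \<lambda>C g. s C (Cmp a C B A f g))})\<rparr>"

definition plus_map :: "'k ring \<Rightarrow> ('k, 'o, 'm) lincat \<Rightarrow> ('o, 'm) cov \<Rightarrow> ('k, 'o, 'm, 'w) psh
    \<Rightarrow> ('o \<Rightarrow> 'v \<Rightarrow> 'w) \<Rightarrow> 'o \<Rightarrow> ('o, 'm, 'v) germ set \<Rightarrow> ('o, 'm, 'w) germ set" where
  "plus_map k a T G \<phi> = (\<lambda>A c. \<Union>(R, s)\<in>c. germ_rel k a T G A `` {(R, \<lambda>B f. \<phi> B (s B f))})"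

type_synonym ('o, 'm, 'v) shv = "('o, 'm, ('o, 'm, 'v) germ set) germ set"

definition sheafify :: "'k ring \<Rightarrow> ('k, 'o, 'm) lincat \<Rightarrow> ('o, 'm) cov
    \<Rightarrow> ('k, 'o, 'm, 'v) psh \<Rightarrow> ('k, 'o, 'm, ('o, 'm, 'v) shv) psh" where
  "sheafify k a T F = plus k a T (plus k a T F)"

text \<open>\<open>sheafify_map k a T G \<phi>\<close> is the action of sheafification on \<open>\<phi> : F \<rightarrow> G\<close>.\<close>

definition sheafify_map :: "'k ring \<Rightarrow> ('k, 'o, 'm) lincat \<Rightarrow> ('o, 'm) cov
    \<Rightarrow> ('k, 'o, 'm, 'w) psh \<Rightarrow> ('o \<Rightarrow> 'v \<Rightarrow> 'w)
    \<Rightarrow> 'o \<Rightarrow> ('o, 'm, 'v) shv \<Rightarrow> ('o, 'm, 'w) shv" where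
  "sheafify_map k a T G \<phi> = plus_map k a T (plus k a T G) (plus_map k a T G \<phi>)"

definition Zobj :: "'k ring \<Rightarrow> ('k, 'o, 'm) lincat \<Rightarrow> ('o, 'm) cov \<Rightarrow> 'o
    \<Rightarrow> ('k, 'o, 'm, ('o, 'm, 'm) shv) psh" where
  "Zobj k a T A = sheafify k a T (yoneda a A)"

definition Ymap :: "('k, 'o, 'm) lincat \<Rightarrow> 'o \<Rightarrow> 'o \<Rightarrow> 'm \<Rightarrow> 'o \<Rightarrow> 'm \<Rightarrow> 'm" where
  "Ymap a A B f = (\<lambda>C g. Cmp a C A B f g)"

definition Zmap :: "'k ring \<Rightarrow> ('k, 'o, 'm) lincat \<Rightarrow> ('o, 'm) cov \<Rightarrow> 'o \<Rightarrow> 'o \<Rightarrow> 'm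
    \<Rightarrow> 'o \<Rightarrow> ('o, 'm, 'm) shv \<Rightarrow> ('o, 'm, 'm) shv" where
  "Zmap k a T A B f = sheafify_map k a T (yoneda a B) (Ymap a A B f)"


subsection \<open>Exactness in the category of sheaves\<close>

text \<open>The image of a morphism into a sheaf \<open>G\<close>, taken in the abelian category of sheaves, is the
  smallest subobject of \<open>G\<close> through which the morphism factors, that is, the smallest subfunctor
  that is a sheaf and contains all values. Kernels are computed as for presheaves.\<close>

definition subsheaf :: "'k ring \<Rightarrow> ('k, 'o, 'm) lincat \<Rightarrow> ('o, 'm) cov
    \<Rightarrow> ('k, 'o, 'm, 'v) psh \<Rightarrow> ('o \<Rightarrow> 'v set) \<Rightarrow> bool" where
  "subsheaf k a T G H \<longleftrightarrow> subfunctor k a G H \<and> sheaf k a T (sub_psh G H)"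

definition sh_image :: "'k ring \<Rightarrow> ('k, 'o, 'm) lincat \<Rightarrow> ('o, 'm) cov \<Rightarrow> ('k, 'o, 'm, 'v) psh
    \<Rightarrow> ('k, 'o, 'm, 'w) psh \<Rightarrow> ('o \<Rightarrow> 'v \<Rightarrow> 'w) \<Rightarrow> 'o \<Rightarrow> 'w set" where
  "sh_image k a T F G \<phi> = (LEAST H. subsheaf k a T G H \<and> psh_image a F \<phi> \<le> H)"

text \<open>Exactness of \<open>F \<rightarrow> G \<rightarrow> H \<rightarrow> 0\<close> in the category of sheaves.\<close>

definition sh_right_exact :: "'k ring \<Rightarrow> ('k, 'o, 'm) lincat \<Rightarrow> ('o, 'm) cov
    \<Rightarrow> ('k, 'o, 'm, 'u) psh \<Rightarrow> ('k, 'o, 'm, 'v) psh \<Rightarrow> ('k, 'o, 'm, 'w) psh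
    \<Rightarrow> ('o \<Rightarrow> 'u \<Rightarrow> 'v) \<Rightarrow> ('o \<Rightarrow> 'v \<Rightarrow> 'w) \<Rightarrow> bool" where
  "sh_right_exact k a T F G H \<phi> \<psi> \<longleftrightarrow>
     sh_image k a T F G \<phi> = psh_kernel a G H \<psi> \<and> sh_image k a T G H \<psi> = psh_all a H"


section \<open>Formal morphisms and sequences\<close>

text \<open>A formal coproduct is a family of objects indexed by a set of indices; an object is the
  family with the single index \<open>()\<close>. All functions are extensional, so that formal morphisms which
  agree on their index sets are equal.\<close>

record ('i, 'o) fam =
  Ix :: "'i set"
  At :: "'i \<Rightarrow> 'o"

record ('i, 'j, 'o, 'm) fmor =
  Dom :: "('i, 'o) fam"
  Cod :: "('j, 'o) fam"
  Ent :: "'i \<Rightarrow> 'j \<Rightarrow> 'm"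

definition family :: "('k, 'o, 'm) lincat \<Rightarrow> ('i, 'o) fam \<Rightarrow> bool" where
  "family a D \<longleftrightarrow> At D \<in> Ix D \<rightarrow>\<^sub>E Obj a"

definition one_fam :: "'o \<Rightarrow> (unit, 'o) fam" where
  "one_fam A = \<lparr>Ix = {()}, At = (\<lambda>_. A)\<rparr>"

definition formal_morphism :: "('k, 'o, 'm) lincat \<Rightarrow> ('i, 'j, 'o, 'm) fmor \<Rightarrow> bool" where
  "formal_morphism a f \<longleftrightarrow> family a (Dom f) \<and> family a (Cod f) \<and>
     Ent f \<in> (\<Pi>\<^sub>E \<alpha>\<in>Ix (Dom f).
       carrier (dsum (Ix (Cod f)) (\<lambda>\<beta>. Hom a (At (Dom f) \<alpha>) (At (Cod f) \<beta>))))"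

definition fcomp :: "('k, 'o, 'm) lincat \<Rightarrow> ('j, 'l, 'o, 'm) fmor \<Rightarrow> ('i, 'j, 'o, 'm) fmor
    \<Rightarrow> ('i, 'l, 'o, 'm) fmor" where
  "fcomp a g f = \<lparr>Dom = Dom f, Cod = Cod g,
     Ent = (\<lambda>\<alpha>\<in>Ix (Dom f). \<lambda>\<gamma>\<in>Ix (Cod g).
       \<Oplus>\<^bsub>Hom a (At (Dom f) \<alpha>) (At (Cod g) \<gamma>)\<^esub>
         \<beta>\<in>{\<beta> \<in> Ix (Dom g). Ent f \<alpha> \<beta> \<noteq> \<zero>\<^bsub>Hom a (At (Dom f) \<alpha>) (At (Dom g) \<beta>)\<^esub>}.
           Cmp a (At (Dom f) \<alpha>) (At (Dom g) \<beta>) (At (Cod g) \<gamma>) (Ent g \<beta> \<gamma>) (Ent f \<alpha> \<beta>))\<rparr>"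

definition zero_fmor :: "('k, 'o, 'm) lincat \<Rightarrow> ('i, 'o) fam \<Rightarrow> ('j, 'o) fam
    \<Rightarrow> ('i, 'j, 'o, 'm) fmor" where
  "zero_fmor a D E = \<lparr>Dom = D, Cod = E,
     Ent = (\<lambda>\<alpha>\<in>Ix D. \<lambda>\<beta>\<in>Ix E. \<zero>\<^bsub>Hom a (At D \<alpha>) (At E \<beta>)\<^esub>)\<rparr>"

definition obj_fmor :: "'o \<Rightarrow> 'o \<Rightarrow> 'm \<Rightarrow> (unit, unit, 'o, 'm) fmor" where
  "obj_fmor A B f = \<lparr>Dom = one_fam A, Cod = one_fam B, Ent = (\<lambda>_ _. f)\<rparr>"

type_synonym ('i, 'o, 'm) seqn = "('i, 'i, 'o, 'm) fmor \<times> ('i, unit, 'o, 'm) fmor"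

definition sequence :: "('k, 'o, 'm) lincat \<Rightarrow> ('i, 'o, 'm) seqn \<Rightarrow> bool" where
  "sequence a = (\<lambda>(p, q). formal_morphism a p \<and> formal_morphism a q \<and> Cod p = Dom q \<and>
     (\<exists>X\<in>Obj a. Cod q = one_fam X) \<and> fcomp a q p = zero_fmor a (Dom p) (Cod q))"

text \<open>The sieve generated by the components of \<open>v\<close>, whose target is a single object.\<close>

definition gen_sieve :: "'k ring \<Rightarrow> ('k, 'o, 'm) lincat \<Rightarrow> ('i, unit, 'o, 'm) fmor
    \<Rightarrow> ('o, 'm) sieve" where
  "gen_sieve k a v = (LEAST R. sieve k a (At (Cod v) ()) R \<and>
     (\<forall>\<alpha>\<in>Ix (Dom v). Ent v \<alpha> () \<in> R (At (Dom v) \<alpha>)))"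


subsection \<open>Iterated coverings\<close>

definition Co :: "('i, 'o, 'm) seqn set \<Rightarrow> ('i, unit, 'o, 'm) fmor set" where
  "Co S = snd ` S"

text \<open>The family of all composites \<open>v\<^sub>\<alpha> \<circ> w(\<alpha>)\<^sub>\<delta>\<close>, indexed by the pairs \<open>(\<alpha>, \<delta>)\<close>.\<close>

definition fam_comp :: "('k, 'o, 'm) lincat \<Rightarrow> ('i, unit, 'o, 'm) fmor
    \<Rightarrow> ('i \<Rightarrow> ('j, unit, 'o, 'm) fmor) \<Rightarrow> ('i \<times> 'j, unit, 'o, 'm) fmor" where
  "fam_comp a v w = (let I = (SIGMA \<alpha>:Ix (Dom v). Ix (Dom (w \<alpha>))) in
     \<lparr>Dom = \<lparr>Ix = I, At = (\<lambda>(\<alpha>, \<delta>)\<in>I. At (Dom (w \<alpha>)) \<delta>)\<rparr>, Cod = Cod v,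
      Ent = (\<lambda>(\<alpha>, \<delta>)\<in>I. \<lambda>_. Cmp a (At (Dom (w \<alpha>)) \<delta>) (At (Dom v) \<alpha>) (At (Cod v) ())
                                (Ent v \<alpha> ()) (Ent (w \<alpha>) \<delta> ()))\<rparr>)"

text \<open>Renaming of the indices of the source along an injection. An \<open>n\<close>-fold composite is indexed by
  lists of length \<open>n\<close>, which list the indices from the target to the source.\<close>

definition relabel :: "('i \<Rightarrow> 'j) \<Rightarrow> ('i, unit, 'o, 'm) fmor \<Rightarrow> ('j, unit, 'o, 'm) fmor" where
  "relabel h v = \<lparr>
     Dom = \<lparr>Ix = h ` Ix (Dom v), At = (\<lambda>j\<in>h ` Ix (Dom v). At (Dom v) (inv_into (Ix (Dom v)) h j))\<rparr>,
     Cod = Cod v,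
     Ent = (\<lambda>j\<in>h ` Ix (Dom v). Ent v (inv_into (Ix (Dom v)) h j))\<rparr>"

definition ident_fmor :: "('k, 'o, 'm) lincat \<Rightarrow> 'o \<Rightarrow> ('i list, unit, 'o, 'm) fmor" where
  "ident_fmor a X = relabel (\<lambda>_. []) (obj_fmor X X (Idt a X))"

fun Co_iter :: "('k, 'o, 'm) lincat \<Rightarrow> ('i, 'o, 'm) seqn set \<Rightarrow> nat
    \<Rightarrow> ('i list, unit, 'o, 'm) fmor set" where
  "Co_iter a S 0 = ident_fmor a ` Obj a"
| "Co_iter a S (Suc 0) = relabel (\<lambda>\<beta>. [\<beta>]) ` Co S"
| "Co_iter a S (Suc (Suc n)) = {relabel (\<lambda>(\<alpha>, \<delta>). \<alpha> @ [\<delta>]) (fam_comp a v w) | v w.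
     v \<in> Co_iter a S (Suc n) \<and>
     (\<forall>\<alpha>\<in>Ix (Dom v). w \<alpha> \<in> Co S \<and> Cod (w \<alpha>) = one_fam (At (Dom v) \<alpha>))}"

definition Co_tilde :: "('k, 'o, 'm) lincat \<Rightarrow> ('i, 'o, 'm) seqn set
    \<Rightarrow> ('i list, unit, 'o, 'm) fmor set" where
  "Co_tilde a S = (\<Union>n. Co_iter a S n)"

text \<open>The composites in \<open>Co_tilde\<close> have the same finite depth on all branches. This class is not
  closed under composition: branches may have different, even unbounded, depths. For
  example, in the linearisation of the poset \<open>A < X\<close>, \<open>C < B < X\<close>, the sequences
  \<open>0 \<rightarrow> A \<amalg> B \<rightarrow> X\<close> and \<open>0 \<rightarrow> C \<rightarrow> B\<close> form a pretopology, but no element of \<open>Co_tilde\<close> refines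
  the family \<open>A \<amalg> C \<rightarrow> X\<close>, because no right-hand morphism has target \<open>A\<close>; so the sieves that
  contain some \<open>R\<^sub>r\<close> with \<open>r\<close> in \<open>Co_tilde\<close> violate the transitivity axiom. The following
  closure allows arbitrary well-founded trees of compositions and contains \<open>Co_tilde\<close>.\<close>

inductive_set Co_closure :: "('k, 'o, 'm) lincat \<Rightarrow> ('i, 'o, 'm) seqn set
    \<Rightarrow> ('i list, unit, 'o, 'm) fmor set"
  for a :: "('k, 'o, 'm) lincat" and S :: "('i, 'o, 'm) seqn set" where
  ident: "X \<in> Obj a \<Longrightarrow> ident_fmor a X \<in> Co_closure a S"
| comp: "\<lbrakk>q \<in> Co S; \<And>\<beta>. \<beta> \<in> Ix (Dom q) \<Longrightarrow> w \<beta> \<in> Co_closure a S;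
      \<And>\<beta>. \<beta> \<in> Ix (Dom q) \<Longrightarrow> Cod (w \<beta>) = one_fam (At (Dom q) \<beta>)\<rbrakk>
    \<Longrightarrow> relabel (\<lambda>(\<beta>, l). \<beta> # l) (fam_comp a q w) \<in> Co_closure a S"


section \<open>Pretopologies\<close>

definition PTa :: "('k, 'o, 'm) lincat \<Rightarrow> ('i, 'o, 'm) seqn set \<Rightarrow> bool" where
  "PTa a S \<longleftrightarrow> (\<forall>q\<in>Co S. \<forall>X\<in>Obj a. Cod q = one_fam X \<longrightarrow>
     (\<forall>A\<in>Obj a. \<forall>f\<in>arr a A X.
        \<exists>q'\<in>Co_tilde a S. Cod q' = one_fam A \<and>
          (\<exists>f'. formal_morphism a f' \<and> Dom f' = Dom q' \<and> Cod f' = Dom q \<and>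
             fcomp a q f' = fcomp a (obj_fmor A X f) q')))"

definition PTb :: "('k, 'o, 'm) lincat \<Rightarrow> ('i, 'o, 'm) seqn set \<Rightarrow> bool" where
  "PTb a S \<longleftrightarrow> (\<forall>(p, q)\<in>S. \<forall>A\<in>Obj a. \<forall>f. formal_morphism a f \<and> Dom f = one_fam A \<and>
     Cod f = Dom q \<and> fcomp a q f = zero_fmor a (Dom f) (Cod q) \<longrightarrow>
        (\<exists>q'\<in>Co_tilde a S. Cod q' = one_fam A \<and>
          (\<exists>f'. formal_morphism a f' \<and> Dom f' = Dom q' \<and> Cod f' = Dom p \<and>
             fcomp a p f' = fcomp a f q')))"

definition pretopology :: "('k, 'o, 'm) lincat \<Rightarrow> ('i, 'o, 'm) seqn set \<Rightarrow> bool" where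
  "pretopology a S \<longleftrightarrow> (\<forall>s\<in>S. sequence a s) \<and> PTa a S \<and> PTb a S"

definition sieves_over :: "'k ring \<Rightarrow> ('k, 'o, 'm) lincat \<Rightarrow> ('i, unit, 'o, 'm) fmor set
    \<Rightarrow> ('o, 'm) cov" where
  "sieves_over k a C = (\<lambda>X. {R. X \<in> Obj a \<and> sieve k a X R \<and>
     (\<exists>r\<in>C. Cod r = one_fam X \<and> gen_sieve k a r \<le> R)})"

definition top_fin :: "'k ring \<Rightarrow> ('k, 'o, 'm) lincat \<Rightarrow> ('i, 'o, 'm) seqn set \<Rightarrow> ('o, 'm) cov" where
  "top_fin k a S = sieves_over k a (Co_tilde a S)"

definition top_of :: "'k ring \<Rightarrow> ('k, 'o, 'm) lincat \<Rightarrow> ('i, 'o, 'm) seqn set \<Rightarrow> ('o, 'm) cov" where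
  "top_of k a S = sieves_over k a (Co_closure a S)"

definition pre'_of :: "('k, 'o, 'm) lincat \<Rightarrow> ('o, 'm) cov \<Rightarrow> ('i, 'o, 'm) seqn set" where
  "pre'_of a T = {(p, q). sequence a (p, q) \<and>
     (let X = At (Cod q) ();
          F = (\<lambda>\<gamma>. yoneda a (At (Dom p) \<gamma>));
          G = (\<lambda>\<beta>. yoneda a (At (Dom q) \<beta>));
          \<phi> = matrix_map (Ix (Dom p)) F (Ix (Dom q)) G
                (\<lambda>\<gamma> \<beta>. Ymap a (At (Dom p) \<gamma>) (At (Dom q) \<beta>) (Ent p \<gamma> \<beta>));
          \<psi> = copair (Ix (Dom q)) G (yoneda a X) (\<lambda>\<beta>. Ymap a (At (Dom q) \<beta>) X (Ent q \<beta> ()))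
      in psh_image a (psum (Ix (Dom p)) F) \<phi> = psh_kernel a (psum (Ix (Dom q)) G) (yoneda a X) \<psi> \<and>
         psh_image a (psum (Ix (Dom q)) G) \<psi> \<in> T X)}"

text \<open>Direct sums of sheaves are the sheafified direct sums of presheaves: the sequence of
  sheaves is the sheafification of \<open>\<Oplus>\<^sub>\<gamma> Z(Z\<^sub>\<gamma>) \<rightarrow> \<Oplus>\<^sub>\<beta> Z(Y\<^sub>\<beta>) \<rightarrow> Z(X)\<close> formed in presheaves,
  whose last term is a sheaf already and therefore isomorphic to its sheafification.\<close>

definition pre_of :: "'k ring \<Rightarrow> ('k, 'o, 'm) lincat \<Rightarrow> ('o, 'm) cov
    \<Rightarrow> ('i, 'o, 'm) seqn set" where
  "pre_of k a T = {(p, q). sequence a (p, q) \<and>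
     (let X = At (Cod q) ();
          F = (\<lambda>\<gamma>. Zobj k a T (At (Dom p) \<gamma>));
          G = (\<lambda>\<beta>. Zobj k a T (At (Dom q) \<beta>));
          \<phi> = matrix_map (Ix (Dom p)) F (Ix (Dom q)) G
                (\<lambda>\<gamma> \<beta>. Zmap k a T (At (Dom p) \<gamma>) (At (Dom q) \<beta>) (Ent p \<gamma> \<beta>));
          \<psi> = copair (Ix (Dom q)) G (Zobj k a T X)
                (\<lambda>\<beta>. Zmap k a T (At (Dom q) \<beta>) X (Ent q \<beta> ()))
      in sh_right_exact k a T
           (sheafify k a T (psum (Ix (Dom p)) F))
           (sheafify k a T (psum (Ix (Dom q)) G))
           (sheafify k a T (Zobj k a T X))
           (sheafify_map k a T (psum (Ix (Dom q)) G) \<phi>)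
           (sheafify_map k a T (Zobj k a T X) \<psi>))}"

end

theory Submission
  imports Defs "HOL-Algebra.Free_Abelian_Groups"
begin

text \<open>For a subfunctor \<open>H\<close> of a presheaf \<open>F\<close>, the elements of \<open>F\<close> that lie in \<open>H\<close> locally form
  a closed subfunctor, the local closure of \<open>H\<close>. In a sheaf, the subsheaves are the closed
  subfunctors and the image of a morphism is the closure of its presheaf image. Since
  sheafification is a local isomorphism, exactness of a sequence of sheaves becomes a condition on
  the presheaf sequence: \<open>(p, q)\<close> lies in \<open>pre(T)\<close> iff \<open>q\<close> generates a covering sieve and
  the kernel of \<open>q\<close> is contained in the closure of the image of \<open>p\<close>. By essential smallness,
  every covering sieve is generated by a small family \<open>q\<close> whose kernel is the image of some
  \<open>p\<close>, so that both \<open>pre(T)\<close> and \<open>pre'(T)\<close> contain enough coverings to be pretopologies and to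
  recover \<open>T\<close>.

  Conversely, a sieve belongs to \<open>top(S)\<close> iff it is reached by a well-founded tree of coverings.
  Transitivity is then an induction on trees, stability under pullback is a second one that uses
  (PTa), and \<open>top(S)\<close> is the smallest topology containing the sieves generated by the coverings
  of \<open>S\<close>, which gives the statement on joins.\<close>


section \<open>Modules\<close>

text \<open>The obstacle in stability under pullback is linearity. (PTa) factors the composites of
  \<open>f\<close> with the components of \<open>q'\<close> through a formal morphism, so they are
  finite sums of arrows through the sources of \<open>q\<close>, whereas the induction hypothesis on
  trees speaks of single arrows. Hence the arrows with covering pullbacks must be shown to be closed
  under addition, which uses transitivity once more. Trees are built from the target, while
  \<open>Co_tilde\<close> grows at the sources. The two are linked by grafting arbitrary trees onto
  the sources of an iterated covering. For \<open>pre(T)\<close> and \<open>pre'(T)\<close> the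
  difference disappears, since a single covering generates any given sieve of \<open>T\<close>.
  Sheafified presheaves take values in other types than the given ones. Comparisons therefore run
  through the units, which are local isomorphisms, and through closed subfunctors, which such
  morphisms transport both ways. An infinite index type absorbs pairs and finite subsets, which
  keeps the generators of kernels in direct sums small.\<close>

lemma mod_hom_closed: "\<lbrakk>h \<in> mod_hom k M N; x \<in> carrier M\<rbrakk> \<Longrightarrow> h x \<in> carrier N"
  by (auto simp: mod_hom_def)

lemma mod_hom_add:
  "\<lbrakk>h \<in> mod_hom k M N; x \<in> carrier M; y \<in> carrier M\<rbrakk> \<Longrightarrow> h (x \<oplus>\<^bsub>M\<^esub> y) = h x \<oplus>\<^bsub>N\<^esub> h y"
  by (auto simp: mod_hom_def)

lemma mod_hom_smult:
  "\<lbrakk>h \<in> mod_hom k M N; r \<in> carrier k; x \<in> carrier M\<rbrakk> \<Longrightarrow> h (r \<odot>\<^bsub>M\<^esub> x) = r \<odot>\<^bsub>N\<^esub> h x"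
  by (auto simp: mod_hom_def)

lemma mod_homI:
  assumes "\<And>x. x \<in> carrier M \<Longrightarrow> h x \<in> carrier N"
    and "\<And>x y. \<lbrakk>x \<in> carrier M; y \<in> carrier M\<rbrakk> \<Longrightarrow> h (x \<oplus>\<^bsub>M\<^esub> y) = h x \<oplus>\<^bsub>N\<^esub> h y"
    and "\<And>r x. \<lbrakk>r \<in> carrier k; x \<in> carrier M\<rbrakk> \<Longrightarrow> h (r \<odot>\<^bsub>M\<^esub> x) = r \<odot>\<^bsub>N\<^esub> h x"
  shows "h \<in> mod_hom k M N"
  using assms by (auto simp: mod_hom_def)

text \<open>Maps of presheaves matter on carriers only. This transfers linearity from a copairing to
  a matrix map, known to agree with it there.\<close>

lemma mod_hom_cong:
  assumes "h \<in> mod_hom k M N" "module k M" "\<And>x. x \<in> carrier M \<Longrightarrow> g x = h x"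
  shows "g \<in> mod_hom k M N"
proof -
  interpret M: module k M by fact
  show ?thesis
    using assms(1) by (intro mod_homI) (simp_all add: assms(3) mod_hom_closed mod_hom_add mod_hom_smult)
qed

text \<open>Zero is the multiple of itself by the scalar zero, so homogeneity suffices.\<close>

lemma mod_hom_zero:
  assumes "h \<in> mod_hom k M N" "module k M" "module k N"
  shows "h \<zero>\<^bsub>M\<^esub> = \<zero>\<^bsub>N\<^esub>"
proof -
  interpret M: module k M by fact
  interpret N: module k N by fact
  have "h (\<zero>\<^bsub>k\<^esub> \<odot>\<^bsub>M\<^esub> \<zero>\<^bsub>M\<^esub>) = \<zero>\<^bsub>k\<^esub> \<odot>\<^bsub>N\<^esub> h \<zero>\<^bsub>M\<^esub>"
    using assms(1) by (intro mod_hom_smult) auto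
  then show ?thesis using mod_hom_closed[OF assms(1), of "\<zero>\<^bsub>M\<^esub>"] by simp
qed

lemma mod_hom_finsum:
  assumes "h \<in> mod_hom k M N" "module k M" "module k N" "finite A" "f \<in> A \<rightarrow> carrier M"
  shows "h (\<Oplus>\<^bsub>M\<^esub>i\<in>A. f i) = (\<Oplus>\<^bsub>N\<^esub>i\<in>A. h (f i))"
proof -
  interpret M: module k M by fact
  interpret N: module k N by fact
  show ?thesis using assms(4,5)
  proof (induction rule: finite_induct)
    case empty
    then show ?case using mod_hom_zero[OF assms(1-3)] by simp
  next
    case (insert x F)
    have "(\<lambda>i. h (f i)) \<in> F \<rightarrow> carrier N" "h (f x) \<in> carrier N"
      using insert.prems mod_hom_closed[OF assms(1)] by (auto simp: Pi_iff)
    then show ?case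
      using insert by (simp add: Pi_iff mod_hom_add[OF assms(1)] M.finsum_closed)
  qed
qed

text \<open>Negatives come from scalars, as multiples by -1, so the criterion mentions no
  inverses.\<close>

lemma submodule_iff:
  assumes "module k M"
  shows "submodule H k M \<longleftrightarrow> H \<subseteq> carrier M \<and> \<zero>\<^bsub>M\<^esub> \<in> H \<and>
    (\<forall>x\<in>H. \<forall>y\<in>H. x \<oplus>\<^bsub>M\<^esub> y \<in> H) \<and> (\<forall>r\<in>carrier k. \<forall>x\<in>H. r \<odot>\<^bsub>M\<^esub> x \<in> H)"
    (is "_ \<longleftrightarrow> ?R")
proof -
  interpret M: module k M by fact
  show ?thesis
  proof
    assume H: "submodule H k M"
    show ?R
      using M.submoduleE[OF H] subgroup.one_closed[OF submodule.axioms(1)[OF H]] by auto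
  next
    assume R: ?R
    show "submodule H k M"
    proof (rule M.submoduleI)
      fix x assume x: "x \<in> H"
      with R have c: "x \<in> carrier M" by auto
      have "\<ominus>\<^bsub>M\<^esub> x = (\<ominus>\<^bsub>k\<^esub> \<one>\<^bsub>k\<^esub>) \<odot>\<^bsub>M\<^esub> x"
        using c M.smult_l_minus[of "\<one>\<^bsub>k\<^esub>" x] by simp
      then show "\<ominus>\<^bsub>M\<^esub> x \<in> H" using R x by simp
    qed (use R in auto)
  qed
qed


section \<open>Presheaves and subfunctors\<close>

lemma
  assumes "presheaf k a F" "A \<in> Obj a"
  shows psh_module: "module k (Val F A)"
    and Res_hom: "\<lbrakk>B \<in> Obj a; f \<in> arr a B A\<rbrakk> \<Longrightarrow> Res F A B f \<in> mod_hom k (Val F A) (Val F B)"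
    and Res_id: "x \<in> carrier (Val F A) \<Longrightarrow> Res F A A (Idt a A) x = x"
    and Res_comp: "\<lbrakk>B \<in> Obj a; C \<in> Obj a; f \<in> arr a B A; g \<in> arr a C B; x \<in> carrier (Val F A)\<rbrakk>
      \<Longrightarrow> Res F A C (Cmp a C B A f g) x = Res F B C g (Res F A B f x)"
    and Res_hom_arr: "\<lbrakk>B \<in> Obj a; x \<in> carrier (Val F A)\<rbrakk>
      \<Longrightarrow> (\<lambda>f. Res F A B f x) \<in> mod_hom k (Hom a B A) (Val F B)"
  using assms unfolding presheaf_def by blast+

lemma Res_closed:
  "\<lbrakk>presheaf k a F; A \<in> Obj a; B \<in> Obj a; f \<in> arr a B A; x \<in> carrier (Val F A)\<rbrakk>
    \<Longrightarrow> Res F A B f x \<in> carrier (Val F B)"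
  using Res_hom mod_hom_closed by fast

lemma
  assumes "nat_trans k a F G \<phi>" "A \<in> Obj a"
  shows nat_hom: "\<phi> A \<in> mod_hom k (Val F A) (Val G A)"
    and nat_Res: "\<lbrakk>B \<in> Obj a; f \<in> arr a B A; x \<in> carrier (Val F A)\<rbrakk>
      \<Longrightarrow> \<phi> B (Res F A B f x) = Res G A B f (\<phi> A x)"
  using assms by (auto simp: nat_trans_def)

lemma nat_closed:
  "\<lbrakk>nat_trans k a F G \<phi>; A \<in> Obj a; x \<in> carrier (Val F A)\<rbrakk> \<Longrightarrow> \<phi> A x \<in> carrier (Val G A)"
  using nat_hom mod_hom_closed by fast

lemma nat_transI:
  assumes "\<And>A. A \<in> Obj a \<Longrightarrow> \<phi> A \<in> mod_hom k (Val F A) (Val G A)"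
    and "\<And>A B f x. \<lbrakk>A \<in> Obj a; B \<in> Obj a; f \<in> arr a B A; x \<in> carrier (Val F A)\<rbrakk>
      \<Longrightarrow> \<phi> B (Res F A B f x) = Res G A B f (\<phi> A x)"
  shows "nat_trans k a F G \<phi>"
  using assms by (auto simp: nat_trans_def)

lemma nat_trans_comp:
  assumes "nat_trans k a F G \<phi>" "nat_trans k a G H \<psi>"
  shows "nat_trans k a F H (\<lambda>A x. \<psi> A (\<phi> A x))"
proof (rule nat_transI)
  fix A assume A: "A \<in> Obj a"
  show "(\<lambda>x. \<psi> A (\<phi> A x)) \<in> mod_hom k (Val F A) (Val H A)"
    using nat_hom[OF assms(1) A] nat_hom[OF assms(2) A]
    by (intro mod_homI) (auto simp: mod_hom_closed mod_hom_add mod_hom_smult)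
qed (use assms in \<open>auto simp: nat_Res nat_closed\<close>)

lemma subfunctor_iff:
  assumes "presheaf k a F"
  shows "subfunctor k a F H \<longleftrightarrow>
    (\<forall>A\<in>Obj a. H A \<subseteq> carrier (Val F A) \<and> \<zero>\<^bsub>Val F A\<^esub> \<in> H A \<and>
       (\<forall>x\<in>H A. \<forall>y\<in>H A. x \<oplus>\<^bsub>Val F A\<^esub> y \<in> H A) \<and>
       (\<forall>r\<in>carrier k. \<forall>x\<in>H A. r \<odot>\<^bsub>Val F A\<^esub> x \<in> H A)) \<and>
    (\<forall>A\<in>Obj a. \<forall>B\<in>Obj a. \<forall>f\<in>arr a B A. \<forall>x\<in>H A. Res F A B f x \<in> H B) \<and>
    (\<forall>A. A \<notin> Obj a \<longrightarrow> H A = {})"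
  unfolding subfunctor_def using psh_module[OF assms] by (simp add: submodule_iff)

lemma
  assumes "subfunctor k a F H" "presheaf k a F" "A \<in> Obj a"
  shows sub_carrier: "x \<in> H A \<Longrightarrow> x \<in> carrier (Val F A)"
    and sub_zero: "\<zero>\<^bsub>Val F A\<^esub> \<in> H A"
    and sub_add: "\<lbrakk>x \<in> H A; y \<in> H A\<rbrakk> \<Longrightarrow> x \<oplus>\<^bsub>Val F A\<^esub> y \<in> H A"
    and sub_smult: "\<lbrakk>r \<in> carrier k; x \<in> H A\<rbrakk> \<Longrightarrow> r \<odot>\<^bsub>Val F A\<^esub> x \<in> H A"
    and sub_Res: "\<lbrakk>B \<in> Obj a; f \<in> arr a B A; x \<in> H A\<rbrakk> \<Longrightarrow> Res F A B f x \<in> H B"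
  using assms by (auto simp: subfunctor_iff)

lemma sub_outside: "\<lbrakk>subfunctor k a F H; A \<notin> Obj a\<rbrakk> \<Longrightarrow> H A = {}"
  by (auto simp: subfunctor_def)

lemma sub_ObjD: "\<lbrakk>subfunctor k a F H; x \<in> H A\<rbrakk> \<Longrightarrow> A \<in> Obj a"
  by (metis empty_iff sub_outside)

lemma sub_finsum:
  assumes "subfunctor k a F H" "presheaf k a F" "A \<in> Obj a" "finite I" "\<And>i. i \<in> I \<Longrightarrow> f i \<in> H A"
  shows "(\<Oplus>\<^bsub>Val F A\<^esub>i\<in>I. f i) \<in> H A"
proof -
  interpret M: module k "Val F A" by (rule psh_module[OF assms(2,3)])
  show ?thesis using assms(4,5)
  proof (induction rule: finite_induct)
    case empty
    then show ?case using sub_zero[OF assms(1-3)] by simp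
  next
    case (insert x S)
    have "f \<in> S \<rightarrow> carrier (Val F A)" "f x \<in> carrier (Val F A)"
      using insert.prems sub_carrier[OF assms(1-3)] by auto
    then show ?case using insert sub_add[OF assms(1-3)] by simp
  qed
qed

section \<open>Zero subfunctor, preimages and images\<close>

definition zero_sub :: "('k, 'o, 'm) lincat \<Rightarrow> ('k, 'o, 'm, 'v) psh \<Rightarrow> 'o \<Rightarrow> 'v set" where
  "zero_sub a F = (\<lambda>A. if A \<in> Obj a then {\<zero>\<^bsub>Val F A\<^esub>} else {})"

definition preim :: "('k, 'o, 'm) lincat \<Rightarrow> ('k, 'o, 'm, 'v) psh \<Rightarrow> ('o \<Rightarrow> 'v \<Rightarrow> 'w)
    \<Rightarrow> ('o \<Rightarrow> 'w set) \<Rightarrow> 'o \<Rightarrow> 'v set" where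
  "preim a F \<phi> K = (\<lambda>A. {x \<in> psh_all a F A. \<phi> A x \<in> K A})"

definition sub_img :: "('o \<Rightarrow> 'v \<Rightarrow> 'w) \<Rightarrow> ('o \<Rightarrow> 'v set) \<Rightarrow> 'o \<Rightarrow> 'w set" where
  "sub_img \<phi> H = (\<lambda>A. \<phi> A ` H A)"

lemma psh_image_eq: "psh_image a F \<phi> = sub_img \<phi> (psh_all a F)"
  by (simp add: psh_image_def sub_img_def)

text \<open>In this form kernels are subject to \<open>preim_sub\<close> and
  \<open>preim_closure\<close>.\<close>

lemma psh_kernel_eq: "psh_kernel a F G \<phi> = preim a F \<phi> (zero_sub a G)"
  by (auto simp: psh_kernel_def preim_def zero_sub_def psh_all_def fun_eq_iff)

lemma psh_all_mem: "x \<in> psh_all a F A \<longleftrightarrow> A \<in> Obj a \<and> x \<in> carrier (Val F A)"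
  by (auto simp: psh_all_def)

lemma psh_all_sub: "presheaf k a F \<Longrightarrow> subfunctor k a F (psh_all a F)"
  unfolding subfunctor_def psh_all_def
  by (auto intro: module.carrier_is_submodule psh_module Res_closed)

lemma sub_le_all: "\<lbrakk>presheaf k a F; subfunctor k a F H\<rbrakk> \<Longrightarrow> H \<le> psh_all a F"
proof (intro le_funI subsetI)
  fix A x assume "presheaf k a F" "subfunctor k a F H" "x \<in> H A"
  then show "x \<in> psh_all a F A" using sub_carrier sub_ObjD unfolding psh_all_mem by metis
qed

lemma zero_sub_sub: "presheaf k a F \<Longrightarrow> subfunctor k a F (zero_sub a F)"
proof -
  assume F: "presheaf k a F"
  have *: "abelian_group (Val F A)" if "A \<in> Obj a" for A
    using psh_module[OF F that] by (simp add: module_def)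
  show ?thesis
    unfolding subfunctor_iff[OF F] zero_sub_def
    using * psh_module[OF F] mod_hom_zero[OF Res_hom[OF F]]
    by (auto simp: abelian_monoid.zero_closed abelian_monoid.l_zero abelian_group.axioms
      intro: module.smult_r_null)
qed

lemma zero_sub_le:
  "\<lbrakk>presheaf k a F; subfunctor k a F H\<rbrakk> \<Longrightarrow> zero_sub a F \<le> H"
  by (auto simp: le_fun_def zero_sub_def sub_zero)

lemma preim_sub:
  assumes "presheaf k a F" "presheaf k a G" "nat_trans k a F G \<phi>" "subfunctor k a G K"
  shows "subfunctor k a F (preim a F \<phi> K)"
proof -
  have *: "\<phi> A \<zero>\<^bsub>Val F A\<^esub> \<in> K A" if "A \<in> Obj a" for A
    using mod_hom_zero[OF nat_hom[OF assms(3) that] psh_module psh_module] that assms sub_zero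
    by fastforce
  show ?thesis
    unfolding subfunctor_iff[OF assms(1)] preim_def
    using psh_all_sub[OF assms(1)] assms *
    by (auto simp: psh_all_mem subfunctor_iff nat_Res mod_hom_add[OF nat_hom] mod_hom_smult[OF nat_hom])
qed

lemma sub_img_sub:
  assumes "presheaf k a F" "presheaf k a G" "nat_trans k a F G \<phi>" "subfunctor k a F H"
  shows "subfunctor k a G (sub_img \<phi> H)"
proof -
  have *: "\<zero>\<^bsub>Val G A\<^esub> = \<phi> A \<zero>\<^bsub>Val F A\<^esub>" if "A \<in> Obj a" for A
    using mod_hom_zero[OF nat_hom[OF assms(3) that] psh_module psh_module] that assms by metis
  note H = sub_carrier[OF assms(4,1)]
  show ?thesis
    unfolding subfunctor_iff[OF assms(2)]
  proof (intro conjI ballI allI impI)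
    fix A x y assume A: "A \<in> Obj a" and "x \<in> sub_img \<phi> H A" "y \<in> sub_img \<phi> H A"
    then obtain u v where "u \<in> H A" "v \<in> H A" "x = \<phi> A u" "y = \<phi> A v" by (auto simp: sub_img_def)
    then show "x \<oplus>\<^bsub>Val G A\<^esub> y \<in> sub_img \<phi> H A"
      using mod_hom_add[OF nat_hom[OF assms(3) A], of u v] H[OF A] sub_add[OF assms(4,1) A]
      unfolding sub_img_def by (metis image_eqI)
  next
    fix A r x assume A: "A \<in> Obj a" and "r \<in> carrier k" "x \<in> sub_img \<phi> H A"
    then show "r \<odot>\<^bsub>Val G A\<^esub> x \<in> sub_img \<phi> H A"
      using mod_hom_smult[OF nat_hom[OF assms(3) A]] H[OF A] sub_smult[OF assms(4,1) A]
      unfolding sub_img_def by (smt (verit) image_iff)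
  next
    fix A B f x assume A: "A \<in> Obj a" "B \<in> Obj a" "f \<in> arr a B A" and "x \<in> sub_img \<phi> H A"
    then show "Res G A B f x \<in> sub_img \<phi> H B"
      using nat_Res[OF assms(3) A] H[OF A(1)] sub_Res[OF assms(4,1) A]
      unfolding sub_img_def by (smt (verit) image_iff)
  next
    fix A assume A: "A \<in> Obj a"
    show "\<zero>\<^bsub>Val G A\<^esub> \<in> sub_img \<phi> H A"
      using *[OF A] sub_zero[OF assms(4,1) A] by (auto simp: sub_img_def)
    show "sub_img \<phi> H A \<subseteq> carrier (Val G A)"
      using H[OF A] nat_closed[OF assms(3) A] by (auto simp: sub_img_def)
  next
    fix A assume "A \<notin> Obj a"
    then show "sub_img \<phi> H A = {}" using sub_outside[OF assms(4)] by (simp add: sub_img_def)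
  qed
qed

lemma sub_psh_presheaf:
  assumes "presheaf k a F" "subfunctor k a F H"
  shows "presheaf k a (sub_psh F H)"
proof -
  have m: "module k ((Val F A)\<lparr>carrier := H A\<rparr>)" if "A \<in> Obj a" for A
    using assms that by (auto simp: subfunctor_def intro: submodule.submodule_is_module psh_module)
  note c = sub_carrier[OF assms(2,1)]
  show ?thesis
    unfolding presheaf_def sub_psh_def
    using m c sub_Res[OF assms(2,1)] Res_id[OF assms(1)] Res_comp[OF assms(1)]
      mod_hom_add[OF Res_hom[OF assms(1)]] mod_hom_smult[OF Res_hom[OF assms(1)]]
      mod_hom_add[OF Res_hom_arr[OF assms(1)]] mod_hom_smult[OF Res_hom_arr[OF assms(1)]]
    by (auto simp: mod_hom_def)
qed

lemma sub_psh_sel [simp]: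
  "carrier (Val (sub_psh F H) A) = H A" "Res (sub_psh F H) = Res F"
  "add (Val (sub_psh F H) A) = add (Val F A)" "\<zero>\<^bsub>Val (sub_psh F H) A\<^esub> = \<zero>\<^bsub>Val F A\<^esub>"
  "smult (Val (sub_psh F H) A) = smult (Val F A)"
  by (auto simp: sub_psh_def)

lemma yoneda_sel [simp]:
  "Val (yoneda a A) B = Hom a B A" "Res (yoneda a A) B C f g = Cmp a C B A g f"
  by (auto simp: yoneda_def)

text \<open>\<open>sub_psh\<close> alters only carriers, so a morphism into it is a morphism into
  \<open>G\<close> with values in \<open>H\<close>. The unfolded form lets sections pass between the
  two in \<open>subsheaf_iff\<close>.\<close>

lemma nat_into_sub:
  "nat_trans k a F (sub_psh G H) s \<longleftrightarrow>
    (\<forall>A\<in>Obj a. s A \<in> carrier (Val F A) \<rightarrow> H A) \<and>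
    (\<forall>A\<in>Obj a. (\<forall>x\<in>carrier (Val F A). \<forall>y\<in>carrier (Val F A).
        s A (x \<oplus>\<^bsub>Val F A\<^esub> y) = s A x \<oplus>\<^bsub>Val G A\<^esub> s A y) \<and>
      (\<forall>r\<in>carrier k. \<forall>x\<in>carrier (Val F A). s A (r \<odot>\<^bsub>Val F A\<^esub> x) = r \<odot>\<^bsub>Val G A\<^esub> s A x)) \<and>
    (\<forall>A\<in>Obj a. \<forall>B\<in>Obj a. \<forall>f\<in>arr a B A. \<forall>x\<in>carrier (Val F A).
        s B (Res F A B f x) = Res G A B f (s A x))"
  by (auto simp: nat_trans_def mod_hom_def)

text \<open>The sieve of all arrows that carry \<open>x \<in> F(A)\<close> into the subfunctor \<open>H\<close>. Pullbacks of sieves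
  are the case \<open>F = a(-,A)\<close>.\<close>

definition locus :: "('k, 'o, 'm) lincat \<Rightarrow> ('k, 'o, 'm, 'v) psh \<Rightarrow> 'o \<Rightarrow> ('o \<Rightarrow> 'v set) \<Rightarrow> 'v
    \<Rightarrow> ('o, 'm) sieve" where
  "locus a F A H x = (\<lambda>B. {f \<in> max_sieve a A B. Res F A B f x \<in> H B})"

lemma pull_eq_locus: "pull a A R B f = locus a (yoneda a A) B R f"
  by (simp add: pull_def locus_def)

lemma max_sieve_mem: "f \<in> max_sieve a A B \<longleftrightarrow> B \<in> Obj a \<and> f \<in> arr a B A"
  by (simp add: psh_all_mem)

lemma pull_mem: "g \<in> pull a A R B f C \<longleftrightarrow> C \<in> Obj a \<and> g \<in> arr a C B \<and> Cmp a C B A f g \<in> R C"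
  by (auto simp: pull_def max_sieve_mem)

lemma locus_mem: "f \<in> locus a F A H x B \<longleftrightarrow> B \<in> Obj a \<and> f \<in> arr a B A \<and> Res F A B f x \<in> H B"
  by (auto simp: locus_def max_sieve_mem)


section \<open>Sieves and their pullbacks\<close>

context linear_category
begin

lemma comp_closed:
  "\<lbrakk>A \<in> Obj a; B \<in> Obj a; C \<in> Obj a; f \<in> arr a A B; g \<in> arr a B C\<rbrakk> \<Longrightarrow> Cmp a A B C g f \<in> arr a A C"
  using comp_linear_left mod_hom_closed by fast

lemma yoneda_presheaf: "A \<in> Obj a \<Longrightarrow> presheaf k a (yoneda a A)"
  using comp_linear_left
  unfolding presheaf_def yoneda_def
  by (simp add: hom_module id_right comp_linear_right comp_assoc)

lemma sieve_iff:
  assumes "A \<in> Obj a"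
  shows "sieve k a A R \<longleftrightarrow>
    (\<forall>B\<in>Obj a. R B \<subseteq> arr a B A \<and> \<zero>\<^bsub>Hom a B A\<^esub> \<in> R B \<and>
       (\<forall>x\<in>R B. \<forall>y\<in>R B. x \<oplus>\<^bsub>Hom a B A\<^esub> y \<in> R B) \<and>
       (\<forall>r\<in>carrier k. \<forall>x\<in>R B. r \<odot>\<^bsub>Hom a B A\<^esub> x \<in> R B)) \<and>
    (\<forall>B\<in>Obj a. \<forall>C\<in>Obj a. \<forall>f\<in>arr a C B. \<forall>x\<in>R B. Cmp a C B A x f \<in> R C) \<and>
    (\<forall>B. B \<notin> Obj a \<longrightarrow> R B = {})"
  unfolding sieve_def subfunctor_iff[OF yoneda_presheaf[OF assms]] by simp

lemma
  assumes "A \<in> Obj a" "sieve k a A R"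
  shows sieve_arr: "f \<in> R B \<Longrightarrow> f \<in> arr a B A"
    and sieve_Obj: "f \<in> R B \<Longrightarrow> B \<in> Obj a"
    and sieve_comp: "\<lbrakk>f \<in> R B; C \<in> Obj a; g \<in> arr a C B\<rbrakk> \<Longrightarrow> Cmp a C B A f g \<in> R C"
    and sieve_zero: "B \<in> Obj a \<Longrightarrow> \<zero>\<^bsub>Hom a B A\<^esub> \<in> R B"
    and sieve_add: "\<lbrakk>f \<in> R B; g \<in> R B\<rbrakk> \<Longrightarrow> f \<oplus>\<^bsub>Hom a B A\<^esub> g \<in> R B"
    and sieve_smult: "\<lbrakk>r \<in> carrier k; f \<in> R B\<rbrakk> \<Longrightarrow> r \<odot>\<^bsub>Hom a B A\<^esub> f \<in> R B"
proof -
  have H: "subfunctor k a (yoneda a A) R" using assms(2) by (simp add: sieve_def)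
  note [simp] = sub_ObjD[OF H]
  note Y = yoneda_presheaf[OF assms(1)]
  show "f \<in> R B \<Longrightarrow> B \<in> Obj a" by simp
  show "f \<in> R B \<Longrightarrow> f \<in> arr a B A" using sub_carrier[OF H Y, of B f] by simp
  show "\<lbrakk>f \<in> R B; C \<in> Obj a; g \<in> arr a C B\<rbrakk> \<Longrightarrow> Cmp a C B A f g \<in> R C"
    using sub_Res[OF H Y, of B C g f] by simp
  show "B \<in> Obj a \<Longrightarrow> \<zero>\<^bsub>Hom a B A\<^esub> \<in> R B" using sub_zero[OF H Y] by simp
  show "\<lbrakk>f \<in> R B; g \<in> R B\<rbrakk> \<Longrightarrow> f \<oplus>\<^bsub>Hom a B A\<^esub> g \<in> R B" using sub_add[OF H Y, of B f g] by simp
  show "\<lbrakk>r \<in> carrier k; f \<in> R B\<rbrakk> \<Longrightarrow> r \<odot>\<^bsub>Hom a B A\<^esub> f \<in> R B"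
    using sub_smult[OF H Y, of B r f] by simp
qed

lemma max_sieve_sieve: "A \<in> Obj a \<Longrightarrow> sieve k a A (max_sieve a A)"
  by (simp add: sieve_def psh_all_sub yoneda_presheaf)

lemma sieve_inf: "\<lbrakk>A \<in> Obj a; sieve k a A R; sieve k a A Q\<rbrakk> \<Longrightarrow> sieve k a A (inf R Q)"
  by (auto simp: sieve_iff)

text \<open>Every arrow into \<open>A\<close> factors through the identity of
  \<open>A\<close>.\<close>

lemma sieve_eq_max:
  assumes "A \<in> Obj a" "sieve k a A R" "Idt a A \<in> R A"
  shows "R = max_sieve a A"
  unfolding fun_eq_iff set_eq_iff
proof (intro allI)
  fix B f
  show "f \<in> R B \<longleftrightarrow> f \<in> max_sieve a A B"
  proof
    assume "f \<in> R B"
    then show "f \<in> max_sieve a A B"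
      using sieve_arr[OF assms(1,2)] sieve_Obj[OF assms(1,2)] by (simp add: max_sieve_mem)
  next
    assume "f \<in> max_sieve a A B"
    then have "B \<in> Obj a" "f \<in> arr a B A" by (simp_all add: max_sieve_mem)
    then show "f \<in> R B"
      using sieve_comp[OF assms(1,2,3), of B f] id_left[of B A f] assms(1) by simp
  qed
qed

text \<open>This is the morphism that corresponds to \<open>x\<close> under the Yoneda
  lemma.\<close>

lemma yoneda_nat:
  assumes "presheaf k a F" "A \<in> Obj a" "x \<in> carrier (Val F A)"
  shows "nat_trans k a (yoneda a A) F (\<lambda>B f. Res F A B f x)"
  using assms by (intro nat_transI) (simp_all add: Res_hom_arr Res_comp)

text \<open>The locus is the preimage of \<open>H\<close> under the Yoneda morphism of
  \<open>x\<close>.\<close>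

lemma locus_sieve:
  assumes "presheaf k a F" "subfunctor k a F H" "A \<in> Obj a" "x \<in> carrier (Val F A)"
  shows "sieve k a A (locus a F A H x)"
proof -
  have "locus a F A H x = preim a (yoneda a A) (\<lambda>B f. Res F A B f x) H"
    by (simp add: locus_def preim_def)
  then show ?thesis
    using preim_sub[OF yoneda_presheaf[OF assms(3)] assms(1) yoneda_nat assms(2)] assms
    by (simp add: sieve_def)
qed

lemma pull_sieve:
  "\<lbrakk>A \<in> Obj a; B \<in> Obj a; sieve k a A R; f \<in> arr a B A\<rbrakk> \<Longrightarrow> sieve k a B (pull a A R B f)"
  unfolding pull_eq_locus by (rule locus_sieve) (auto simp: yoneda_presheaf sieve_def)

text \<open>An arrow \<open>g\<close> carries \<open>Res F A B f x\<close> into \<open>H\<close> iff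
  the composite of \<open>f\<close> and \<open>g\<close> carries \<open>x\<close> there. Through
  this identity (T2) and (T3) become statements about local membership.\<close>

lemma pull_locus:
  assumes "presheaf k a F" "A \<in> Obj a" "x \<in> carrier (Val F A)" "B \<in> Obj a" "f \<in> arr a B A"
  shows "pull a A (locus a F A H x) B f = locus a F B H (Res F A B f x)"
  using assms by (auto simp: fun_eq_iff set_eq_iff pull_mem locus_mem Res_comp comp_closed)

lemma pull_pull:
  assumes "A \<in> Obj a" "B \<in> Obj a" "f \<in> arr a B A" "C \<in> Obj a" "g \<in> arr a C B"
  shows "pull a B (pull a A R B f) C g = pull a A R C (Cmp a C B A f g)"
  using assms by (auto simp: fun_eq_iff set_eq_iff pull_mem comp_closed comp_assoc)

lemma pull_id: "\<lbrakk>A \<in> Obj a; sieve k a A R\<rbrakk> \<Longrightarrow> pull a A R A (Idt a A) = R"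
  by (simp add: fun_eq_iff set_eq_iff pull_mem) (metis id_left sieve_Obj sieve_arr)

lemma pull_max: "\<lbrakk>A \<in> Obj a; sieve k a A R; f \<in> R B\<rbrakk> \<Longrightarrow> pull a A R B f = max_sieve a B"
  by (simp add: fun_eq_iff set_eq_iff pull_mem max_sieve_mem) (metis sieve_comp)

end


section \<open>Local closure of subfunctors\<close>

lemma subD: "\<lbrakk>H \<le> K; x \<in> H A\<rbrakk> \<Longrightarrow> x \<in> (K A :: 'a set)"
  by (auto simp: le_fun_def)

definition local_closure :: "('k, 'o, 'm) lincat \<Rightarrow> ('o, 'm) cov \<Rightarrow> ('k, 'o, 'm, 'v) psh
    \<Rightarrow> ('o \<Rightarrow> 'v set) \<Rightarrow> 'o \<Rightarrow> 'v set" where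
  "local_closure a T F H = (\<lambda>A. {x \<in> psh_all a F A. locus a F A H x \<in> T A})"

definition separated :: "('k, 'o, 'm) lincat \<Rightarrow> ('o, 'm) cov \<Rightarrow> ('k, 'o, 'm, 'v) psh \<Rightarrow> bool" where
  "separated a T F \<longleftrightarrow> (\<forall>A R x y. A \<in> Obj a \<and> R \<in> T A \<and> x \<in> carrier (Val F A) \<and> y \<in> carrier (Val F A) \<and>
     (\<forall>B f. f \<in> R B \<longrightarrow> Res F A B f x = Res F A B f y) \<longrightarrow> x = y)"

lemma separatedD:
  assumes "separated a T F" "A \<in> Obj a" "R \<in> T A" "x \<in> carrier (Val F A)" "y \<in> carrier (Val F A)"
    and "\<And>B f. f \<in> R B \<Longrightarrow> Res F A B f x = Res F A B f y"
  shows "x = y"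
  using assms unfolding separated_def by metis

text \<open>Morphisms of presheaves that become isomorphisms after sheafification.\<close>

definition local_iso :: "'k ring \<Rightarrow> ('k, 'o, 'm) lincat \<Rightarrow> ('o, 'm) cov \<Rightarrow> ('k, 'o, 'm, 'v) psh
    \<Rightarrow> ('k, 'o, 'm, 'w) psh \<Rightarrow> ('o \<Rightarrow> 'v \<Rightarrow> 'w) \<Rightarrow> bool" where
  "local_iso k a T F G \<phi> \<longleftrightarrow> presheaf k a F \<and> presheaf k a G \<and> nat_trans k a F G \<phi> \<and>
     psh_kernel a F G \<phi> \<le> local_closure a T F (zero_sub a F) \<and>
     psh_all a G \<le> local_closure a T G (psh_image a F \<phi>)"

locale linear_site = linear_category k a for k :: "'k ring" and a :: "('k, 'o, 'm) lincat" +
  fixes T :: "('o, 'm) cov"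
  assumes topology: "topology k a T"
begin

lemma
  shows T_sieve: "\<lbrakk>A \<in> Obj a; R \<in> T A\<rbrakk> \<Longrightarrow> sieve k a A R"
    and T_Obj: "R \<in> T A \<Longrightarrow> A \<in> Obj a"
    and T_max: "A \<in> Obj a \<Longrightarrow> max_sieve a A \<in> T A"
    and T_pull: "\<lbrakk>A \<in> Obj a; B \<in> Obj a; R \<in> T A; f \<in> arr a B A\<rbrakk> \<Longrightarrow> pull a A R B f \<in> T B"
    and T_trans: "\<lbrakk>A \<in> Obj a; sieve k a A S; R \<in> T A; \<And>B f. f \<in> R B \<Longrightarrow> pull a A S B f \<in> T B\<rbrakk> \<Longrightarrow> S \<in> T A"
proof -
  from topology obtain
    1: "\<forall>A\<in>Obj a. \<forall>R\<in>T A. sieve k a A R" and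
    2: "\<forall>A. A \<notin> Obj a \<longrightarrow> T A = {}" and
    3: "\<forall>A\<in>Obj a. max_sieve a A \<in> T A" and
    4: "\<forall>A\<in>Obj a. \<forall>B\<in>Obj a. \<forall>R\<in>T A. \<forall>f\<in>arr a B A. pull a A R B f \<in> T B" and
    5: "\<forall>A\<in>Obj a. \<forall>S R. sieve k a A S \<and> R \<in> T A \<and> (\<forall>B\<in>Obj a. \<forall>f\<in>R B. pull a A S B f \<in> T B) \<longrightarrow> S \<in> T A"
    unfolding topology_def covering_system_def by (elim conjE) (rule that)
  show "\<lbrakk>A \<in> Obj a; R \<in> T A\<rbrakk> \<Longrightarrow> sieve k a A R" using 1 by blast
  show "R \<in> T A \<Longrightarrow> A \<in> Obj a" using 2 by blast
  show "A \<in> Obj a \<Longrightarrow> max_sieve a A \<in> T A" using 3 by blast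
  show "\<lbrakk>A \<in> Obj a; B \<in> Obj a; R \<in> T A; f \<in> arr a B A\<rbrakk> \<Longrightarrow> pull a A R B f \<in> T B" using 4 by blast
  show "\<lbrakk>A \<in> Obj a; sieve k a A S; R \<in> T A; \<And>B f. f \<in> R B \<Longrightarrow> pull a A S B f \<in> T B\<rbrakk> \<Longrightarrow> S \<in> T A"
    by (rule 5[rule_format, of A S R]) simp_all
qed

text \<open>Along an arrow of \<open>R\<close> the pullback of \<open>S\<close> is maximal, so (T3)
  applies with \<open>R\<close>.\<close>

lemma T_mono:
  assumes "A \<in> Obj a" "sieve k a A S" "R \<in> T A" "R \<le> S"
  shows "S \<in> T A"
proof (rule T_trans[OF assms(1-3)])
  fix B f assume f: "f \<in> R B"
  then have "f \<in> S B" using assms(4) by (rule subD[rotated])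
  then show "pull a A S B f \<in> T B"
    using pull_max[OF assms(1,2), of f B] T_max[of B] sieve_Obj[OF assms(1,2), of f B] by metis
qed

text \<open>Along an arrow of \<open>R\<close> the pullback of the intersection contains the
  pullback of \<open>S\<close>, which covers by (T2); (T3) over \<open>R\<close> concludes.\<close>

lemma T_inf:
  assumes "A \<in> Obj a" "R \<in> T A" "S \<in> T A"
  shows "inf R S \<in> T A"
proof (rule T_trans[OF assms(1) _ assms(2)])
  note R = T_sieve[OF assms(1,2)] and S = T_sieve[OF assms(1,3)]
  show RS: "sieve k a A (inf R S)" using sieve_inf[OF assms(1) R S] .
  fix B f assume f: "f \<in> R B"
  note B = sieve_Obj[OF assms(1) R f] sieve_arr[OF assms(1) R f]
  show "pull a A (inf R S) B f \<in> T B"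
    by (rule T_mono[OF B(1) pull_sieve[OF assms(1) B(1) RS B(2)] T_pull[OF assms(1) B(1) assms(3) B(2)]])
      (auto simp: le_fun_def pull_mem intro: sieve_comp[OF assms(1) R f])
qed

text \<open>Elements of direct sums have finite support; this provides one covering sieve that
  serves all their nonzero components at once.\<close>

lemma T_INF:
  assumes "A \<in> Obj a" "finite I" "\<And>i. i \<in> I \<Longrightarrow> R i \<in> T A"
  shows "\<exists>Q\<in>T A. \<forall>i\<in>I. Q \<le> R i"
  using assms(2,3)
proof (induction rule: finite_induct)
  case empty
  then show ?case using T_max[OF assms(1)] by blast
next
  case (insert i I)
  then obtain Q where Q: "Q \<in> T A" "\<forall>i\<in>I. Q \<le> R i" by auto
  then have "inf Q (R i) \<in> T A" "\<forall>j\<in>insert i I. inf Q (R i) \<le> R j"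
    using T_inf[OF assms(1)] insert.prems by (auto intro: le_infI1)
  then show ?case by blast
qed

lemma T_elem: "\<lbrakk>R \<in> T A; f \<in> R B\<rbrakk> \<Longrightarrow> B \<in> Obj a \<and> f \<in> arr a B A"
  using T_Obj T_sieve sieve_Obj sieve_arr by metis

text \<open>(T3) with the pullback replaced by any covering sieve inside it, the form in which local
  conditions arise below.\<close>

lemma T_local:
  assumes "A \<in> Obj a" "sieve k a A S" "R \<in> T A"
    and "\<And>B f. f \<in> R B \<Longrightarrow> \<exists>P\<in>T B. \<forall>C g. g \<in> P C \<longrightarrow> Cmp a C B A f g \<in> S C"
  shows "S \<in> T A"
proof (rule T_trans[OF assms(1-3)])
  fix B f assume f: "f \<in> R B"
  obtain P where P: "P \<in> T B" "\<And>C g. g \<in> P C \<Longrightarrow> Cmp a C B A f g \<in> S C" using assms(4)[OF f] by blast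
  note B = T_elem[OF assms(3) f]
  show "pull a A S B f \<in> T B"
  proof (rule T_mono[OF _ pull_sieve P(1)])
    show "P \<le> pull a A S B f"
      using P(2) T_elem[OF P(1)] unfolding le_fun_def pull_mem subset_iff by blast
  qed (use B assms in simp_all)
qed

lemma closure_Obj: "x \<in> local_closure a T F H A \<Longrightarrow> A \<in> Obj a"
  and closure_carrier: "x \<in> local_closure a T F H A \<Longrightarrow> x \<in> carrier (Val F A)"
  by (auto simp: local_closure_def psh_all_mem)

text \<open>The locus contains \<open>R\<close>, and sieves above a covering one cover. Any covering
  sieve may therefore witness local membership.\<close>

lemma closureI:
  assumes "presheaf k a F" "subfunctor k a F H" "R \<in> T A" "x \<in> carrier (Val F A)"
    and "\<And>B f. f \<in> R B \<Longrightarrow> Res F A B f x \<in> H B"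
  shows "x \<in> local_closure a T F H A"
proof -
  note A = T_Obj[OF assms(3)]
  have "locus a F A H x \<in> T A"
  proof (rule T_mono[OF A locus_sieve[OF assms(1,2) A assms(4)] assms(3)])
    show "R \<le> locus a F A H x"
      using assms(5) T_elem[OF assms(3)] unfolding le_fun_def locus_mem subset_iff by blast
  qed
  then show ?thesis using assms(4) A by (simp add: local_closure_def psh_all_mem)
qed

lemma closureE:
  assumes "x \<in> local_closure a T F H A"
  obtains R where "R \<in> T A" "\<And>B f. f \<in> R B \<Longrightarrow> Res F A B f x \<in> H B"
    "\<And>B f. f \<in> R B \<Longrightarrow> B \<in> Obj a" "\<And>B f. f \<in> R B \<Longrightarrow> f \<in> arr a B A"
proof (rule that)
  show "locus a F A H x \<in> T A" using assms by (simp add: local_closure_def)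
qed (simp_all add: locus_mem)

lemma closure_inc:
  assumes "presheaf k a F" "subfunctor k a F H"
  shows "H \<le> local_closure a T F H"
proof (intro le_funI subsetI)
  fix A x assume x: "x \<in> H A"
  note A = sub_ObjD[OF assms(2) x]
  show "x \<in> local_closure a T F H A"
    by (rule closureI[OF assms T_max[OF A]])
      (use x A sub_carrier[OF assms(2,1)] sub_Res[OF assms(2,1) A] in \<open>auto simp: max_sieve_mem\<close>)
qed

lemma closure_mono:
  assumes "presheaf k a F" "subfunctor k a F K" "H \<le> K"
  shows "local_closure a T F H \<le> local_closure a T F K"
proof (intro le_funI subsetI)
  fix A x assume x: "x \<in> local_closure a T F H A"
  then obtain R where "R \<in> T A" "\<And>B f. f \<in> R B \<Longrightarrow> Res F A B f x \<in> H B" by (elim closureE) blast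
  then show "x \<in> local_closure a T F K A"
    using closureI[OF assms(1,2)] closure_carrier[OF x] subD[OF assms(3)] by metis
qed

text \<open>A sum is handled on the intersection of two covering sieves. The locus of a restriction
  is the pullback of the locus, which covers by (T2).\<close>

lemma closure_sub:
  assumes F: "presheaf k a F" and H: "subfunctor k a F H"
  shows "subfunctor k a F (local_closure a T F H)"
  unfolding subfunctor_iff[OF F]
proof (intro conjI ballI allI impI)
  fix A assume A: "A \<in> Obj a"
  show "local_closure a T F H A \<subseteq> carrier (Val F A)" by (auto intro: closure_carrier)
  show "\<zero>\<^bsub>Val F A\<^esub> \<in> local_closure a T F H A"
    using subD[OF closure_inc[OF F H]] sub_zero[OF H F A] by blast
  interpret M: module k "Val F A" by (rule psh_module[OF F A])
  {
    fix x y assume x: "x \<in> local_closure a T F H A" and y: "y \<in> local_closure a T F H A"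
    obtain R where R: "R \<in> T A" "\<And>B f. f \<in> R B \<Longrightarrow> Res F A B f x \<in> H B" using x by (elim closureE) blast
    obtain S where S: "S \<in> T A" "\<And>B f. f \<in> S B \<Longrightarrow> Res F A B f y \<in> H B" using y by (elim closureE) blast
    note c = closure_carrier[OF x] closure_carrier[OF y]
    show "x \<oplus>\<^bsub>Val F A\<^esub> y \<in> local_closure a T F H A"
    proof (rule closureI[OF F H T_inf[OF A R(1) S(1)]])
      fix B f assume f: "f \<in> inf R S B"
      then have B: "B \<in> Obj a" "f \<in> arr a B A" using T_elem[OF R(1)] by auto
      show "Res F A B f (x \<oplus>\<^bsub>Val F A\<^esub> y) \<in> H B"
        using mod_hom_add[OF Res_hom[OF F A B] c] R(2) S(2) f sub_add[OF H F B(1)] by simp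
    qed (simp add: c)
  }
  {
    fix r x assume r: "r \<in> carrier k" and x: "x \<in> local_closure a T F H A"
    obtain R where R: "R \<in> T A" "\<And>B f. f \<in> R B \<Longrightarrow> Res F A B f x \<in> H B" using x by (elim closureE) blast
    note c = closure_carrier[OF x]
    show "r \<odot>\<^bsub>Val F A\<^esub> x \<in> local_closure a T F H A"
    proof (rule closureI[OF F H R(1)])
      fix B f assume f: "f \<in> R B"
      note B = T_elem[OF R(1) f]
      show "Res F A B f (r \<odot>\<^bsub>Val F A\<^esub> x) \<in> H B"
        using mod_hom_smult[OF Res_hom[OF F A] r c] B R(2)[OF f] sub_smult[OF H F _ r] by simp
    qed (simp add: c r)
  }
  {
    fix B f x assume B: "B \<in> Obj a" "f \<in> arr a B A" and x: "x \<in> local_closure a T F H A"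
    note c = closure_carrier[OF x]
    show "Res F A B f x \<in> local_closure a T F H B"
      using x T_pull[OF A B(1) _ B(2), of "locus a F A H x"] Res_closed[OF F A B c] B
      by (simp add: local_closure_def psh_all_mem pull_locus[OF F A c B, of H])
  }
next
  fix A assume "A \<notin> Obj a"
  then show "local_closure a T F H A = {}" by (auto dest: closure_Obj)
qed

text \<open>Along an arrow \<open>f\<close> of \<open>R\<close> the pullback of the locus of
  \<open>x\<close> is the locus of \<open>Res F A B f x\<close>, which covers. Hence idempotence is
  (T3).\<close>

lemma closure_idem:
  assumes F: "presheaf k a F" and H: "subfunctor k a F H"
  shows "local_closure a T F (local_closure a T F H) \<le> local_closure a T F H"
proof (intro le_funI subsetI)
  fix A x assume x: "x \<in> local_closure a T F (local_closure a T F H) A"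
  note c = closure_Obj[OF x] closure_carrier[OF x]
  from x obtain R where R: "R \<in> T A" "\<And>B f. f \<in> R B \<Longrightarrow> Res F A B f x \<in> local_closure a T F H B"
    by (elim closureE) blast
  have "locus a F A H x \<in> T A"
  proof (rule T_trans[OF c(1) locus_sieve[OF F H c] R(1)])
    fix B f assume f: "f \<in> R B"
    then show "pull a A (locus a F A H x) B f \<in> T B"
      using pull_locus[OF F c, of B f H] T_elem[OF R(1) f] R(2)[OF f] by (simp add: local_closure_def)
  qed
  then show "x \<in> local_closure a T F H A" using c by (simp add: local_closure_def psh_all_mem)
qed

lemma closure_le_closure:
  assumes "presheaf k a F" "subfunctor k a F H" "subfunctor k a F K" "H \<le> local_closure a T F K"
  shows "local_closure a T F H \<le> local_closure a T F K"
  using closure_mono[OF assms(1) closure_sub[OF assms(1,3)] assms(4)] closure_idem[OF assms(1,3)]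
  by (rule order_trans)

text \<open>By naturality the locus of \<open>\<phi> A x\<close> for \<open>K\<close> is the locus
  of \<open>x\<close> for the preimage of \<open>K\<close>. Having an equality here makes kernels
  computable on the level of presheaves.\<close>

lemma preim_closure:
  assumes "presheaf k a F" "presheaf k a G" "nat_trans k a F G \<phi>" "subfunctor k a G K"
  shows "preim a F \<phi> (local_closure a T G K) = local_closure a T F (preim a F \<phi> K)"
proof -
  have "locus a G A K (\<phi> A x) = locus a F A (preim a F \<phi> K) x" if "A \<in> Obj a" "x \<in> carrier (Val F A)" for A x
    using that nat_Res[OF assms(3)] Res_closed[OF assms(1)]
    by (auto simp: fun_eq_iff set_eq_iff locus_mem preim_def psh_all_mem)
  then have "x \<in> preim a F \<phi> (local_closure a T G K) A \<longleftrightarrow> x \<in> local_closure a T F (preim a F \<phi> K) A" for A x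
    using nat_closed[OF assms(3), of A x] unfolding local_closure_def preim_def[of a F \<phi> "\<lambda>A. {x \<in> _ A. _ A x}"]
    by (auto simp: psh_all_mem)
  then show ?thesis unfolding fun_eq_iff set_eq_iff by blast
qed

text \<open>A covering sieve for \<open>x\<close> serves for \<open>\<phi> A x\<close>. The reverse
  inclusion would require gluing local lifts.\<close>

lemma img_closure:
  assumes "presheaf k a F" "presheaf k a G" "nat_trans k a F G \<phi>" "subfunctor k a F H"
  shows "sub_img \<phi> (local_closure a T F H) \<le> local_closure a T G (sub_img \<phi> H)"
proof (intro le_funI subsetI)
  fix A y assume "y \<in> sub_img \<phi> (local_closure a T F H) A"
  then obtain x where x: "x \<in> local_closure a T F H A" "y = \<phi> A x" by (auto simp: sub_img_def)
  note c = closure_Obj[OF x(1)] closure_carrier[OF x(1)]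
  from x obtain R where R: "R \<in> T A" "\<And>B f. f \<in> R B \<Longrightarrow> Res F A B f x \<in> H B"
    by (elim closureE) blast
  show "y \<in> local_closure a T G (sub_img \<phi> H) A"
  proof (rule closureI[OF assms(2) sub_img_sub[OF assms] R(1)])
    show "y \<in> carrier (Val G A)" using x nat_closed[OF assms(3) c] by simp
    fix B f assume f: "f \<in> R B"
    then show "Res G A B f y \<in> sub_img \<phi> H B"
      using nat_Res[OF assms(3) c(1)] T_elem[OF R(1) f] c(2) R(2)[OF f] x(2)
      unfolding sub_img_def by (metis image_eqI)
  qed
qed

text \<open>Two elements that agree on a covering sieve have a locally zero difference.\<close>

lemma separatedI:
  assumes F: "presheaf k a F" and z: "local_closure a T F (zero_sub a F) \<le> zero_sub a F"
  shows "separated a T F"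
  unfolding separated_def
proof (intro allI impI, elim conjE)
  fix A R x y
  assume A: "A \<in> Obj a" "R \<in> T A" "x \<in> carrier (Val F A)" "y \<in> carrier (Val F A)"
    and e: "\<forall>B f. f \<in> R B \<longrightarrow> Res F A B f x = Res F A B f y"
  interpret M: module k "Val F A" by (rule psh_module[OF F A(1)])
  \<comment> \<open>As a scalar multiple, the negative is respected by restriction maps.\<close>
  have m: "\<ominus>\<^bsub>Val F A\<^esub> y = (\<ominus>\<^bsub>k\<^esub> \<one>\<^bsub>k\<^esub>) \<odot>\<^bsub>Val F A\<^esub> y"
    using A(4) M.smult_l_minus[of "\<one>\<^bsub>k\<^esub>" y] by simp
  have "x \<oplus>\<^bsub>Val F A\<^esub> \<ominus>\<^bsub>Val F A\<^esub> y \<in> local_closure a T F (zero_sub a F) A"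
  proof (rule closureI[OF F zero_sub_sub[OF F] A(2)])
    fix B f assume f: "f \<in> R B"
    note B = T_elem[OF A(2) f]
    interpret N: module k "Val F B" by (rule psh_module[OF F]) (use B in simp)
    have c: "Res F A B f y \<in> carrier (Val F B)" using Res_closed[OF F A(1) _ _ A(4)] B by blast
    have "Res F A B f (\<ominus>\<^bsub>Val F A\<^esub> y) = \<ominus>\<^bsub>Val F B\<^esub> Res F A B f y"
      unfolding m using mod_hom_smult[OF Res_hom[OF F A(1)], of B f "\<ominus>\<^bsub>k\<^esub> \<one>\<^bsub>k\<^esub>" y] B A(4) c
        N.smult_l_minus[of "\<one>\<^bsub>k\<^esub>" "Res F A B f y"] by simp
    then have "Res F A B f (x \<oplus>\<^bsub>Val F A\<^esub> \<ominus>\<^bsub>Val F A\<^esub> y) = \<zero>\<^bsub>Val F B\<^esub>"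
      using mod_hom_add[OF Res_hom[OF F A(1)], of B f x "\<ominus>\<^bsub>Val F A\<^esub> y"] B A e f c N.M.r_neg by simp
    then show "Res F A B f (x \<oplus>\<^bsub>Val F A\<^esub> \<ominus>\<^bsub>Val F A\<^esub> y) \<in> zero_sub a F B"
      using B by (simp add: zero_sub_def)
  qed (use A in simp)
  then have "x \<oplus>\<^bsub>Val F A\<^esub> \<ominus>\<^bsub>Val F A\<^esub> y = \<zero>\<^bsub>Val F A\<^esub>"
    using subD[OF z] A(1) unfolding zero_sub_def by fastforce
  then show "x = y" using A by (simp add: M.M.r_neg M.M.minus_equality M.add.inv_solve_right')
qed

lemma separated_closure_zero:
  assumes F: "presheaf k a F" and s: "separated a T F"
  shows "local_closure a T F (zero_sub a F) = zero_sub a F"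
proof (rule antisym)
  show "zero_sub a F \<le> local_closure a T F (zero_sub a F)"
    by (rule closure_inc[OF F zero_sub_sub[OF F]])
  show "local_closure a T F (zero_sub a F) \<le> zero_sub a F"
  proof (intro le_funI subsetI)
    fix A x assume x: "x \<in> local_closure a T F (zero_sub a F) A"
    note c = closure_Obj[OF x] closure_carrier[OF x]
    from x obtain R where R: "R \<in> T A" "\<And>B f. f \<in> R B \<Longrightarrow> Res F A B f x \<in> zero_sub a F B"
      by (elim closureE) blast
    have "x = \<zero>\<^bsub>Val F A\<^esub>"
    proof (rule separatedD[OF s c(1) R(1) c(2)])
      show "\<zero>\<^bsub>Val F A\<^esub> \<in> carrier (Val F A)"
        using sub_zero[OF psh_all_sub[OF F] F c(1)] by (simp add: psh_all_mem)
      fix B f assume f: "f \<in> R B"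
      show "Res F A B f x = Res F A B f \<zero>\<^bsub>Val F A\<^esub>"
        using R(2)[OF f] T_elem[OF R(1) f] mod_hom_zero[OF Res_hom[OF F c(1)]] psh_module[OF F] c(1)
        by (simp add: zero_sub_def)
    qed
    then show "x \<in> zero_sub a F A" using c by (simp add: zero_sub_def)
  qed
qed

section \<open>Sheaves, subsheaves and images\<close>

lemma sheaf_presheaf: "sheaf k a T F \<Longrightarrow> presheaf k a F"
  by (simp add: sheaf_def)

lemma yoneda_sieve_nat:
  assumes "presheaf k a F" "A \<in> Obj a" "x \<in> carrier (Val F A)" "sieve k a A R"
  shows "nat_trans k a (sub_psh (yoneda a A) R) F (\<lambda>B f. Res F A B f x)"
proof (rule nat_transI)
  fix B assume B: "B \<in> Obj a"
  show "(\<lambda>f. Res F A B f x) \<in> mod_hom k (Val (sub_psh (yoneda a A) R) B) (Val F B)"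
    using Res_closed[OF assms(1,2) B _ assms(3)] sieve_arr[OF assms(2,4), of _ B]
      mod_hom_add[OF Res_hom_arr[OF assms(1,2) B assms(3)]] mod_hom_smult[OF Res_hom_arr[OF assms(1,2) B assms(3)]]
    by (intro mod_homI) simp_all
next
  fix B C g f assume "B \<in> Obj a" "C \<in> Obj a" "g \<in> arr a C B" "f \<in> carrier (Val (sub_psh (yoneda a A) R) B)"
  then show "Res F A C (Res (sub_psh (yoneda a A) R) B C g f) x = Res F B C g (Res F A B f x)"
    using assms sieve_arr[OF assms(2,4)] by (simp add: Res_comp)
qed

text \<open>Both \<open>x\<close> and \<open>y\<close> amalgamate the section that \<open>x\<close>
  induces on \<open>R\<close>, and amalgamations are unique.\<close>

lemma sheaf_separated:
  assumes "sheaf k a T F"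
  shows "separated a T F"
  unfolding separated_def
proof (intro allI impI, elim conjE)
  fix A R x y
  assume A: "A \<in> Obj a" "R \<in> T A" "x \<in> carrier (Val F A)" "y \<in> carrier (Val F A)"
    and e: "\<forall>B f. f \<in> R B \<longrightarrow> Res F A B f x = Res F A B f y"
  have "\<exists>!z. z \<in> carrier (Val F A) \<and> (\<forall>B\<in>Obj a. \<forall>f\<in>R B. Res F A B f x = Res F A B f z)"
    using assms A yoneda_sieve_nat[OF sheaf_presheaf[OF assms] A(1,3) T_sieve[OF A(1,2)]]
    unfolding sheaf_def by blast
  then show "x = y" using A e by blast
qed

lemma sheafI:
  assumes "presheaf k a F" "separated a T F"
    and "\<And>A R s. \<lbrakk>A \<in> Obj a; R \<in> T A; nat_trans k a (sub_psh (yoneda a A) R) F s\<rbrakk>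
      \<Longrightarrow> \<exists>x\<in>carrier (Val F A). \<forall>B\<in>Obj a. \<forall>f\<in>R B. s B f = Res F A B f x"
  shows "sheaf k a T F"
  unfolding sheaf_def
proof (intro conjI ballI allI impI)
  fix A R s assume A: "A \<in> Obj a" "R \<in> T A" "nat_trans k a (sub_psh (yoneda a A) R) F s"
  obtain x where x: "x \<in> carrier (Val F A)" "\<forall>B\<in>Obj a. \<forall>f\<in>R B. s B f = Res F A B f x"
    using assms(3)[OF A] by blast
  show "\<exists>!x. x \<in> carrier (Val F A) \<and> (\<forall>B\<in>Obj a. \<forall>f\<in>R B. s B f = Res F A B f x)"
  proof (rule ex1I[of _ x])
    fix y assume "y \<in> carrier (Val F A) \<and> (\<forall>B\<in>Obj a. \<forall>f\<in>R B. s B f = Res F A B f y)"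
    then show "y = x"
      using separatedD[OF assms(2) A(1,2), of y x] x T_elem[OF A(2)] by metis
  qed (use x in blast)
qed (rule assms(1))

text \<open>If \<open>H\<close> is a sheaf, an element lying in it locally is glued inside
  \<open>H\<close>, and separatedness of \<open>G\<close> identifies the result with the element. If
  \<open>H\<close> is closed, gluing a section of \<open>H\<close> in \<open>G\<close> gives an
  element that lies in \<open>H\<close> locally, hence in \<open>H\<close>.\<close>

lemma subsheaf_iff:
  assumes G: "sheaf k a T G"
  shows "subsheaf k a T G H \<longleftrightarrow> subfunctor k a G H \<and> local_closure a T G H \<le> H"
proof -
  note Gp = sheaf_presheaf[OF G]
  note Gs = sheaf_separated[OF G]
  have 1: "local_closure a T G H \<le> H" if H: "subfunctor k a G H" and sh: "sheaf k a T (sub_psh G H)"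
  proof (intro le_funI subsetI)
    fix A x assume x: "x \<in> local_closure a T G H A"
    note c = closure_Obj[OF x] closure_carrier[OF x]
    from x obtain R where R: "R \<in> T A" "\<And>B f. f \<in> R B \<Longrightarrow> Res G A B f x \<in> H B"
      by (elim closureE) blast
    note n = yoneda_sieve_nat[OF Gp c T_sieve[OF c(1) R(1)]]
    have "nat_trans k a (sub_psh (yoneda a A) R) (sub_psh G H) (\<lambda>B f. Res G A B f x)"
      using n R(2) unfolding nat_into_sub nat_trans_def mod_hom_def by simp
    then obtain y where y: "y \<in> H A" "\<forall>B\<in>Obj a. \<forall>f\<in>R B. Res G A B f x = Res G A B f y"
      using sh c R(1) unfolding sheaf_def sub_psh_sel by metis
    have "x = y"
      using separatedD[OF Gs c(1) R(1) c(2) sub_carrier[OF H Gp c(1) y(1)]] y(2) T_elem[OF R(1)] by metis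
    then show "x \<in> H A" using y by simp
  qed
  have 2: "sheaf k a T (sub_psh G H)" if H: "subfunctor k a G H" and cl: "local_closure a T G H \<le> H"
  proof (rule sheafI)
    show "presheaf k a (sub_psh G H)" by (rule sub_psh_presheaf[OF Gp H])
    show "separated a T (sub_psh G H)"
      unfolding separated_def sub_psh_sel
      using sub_carrier[OF H Gp] separatedD[OF Gs] by metis
    fix A R s assume A: "A \<in> Obj a" "R \<in> T A" "nat_trans k a (sub_psh (yoneda a A) R) (sub_psh G H) s"
    have "nat_trans k a (sub_psh (yoneda a A) R) G s"
      using A(3) sub_carrier[OF H Gp] unfolding nat_into_sub nat_trans_def mod_hom_def
      by (simp add: Pi_iff)
    then obtain x where x: "x \<in> carrier (Val G A)" "\<forall>B\<in>Obj a. \<forall>f\<in>R B. s B f = Res G A B f x"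
      using G A(1,2) unfolding sheaf_def by metis
    have "s B f \<in> H B" if "f \<in> R B" for B f
      using A(3) that T_elem[OF A(2) that] unfolding nat_into_sub by auto
    then have "x \<in> local_closure a T G H A"
      using closureI[OF Gp H A(2) x(1)] x(2) T_elem[OF A(2)] by metis
    then have "x \<in> H A" by (rule subD[OF cl])
    then show "\<exists>x\<in>carrier (Val (sub_psh G H) A). \<forall>B\<in>Obj a. \<forall>f\<in>R B. s B f = Res (sub_psh G H) A B f x"
      using x by auto
  qed
  show ?thesis unfolding subsheaf_def using 1 2 by blast
qed

text \<open>By monotonicity and idempotence the closure is the least closed subfunctor above the
  presheaf image, which settles the existence behind \<open>LEAST\<close>.\<close>

lemma sh_image_eq:
  assumes F: "presheaf k a F" and G: "sheaf k a T G" and n: "nat_trans k a F G \<phi>"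
  shows "sh_image k a T F G \<phi> = local_closure a T G (psh_image a F \<phi>)"
  unfolding sh_image_def
proof (rule Least_equality)
  note Gp = sheaf_presheaf[OF G]
  have i: "subfunctor k a G (psh_image a F \<phi>)"
    unfolding psh_image_eq by (rule sub_img_sub[OF F Gp n psh_all_sub[OF F]])
  show "subsheaf k a T G (local_closure a T G (psh_image a F \<phi>)) \<and>
      psh_image a F \<phi> \<le> local_closure a T G (psh_image a F \<phi>)"
    using closure_sub[OF Gp i] closure_idem[OF Gp i] closure_inc[OF Gp i] by (simp add: subsheaf_iff[OF G])
  fix H assume "subsheaf k a T G H \<and> psh_image a F \<phi> \<le> H"
  then show "local_closure a T G (psh_image a F \<phi>) \<le> H"
    using closure_mono[OF Gp, of H "psh_image a F \<phi>"] by (auto simp: subsheaf_iff[OF G])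
qed


section \<open>Local isomorphisms\<close>

text \<open>The kernel of the composite is the preimage under \<open>\<phi>\<close> of the kernel of
  \<open>\<psi>\<close>, hence within the preimage of the closure of zero, which by
  \<open>preim_closure\<close> is the closure of the kernel of \<open>\<phi>\<close>. Images are
  treated similarly with \<open>img_closure\<close>.\<close>

lemma local_iso_comp:
  assumes "local_iso k a T F G \<phi>" "local_iso k a T G H \<psi>"
  shows "local_iso k a T F H (\<lambda>A x. \<psi> A (\<phi> A x))"
proof -
  have F: "presheaf k a F" and G: "presheaf k a G" and H: "presheaf k a H"
    and p: "nat_trans k a F G \<phi>" and q: "nat_trans k a G H \<psi>"
    and kp: "preim a F \<phi> (zero_sub a G) \<le> local_closure a T F (zero_sub a F)"
    and kq: "preim a G \<psi> (zero_sub a H) \<le> local_closure a T G (zero_sub a G)"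
    and ip: "psh_all a G \<le> local_closure a T G (sub_img \<phi> (psh_all a F))"
    and iq: "psh_all a H \<le> local_closure a T H (sub_img \<psi> (psh_all a G))"
    using assms by (simp_all add: local_iso_def psh_kernel_eq psh_image_eq)
  note zF = zero_sub_sub[OF F] and zG = zero_sub_sub[OF G] and zH = zero_sub_sub[OF H]
  note iF = sub_img_sub[OF F G p psh_all_sub[OF F]]
  have "preim a F (\<lambda>A x. \<psi> A (\<phi> A x)) (zero_sub a H) = preim a F \<phi> (preim a G \<psi> (zero_sub a H))"
    using nat_closed[OF p] by (auto simp: preim_def psh_all_mem fun_eq_iff)
  also have "\<dots> \<le> preim a F \<phi> (local_closure a T G (zero_sub a G))"
    using subD[OF kq] by (auto simp: preim_def le_fun_def)
  also have "\<dots> = local_closure a T F (preim a F \<phi> (zero_sub a G))"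
    by (rule preim_closure[OF F G p zG])
  also have "\<dots> \<le> local_closure a T F (zero_sub a F)"
    by (rule closure_le_closure[OF F preim_sub[OF F G p zG] zF kp])
  finally have 1: "preim a F (\<lambda>A x. \<psi> A (\<phi> A x)) (zero_sub a H) \<le> local_closure a T F (zero_sub a F)" .
  have e: "sub_img (\<lambda>A x. \<psi> A (\<phi> A x)) (psh_all a F) = sub_img \<psi> (sub_img \<phi> (psh_all a F))"
    by (auto simp: sub_img_def fun_eq_iff)
  have "sub_img \<psi> (psh_all a G) \<le> sub_img \<psi> (local_closure a T G (sub_img \<phi> (psh_all a F)))"
    using subD[OF ip] by (auto simp: sub_img_def le_fun_def)
  also have "\<dots> \<le> local_closure a T H (sub_img \<psi> (sub_img \<phi> (psh_all a F)))"
    by (rule img_closure[OF G H q iF])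
  finally have "local_closure a T H (sub_img \<psi> (psh_all a G)) \<le> local_closure a T H (sub_img \<psi> (sub_img \<phi> (psh_all a F)))"
    by (intro closure_le_closure[OF H sub_img_sub[OF G H q psh_all_sub[OF G]] sub_img_sub[OF G H q iF]])
  then show ?thesis
    using 1 iq F H nat_trans_comp[OF p q] e unfolding local_iso_def psh_kernel_eq psh_image_eq
    by (auto intro: order_trans)
qed

text \<open>If \<open>\<phi> A x = \<phi> A y\<close> with \<open>y\<close> in \<open>H\<close>, the
  difference lies in the kernel and is locally zero, so \<open>x\<close> lies in the closure of
  \<open>H\<close>. A closed subfunctor of the source is thus recovered from its image.\<close>

lemma local_iso_preim_closure:
  assumes "local_iso k a T F G \<phi>" "subfunctor k a F H"
  shows "preim a F \<phi> (local_closure a T G (sub_img \<phi> H)) = local_closure a T F H"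
proof -
  have F: "presheaf k a F" and G: "presheaf k a G" and p: "nat_trans k a F G \<phi>"
    and kp: "preim a F \<phi> (zero_sub a G) \<le> local_closure a T F (zero_sub a F)"
    using assms(1) by (simp_all add: local_iso_def psh_kernel_eq)
  note H = assms(2)
  note iH = sub_img_sub[OF F G p H]
  note cH = closure_sub[OF F H]
  have cz: "local_closure a T F (zero_sub a F) \<le> local_closure a T F H"
    by (rule closure_mono[OF F H zero_sub_le[OF F H]])
  have "preim a F \<phi> (sub_img \<phi> H) \<le> local_closure a T F H"
  proof (intro le_funI subsetI)
    fix A x assume "x \<in> preim a F \<phi> (sub_img \<phi> H) A"
    then obtain y where A: "A \<in> Obj a" and x: "x \<in> carrier (Val F A)" and y: "y \<in> H A" "\<phi> A x = \<phi> A y"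
      by (auto simp: preim_def psh_all_mem sub_img_def)
    interpret M: module k "Val F A" by (rule psh_module[OF F A])
    interpret N: module k "Val G A" by (rule psh_module[OF G A])
    note yc = sub_carrier[OF H F A y(1)]
    let ?m = "(\<ominus>\<^bsub>k\<^esub> \<one>\<^bsub>k\<^esub>) \<odot>\<^bsub>Val F A\<^esub> y"
    have m: "?m = \<ominus>\<^bsub>Val F A\<^esub> y" using yc M.smult_l_minus[of "\<one>\<^bsub>k\<^esub>" y] by simp
    have c: "\<phi> A y \<in> carrier (Val G A)" using nat_closed[OF p A yc] .
    have "\<phi> A ?m = \<ominus>\<^bsub>Val G A\<^esub> \<phi> A y"
      using mod_hom_smult[OF nat_hom[OF p A] _ yc] N.smult_l_minus[of "\<one>\<^bsub>k\<^esub>" "\<phi> A y"] c by simp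
    then have "\<phi> A (x \<oplus>\<^bsub>Val F A\<^esub> ?m) = \<zero>\<^bsub>Val G A\<^esub>"
      using mod_hom_add[OF nat_hom[OF p A] x, of ?m] yc y(2) c N.M.r_neg by simp
    then have "x \<oplus>\<^bsub>Val F A\<^esub> ?m \<in> preim a F \<phi> (zero_sub a G) A"
      using A x yc by (simp add: preim_def psh_all_mem zero_sub_def)
    then have "x \<oplus>\<^bsub>Val F A\<^esub> ?m \<in> local_closure a T F H A" by (intro subD[OF cz] subD[OF kp])
    moreover have "y \<in> local_closure a T F H A" by (rule subD[OF closure_inc[OF F H] y(1)])
    ultimately have "(x \<oplus>\<^bsub>Val F A\<^esub> ?m) \<oplus>\<^bsub>Val F A\<^esub> y \<in> local_closure a T F H A"
      by (rule sub_add[OF cH F A])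
    then show "x \<in> local_closure a T F H A"
      unfolding m using x yc by (simp add: M.a_assoc M.l_neg)
  qed
  then have "local_closure a T F (preim a F \<phi> (sub_img \<phi> H)) \<le> local_closure a T F H"
    by (rule closure_le_closure[OF F preim_sub[OF F G p iH] H])
  moreover have "local_closure a T F H \<le> local_closure a T F (preim a F \<phi> (sub_img \<phi> H))"
    by (rule closure_mono[OF F preim_sub[OF F G p iH]])
      (use subD[OF sub_le_all[OF F H]] in \<open>auto simp: le_fun_def preim_def sub_img_def\<close>)
  ultimately show ?thesis using preim_closure[OF F G p iH] by simp
qed

end


section \<open>The plus construction\<close>

text \<open>The canonical morphism from \<open>F\<close> to its plus construction.\<close>

definition plus_unit :: "'k ring \<Rightarrow> ('k, 'o, 'm) lincat \<Rightarrow> ('o, 'm) cov \<Rightarrow> ('k, 'o, 'm, 'v) psh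
    \<Rightarrow> 'o \<Rightarrow> 'v \<Rightarrow> ('o, 'm, 'v) germ set" where
  "plus_unit k a T F A x = germ_rel k a T F A `` {(max_sieve a A, \<lambda>B f. Res F A B f x)}"

context linear_site
begin

text \<open>Sieves are empty outside \<open>Obj a\<close>, so quantifiers over objects are absorbed
  into membership in \<open>R\<close>.\<close>

lemma section_iff:
  assumes "A \<in> Obj a" "sieve k a A R"
  shows "nat_trans k a (sub_psh (yoneda a A) R) F s \<longleftrightarrow>
    (\<forall>B f. f \<in> R B \<longrightarrow> s B f \<in> carrier (Val F B)) \<and>
    (\<forall>B f g. f \<in> R B \<longrightarrow> g \<in> R B \<longrightarrow> s B (f \<oplus>\<^bsub>Hom a B A\<^esub> g) = s B f \<oplus>\<^bsub>Val F B\<^esub> s B g) \<and>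
    (\<forall>B f r. r \<in> carrier k \<longrightarrow> f \<in> R B \<longrightarrow> s B (r \<odot>\<^bsub>Hom a B A\<^esub> f) = r \<odot>\<^bsub>Val F B\<^esub> s B f) \<and>
    (\<forall>B C f g. f \<in> R B \<longrightarrow> C \<in> Obj a \<longrightarrow> g \<in> arr a C B \<longrightarrow> s C (Cmp a C B A f g) = Res F B C g (s B f))"
    (is "?L \<longleftrightarrow> ?R")
proof
  note O = sieve_Obj[OF assms]
  assume L: ?L
  show ?R
    using L O unfolding nat_trans_def mod_hom_def sub_psh_sel yoneda_sel by (auto simp: Pi_iff)
next
  assume ?R
  then show ?L unfolding nat_trans_def mod_hom_def sub_psh_sel yoneda_sel by (auto simp: Pi_iff)
qed

context
  fixes F :: "('k, 'o, 'm, 'v) psh"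
  assumes F: "presheaf k a F"
begin

lemma germs_iff:
  "(R, s) \<in> germs k a T F A \<longleftrightarrow> R \<in> T A \<and> nat_trans k a (sub_psh (yoneda a A) R) F s"
  by (simp add: germs_def)

lemma germ_T: "(R, s) \<in> germs k a T F A \<Longrightarrow> R \<in> T A"
  by (simp add: germs_iff)

lemma germ_Obj: "(R, s) \<in> germs k a T F A \<Longrightarrow> A \<in> Obj a"
  by (auto simp: germs_iff dest: T_Obj)

lemma
  assumes "(R, s) \<in> germs k a T F A"
  shows germ_sieve: "sieve k a A R"
    and germ_closed: "f \<in> R B \<Longrightarrow> s B f \<in> carrier (Val F B)"
    and germ_add: "\<lbrakk>f \<in> R B; g \<in> R B\<rbrakk> \<Longrightarrow> s B (f \<oplus>\<^bsub>Hom a B A\<^esub> g) = s B f \<oplus>\<^bsub>Val F B\<^esub> s B g"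
    and germ_smult: "\<lbrakk>r \<in> carrier k; f \<in> R B\<rbrakk> \<Longrightarrow> s B (r \<odot>\<^bsub>Hom a B A\<^esub> f) = r \<odot>\<^bsub>Val F B\<^esub> s B f"
    and germ_comp: "\<lbrakk>f \<in> R B; C \<in> Obj a; g \<in> arr a C B\<rbrakk> \<Longrightarrow> s C (Cmp a C B A f g) = Res F B C g (s B f)"
proof -
  note A = germ_Obj[OF assms]
  have R: "R \<in> T A" and s: "nat_trans k a (sub_psh (yoneda a A) R) F s"
    using assms by (simp_all add: germs_iff)
  show "sieve k a A R" by (rule T_sieve[OF A R])
  note * = s[unfolded section_iff[OF A T_sieve[OF A R]]]
  show "f \<in> R B \<Longrightarrow> s B f \<in> carrier (Val F B)"
    "\<lbrakk>f \<in> R B; g \<in> R B\<rbrakk> \<Longrightarrow> s B (f \<oplus>\<^bsub>Hom a B A\<^esub> g) = s B f \<oplus>\<^bsub>Val F B\<^esub> s B g"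
    "\<lbrakk>r \<in> carrier k; f \<in> R B\<rbrakk> \<Longrightarrow> s B (r \<odot>\<^bsub>Hom a B A\<^esub> f) = r \<odot>\<^bsub>Val F B\<^esub> s B f"
    "\<lbrakk>f \<in> R B; C \<in> Obj a; g \<in> arr a C B\<rbrakk> \<Longrightarrow> s C (Cmp a C B A f g) = Res F B C g (s B f)"
    using * by simp_all
qed

lemma germI:
  assumes "A \<in> Obj a" "R \<in> T A"
    and "\<And>B f. f \<in> R B \<Longrightarrow> s B f \<in> carrier (Val F B)"
    and "\<And>B f g. \<lbrakk>f \<in> R B; g \<in> R B\<rbrakk> \<Longrightarrow> s B (f \<oplus>\<^bsub>Hom a B A\<^esub> g) = s B f \<oplus>\<^bsub>Val F B\<^esub> s B g"
    and "\<And>B f r. \<lbrakk>r \<in> carrier k; f \<in> R B\<rbrakk> \<Longrightarrow> s B (r \<odot>\<^bsub>Hom a B A\<^esub> f) = r \<odot>\<^bsub>Val F B\<^esub> s B f"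
    and "\<And>B C f g. \<lbrakk>f \<in> R B; C \<in> Obj a; g \<in> arr a C B\<rbrakk> \<Longrightarrow> s C (Cmp a C B A f g) = Res F B C g (s B f)"
  shows "(R, s) \<in> germs k a T F A"
  using assms by (simp add: germs_iff section_iff[OF assms(1) T_sieve[OF assms(1,2)]])

lemma germ_elem: "\<lbrakk>(R, s) \<in> germs k a T F A; f \<in> R B\<rbrakk> \<Longrightarrow> B \<in> Obj a \<and> f \<in> arr a B A"
  using germ_T T_elem by blast

lemma germ_rel_iff:
  "((R, s), (Q, t)) \<in> germ_rel k a T F A \<longleftrightarrow> (R, s) \<in> germs k a T F A \<and> (Q, t) \<in> germs k a T F A \<and>
     (\<exists>P\<in>T A. P \<le> R \<and> P \<le> Q \<and> (\<forall>B\<in>Obj a. \<forall>f\<in>P B. s B f = t B f))"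
  by (simp add: germ_rel_def)

text \<open>Transitivity passes to the intersection of the two witnessing sieves.\<close>

lemma germ_equiv: "equiv (germs k a T F A) (germ_rel k a T F A)"
proof (rule equivI)
  show "germ_rel k a T F A \<subseteq> germs k a T F A \<times> germs k a T F A"
    by (auto simp: germ_rel_def)
  show "refl_on (germs k a T F A) (germ_rel k a T F A)"
    unfolding refl_on_def using germ_T by (force simp: germ_rel_iff)
  show "sym (germ_rel k a T F A)"
    by (rule symI) (auto simp: germ_rel_iff; metis)
  show "trans (germ_rel k a T F A)"
  proof (rule transI, clarsimp simp: germ_rel_iff)
    fix R s Q t U u P P'
    assume g: "(R, s) \<in> germs k a T F A" and P: "P \<in> T A" "P \<le> R" "P \<le> Q" "\<forall>B\<in>Obj a. \<forall>f\<in>P B. s B f = t B f"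
      and P': "P' \<in> T A" "P' \<le> Q" "P' \<le> U" "\<forall>B\<in>Obj a. \<forall>f\<in>P' B. t B f = u B f"
    show "\<exists>P\<in>T A. P \<le> R \<and> P \<le> U \<and> (\<forall>B\<in>Obj a. \<forall>f\<in>P B. s B f = u B f)"
      using P P' T_inf[OF germ_Obj[OF g] P(1) P'(1)]
      by (intro bexI[of _ "inf P P'"]) (auto intro: le_infI1 le_infI2)
  qed
qed

lemma cls_eq_iff:
  assumes "(R, s) \<in> germs k a T F A" "(Q, t) \<in> germs k a T F A"
  shows "germ_rel k a T F A `` {(R, s)} = germ_rel k a T F A `` {(Q, t)} \<longleftrightarrow>
    (\<exists>P\<in>T A. P \<le> R \<and> P \<le> Q \<and> (\<forall>B\<in>Obj a. \<forall>f\<in>P B. s B f = t B f))"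
  using eq_equiv_class_iff[OF germ_equiv assms] assms by (simp add: germ_rel_iff)

lemma cls_eqI:
  assumes "(R, s) \<in> germs k a T F A" "(Q, t) \<in> germs k a T F A" "P \<in> T A" "P \<le> R" "P \<le> Q"
    and "\<And>B f. f \<in> P B \<Longrightarrow> s B f = t B f"
  shows "germ_rel k a T F A `` {(R, s)} = germ_rel k a T F A `` {(Q, t)}"
  unfolding cls_eq_iff[OF assms(1,2)]
  by (rule bexI[OF _ assms(3)]) (simp add: assms(4-6))

lemma plus_carrier: "carrier (Val (plus k a T F) A) = germs k a T F A // germ_rel k a T F A"
  by (simp add: plus_def)

lemma cls_in_plus:
  "(R, s) \<in> germs k a T F A \<Longrightarrow> germ_rel k a T F A `` {(R, s)} \<in> carrier (Val (plus k a T F) A)"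
  unfolding plus_carrier by (rule quotientI)

lemma plusE:
  assumes "c \<in> carrier (Val (plus k a T F) A)"
  obtains R s where "(R, s) \<in> germs k a T F A" "c = germ_rel k a T F A `` {(R, s)}"
  using assms unfolding plus_carrier by (auto elim!: quotientE)

text \<open>The operations of \<open>plus\<close> are unions over all representatives. Once the
  members do not depend on the representative, the union is the value at any one of them, because
  the class is nonempty.\<close>

lemma UN_cls:
  assumes "(R, s) \<in> germs k a T F A"
    and "\<And>Q t. ((R, s), (Q, t)) \<in> germ_rel k a T F A \<Longrightarrow> h Q t = h R s"
  shows "(\<Union>(Q, t)\<in>germ_rel k a T F A `` {(R, s)}. h Q t) = h R s"
proof -
  have "(R, s) \<in> germ_rel k a T F A `` {(R, s)}" by (rule equiv_class_self[OF germ_equiv assms(1)])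
  moreover have "(case p of (Q, t) \<Rightarrow> h Q t) = h R s" if "p \<in> germ_rel k a T F A `` {(R, s)}" for p
    using that assms(2)[of "fst p" "snd p"] by (simp add: case_prod_beta)
  ultimately show ?thesis by (metis (mono_tags, lifting) SUP_eq_const empty_iff)
qed

section \<open>Operations on germs and on their classes\<close>

lemma germ_plus:
  assumes "(R, s) \<in> germs k a T F A" "(Q, t) \<in> germs k a T F A"
  shows "(inf R Q, \<lambda>B f. s B f \<oplus>\<^bsub>Val F B\<^esub> t B f) \<in> germs k a T F A"
proof (rule germI)
  note A = germ_Obj[OF assms(1)]
  show "A \<in> Obj a" by (rule A)
  show "inf R Q \<in> T A" by (rule T_inf[OF A germ_T[OF assms(1)] germ_T[OF assms(2)]])
  fix B f assume f: "f \<in> inf R Q B"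
  then have fR: "f \<in> R B" and fQ: "f \<in> Q B" by auto
  have B: "B \<in> Obj a" using germ_elem[OF assms(1) fR] by simp
  interpret M: module k "Val F B" by (rule psh_module[OF F B])
  note c = germ_closed[OF assms(1)] germ_closed[OF assms(2)]
  show "s B f \<oplus>\<^bsub>Val F B\<^esub> t B f \<in> carrier (Val F B)" using c fR fQ by simp
  show "s B (r \<odot>\<^bsub>Hom a B A\<^esub> f) \<oplus>\<^bsub>Val F B\<^esub> t B (r \<odot>\<^bsub>Hom a B A\<^esub> f) = r \<odot>\<^bsub>Val F B\<^esub> (s B f \<oplus>\<^bsub>Val F B\<^esub> t B f)"
    if "r \<in> carrier k" for r
    using that c fR fQ by (simp add: germ_smult[OF assms(1)] germ_smult[OF assms(2)] M.smult_r_distr)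
  show "s C (Cmp a C B A f g) \<oplus>\<^bsub>Val F C\<^esub> t C (Cmp a C B A f g) = Res F B C g (s B f \<oplus>\<^bsub>Val F B\<^esub> t B f)"
    if "C \<in> Obj a" "g \<in> arr a C B" for C g
    using that c fR fQ B
    by (simp add: germ_comp[OF assms(1)] germ_comp[OF assms(2)] mod_hom_add[OF Res_hom[OF F]])
  fix g assume g: "g \<in> inf R Q B"
  then have gR: "g \<in> R B" and gQ: "g \<in> Q B" by auto
  show "s B (f \<oplus>\<^bsub>Hom a B A\<^esub> g) \<oplus>\<^bsub>Val F B\<^esub> t B (f \<oplus>\<^bsub>Hom a B A\<^esub> g) =
    s B f \<oplus>\<^bsub>Val F B\<^esub> t B f \<oplus>\<^bsub>Val F B\<^esub> (s B g \<oplus>\<^bsub>Val F B\<^esub> t B g)"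
    using c fR fQ gR gQ by (simp add: germ_add[OF assms(1)] germ_add[OF assms(2)] M.a_ac)
qed

lemma germ_scale:
  assumes "(R, s) \<in> germs k a T F A" "r \<in> carrier k"
  shows "(R, \<lambda>B f. r \<odot>\<^bsub>Val F B\<^esub> s B f) \<in> germs k a T F A"
proof (rule germI)
  note A = germ_Obj[OF assms(1)]
  show "A \<in> Obj a" by (rule A)
  show "R \<in> T A" by (rule germ_T[OF assms(1)])
  fix B f assume f: "f \<in> R B"
  have B: "B \<in> Obj a" using germ_elem[OF assms(1) f] by simp
  interpret M: module k "Val F B" by (rule psh_module[OF F B])
  note c = germ_closed[OF assms(1)]
  show "r \<odot>\<^bsub>Val F B\<^esub> s B f \<in> carrier (Val F B)" using c f assms(2) by simp
  \<comment> \<open>Commutativity of \<open>k\<close> enters here: rescaling by \<open>r\<close>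
    preserves the compatibility of the section with \<open>r'\<close>.\<close>
  show "r \<odot>\<^bsub>Val F B\<^esub> s B (r' \<odot>\<^bsub>Hom a B A\<^esub> f) = r' \<odot>\<^bsub>Val F B\<^esub> (r \<odot>\<^bsub>Val F B\<^esub> s B f)"
    if "r' \<in> carrier k" for r'
    using that c f assms(2) m_comm[of r r']
    by (simp add: germ_smult[OF assms(1)] flip: M.smult_assoc1)
  show "r \<odot>\<^bsub>Val F C\<^esub> s C (Cmp a C B A f g) = Res F B C g (r \<odot>\<^bsub>Val F B\<^esub> s B f)"
    if "C \<in> Obj a" "g \<in> arr a C B" for C g
    using that c f B assms(2)
    by (simp add: germ_comp[OF assms(1)] mod_hom_smult[OF Res_hom[OF F]])
  fix g assume g: "g \<in> R B"
  show "r \<odot>\<^bsub>Val F B\<^esub> s B (f \<oplus>\<^bsub>Hom a B A\<^esub> g) = r \<odot>\<^bsub>Val F B\<^esub> s B f \<oplus>\<^bsub>Val F B\<^esub> r \<odot>\<^bsub>Val F B\<^esub> s B g"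
    using c f g assms(2) by (simp add: germ_add[OF assms(1)] M.smult_r_distr)
qed

lemma germ_zero:
  assumes "A \<in> Obj a"
  shows "(max_sieve a A, \<lambda>B f. \<zero>\<^bsub>Val F B\<^esub>) \<in> germs k a T F A"
proof (rule germI)
  show "A \<in> Obj a" "max_sieve a A \<in> T A" using assms T_max by auto
  fix B f assume "f \<in> max_sieve a A B"
  then have B: "B \<in> Obj a" by (simp add: max_sieve_mem)
  interpret M: module k "Val F B" by (rule psh_module[OF F B])
  show "\<zero>\<^bsub>Val F B\<^esub> \<in> carrier (Val F B)" "\<zero>\<^bsub>Val F B\<^esub> = \<zero>\<^bsub>Val F B\<^esub> \<oplus>\<^bsub>Val F B\<^esub> \<zero>\<^bsub>Val F B\<^esub>" by simp_all
  show "\<zero>\<^bsub>Val F B\<^esub> = r \<odot>\<^bsub>Val F B\<^esub> \<zero>\<^bsub>Val F B\<^esub>" if "r \<in> carrier k" for r using that by simp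
  show "\<zero>\<^bsub>Val F C\<^esub> = Res F B C g \<zero>\<^bsub>Val F B\<^esub>" if "C \<in> Obj a" "g \<in> arr a C B" for C g
    using mod_hom_zero[OF Res_hom[OF F B that] psh_module[OF F B] psh_module[OF F that(1)]] by simp
qed

lemma germ_pull:
  assumes "(R, s) \<in> germs k a T F A" "B \<in> Obj a" "f \<in> arr a B A"
  shows "(pull a A R B f, \<lambda>C g. s C (Cmp a C B A f g)) \<in> germs k a T F B"
proof (rule germI)
  note A = germ_Obj[OF assms(1)]
  show "B \<in> Obj a" "pull a A R B f \<in> T B"
    using assms T_pull[OF A _ germ_T[OF assms(1)]] by simp_all
  fix C g assume "g \<in> pull a A R B f C"
  then have C: "C \<in> Obj a" and g: "g \<in> arr a C B" and fg: "Cmp a C B A f g \<in> R C" by (simp_all add: pull_mem)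
  show "s C (Cmp a C B A f g) \<in> carrier (Val F C)" using germ_closed[OF assms(1) fg] .
  show "s C (Cmp a C B A f (r \<odot>\<^bsub>Hom a C B\<^esub> g)) = r \<odot>\<^bsub>Val F C\<^esub> s C (Cmp a C B A f g)"
    if "r \<in> carrier k" for r
    using mod_hom_smult[OF comp_linear_right[OF C assms(2) A assms(3)] that g] germ_smult[OF assms(1) that fg] by simp
  show "s D (Cmp a D B A f (Cmp a D C B g h)) = Res F C D h (s C (Cmp a C B A f g))"
    if "D \<in> Obj a" "h \<in> arr a D C" for D h
    using comp_assoc[OF that(1) C assms(2) A that(2) g assms(3)] germ_comp[OF assms(1) fg that] by simp
  fix h assume "h \<in> pull a A R B f C"
  then have h: "h \<in> arr a C B" and fh: "Cmp a C B A f h \<in> R C" by (simp_all add: pull_mem)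
  show "s C (Cmp a C B A f (g \<oplus>\<^bsub>Hom a C B\<^esub> h)) = s C (Cmp a C B A f g) \<oplus>\<^bsub>Val F C\<^esub> s C (Cmp a C B A f h)"
    using mod_hom_add[OF comp_linear_right[OF C assms(2) A assms(3)] g h] germ_add[OF assms(1) fg fh] by simp
qed

text \<open>Sums formed from equivalent representatives agree on the intersection of the sieves that
  witness the equivalences, so \<open>UN_cls\<close> applies twice.\<close>

lemma add_plus:
  assumes "(R, s) \<in> germs k a T F A" "(Q, t) \<in> germs k a T F A"
  shows "germ_rel k a T F A `` {(R, s)} \<oplus>\<^bsub>Val (plus k a T F) A\<^esub> germ_rel k a T F A `` {(Q, t)} =
    germ_rel k a T F A `` {(inf R Q, \<lambda>B f. s B f \<oplus>\<^bsub>Val F B\<^esub> t B f)}"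
proof -
  have *: "germ_rel k a T F A `` {(inf R' Q', \<lambda>B f. s' B f \<oplus>\<^bsub>Val F B\<^esub> t' B f)} =
    germ_rel k a T F A `` {(inf R Q, \<lambda>B f. s B f \<oplus>\<^bsub>Val F B\<^esub> t B f)}"
    if rel: "((R, s), (R', s')) \<in> germ_rel k a T F A" "((Q, t), (Q', t')) \<in> germ_rel k a T F A" for R' s' Q' t'
  proof -
    obtain P where P: "P \<in> T A" "P \<le> R" "P \<le> R'" "\<forall>B\<in>Obj a. \<forall>f\<in>P B. s B f = s' B f" and g: "(R', s') \<in> germs k a T F A"
      using rel(1) unfolding germ_rel_iff by blast
    obtain P' where P': "P' \<in> T A" "P' \<le> Q" "P' \<le> Q'" "\<forall>B\<in>Obj a. \<forall>f\<in>P' B. t B f = t' B f" and g': "(Q', t') \<in> germs k a T F A"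
      using rel(2) unfolding germ_rel_iff by blast
    show ?thesis
      using P P' T_elem[OF P(1)]
      by (intro cls_eqI[OF germ_plus[OF g g'] germ_plus[OF assms] T_inf[OF germ_Obj[OF g] P(1) P'(1)]])
        (auto intro: le_infI1 le_infI2)
  qed
  have r: "((R, s), (R, s)) \<in> germ_rel k a T F A" "((Q, t), (Q, t)) \<in> germ_rel k a T F A"
    using germ_equiv assms by (auto simp: equiv_def refl_on_def)
  have "(\<Union>(Q', t')\<in>germ_rel k a T F A `` {(Q, t)}.
      germ_rel k a T F A `` {(inf R' Q', \<lambda>B f. s' B f \<oplus>\<^bsub>Val F B\<^esub> t' B f)}) =
      germ_rel k a T F A `` {(inf R Q, \<lambda>B f. s B f \<oplus>\<^bsub>Val F B\<^esub> t B f)}"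
    if "((R, s), (R', s')) \<in> germ_rel k a T F A" for R' s'
    using UN_cls[OF assms(2), of "\<lambda>Q' t'. germ_rel k a T F A `` {(inf R' Q', \<lambda>B f. s' B f \<oplus>\<^bsub>Val F B\<^esub> t' B f)}"]
      *[OF that] r(2) by simp
  then show ?thesis
    using UN_cls[OF assms(1), of "\<lambda>R' s'. (\<Union>(Q', t')\<in>germ_rel k a T F A `` {(Q, t)}.
      germ_rel k a T F A `` {(inf R' Q', \<lambda>B f. s' B f \<oplus>\<^bsub>Val F B\<^esub> t' B f)})"] r(1)
    by (simp add: plus_def)
qed

lemma smult_plus:
  assumes "(R, s) \<in> germs k a T F A" "r \<in> carrier k"
  shows "r \<odot>\<^bsub>Val (plus k a T F) A\<^esub> germ_rel k a T F A `` {(R, s)} =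
    germ_rel k a T F A `` {(R, \<lambda>B f. r \<odot>\<^bsub>Val F B\<^esub> s B f)}"
proof -
  have "germ_rel k a T F A `` {(Q, \<lambda>B f. r \<odot>\<^bsub>Val F B\<^esub> t B f)} = germ_rel k a T F A `` {(R, \<lambda>B f. r \<odot>\<^bsub>Val F B\<^esub> s B f)}"
    if rel: "((R, s), (Q, t)) \<in> germ_rel k a T F A" for Q t
  proof -
    obtain P where P: "P \<in> T A" "P \<le> R" "P \<le> Q" "\<forall>B\<in>Obj a. \<forall>f\<in>P B. s B f = t B f" and g: "(Q, t) \<in> germs k a T F A"
      using rel unfolding germ_rel_iff by blast
    show ?thesis
      using P T_elem[OF P(1)]
      by (intro cls_eqI[OF germ_scale[OF g assms(2)] germ_scale[OF assms] P(1)]) auto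
  qed
  then show ?thesis
    using UN_cls[OF assms(1), of "\<lambda>R s. germ_rel k a T F A `` {(R, \<lambda>B f. r \<odot>\<^bsub>Val F B\<^esub> s B f)}"]
    by (simp add: plus_def)
qed

lemma zero_plus: "\<zero>\<^bsub>Val (plus k a T F) A\<^esub> = germ_rel k a T F A `` {(max_sieve a A, \<lambda>B f. \<zero>\<^bsub>Val F B\<^esub>)}"
  by (simp add: plus_def)

lemma Res_plus:
  assumes "(R, s) \<in> germs k a T F A" "B \<in> Obj a" "f \<in> arr a B A"
  shows "Res (plus k a T F) A B f (germ_rel k a T F A `` {(R, s)}) =
    germ_rel k a T F B `` {(pull a A R B f, \<lambda>C g. s C (Cmp a C B A f g))}"
proof -
  note A = germ_Obj[OF assms(1)]
  have "germ_rel k a T F B `` {(pull a A Q B f, \<lambda>C g. t C (Cmp a C B A f g))} =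
      germ_rel k a T F B `` {(pull a A R B f, \<lambda>C g. s C (Cmp a C B A f g))}"
    if rel: "((R, s), (Q, t)) \<in> germ_rel k a T F A" for Q t
  proof -
    obtain P where P: "P \<in> T A" "P \<le> R" "P \<le> Q" "\<forall>B\<in>Obj a. \<forall>f\<in>P B. s B f = t B f" and g: "(Q, t) \<in> germs k a T F A"
      using rel unfolding germ_rel_iff by blast
    show ?thesis
    \<comment> \<open>The pullback of the witness \<open>P\<close> along \<open>f\<close> witnesses
      the equivalence of the pulled back germs.\<close>
    proof (rule cls_eqI[OF germ_pull[OF g assms(2,3)] germ_pull[OF assms] T_pull[OF A assms(2) P(1) assms(3)]])
      show "pull a A P B f \<le> pull a A Q B f" "pull a A P B f \<le> pull a A R B f"
        using subD[OF P(2)] subD[OF P(3)] unfolding le_fun_def subset_iff pull_mem by blast+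
      show "t C (Cmp a C B A f g) = s C (Cmp a C B A f g)" if "g \<in> pull a A P B f C" for C g
        using that P(4) by (simp add: pull_mem)
    qed
  qed
  then show ?thesis
    using UN_cls[OF assms(1), of "\<lambda>R s. germ_rel k a T F B `` {(pull a A R B f, \<lambda>C g. s C (Cmp a C B A f g))}"]
    by (simp add: plus_def)
qed

text \<open>Each axiom reduces by \<open>cls_eqI\<close> to the same axiom in the values of
  \<open>F\<close>, on a covering sieve where all germs involved are defined.\<close>

lemma plus_module:
  assumes A: "A \<in> Obj a"
  shows "module k (Val (plus k a T F) A)"
proof (rule moduleI)
  have M: "module k (Val F B)" if "(R, s) \<in> germs k a T F A" "f \<in> R B" for R s B f
    using psh_module[OF F] germ_elem[OF that] by blast
  have ab: "abelian_group (Val F B)" if "(R, s) \<in> germs k a T F A" "f \<in> R B" for R s B f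
    using M[OF that] by (simp add: module_def)
  note mon = abelian_group.axioms(1)[OF ab]
  show "cring k" by (rule cring_axioms)
  show "abelian_group (Val (plus k a T F) A)"
  proof (rule abelian_groupI)
    show "\<zero>\<^bsub>Val (plus k a T F) A\<^esub> \<in> carrier (Val (plus k a T F) A)"
      unfolding zero_plus by (rule cls_in_plus[OF germ_zero[OF A]])
    fix x assume "x \<in> carrier (Val (plus k a T F) A)"
    then obtain R s where g: "(R, s) \<in> germs k a T F A" and x: "x = germ_rel k a T F A `` {(R, s)}" by (rule plusE)
    note gR = germ_T[OF g]
    show "\<zero>\<^bsub>Val (plus k a T F) A\<^esub> \<oplus>\<^bsub>Val (plus k a T F) A\<^esub> x = x"
      unfolding x zero_plus add_plus[OF germ_zero[OF A] g]
      by (rule cls_eqI[OF germ_plus[OF germ_zero[OF A] g] g T_inf[OF A T_max[OF A] gR]])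
        (auto intro: abelian_monoid.l_zero[OF mon[OF g]] germ_closed[OF g])
    show "\<exists>y\<in>carrier (Val (plus k a T F) A). y \<oplus>\<^bsub>Val (plus k a T F) A\<^esub> x = \<zero>\<^bsub>Val (plus k a T F) A\<^esub>"
    proof (rule bexI)
      \<comment> \<open>The inverse is the multiple by -1, which is a germ by
        \<open>germ_scale\<close>.\<close>
      let ?y = "germ_rel k a T F A `` {(R, \<lambda>B f. (\<ominus>\<^bsub>k\<^esub> \<one>\<^bsub>k\<^esub>) \<odot>\<^bsub>Val F B\<^esub> s B f)}"
      have m: "\<ominus>\<^bsub>k\<^esub> \<one>\<^bsub>k\<^esub> \<in> carrier k" by simp
      show "?y \<in> carrier (Val (plus k a T F) A)" by (rule cls_in_plus[OF germ_scale[OF g m]])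
      show "?y \<oplus>\<^bsub>Val (plus k a T F) A\<^esub> x = \<zero>\<^bsub>Val (plus k a T F) A\<^esub>"
        unfolding x zero_plus add_plus[OF germ_scale[OF g m] g]
      proof (rule cls_eqI[OF germ_plus[OF germ_scale[OF g m] g] germ_zero[OF A] gR])
        show "R \<le> max_sieve a A" using T_elem[OF gR] by (auto simp: le_fun_def max_sieve_mem)
        fix B f assume f: "f \<in> R B"
        interpret V: module k "Val F B" by (rule M[OF g f])
        show "(\<ominus>\<^bsub>k\<^esub> \<one>\<^bsub>k\<^esub>) \<odot>\<^bsub>Val F B\<^esub> s B f \<oplus>\<^bsub>Val F B\<^esub> s B f = \<zero>\<^bsub>Val F B\<^esub>"
          using germ_closed[OF g f] V.smult_l_minus[of "\<one>\<^bsub>k\<^esub>" "s B f"] by (simp add: V.M.l_neg)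
      qed auto
    qed
    fix y assume "y \<in> carrier (Val (plus k a T F) A)"
    then obtain Q t where h: "(Q, t) \<in> germs k a T F A" and y: "y = germ_rel k a T F A `` {(Q, t)}" by (rule plusE)
    show "x \<oplus>\<^bsub>Val (plus k a T F) A\<^esub> y \<in> carrier (Val (plus k a T F) A)"
      unfolding x y add_plus[OF g h] by (rule cls_in_plus[OF germ_plus[OF g h]])
    show "x \<oplus>\<^bsub>Val (plus k a T F) A\<^esub> y = y \<oplus>\<^bsub>Val (plus k a T F) A\<^esub> x"
      unfolding x y add_plus[OF g h] add_plus[OF h g]
      by (rule cls_eqI[OF germ_plus[OF g h] germ_plus[OF h g] germ_T[OF germ_plus[OF g h]]])
        (auto intro: abelian_monoid.a_comm[OF mon[OF g]] germ_closed[OF g] germ_closed[OF h])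
    fix z assume "z \<in> carrier (Val (plus k a T F) A)"
    then obtain U u where i: "(U, u) \<in> germs k a T F A" and z: "z = germ_rel k a T F A `` {(U, u)}" by (rule plusE)
    note gh = germ_plus[OF g h] and hi = germ_plus[OF h i]
    show "x \<oplus>\<^bsub>Val (plus k a T F) A\<^esub> y \<oplus>\<^bsub>Val (plus k a T F) A\<^esub> z = x \<oplus>\<^bsub>Val (plus k a T F) A\<^esub> (y \<oplus>\<^bsub>Val (plus k a T F) A\<^esub> z)"
      unfolding x y z add_plus[OF g h] add_plus[OF h i] add_plus[OF gh i] add_plus[OF g hi]
      by (rule cls_eqI[OF germ_plus[OF gh i] germ_plus[OF g hi] germ_T[OF germ_plus[OF gh i]]])
        (auto intro: le_infI1 abelian_monoid.a_assoc[OF mon[OF g]] germ_closed[OF g] germ_closed[OF h] germ_closed[OF i])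
  qed
  fix x assume "x \<in> carrier (Val (plus k a T F) A)"
  then obtain R s where g: "(R, s) \<in> germs k a T F A" and x: "x = germ_rel k a T F A `` {(R, s)}" by (rule plusE)
  note gR = germ_T[OF g]
  show "\<one>\<^bsub>k\<^esub> \<odot>\<^bsub>Val (plus k a T F) A\<^esub> x = x"
    unfolding x smult_plus[OF g one_closed]
    by (rule cls_eqI[OF germ_scale[OF g one_closed] g gR])
      (auto intro: module.smult_one[OF M[OF g]] germ_closed[OF g])
  fix r assume r: "r \<in> carrier k"
  show "r \<odot>\<^bsub>Val (plus k a T F) A\<^esub> x \<in> carrier (Val (plus k a T F) A)"
    unfolding x smult_plus[OF g r] by (rule cls_in_plus[OF germ_scale[OF g r]])
  {
    fix r' assume r': "r' \<in> carrier k"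
    have rr: "r \<oplus>\<^bsub>k\<^esub> r' \<in> carrier k" "r \<otimes>\<^bsub>k\<^esub> r' \<in> carrier k" using r r' by auto
    show "(r \<oplus>\<^bsub>k\<^esub> r') \<odot>\<^bsub>Val (plus k a T F) A\<^esub> x =
      r \<odot>\<^bsub>Val (plus k a T F) A\<^esub> x \<oplus>\<^bsub>Val (plus k a T F) A\<^esub> r' \<odot>\<^bsub>Val (plus k a T F) A\<^esub> x"
      unfolding x smult_plus[OF g rr(1)] smult_plus[OF g r] smult_plus[OF g r'] add_plus[OF germ_scale[OF g r] germ_scale[OF g r']]
      by (rule cls_eqI[OF germ_scale[OF g rr(1)] germ_plus[OF germ_scale[OF g r] germ_scale[OF g r']] gR])
        (auto intro: module.smult_l_distr[OF M[OF g]] germ_closed[OF g] r r')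
    show "(r \<otimes>\<^bsub>k\<^esub> r') \<odot>\<^bsub>Val (plus k a T F) A\<^esub> x =
      r \<odot>\<^bsub>Val (plus k a T F) A\<^esub> (r' \<odot>\<^bsub>Val (plus k a T F) A\<^esub> x)"
      unfolding x smult_plus[OF g rr(2)] smult_plus[OF g r'] smult_plus[OF germ_scale[OF g r'] r]
      by (rule cls_eqI[OF germ_scale[OF g rr(2)] germ_scale[OF germ_scale[OF g r'] r] gR])
        (auto intro: module.smult_assoc1[OF M[OF g]] germ_closed[OF g] r r')
  }
  fix y assume "y \<in> carrier (Val (plus k a T F) A)"
  then obtain Q t where h: "(Q, t) \<in> germs k a T F A" and y: "y = germ_rel k a T F A `` {(Q, t)}" by (rule plusE)
  note gh = germ_plus[OF g h] and rgh = germ_plus[OF germ_scale[OF g r] germ_scale[OF h r]]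
  show "r \<odot>\<^bsub>Val (plus k a T F) A\<^esub> (x \<oplus>\<^bsub>Val (plus k a T F) A\<^esub> y) =
     r \<odot>\<^bsub>Val (plus k a T F) A\<^esub> x \<oplus>\<^bsub>Val (plus k a T F) A\<^esub> r \<odot>\<^bsub>Val (plus k a T F) A\<^esub> y"
    unfolding x y add_plus[OF g h] smult_plus[OF gh r] smult_plus[OF g r] smult_plus[OF h r]
      add_plus[OF germ_scale[OF g r] germ_scale[OF h r]]
    by (rule cls_eqI[OF germ_scale[OF gh r] rgh germ_T[OF gh]])
      (auto intro: module.smult_r_distr[OF M[OF g]] germ_closed[OF g] germ_closed[OF h] r)
qed

lemma plus_presheaf: "presheaf k a (plus k a T F)"
  unfolding presheaf_def
proof (intro conjI ballI)
  fix A assume A: "A \<in> Obj a"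
  show "module k (Val (plus k a T F) A)" by (rule plus_module[OF A])
  {
    fix x assume "x \<in> carrier (Val (plus k a T F) A)"
    then obtain R s where g: "(R, s) \<in> germs k a T F A" and x: "x = germ_rel k a T F A `` {(R, s)}" by (rule plusE)
    note I = id_closed[OF A] and R = germ_sieve[OF g]
    show "Res (plus k a T F) A A (Idt a A) x = x"
      unfolding x Res_plus[OF g A I]
      by (rule cls_eqI[OF germ_pull[OF g A I] g germ_T[OF g]])
        (use pull_id[OF A R] id_left germ_elem[OF g] A in auto)
  }
  fix B assume B: "B \<in> Obj a"
  {
    fix f assume f: "f \<in> arr a B A"
    show "Res (plus k a T F) A B f \<in> mod_hom k (Val (plus k a T F) A) (Val (plus k a T F) B)"
    proof (rule mod_homI)
      fix x assume "x \<in> carrier (Val (plus k a T F) A)"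
      then obtain R s where g: "(R, s) \<in> germs k a T F A" and x: "x = germ_rel k a T F A `` {(R, s)}" by (rule plusE)
      note gf = germ_pull[OF g B f]
      show "Res (plus k a T F) A B f x \<in> carrier (Val (plus k a T F) B)"
        unfolding x Res_plus[OF g B f] by (rule cls_in_plus[OF gf])
      show "Res (plus k a T F) A B f (r \<odot>\<^bsub>Val (plus k a T F) A\<^esub> x) = r \<odot>\<^bsub>Val (plus k a T F) B\<^esub> Res (plus k a T F) A B f x"
        if r: "r \<in> carrier k" for r
        unfolding x Res_plus[OF g B f] smult_plus[OF g r] smult_plus[OF gf r] Res_plus[OF germ_scale[OF g r] B f] ..
      fix y assume "y \<in> carrier (Val (plus k a T F) A)"
      then obtain Q t where h: "(Q, t) \<in> germs k a T F A" and y: "y = germ_rel k a T F A `` {(Q, t)}" by (rule plusE)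
      note hf = germ_pull[OF h B f]
      \<comment> \<open>Pullback commutes with intersection, so both sides have the same
        representative.\<close>
      have "pull a A (inf R Q) B f = inf (pull a A R B f) (pull a A Q B f)"
        by (auto simp: fun_eq_iff set_eq_iff pull_mem)
      then show "Res (plus k a T F) A B f (x \<oplus>\<^bsub>Val (plus k a T F) A\<^esub> y) =
          Res (plus k a T F) A B f x \<oplus>\<^bsub>Val (plus k a T F) B\<^esub> Res (plus k a T F) A B f y"
        unfolding x y Res_plus[OF g B f] Res_plus[OF h B f] add_plus[OF g h] add_plus[OF gf hf]
          Res_plus[OF germ_plus[OF g h] B f] by simp
    qed
    fix C g x assume C: "C \<in> Obj a" and g: "g \<in> arr a C B" and "x \<in> carrier (Val (plus k a T F) A)"
    then obtain R s where gs: "(R, s) \<in> germs k a T F A" and x: "x = germ_rel k a T F A `` {(R, s)}" by (elim plusE)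
    note fg = comp_closed[OF C B A g f]
    note p1 = germ_pull[OF gs C fg] and p2 = germ_pull[OF germ_pull[OF gs B f] C g]
    show "Res (plus k a T F) A C (Cmp a C B A f g) x = Res (plus k a T F) B C g (Res (plus k a T F) A B f x)"
      unfolding x Res_plus[OF gs B f] Res_plus[OF germ_pull[OF gs B f] C g] Res_plus[OF gs C fg]
    proof (rule cls_eqI[OF p1 p2 germ_T[OF p1]])
      show "pull a A R C (Cmp a C B A f g) \<le> pull a B (pull a A R B f) C g"
        by (simp add: pull_pull[OF A B f C g])
      fix D h assume "h \<in> pull a A R C (Cmp a C B A f g) D"
      then have "D \<in> Obj a" "h \<in> arr a D C" by (simp_all add: pull_mem)
      then show "s D (Cmp a D C A (Cmp a C B A f g) h) = s D (Cmp a D B A f (Cmp a D C B g h))"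
        using comp_assoc[OF _ C B A _ g f] by simp
    qed simp
  }
  fix x assume "x \<in> carrier (Val (plus k a T F) A)"
  then obtain R s where g: "(R, s) \<in> germs k a T F A" and x: "x = germ_rel k a T F A `` {(R, s)}" by (rule plusE)
  interpret H: module k "Hom a B A" by (rule hom_module[OF B A])
  \<comment> \<open>For linearity in \<open>f\<close>, the domain pulled back along a multiple or a
    sum may exceed the one on the other side. The germs are compared on the smaller sieve.\<close>
  note lin = comp_linear_left[OF _ B A]
  show "(\<lambda>f. Res (plus k a T F) A B f x) \<in> mod_hom k (Hom a B A) (Val (plus k a T F) B)"
    unfolding x
  proof (rule mod_homI)
    fix f assume f: "f \<in> arr a B A"
    note gf = germ_pull[OF g B f]
    show "Res (plus k a T F) A B f (germ_rel k a T F A `` {(R, s)}) \<in> carrier (Val (plus k a T F) B)"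
      unfolding x Res_plus[OF g B f] by (rule cls_in_plus[OF gf])
    {
      fix r assume r: "r \<in> carrier k"
      have rf: "r \<odot>\<^bsub>Hom a B A\<^esub> f \<in> arr a B A" using r f by simp
      have c: "Cmp a C B A (r \<odot>\<^bsub>Hom a B A\<^esub> f) h = r \<odot>\<^bsub>Hom a C A\<^esub> Cmp a C B A f h" if "C \<in> Obj a" "h \<in> arr a C B" for C h
        using mod_hom_smult[OF lin[OF that] r f] .
      show "Res (plus k a T F) A B (r \<odot>\<^bsub>Hom a B A\<^esub> f) (germ_rel k a T F A `` {(R, s)}) =
         r \<odot>\<^bsub>Val (plus k a T F) B\<^esub> Res (plus k a T F) A B f (germ_rel k a T F A `` {(R, s)})"
        unfolding Res_plus[OF g B f] Res_plus[OF g B rf] smult_plus[OF gf r]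
        by (rule cls_eqI[OF germ_pull[OF g B rf] germ_scale[OF gf r] germ_T[OF gf]])
          (auto simp: le_fun_def pull_mem c sieve_smult[OF A germ_sieve[OF g] r] germ_smult[OF g r])
    }
    fix f' assume f': "f' \<in> arr a B A"
    note gf' = germ_pull[OF g B f']
    have rf: "f \<oplus>\<^bsub>Hom a B A\<^esub> f' \<in> arr a B A" using f f' by simp
    have c: "Cmp a C B A (f \<oplus>\<^bsub>Hom a B A\<^esub> f') h = Cmp a C B A f h \<oplus>\<^bsub>Hom a C A\<^esub> Cmp a C B A f' h"
      if "C \<in> Obj a" "h \<in> arr a C B" for C h
      using mod_hom_add[OF lin[OF that] f f'] .
    show "Res (plus k a T F) A B (f \<oplus>\<^bsub>Hom a B A\<^esub> f') (germ_rel k a T F A `` {(R, s)}) =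
       Res (plus k a T F) A B f (germ_rel k a T F A `` {(R, s)}) \<oplus>\<^bsub>Val (plus k a T F) B\<^esub>
       Res (plus k a T F) A B f' (germ_rel k a T F A `` {(R, s)})"
      unfolding Res_plus[OF g B f] Res_plus[OF g B f'] Res_plus[OF g B rf] add_plus[OF gf gf']
      by (rule cls_eqI[OF germ_pull[OF g B rf] germ_plus[OF gf gf'] germ_T[OF germ_plus[OF gf gf']]])
        (auto simp: le_fun_def pull_mem c sieve_add[OF A germ_sieve[OF g]] germ_add[OF g])
  qed
qed

section \<open>The unit, separatedness and gluing\<close>

lemma germ_unit:
  assumes "A \<in> Obj a" "x \<in> carrier (Val F A)"
  shows "(max_sieve a A, \<lambda>B f. Res F A B f x) \<in> germs k a T F A"
  unfolding germs_iff using T_max[OF assms(1)] yoneda_sieve_nat[OF F assms max_sieve_sieve[OF assms(1)]] by simp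

lemma unit_closed:
  "\<lbrakk>A \<in> Obj a; x \<in> carrier (Val F A)\<rbrakk> \<Longrightarrow> plus_unit k a T F A x \<in> carrier (Val (plus k a T F) A)"
  unfolding plus_unit_def by (rule cls_in_plus[OF germ_unit])

text \<open>Along an arrow of its domain a germ becomes an actual element of \<open>F\<close>, by
  naturality of the section. Local surjectivity of the unit and gluing both rest on this.\<close>

lemma Res_plus_elem:
  assumes "(R, s) \<in> germs k a T F A" "f \<in> R B"
  shows "Res (plus k a T F) A B f (germ_rel k a T F A `` {(R, s)}) = plus_unit k a T F B (s B f)"
proof -
  have B: "B \<in> Obj a" "f \<in> arr a B A" using germ_elem[OF assms] by simp_all
  note p = germ_pull[OF assms(1) B]
  show ?thesis
    unfolding Res_plus[OF assms(1) B] plus_unit_def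
    by (rule cls_eqI[OF p germ_unit[OF B(1) germ_closed[OF assms]] germ_T[OF p]])
      (auto simp: le_fun_def pull_mem max_sieve_mem germ_comp[OF assms])
qed

lemma unit_nat: "nat_trans k a F (plus k a T F) (plus_unit k a T F)"
proof (rule nat_transI)
  fix A assume A: "A \<in> Obj a"
  show "plus_unit k a T F A \<in> mod_hom k (Val F A) (Val (plus k a T F) A)"
  proof (rule mod_homI)
    fix x assume x: "x \<in> carrier (Val F A)"
    interpret M: module k "Val F A" by (rule psh_module[OF F A])
    note u = germ_unit[OF A x]
    show "plus_unit k a T F A x \<in> carrier (Val (plus k a T F) A)" by (rule unit_closed[OF A x])
    show "plus_unit k a T F A (r \<odot>\<^bsub>Val F A\<^esub> x) = r \<odot>\<^bsub>Val (plus k a T F) A\<^esub> plus_unit k a T F A x"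
      if r: "r \<in> carrier k" for r
      unfolding plus_unit_def smult_plus[OF u r]
      by (rule cls_eqI[OF germ_unit[OF A] germ_scale[OF u r] T_max[OF A]])
        (use r x A mod_hom_smult[OF Res_hom[OF F A] r x] in \<open>auto simp: max_sieve_mem\<close>)
    fix y assume y: "y \<in> carrier (Val F A)"
    show "plus_unit k a T F A (x \<oplus>\<^bsub>Val F A\<^esub> y) =
        plus_unit k a T F A x \<oplus>\<^bsub>Val (plus k a T F) A\<^esub> plus_unit k a T F A y"
      unfolding plus_unit_def add_plus[OF u germ_unit[OF A y]]
      by (rule cls_eqI[OF germ_unit[OF A] germ_plus[OF u germ_unit[OF A y]] T_max[OF A]])
        (use x y A mod_hom_add[OF Res_hom[OF F A] x y] in \<open>auto simp: max_sieve_mem\<close>)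
  qed
  fix B f x assume B: "B \<in> Obj a" "f \<in> arr a B A" and x: "x \<in> carrier (Val F A)"
  show "plus_unit k a T F B (Res F A B f x) = Res (plus k a T F) A B f (plus_unit k a T F A x)"
    using Res_plus_elem[OF germ_unit[OF A x], of f B] B by (simp add: plus_unit_def max_sieve_mem)
qed

text \<open>The zero class is that of the zero section, so equality with it means vanishing on some
  covering sieve.\<close>

lemma unit_eq_zero_iff:
  assumes "A \<in> Obj a" "x \<in> carrier (Val F A)"
  shows "plus_unit k a T F A x = \<zero>\<^bsub>Val (plus k a T F) A\<^esub> \<longleftrightarrow> x \<in> local_closure a T F (zero_sub a F) A"
proof
  assume "plus_unit k a T F A x = \<zero>\<^bsub>Val (plus k a T F) A\<^esub>"
  then obtain P where P: "P \<in> T A" "\<forall>B\<in>Obj a. \<forall>f\<in>P B. Res F A B f x = \<zero>\<^bsub>Val F B\<^esub>"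
    unfolding plus_unit_def zero_plus cls_eq_iff[OF germ_unit[OF assms] germ_zero[OF assms(1)]] by blast
  show "x \<in> local_closure a T F (zero_sub a F) A"
    by (rule closureI[OF F zero_sub_sub[OF F] P(1) assms(2)])
      (use P(2) T_elem[OF P(1)] in \<open>auto simp: zero_sub_def\<close>)
next
  assume "x \<in> local_closure a T F (zero_sub a F) A"
  then obtain P where P: "P \<in> T A" "\<And>B f. f \<in> P B \<Longrightarrow> Res F A B f x \<in> zero_sub a F B"
    by (elim closureE) blast
  have "P \<le> max_sieve a A" using T_elem[OF P(1)] by (auto simp: le_fun_def max_sieve_mem)
  then show "plus_unit k a T F A x = \<zero>\<^bsub>Val (plus k a T F) A\<^esub>"
    unfolding plus_unit_def zero_plus
    by (intro cls_eqI[OF germ_unit[OF assms] germ_zero[OF assms(1)] P(1)])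
      (use P(2) T_elem[OF P(1)] in \<open>fastforce simp: zero_sub_def\<close>)+
qed

lemma unit_local_iso: "local_iso k a T F (plus k a T F) (plus_unit k a T F)"
  unfolding local_iso_def
proof (intro conjI le_funI subsetI)
  note i = sub_img_sub[OF F plus_presheaf unit_nat psh_all_sub[OF F]]
  show "x \<in> local_closure a T F (zero_sub a F) A" if "x \<in> psh_kernel a F (plus k a T F) (plus_unit k a T F) A" for A x
    using that unit_eq_zero_iff by (auto simp: psh_kernel_def psh_all_mem)
  fix A x assume "x \<in> psh_all a (plus k a T F) A"
  then have A: "A \<in> Obj a" and x: "x \<in> carrier (Val (plus k a T F) A)" by (simp_all add: psh_all_mem)
  obtain R s where g: "(R, s) \<in> germs k a T F A" and xs: "x = germ_rel k a T F A `` {(R, s)}" using x by (rule plusE)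
  show "x \<in> local_closure a T (plus k a T F) (psh_image a F (plus_unit k a T F)) A"
    unfolding psh_image_eq
  proof (rule closureI[OF plus_presheaf i germ_T[OF g] x])
    fix B f assume f: "f \<in> R B"
    then have "s B f \<in> psh_all a F B" using germ_closed[OF g f] germ_elem[OF g f] by (simp add: psh_all_mem)
    then show "Res (plus k a T F) A B f x \<in> sub_img (plus_unit k a T F) (psh_all a F) B"
      unfolding xs Res_plus_elem[OF g f] sub_img_def by blast
  qed
qed (rule F plus_presheaf unit_nat)+

text \<open>Let \<open>(R, s)\<close> represent \<open>c\<close>. The arrows of \<open>R\<close> on
  which \<open>s\<close> vanishes form a sieve \<open>P\<close>. Where \<open>c\<close> restricts to
  zero, \<open>unit_eq_zero_iff\<close> makes the values of \<open>s\<close> locally zero, so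
  \<open>P\<close> covers and \<open>c\<close> is zero.\<close>

lemma plus_separated: "separated a T (plus k a T F)"
proof (rule separatedI[OF plus_presheaf], intro le_funI subsetI)
  fix A c assume c: "c \<in> local_closure a T (plus k a T F) (zero_sub a (plus k a T F)) A"
  note A = closure_Obj[OF c]
  obtain R s where g: "(R, s) \<in> germs k a T F A" and cs: "c = germ_rel k a T F A `` {(R, s)}"
    using closure_carrier[OF c] by (rule plusE)
  from c obtain Q where Q: "Q \<in> T A" "\<And>B f. f \<in> Q B \<Longrightarrow> Res (plus k a T F) A B f c \<in> zero_sub a (plus k a T F) B"
    by (elim closureE) blast
  define P where "P = (\<lambda>B. {f \<in> R B. s B f = \<zero>\<^bsub>Val F B\<^esub>})"
  note R = germ_sieve[OF g]
  note zF = zero_sub_sub[OF F]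
  have Ps: "sieve k a A P"
  proof -
    have "nat_trans k a (sub_psh (yoneda a A) R) F s" using g by (simp add: germs_iff)
    then have "subfunctor k a (sub_psh (yoneda a A) R) (preim a (sub_psh (yoneda a A) R) s (zero_sub a F))"
      using preim_sub[OF sub_psh_presheaf[OF yoneda_presheaf[OF A]] F _ zF] R by (simp add: sieve_def)
    moreover have "preim a (sub_psh (yoneda a A) R) s (zero_sub a F) = P"
      using germ_elem[OF g] by (auto simp: P_def preim_def psh_all_mem zero_sub_def fun_eq_iff)
    ultimately have s: "subfunctor k a (sub_psh (yoneda a A) R) P" by simp
    have "presheaf k a (sub_psh (yoneda a A) R)"
      using sub_psh_presheaf[OF yoneda_presheaf[OF A]] R by (simp add: sieve_def)
    from s[unfolded subfunctor_iff[OF this]] show ?thesis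
      unfolding sieve_iff[OF A] using sieve_arr[OF A R] by (auto simp: subset_iff)
  qed
  have "P \<in> T A"
  proof (rule T_local[OF A Ps T_inf[OF A germ_T[OF g] Q(1)]])
    fix B f assume f: "f \<in> inf R Q B"
    then have fR: "f \<in> R B" and fQ: "f \<in> Q B" by auto
    have B: "B \<in> Obj a" using germ_elem[OF g fR] by simp
    have "plus_unit k a T F B (s B f) = \<zero>\<^bsub>Val (plus k a T F) B\<^esub>"
      using Q(2)[OF fQ] B unfolding cs Res_plus_elem[OF g fR] by (simp add: zero_sub_def)
    then have "s B f \<in> local_closure a T F (zero_sub a F) B"
      using unit_eq_zero_iff[OF B germ_closed[OF g fR]] by simp
    then obtain P' where P': "P' \<in> T B" "\<And>C h. h \<in> P' C \<Longrightarrow> Res F B C h (s B f) \<in> zero_sub a F C"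
      by (elim closureE) blast
    show "\<exists>P'\<in>T B. \<forall>C h. h \<in> P' C \<longrightarrow> Cmp a C B A f h \<in> P C"
    proof (intro bexI[OF _ P'(1)] allI impI)
      fix C h assume h: "h \<in> P' C"
      then show "Cmp a C B A f h \<in> P C"
        using P'(2)[OF h] T_elem[OF P'(1) h] germ_comp[OF g fR, of C h] sieve_comp[OF A R fR, of C h]
        by (simp add: P_def zero_sub_def)
    qed
  qed
  then have "c = \<zero>\<^bsub>Val (plus k a T F) A\<^esub>"
    unfolding cs zero_plus
  proof (rule cls_eqI[OF g germ_zero[OF A]])
    show "P \<le> R" "P \<le> max_sieve a A"
      using germ_elem[OF g] by (auto simp: P_def le_fun_def max_sieve_mem)
    show "s B f = \<zero>\<^bsub>Val F B\<^esub>" if "f \<in> P B" for B f using that by (simp add: P_def)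
  qed
  then show "c \<in> zero_sub a (plus k a T F) A" using A by (simp add: zero_sub_def)
qed

lemma unit_inj:
  assumes "separated a T F" "A \<in> Obj a" "x \<in> carrier (Val F A)" "y \<in> carrier (Val F A)"
    and "plus_unit k a T F A x = plus_unit k a T F A y"
  shows "x = y"
proof -
  obtain P where P: "P \<in> T A" "\<forall>B\<in>Obj a. \<forall>f\<in>P B. Res F A B f x = Res F A B f y"
    using assms(5) unfolding plus_unit_def cls_eq_iff[OF germ_unit[OF assms(2,3)] germ_unit[OF assms(2,4)]] by blast
  show ?thesis using separatedD[OF assms(1,2) P(1) assms(3,4)] P(2) T_elem[OF P(1)] by metis
qed

text \<open>A compatible family of germs is lifted along the injective unit on the covering sieve of
  those arrows where this is possible.\<close>

lemma plus_sheaf: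
  assumes sep: "separated a T F"
  shows "sheaf k a T (plus k a T F)"
proof (rule sheafI[OF plus_presheaf plus_separated])
  let ?G = "plus k a T F" and ?u = "plus_unit k a T F"
  fix A R s assume A: "A \<in> Obj a" and R: "R \<in> T A" and s: "nat_trans k a (sub_psh (yoneda a A) R) ?G s"
  note Rs = T_sieve[OF A R]
  note sec = s[unfolded section_iff[OF A Rs]]
  have RO: "B \<in> Obj a" if "f \<in> R B" for B f using T_elem[OF R that] by simp
  let ?I = "sub_img ?u (psh_all a F)"
  have Is: "subfunctor k a ?G ?I" by (rule sub_img_sub[OF F plus_presheaf unit_nat psh_all_sub[OF F]])
  \<comment> \<open>The arrows on which \<open>s\<close> takes values in the image of the unit;
    being a preimage, they form a sieve.\<close>
  define Q where "Q = preim a (sub_psh (yoneda a A) R) s ?I"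
  have Rp: "presheaf k a (sub_psh (yoneda a A) R)"
    using sub_psh_presheaf[OF yoneda_presheaf[OF A]] Rs by (simp add: sieve_def)
  have Q_iff: "f \<in> Q B \<longleftrightarrow> f \<in> R B \<and> s B f \<in> ?I B" for f B
    using RO by (auto simp: Q_def preim_def psh_all_mem)
  have Qs: "sieve k a A Q"
    using preim_sub[OF Rp plus_presheaf s Is, unfolded subfunctor_iff[OF Rp]]
    unfolding Q_def[symmetric] sieve_iff[OF A] using sieve_arr[OF A Rs] by (auto simp: subset_iff)
  have I_iff: "c \<in> ?I B \<longleftrightarrow> B \<in> Obj a \<and> (\<exists>x\<in>carrier (Val F B). c = ?u B x)" for c B
    by (auto simp: sub_img_def psh_all_mem)
  have QT: "Q \<in> T A"
  \<comment> \<open>The unit is locally surjective, so \<open>Q\<close> covers.\<close>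
  proof (rule T_local[OF A Qs R])
    fix B f assume f: "f \<in> R B"
    have "s B f \<in> psh_all a ?G B" using sec f RO[OF f] by (simp add: psh_all_mem)
    then have "s B f \<in> local_closure a T ?G ?I B"
      using unit_local_iso unfolding local_iso_def psh_image_eq by (auto simp: le_fun_def)
    then obtain P where P: "P \<in> T B" "\<And>C h. h \<in> P C \<Longrightarrow> Res ?G B C h (s B f) \<in> ?I C"
      by (elim closureE) blast
    show "\<exists>P\<in>T B. \<forall>C g. g \<in> P C \<longrightarrow> Cmp a C B A f g \<in> Q C"
    proof (intro bexI[OF _ P(1)] allI impI)
      fix C g assume g: "g \<in> P C"
      note gC = T_elem[OF P(1) g]
      have "s C (Cmp a C B A f g) = Res ?G B C g (s B f)" using sec f gC by simp
      then show "Cmp a C B A f g \<in> Q C"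
        using P(2)[OF g] sieve_comp[OF A Rs f] gC by (simp add: Q_iff)
    qed
  qed
  define t where "t B f = (SOME x. x \<in> carrier (Val F B) \<and> s B f = ?u B x)" for B f
  have t: "t B f \<in> carrier (Val F B)" "?u B (t B f) = s B f" if "f \<in> Q B" for B f
  proof -
    have "\<exists>x. x \<in> carrier (Val F B) \<and> s B f = ?u B x" using that by (auto simp: Q_iff I_iff)
    from someI_ex[OF this] show "t B f \<in> carrier (Val F B)" "?u B (t B f) = s B f" by (simp_all add: t_def)
  qed
  \<comment> \<open>Linearity and naturality of the lift \<open>t\<close> are those of
    \<open>s\<close>, cancelled along the unit, which is injective as \<open>F\<close> is
    separated.\<close>
  have g: "(Q, t) \<in> germs k a T F A"
  proof (rule germI[OF A QT])
    fix B f assume f: "f \<in> Q B"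
    then have fR: "f \<in> R B" by (simp add: Q_iff)
    note B = RO[OF fR]
    interpret M: module k "Val F B" by (rule psh_module[OF F B])
    note hom = nat_hom[OF unit_nat B]
    show "t B f \<in> carrier (Val F B)" by (rule t(1)[OF f])
    show "t B (r \<odot>\<^bsub>Hom a B A\<^esub> f) = r \<odot>\<^bsub>Val F B\<^esub> t B f" if r: "r \<in> carrier k" for r
    proof (rule unit_inj[OF sep B])
      have rf: "r \<odot>\<^bsub>Hom a B A\<^esub> f \<in> Q B" by (rule sieve_smult[OF A Qs r f])
      show "t B (r \<odot>\<^bsub>Hom a B A\<^esub> f) \<in> carrier (Val F B)" by (rule t(1)[OF rf])
      show "?u B (t B (r \<odot>\<^bsub>Hom a B A\<^esub> f)) = ?u B (r \<odot>\<^bsub>Val F B\<^esub> t B f)"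
        using t[OF rf] t[OF f] mod_hom_smult[OF hom r t(1)[OF f]] sec r fR by simp
    qed (use r t[OF f] in simp)
    show "t C (Cmp a C B A f h) = Res F B C h (t B f)" if C: "C \<in> Obj a" "h \<in> arr a C B" for C h
    proof (rule unit_inj[OF sep C(1)])
      have rf: "Cmp a C B A f h \<in> Q C" by (rule sieve_comp[OF A Qs f C])
      show "t C (Cmp a C B A f h) \<in> carrier (Val F C)" by (rule t(1)[OF rf])
      show "Res F B C h (t B f) \<in> carrier (Val F C)" by (rule Res_closed[OF F B C t(1)[OF f]])
      have "s C (Cmp a C B A f h) = Res ?G B C h (s B f)" using sec fR C by simp
      then show "?u C (t C (Cmp a C B A f h)) = ?u C (Res F B C h (t B f))"
        using t[OF rf] t[OF f] nat_Res[OF unit_nat B C t(1)[OF f]] by simp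
    qed
    fix h assume h: "h \<in> Q B"
    then have hR: "h \<in> R B" by (simp add: Q_iff)
    show "t B (f \<oplus>\<^bsub>Hom a B A\<^esub> h) = t B f \<oplus>\<^bsub>Val F B\<^esub> t B h"
    proof (rule unit_inj[OF sep B])
      have rf: "f \<oplus>\<^bsub>Hom a B A\<^esub> h \<in> Q B" by (rule sieve_add[OF A Qs f h])
      show "t B (f \<oplus>\<^bsub>Hom a B A\<^esub> h) \<in> carrier (Val F B)" by (rule t(1)[OF rf])
      show "?u B (t B (f \<oplus>\<^bsub>Hom a B A\<^esub> h)) = ?u B (t B f \<oplus>\<^bsub>Val F B\<^esub> t B h)"
        using t[OF rf] t[OF f] t[OF h] mod_hom_add[OF hom t(1)[OF f] t(1)[OF h]] sec fR hR by simp
    qed (use t[OF f] t[OF h] in simp)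
  qed
  let ?x = "germ_rel k a T F A `` {(Q, t)}"
  show "\<exists>x\<in>carrier (Val ?G A). \<forall>B\<in>Obj a. \<forall>f\<in>R B. s B f = Res ?G A B f x"
  proof (intro bexI[of _ ?x] ballI)
    show xc: "?x \<in> carrier (Val ?G A)" by (rule cls_in_plus[OF g])
    fix B f assume B: "B \<in> Obj a" and f: "f \<in> R B"
    have fa: "f \<in> arr a B A" using T_elem[OF R f] by simp
    show "s B f = Res ?G A B f ?x"
    \<comment> \<open>By construction the amalgamation matches \<open>s\<close> on \<open>Q\<close>.
      For an arrow of \<open>R\<close> the two sides agree along the pullback of \<open>Q\<close>,
      which covers, and separatedness of \<open>plus\<close> gives equality.\<close>
    proof (rule separatedD[OF plus_separated B T_pull[OF A B QT fa]])
      show "s B f \<in> carrier (Val ?G B)" using conjunct1[OF sec] f by simp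
      show "Res ?G A B f ?x \<in> carrier (Val ?G B)" by (rule Res_closed[OF plus_presheaf A B fa xc])
      fix C h assume "h \<in> pull a A Q B f C"
      then have C: "C \<in> Obj a" "h \<in> arr a C B" and fh: "Cmp a C B A f h \<in> Q C" by (simp_all add: pull_mem)
      have "Res ?G B C h (s B f) = s C (Cmp a C B A f h)" using sec f C by simp
      also have "\<dots> = Res ?G A C (Cmp a C B A f h) ?x"
        unfolding Res_plus_elem[OF g fh] using t(2)[OF fh] by simp
      also have "\<dots> = Res ?G B C h (Res ?G A B f ?x)"
        by (rule Res_comp[OF plus_presheaf A B C(1) fa C(2) xc])
      finally show "Res ?G B C h (s B f) = Res ?G B C h (Res ?G A B f ?x)" .
    qed
  qed
qed

end

section \<open>Functoriality of the plus construction\<close>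

lemma
  assumes F: "presheaf k a F" and G: "presheaf k a G" and n: "nat_trans k a F G \<phi>"
  shows plus_map_nat: "nat_trans k a (plus k a T F) (plus k a T G) (plus_map k a T G \<phi>)"
    and plus_map_unit: "\<lbrakk>A \<in> Obj a; x \<in> carrier (Val F A)\<rbrakk>
      \<Longrightarrow> plus_map k a T G \<phi> A (plus_unit k a T F A x) = plus_unit k a T G A (\<phi> A x)"
proof -
  have germ: "(R, \<lambda>B f. \<phi> B (s B f)) \<in> germs k a T G A" if "(R, s) \<in> germs k a T F A" for R s A
    using that nat_trans_comp[OF _ n, of "sub_psh (yoneda a A) R" s] by (simp add: germs_iff[OF F] germs_iff[OF G])
  have map: "plus_map k a T G \<phi> A (germ_rel k a T F A `` {(R, s)}) = germ_rel k a T G A `` {(R, \<lambda>B f. \<phi> B (s B f))}"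
    if g: "(R, s) \<in> germs k a T F A" for A R s
  proof -
    have "germ_rel k a T G A `` {(Q, \<lambda>B f. \<phi> B (t B f))} = germ_rel k a T G A `` {(R, \<lambda>B f. \<phi> B (s B f))}"
      if rel: "((R, s), (Q, t)) \<in> germ_rel k a T F A" for Q t
    proof -
      obtain P where P: "P \<in> T A" "P \<le> R" "P \<le> Q" "\<forall>B\<in>Obj a. \<forall>f\<in>P B. s B f = t B f" and h: "(Q, t) \<in> germs k a T F A"
        using rel unfolding germ_rel_iff[OF F] by blast
      show ?thesis
        using P T_elem[OF P(1)] by (intro cls_eqI[OF G germ[OF h] germ[OF g] P(1)]) auto
    qed
    then show ?thesis
      using UN_cls[OF F g, of "\<lambda>R s. germ_rel k a T G A `` {(R, \<lambda>B f. \<phi> B (s B f))}"]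
      by (simp add: plus_map_def)
  qed
  show "plus_map k a T G \<phi> A (plus_unit k a T F A x) = plus_unit k a T G A (\<phi> A x)"
    if A: "A \<in> Obj a" and x: "x \<in> carrier (Val F A)" for A x
    unfolding plus_unit_def map[OF germ_unit[OF F A x]]
    by (rule cls_eqI[OF G germ[OF germ_unit[OF F A x]] germ_unit[OF G A nat_closed[OF n A x]] T_max[OF A]])
      (simp_all add: max_sieve_mem nat_Res[OF n A _ _ x])
  show "nat_trans k a (plus k a T F) (plus k a T G) (plus_map k a T G \<phi>)"
  proof (rule nat_transI)
    fix A assume A: "A \<in> Obj a"
    show "plus_map k a T G \<phi> A \<in> mod_hom k (Val (plus k a T F) A) (Val (plus k a T G) A)"
    proof (rule mod_homI)
      fix x assume "x \<in> carrier (Val (plus k a T F) A)"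
      then obtain R s where g: "(R, s) \<in> germs k a T F A" and x: "x = germ_rel k a T F A `` {(R, s)}"
        by (rule plusE[OF F])
      show "plus_map k a T G \<phi> A x \<in> carrier (Val (plus k a T G) A)"
        unfolding x map[OF g] by (rule cls_in_plus[OF G germ[OF g]])
      show "plus_map k a T G \<phi> A (r \<odot>\<^bsub>Val (plus k a T F) A\<^esub> x) = r \<odot>\<^bsub>Val (plus k a T G) A\<^esub> plus_map k a T G \<phi> A x"
        if r: "r \<in> carrier k" for r
        unfolding x smult_plus[OF F g r] map[OF g] map[OF germ_scale[OF F g r]] smult_plus[OF G germ[OF g] r]
        by (rule cls_eqI[OF G germ[OF germ_scale[OF F g r]] germ_scale[OF G germ[OF g] r] germ_T[OF F g]])
          (use germ_elem[OF F g] germ_closed[OF F g] mod_hom_smult[OF nat_hom[OF n] r] in auto)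
      fix y assume "y \<in> carrier (Val (plus k a T F) A)"
      then obtain Q t where h: "(Q, t) \<in> germs k a T F A" and y: "y = germ_rel k a T F A `` {(Q, t)}"
        by (rule plusE[OF F])
      note gh = germ_plus[OF F g h]
      show "plus_map k a T G \<phi> A (x \<oplus>\<^bsub>Val (plus k a T F) A\<^esub> y) =
          plus_map k a T G \<phi> A x \<oplus>\<^bsub>Val (plus k a T G) A\<^esub> plus_map k a T G \<phi> A y"
        unfolding x y add_plus[OF F g h] map[OF g] map[OF h] map[OF gh] add_plus[OF G germ[OF g] germ[OF h]]
        by (rule cls_eqI[OF G germ[OF gh] germ_plus[OF G germ[OF g] germ[OF h]] germ_T[OF F gh]])
          (use germ_elem[OF F g] germ_closed[OF F g] germ_closed[OF F h] mod_hom_add[OF nat_hom[OF n]] in auto)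
    qed
    fix B f x assume B: "B \<in> Obj a" "f \<in> arr a B A" and "x \<in> carrier (Val (plus k a T F) A)"
    then obtain R s where g: "(R, s) \<in> germs k a T F A" and x: "x = germ_rel k a T F A `` {(R, s)}"
      by (elim plusE[OF F])
    show "plus_map k a T G \<phi> B (Res (plus k a T F) A B f x) = Res (plus k a T G) A B f (plus_map k a T G \<phi> A x)"
      unfolding x Res_plus[OF F g B] map[OF g] map[OF germ_pull[OF F g B]] Res_plus[OF G germ[OF g] B] ..
  qed
qed


section \<open>Sheafification\<close>

text \<open>The first plus construction makes any presheaf separated; the second turns a separated
  presheaf into a sheaf.\<close>

lemma sheafify_sheaf: "presheaf k a F \<Longrightarrow> sheaf k a T (sheafify k a T F)"
  unfolding sheafify_def by (intro plus_sheaf plus_presheaf plus_separated)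

lemma sheafify_unit:
  assumes "presheaf k a F"
  shows "local_iso k a T F (sheafify k a T F) (\<lambda>A x. plus_unit k a T (plus k a T F) A (plus_unit k a T F A x))"
  unfolding sheafify_def
  by (rule local_iso_comp[OF unit_local_iso[OF assms] unit_local_iso[OF plus_presheaf[OF assms]]])

lemma sheafify_map_nat:
  assumes "presheaf k a F" "presheaf k a G" "nat_trans k a F G \<phi>"
  shows "nat_trans k a (sheafify k a T F) (sheafify k a T G) (sheafify_map k a T G \<phi>)"
  unfolding sheafify_def sheafify_map_def
  by (intro plus_map_nat plus_presheaf assms)

lemma sheafify_map_unit:
  assumes "presheaf k a F" "presheaf k a G" "nat_trans k a F G \<phi>" "A \<in> Obj a" "x \<in> carrier (Val F A)"
  shows "sheafify_map k a T G \<phi> A (plus_unit k a T (plus k a T F) A (plus_unit k a T F A x)) =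
    plus_unit k a T (plus k a T G) A (plus_unit k a T G A (\<phi> A x))"
  unfolding sheafify_map_def
  unfolding plus_map_unit[OF plus_presheaf[OF assms(1)] plus_presheaf[OF assms(2)]
      plus_map_nat[OF assms(1-3)] assms(4) unit_closed[OF assms(1,4,5)]] plus_map_unit[OF assms(1-5)] ..

end


section \<open>Direct sums of presheaves\<close>

lemma dsum_carrier: "x \<in> carrier (dsum I M) \<longleftrightarrow>
    x \<in> extensional I \<and> (\<forall>i\<in>I. x i \<in> carrier (M i)) \<and> finite {i \<in> I. x i \<noteq> \<zero>\<^bsub>M i\<^esub>}"
  by (auto simp: dsum_def PiE_def Pi_iff)

lemma dsum_sel [simp]:
  "\<zero>\<^bsub>dsum I M\<^esub> = (\<lambda>i\<in>I. \<zero>\<^bsub>M i\<^esub>)"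
  "x \<oplus>\<^bsub>dsum I M\<^esub> y = (\<lambda>i\<in>I. x i \<oplus>\<^bsub>M i\<^esub> y i)"
  "r \<odot>\<^bsub>dsum I M\<^esub> x = (\<lambda>i\<in>I. r \<odot>\<^bsub>M i\<^esub> x i)"
  by (simp_all add: dsum_def)

text \<open>The laws hold componentwise. What needs care is finite support, which scaling does not
  enlarge and addition keeps within the union of two supports.\<close>

lemma dsum_module:
  assumes k: "cring k" and M: "\<And>i. i \<in> I \<Longrightarrow> module k (M i)"
  shows "module k (dsum I M)"
proof (rule moduleI)
  have ag: "abelian_group (M i)" if "i \<in> I" for i using M[OF that] by (simp add: module_def)
  note am = abelian_group.axioms(1)[OF ag]
  note z = abelian_monoid.zero_closed[OF am] and c = abelian_monoid.a_closed[OF am]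
  show "cring k" by fact
  have scl: "r \<odot>\<^bsub>dsum I M\<^esub> x \<in> carrier (dsum I M)" if r: "r \<in> carrier k" and x: "x \<in> carrier (dsum I M)" for r x
  proof -
    have "{i \<in> I. r \<odot>\<^bsub>M i\<^esub> x i \<noteq> \<zero>\<^bsub>M i\<^esub>} \<subseteq> {i \<in> I. x i \<noteq> \<zero>\<^bsub>M i\<^esub>}"
      using module.smult_r_null[OF M r] by auto
    then show ?thesis
      using x r module.smult_closed[OF M] by (auto simp: dsum_carrier intro: finite_subset)
  qed
  show "abelian_group (dsum I M)"
  proof (rule abelian_groupI)
    fix x y assume x: "x \<in> carrier (dsum I M)" and y: "y \<in> carrier (dsum I M)"
    have "{i \<in> I. x i \<oplus>\<^bsub>M i\<^esub> y i \<noteq> \<zero>\<^bsub>M i\<^esub>} \<subseteq> {i \<in> I. x i \<noteq> \<zero>\<^bsub>M i\<^esub>} \<union> {i \<in> I. y i \<noteq> \<zero>\<^bsub>M i\<^esub>}"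
      using abelian_monoid.l_zero[OF am z] by auto
    then show "x \<oplus>\<^bsub>dsum I M\<^esub> y \<in> carrier (dsum I M)"
      using x y c by (auto simp: dsum_carrier intro: finite_subset[OF _ finite_UnI])
    show "x \<oplus>\<^bsub>dsum I M\<^esub> y = y \<oplus>\<^bsub>dsum I M\<^esub> x"
      using x y abelian_monoid.a_comm[OF am] by (auto simp: dsum_carrier intro!: restrict_ext)
  next
    show "\<zero>\<^bsub>dsum I M\<^esub> \<in> carrier (dsum I M)" using z by (simp add: dsum_carrier)
  next
    fix x y z assume "x \<in> carrier (dsum I M)" "y \<in> carrier (dsum I M)" "z \<in> carrier (dsum I M)"
    then show "x \<oplus>\<^bsub>dsum I M\<^esub> y \<oplus>\<^bsub>dsum I M\<^esub> z = x \<oplus>\<^bsub>dsum I M\<^esub> (y \<oplus>\<^bsub>dsum I M\<^esub> z)"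
      using abelian_monoid.a_assoc[OF am] by (auto simp: dsum_carrier intro!: restrict_ext)
  next
    fix x assume x: "x \<in> carrier (dsum I M)"
    then show "\<zero>\<^bsub>dsum I M\<^esub> \<oplus>\<^bsub>dsum I M\<^esub> x = x"
      using abelian_monoid.l_zero[OF am] by (auto simp: dsum_carrier intro!: extensionalityI[of _ I])
    have m: "\<ominus>\<^bsub>k\<^esub> \<one>\<^bsub>k\<^esub> \<in> carrier k"
      using k by (simp add: cring_def ring_def abelian_group.a_inv_closed monoid.one_closed)
    show "\<exists>y\<in>carrier (dsum I M). y \<oplus>\<^bsub>dsum I M\<^esub> x = \<zero>\<^bsub>dsum I M\<^esub>"
    proof (rule bexI[OF _ scl[OF m x]])
      have "(\<ominus>\<^bsub>k\<^esub> \<one>\<^bsub>k\<^esub>) \<odot>\<^bsub>M i\<^esub> x i \<oplus>\<^bsub>M i\<^esub> x i = \<zero>\<^bsub>M i\<^esub>" if i: "i \<in> I" for i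
      proof -
        interpret V: module k "M i" by (rule M[OF i])
        show ?thesis using x i V.smult_l_minus[of "\<one>\<^bsub>k\<^esub>" "x i"] by (simp add: V.M.l_neg dsum_carrier)
      qed
      then show "(\<ominus>\<^bsub>k\<^esub> \<one>\<^bsub>k\<^esub>) \<odot>\<^bsub>dsum I M\<^esub> x \<oplus>\<^bsub>dsum I M\<^esub> x = \<zero>\<^bsub>dsum I M\<^esub>"
        by (auto intro!: restrict_ext)
    qed
  qed
  show "r \<odot>\<^bsub>dsum I M\<^esub> x \<in> carrier (dsum I M)" if "r \<in> carrier k" "x \<in> carrier (dsum I M)" for r x
    by (rule scl[OF that])
  show "\<one>\<^bsub>k\<^esub> \<odot>\<^bsub>dsum I M\<^esub> x = x" if "x \<in> carrier (dsum I M)" for x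
    using that module.smult_one[OF M] by (auto simp: dsum_carrier intro!: extensionalityI[of _ I])
  show "(r \<oplus>\<^bsub>k\<^esub> s) \<odot>\<^bsub>dsum I M\<^esub> x = r \<odot>\<^bsub>dsum I M\<^esub> x \<oplus>\<^bsub>dsum I M\<^esub> s \<odot>\<^bsub>dsum I M\<^esub> x"
    if "r \<in> carrier k" "s \<in> carrier k" "x \<in> carrier (dsum I M)" for r s x
    using that module.smult_l_distr[OF M] by (auto simp: dsum_carrier intro!: restrict_ext)
  show "(r \<otimes>\<^bsub>k\<^esub> s) \<odot>\<^bsub>dsum I M\<^esub> x = r \<odot>\<^bsub>dsum I M\<^esub> (s \<odot>\<^bsub>dsum I M\<^esub> x)"
    if "r \<in> carrier k" "s \<in> carrier k" "x \<in> carrier (dsum I M)" for r s x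
    using that module.smult_assoc1[OF M] by (auto simp: dsum_carrier intro!: restrict_ext)
  show "r \<odot>\<^bsub>dsum I M\<^esub> (x \<oplus>\<^bsub>dsum I M\<^esub> y) = r \<odot>\<^bsub>dsum I M\<^esub> x \<oplus>\<^bsub>dsum I M\<^esub> r \<odot>\<^bsub>dsum I M\<^esub> y"
    if "r \<in> carrier k" "x \<in> carrier (dsum I M)" "y \<in> carrier (dsum I M)" for r x y
    using that module.smult_r_distr[OF M] by (auto simp: dsum_carrier intro!: restrict_ext)
qed

lemma dsum_proj:
  assumes "j \<in> I"
  shows "(\<lambda>x. x j) \<in> mod_hom k (dsum I M) (M j)"
  using assms by (intro mod_homI) (auto simp: dsum_carrier)

lemma psum_sel [simp]:
  "Val (psum I F) A = dsum I (\<lambda>i. Val (F i) A)"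
  "Res (psum I F) A B f x = (\<lambda>i\<in>I. Res (F i) A B f (x i))"
  by (simp_all add: psum_def)

lemma dsum_map_closed:
  assumes x: "x \<in> carrier (dsum I M)" and c: "\<And>i. i \<in> I \<Longrightarrow> h i (x i) \<in> carrier (N i)"
    and z: "\<And>i. i \<in> I \<Longrightarrow> h i \<zero>\<^bsub>M i\<^esub> = \<zero>\<^bsub>N i\<^esub>"
  shows "(\<lambda>i\<in>I. h i (x i)) \<in> carrier (dsum I N)"
proof -
  have "{i \<in> I. h i (x i) \<noteq> \<zero>\<^bsub>N i\<^esub>} \<subseteq> {i \<in> I. x i \<noteq> \<zero>\<^bsub>M i\<^esub>}" using z by auto
  then show ?thesis using x c by (auto simp: dsum_carrier intro: finite_subset)
qed

lemma psum_presheaf: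
  assumes k: "cring k" and F: "\<And>i. i \<in> I \<Longrightarrow> presheaf k a (F i)"
  shows "presheaf k a (psum I F)"
proof -
  have m: "module k (Val (F i) A)" if "i \<in> I" "A \<in> Obj a" for i A using psh_module[OF F] that by simp
  have z: "Res (F i) A B f \<zero>\<^bsub>Val (F i) A\<^esub> = \<zero>\<^bsub>Val (F i) B\<^esub>"
    if "i \<in> I" "A \<in> Obj a" "B \<in> Obj a" "f \<in> arr a B A" for i A B f
    by (rule mod_hom_zero[OF Res_hom[OF F] m m]) (use that in simp_all)
  have cl: "(\<lambda>i\<in>I. Res (F i) A B f (x i)) \<in> carrier (dsum I (\<lambda>i. Val (F i) B))"
    if "A \<in> Obj a" "B \<in> Obj a" "f \<in> arr a B A" "x \<in> carrier (dsum I (\<lambda>i. Val (F i) A))" for A B f x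
    by (rule dsum_map_closed[OF that(4)]) (use that z Res_closed[OF F] in \<open>auto simp: dsum_carrier\<close>)
  show ?thesis
    unfolding presheaf_def psum_sel
  proof (intro conjI ballI)
    fix A assume A: "A \<in> Obj a"
    show "module k (dsum I (\<lambda>i. Val (F i) A))" by (rule dsum_module[OF k m[OF _ A]])
    show "(\<lambda>i\<in>I. Res (F i) A A (Idt a A) (x i)) = x" if "x \<in> carrier (dsum I (\<lambda>i. Val (F i) A))" for x
      using that Res_id[OF F A] by (auto simp: dsum_carrier intro!: extensionalityI[of _ I])
    fix B assume B: "B \<in> Obj a"
    show "(\<lambda>f. \<lambda>i\<in>I. Res (F i) A B f (x i)) \<in> mod_hom k (Hom a B A) (dsum I (\<lambda>i. Val (F i) B))"
      if x: "x \<in> carrier (dsum I (\<lambda>i. Val (F i) A))" for x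
      using cl[OF A B _ x] x mod_hom_add[OF Res_hom_arr[OF F A B]] mod_hom_smult[OF Res_hom_arr[OF F A B]]
      by (intro mod_homI) (auto simp: dsum_carrier intro!: restrict_ext)
    fix f assume f: "f \<in> arr a B A"
    show "(\<lambda>x. \<lambda>i\<in>I. Res (F i) A B f (x i)) \<in> mod_hom k (dsum I (\<lambda>i. Val (F i) A)) (dsum I (\<lambda>i. Val (F i) B))"
    proof (rule mod_homI)
      show "(\<lambda>i\<in>I. Res (F i) A B f (x i)) \<in> carrier (dsum I (\<lambda>i. Val (F i) B))"
        if "x \<in> carrier (dsum I (\<lambda>i. Val (F i) A))" for x using cl[OF A B f that] by simp
      show "(\<lambda>i\<in>I. Res (F i) A B f ((x \<oplus>\<^bsub>dsum I (\<lambda>i. Val (F i) A)\<^esub> y) i)) =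
          (\<lambda>i\<in>I. Res (F i) A B f (x i)) \<oplus>\<^bsub>dsum I (\<lambda>i. Val (F i) B)\<^esub> (\<lambda>i\<in>I. Res (F i) A B f (y i))"
        if "x \<in> carrier (dsum I (\<lambda>i. Val (F i) A))" "y \<in> carrier (dsum I (\<lambda>i. Val (F i) A))" for x y
        using that mod_hom_add[OF Res_hom[OF F A B f]] by (auto simp: dsum_carrier intro!: restrict_ext)
      show "(\<lambda>i\<in>I. Res (F i) A B f ((r \<odot>\<^bsub>dsum I (\<lambda>i. Val (F i) A)\<^esub> x) i)) =
          r \<odot>\<^bsub>dsum I (\<lambda>i. Val (F i) B)\<^esub> (\<lambda>i\<in>I. Res (F i) A B f (x i))"
        if "r \<in> carrier k" "x \<in> carrier (dsum I (\<lambda>i. Val (F i) A))" for r x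
        using that mod_hom_smult[OF Res_hom[OF F A B f]] by (auto simp: dsum_carrier intro!: restrict_ext)
    qed
    fix C g x assume "C \<in> Obj a" "g \<in> arr a C B" "x \<in> carrier (dsum I (\<lambda>i. Val (F i) A))"
    then show "(\<lambda>i\<in>I. Res (F i) A C (Cmp a C B A f g) (x i)) = (\<lambda>i\<in>I. Res (F i) B C g ((\<lambda>i\<in>I. Res (F i) A B f (x i)) i))"
      using Res_comp[OF F A B _ f] by (auto simp: dsum_carrier intro!: restrict_ext)
  qed
qed

section \<open>Copairings and matrix maps\<close>

lemma finsum_support:
  assumes k: "module k N" and x: "x \<in> carrier (dsum I M)" and J: "finite J" "{i \<in> I. x i \<noteq> \<zero>\<^bsub>M i\<^esub>} \<subseteq> J" "J \<subseteq> I"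
    and c: "\<And>i. i \<in> I \<Longrightarrow> h i (x i) \<in> carrier N" and z: "\<And>i. i \<in> I \<Longrightarrow> h i \<zero>\<^bsub>M i\<^esub> = \<zero>\<^bsub>N\<^esub>"
  shows "(\<Oplus>\<^bsub>N\<^esub>i\<in>{i \<in> I. x i \<noteq> \<zero>\<^bsub>M i\<^esub>}. h i (x i)) = (\<Oplus>\<^bsub>N\<^esub>i\<in>J. h i (x i))"
proof -
  interpret N: module k N by fact
  show ?thesis
    by (rule N.add.finprod_mono_neutral_cong_left[OF J(1,2)]) (use z c J(3) in auto)
qed

text \<open>\<open>copair\<close> sums over the exact support of its argument, which changes under
  addition and restriction. Summing over any finite superset makes different arguments
  comparable.\<close>

lemma copair_eq:
  assumes G: "presheaf k a G" and F: "\<And>i. i \<in> I \<Longrightarrow> presheaf k a (F i)"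
    and n: "\<And>i. i \<in> I \<Longrightarrow> nat_trans k a (F i) G (\<phi> i)" and A: "A \<in> Obj a"
    and x: "x \<in> carrier (Val (psum I F) A)"
    and J: "finite J" "{i \<in> I. x i \<noteq> \<zero>\<^bsub>Val (F i) A\<^esub>} \<subseteq> J" "J \<subseteq> I"
  shows "copair I F G \<phi> A x = (\<Oplus>\<^bsub>Val G A\<^esub>i\<in>J. \<phi> i A (x i))"
  unfolding copair_def
proof (rule finsum_support[OF psh_module[OF G A] _ J])
  show x': "x \<in> carrier (dsum I (\<lambda>i. Val (F i) A))" using x by simp
  fix i assume i: "i \<in> I"
  show "\<phi> i A (x i) \<in> carrier (Val G A)" using nat_closed[OF n[OF i] A] x' i by (simp add: dsum_carrier)
  show "\<phi> i A \<zero>\<^bsub>Val (F i) A\<^esub> = \<zero>\<^bsub>Val G A\<^esub>"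
    by (rule mod_hom_zero[OF nat_hom[OF n[OF i] A] psh_module[OF F[OF i] A] psh_module[OF G A]])
qed

lemma copair_nat:
  assumes k: "cring k" and G: "presheaf k a G" and F: "\<And>i. i \<in> I \<Longrightarrow> presheaf k a (F i)"
    and n: "\<And>i. i \<in> I \<Longrightarrow> nat_trans k a (F i) G (\<phi> i)"
  shows "nat_trans k a (psum I F) G (copair I F G \<phi>)"
proof (rule nat_transI)
  note P = psum_presheaf[OF k F]
  have eq: "copair I F G \<phi> A x = (\<Oplus>\<^bsub>Val G A\<^esub>i\<in>J. \<phi> i A (x i))"
    if "A \<in> Obj a" "x \<in> carrier (Val (psum I F) A)" "finite J" "{i \<in> I. x i \<noteq> \<zero>\<^bsub>Val (F i) A\<^esub>} \<subseteq> J" "J \<subseteq> I" for A x J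
    by (rule copair_eq[OF G F n that])
  define supp where "supp A x = {i \<in> I. x i \<noteq> \<zero>\<^bsub>Val (F i) A\<^esub>}" for A x
  have fin: "finite (supp A x)" if "x \<in> carrier (Val (psum I F) A)" for A x
    using that by (simp add: dsum_carrier supp_def)
  have sub: "supp A x \<subseteq> I" for A x by (auto simp: supp_def)
  fix A assume A: "A \<in> Obj a"
  interpret V: module k "Val G A" by (rule psh_module[OF G A])
  interpret PM: module k "Val (psum I F) A" by (rule psh_module[OF P A])
  have ph: "\<phi> i A (x i) \<in> carrier (Val G A)" if "i \<in> I" "x \<in> carrier (Val (psum I F) A)" for i x
    using nat_closed[OF n[OF that(1)] A] that by (simp add: dsum_carrier)
  have cl: "copair I F G \<phi> A x \<in> carrier (Val G A)" if x: "x \<in> carrier (Val (psum I F) A)" for x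
    unfolding copair_def using ph[OF _ x] by (intro V.finsum_closed) auto
  show "copair I F G \<phi> A \<in> mod_hom k (Val (psum I F) A) (Val G A)"
  proof (rule mod_homI)
    fix x assume x: "x \<in> carrier (Val (psum I F) A)"
    show "copair I F G \<phi> A x \<in> carrier (Val G A)" by (rule cl[OF x])
    show "copair I F G \<phi> A (r \<odot>\<^bsub>Val (psum I F) A\<^esub> x) = r \<odot>\<^bsub>Val G A\<^esub> copair I F G \<phi> A x" if r: "r \<in> carrier k" for r
    proof -
      have rx: "r \<odot>\<^bsub>Val (psum I F) A\<^esub> x \<in> carrier (Val (psum I F) A)" using r x PM.smult_closed by blast
      have s: "supp A (r \<odot>\<^bsub>Val (psum I F) A\<^esub> x) \<subseteq> supp A x"
        using module.smult_r_null[OF psh_module[OF F A] r] by (auto simp: supp_def)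
      have "copair I F G \<phi> A (r \<odot>\<^bsub>Val (psum I F) A\<^esub> x) = (\<Oplus>\<^bsub>Val G A\<^esub>i\<in>supp A x. \<phi> i A ((r \<odot>\<^bsub>Val (psum I F) A\<^esub> x) i))"
        by (rule eq[OF A rx fin[OF x] s[unfolded supp_def[of A "r \<odot>\<^bsub>_\<^esub> x"]] sub])
      also have "\<dots> = (\<Oplus>\<^bsub>Val G A\<^esub>i\<in>supp A x. r \<odot>\<^bsub>Val G A\<^esub> \<phi> i A (x i))"
        using x r ph[OF _ x] mod_hom_smult[OF nat_hom[OF n A] r]
        by (intro V.finsum_cong') (auto simp: supp_def dsum_carrier)
      also have "\<dots> = r \<odot>\<^bsub>Val G A\<^esub> copair I F G \<phi> A x"
        unfolding copair_def supp_def[symmetric]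
        by (rule V.finsum_smult_ldistr[symmetric, OF fin[OF x] r]) (use ph[OF _ x] sub in auto)
      finally show ?thesis .
    qed
    fix y assume y: "y \<in> carrier (Val (psum I F) A)"
    \<comment> \<open>Both arguments and their sum are summed over the union of the two supports, as
      cancellation may make the support of the sum smaller.\<close>
    let ?s = "supp A x \<union> supp A y"
    have xy: "x \<oplus>\<^bsub>Val (psum I F) A\<^esub> y \<in> carrier (Val (psum I F) A)" using x y PM.a_closed by blast
    have f: "finite ?s" and si: "?s \<subseteq> I" using fin[OF x] fin[OF y] sub by auto
    have s: "{i \<in> I. (x \<oplus>\<^bsub>Val (psum I F) A\<^esub> y) i \<noteq> \<zero>\<^bsub>Val (F i) A\<^esub>} \<subseteq> ?s"
      using abelian_monoid.l_zero[OF abelian_group.axioms(1)[OF module.axioms(2)[OF psh_module[OF F A]]]]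
        abelian_monoid.zero_closed[OF abelian_group.axioms(1)[OF module.axioms(2)[OF psh_module[OF F A]]]]
      by (auto simp: supp_def)
    have "copair I F G \<phi> A (x \<oplus>\<^bsub>Val (psum I F) A\<^esub> y) = (\<Oplus>\<^bsub>Val G A\<^esub>i\<in>?s. \<phi> i A ((x \<oplus>\<^bsub>Val (psum I F) A\<^esub> y) i))"
      by (rule eq[OF A xy f s si])
    also have "\<dots> = (\<Oplus>\<^bsub>Val G A\<^esub>i\<in>?s. \<phi> i A (x i) \<oplus>\<^bsub>Val G A\<^esub> \<phi> i A (y i))"
      using x y ph[OF _ x] ph[OF _ y] si mod_hom_add[OF nat_hom[OF n A]]
      by (intro V.finsum_cong') (auto simp: supp_def dsum_carrier)
    also have "\<dots> = (\<Oplus>\<^bsub>Val G A\<^esub>i\<in>?s. \<phi> i A (x i)) \<oplus>\<^bsub>Val G A\<^esub> (\<Oplus>\<^bsub>Val G A\<^esub>i\<in>?s. \<phi> i A (y i))"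
      by (rule V.finsum_addf) (use ph[OF _ x] ph[OF _ y] si in auto)
    also have "\<dots> = copair I F G \<phi> A x \<oplus>\<^bsub>Val G A\<^esub> copair I F G \<phi> A y"
      using eq[OF A x f _ si] eq[OF A y f _ si] by (simp add: supp_def)
    finally show "copair I F G \<phi> A (x \<oplus>\<^bsub>Val (psum I F) A\<^esub> y) = copair I F G \<phi> A x \<oplus>\<^bsub>Val G A\<^esub> copair I F G \<phi> A y" .
  qed
  fix B f x assume B: "B \<in> Obj a" "f \<in> arr a B A" and x: "x \<in> carrier (Val (psum I F) A)"
  interpret W: module k "Val G B" by (rule psh_module[OF G B(1)])
  have xi: "x i \<in> carrier (Val (F i) A)" if "i \<in> I" for i using x that by (simp add: dsum_carrier)
  have fx: "Res (psum I F) A B f x \<in> carrier (Val (psum I F) B)" by (rule Res_closed[OF P A B x])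
  have z: "Res (F i) A B f \<zero>\<^bsub>Val (F i) A\<^esub> = \<zero>\<^bsub>Val (F i) B\<^esub>" if "i \<in> I" for i
    by (rule mod_hom_zero[OF Res_hom[OF F[OF that] A B] psh_module[OF F[OF that] A] psh_module[OF F[OF that] B(1)]])
  have s: "{i \<in> I. Res (psum I F) A B f x i \<noteq> \<zero>\<^bsub>Val (F i) B\<^esub>} \<subseteq> supp A x"
    using z by (auto simp: supp_def)
  have "copair I F G \<phi> B (Res (psum I F) A B f x) = (\<Oplus>\<^bsub>Val G B\<^esub>i\<in>supp A x. \<phi> i B (Res (psum I F) A B f x i))"
    by (rule eq[OF B(1) fx fin[OF x] s sub])
  also have "\<dots> = (\<Oplus>\<^bsub>Val G B\<^esub>i\<in>supp A x. Res G A B f (\<phi> i A (x i)))"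
    using nat_Res[OF n A B xi] Res_closed[OF G A B ph[OF _ x]]
    by (intro W.finsum_cong') (auto simp: supp_def)
  also have "\<dots> = Res G A B f (\<Oplus>\<^bsub>Val G A\<^esub>i\<in>supp A x. \<phi> i A (x i))"
    by (rule mod_hom_finsum[symmetric, OF Res_hom[OF G A B] psh_module[OF G A] psh_module[OF G B(1)] fin[OF x]])
      (use ph[OF _ x] sub in auto)
  finally show "copair I F G \<phi> B (Res (psum I F) A B f x) = Res G A B f (copair I F G \<phi> A x)"
    by (simp add: copair_def supp_def)
qed

text \<open>The copairings are compared summand by summand. As \<open>u\<close> may shrink the
  support, both are written over the support of \<open>x\<close>.\<close>

lemma copair_square:
  assumes F: "\<And>i. i \<in> I \<Longrightarrow> presheaf k a (F i)" and F': "\<And>i. i \<in> I \<Longrightarrow> presheaf k a (F' i)"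
    and G: "presheaf k a G" and G': "presheaf k a G'"
    and u: "\<And>i. i \<in> I \<Longrightarrow> nat_trans k a (F i) (F' i) (u i)" and w: "nat_trans k a G G' w"
    and n: "\<And>i. i \<in> I \<Longrightarrow> nat_trans k a (F i) G (\<phi> i)" and n': "\<And>i. i \<in> I \<Longrightarrow> nat_trans k a (F' i) G' (\<phi>' i)"
    and sq: "\<And>i y. \<lbrakk>i \<in> I; y \<in> carrier (Val (F i) A)\<rbrakk> \<Longrightarrow> \<phi>' i A (u i A y) = w A (\<phi> i A y)"
    and A: "A \<in> Obj a" and x: "x \<in> carrier (Val (psum I F) A)"
  shows "copair I F' G' \<phi>' A (\<lambda>i\<in>I. u i A (x i)) = w A (copair I F G \<phi> A x)"
proof -
  let ?s = "{i \<in> I. x i \<noteq> \<zero>\<^bsub>Val (F i) A\<^esub>}"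
  have fin: "finite ?s" and xi: "\<And>i. i \<in> I \<Longrightarrow> x i \<in> carrier (Val (F i) A)"
    using x by (simp_all add: dsum_carrier)
  interpret W: module k "Val G' A" by (rule psh_module[OF G' A])
  have z: "u i A \<zero>\<^bsub>Val (F i) A\<^esub> = \<zero>\<^bsub>Val (F' i) A\<^esub>" if "i \<in> I" for i
    by (rule mod_hom_zero[OF nat_hom[OF u[OF that] A] psh_module[OF F[OF that] A] psh_module[OF F'[OF that] A]])
  have "(\<lambda>i\<in>I. u i A (x i)) \<in> carrier (Val (psum I F') A)"
    using dsum_map_closed[of x I "\<lambda>i. Val (F i) A" "\<lambda>i. u i A" "\<lambda>i. Val (F' i) A"] x z xi nat_closed[OF u A] by simp
  then have "copair I F' G' \<phi>' A (\<lambda>i\<in>I. u i A (x i)) = (\<Oplus>\<^bsub>Val G' A\<^esub>i\<in>?s. \<phi>' i A ((\<lambda>i\<in>I. u i A (x i)) i))"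
    by (intro copair_eq[OF G' F' n' A _ fin]) (use z in auto)
  also have "\<dots> = (\<Oplus>\<^bsub>Val G' A\<^esub>i\<in>?s. w A (\<phi> i A (x i)))"
    using sq xi nat_closed[OF w A] nat_closed[OF n A] by (intro W.finsum_cong') auto
  also have "\<dots> = w A (copair I F G \<phi> A x)"
    unfolding copair_def
    by (rule mod_hom_finsum[symmetric, OF nat_hom[OF w A] psh_module[OF G A] psh_module[OF G' A] fin])
      (use nat_closed[OF n A] xi in auto)
  finally show ?thesis .
qed

text \<open>A family of morphisms maps into the product; the finiteness assumption places it in the
  direct sum.\<close>

lemma row_nat:
  assumes "\<And>j. j \<in> J \<Longrightarrow> nat_trans k a F (G j) (\<Phi> j)"
    and "\<And>A x. \<lbrakk>A \<in> Obj a; x \<in> carrier (Val F A)\<rbrakk> \<Longrightarrow> finite {j \<in> J. \<Phi> j A x \<noteq> \<zero>\<^bsub>Val (G j) A\<^esub>}"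
  shows "nat_trans k a F (psum J G) (\<lambda>A x. \<lambda>j\<in>J. \<Phi> j A x)"
proof (rule nat_transI)
  fix A assume A: "A \<in> Obj a"
  have e: "{j \<in> J. (\<lambda>j\<in>J. \<Phi> j A x) j \<noteq> \<zero>\<^bsub>Val (G j) A\<^esub>} = {j \<in> J. \<Phi> j A x \<noteq> \<zero>\<^bsub>Val (G j) A\<^esub>}" for x by auto
  note h = nat_hom[OF assms(1) A]
  have cl: "(\<lambda>j\<in>J. \<Phi> j A x) \<in> carrier (Val (psum J G) A)" if "x \<in> carrier (Val F A)" for x
    unfolding psum_sel dsum_carrier e using assms(2)[OF A that] mod_hom_closed[OF h that] by simp
  show "(\<lambda>x. \<lambda>j\<in>J. \<Phi> j A x) \<in> mod_hom k (Val F A) (Val (psum J G) A)"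
    using mod_hom_add[OF h] mod_hom_smult[OF h]
    by (intro mod_homI cl) (auto intro!: restrict_ext)
  show "(\<lambda>j\<in>J. \<Phi> j B (Res F A B f x)) = Res (psum J G) A B f (\<lambda>j\<in>J. \<Phi> j A x)"
    if "B \<in> Obj a" "f \<in> arr a B A" "x \<in> carrier (Val F A)" for B f x
    using nat_Res[OF assms(1) A that] by (auto intro!: restrict_ext)
qed

text \<open>A matrix map is defined one target component at a time. As a copairing of its rows it
  inherits linearity and naturality from \<open>copair_nat\<close>.\<close>

lemma matrix_map_eq_copair:
  assumes k: "cring k" and F: "\<And>i. i \<in> I \<Longrightarrow> presheaf k a (F i)" and G: "\<And>j. j \<in> J \<Longrightarrow> presheaf k a (G j)"
    and n: "\<And>i j. \<lbrakk>i \<in> I; j \<in> J\<rbrakk> \<Longrightarrow> nat_trans k a (F i) (G j) (\<Phi> i j)"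
    and fin: "\<And>i A y. \<lbrakk>i \<in> I; A \<in> Obj a; y \<in> carrier (Val (F i) A)\<rbrakk> \<Longrightarrow> finite {j \<in> J. \<Phi> i j A y \<noteq> \<zero>\<^bsub>Val (G j) A\<^esub>}"
    and A: "A \<in> Obj a" and x: "x \<in> carrier (Val (psum I F) A)"
  shows "matrix_map I F J G \<Phi> A x = copair I F (psum J G) (\<lambda>i A y. \<lambda>j\<in>J. \<Phi> i j A y) A x"
proof (rule extensionalityI[of _ J])
  let ?c = "copair I F (psum J G) (\<lambda>i A y. \<lambda>j\<in>J. \<Phi> i j A y)"
  note P = psum_presheaf[OF k G]
  have rn: "nat_trans k a (F i) (psum J G) (\<lambda>A y. \<lambda>j\<in>J. \<Phi> i j A y)" if "i \<in> I" for i
    by (rule row_nat) (use n fin that in auto)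
  have xi: "\<And>i. i \<in> I \<Longrightarrow> x i \<in> carrier (Val (F i) A)" and fs: "finite {i \<in> I. x i \<noteq> \<zero>\<^bsub>Val (F i) A\<^esub>}"
    using x by (simp_all add: dsum_carrier)
  have "?c A x \<in> carrier (Val (psum J G) A)"
    by (rule nat_closed[OF copair_nat[OF k P F rn] A x])
  then show "?c A x \<in> extensional J" by (simp add: dsum_carrier)
  show "matrix_map I F J G \<Phi> A x \<in> extensional J" by (simp add: matrix_map_def)
  fix j assume j: "j \<in> J"
  interpret V: module k "Val (G j) A" by (rule psh_module[OF G[OF j] A])
  \<comment> \<open>Projection to the component \<open>j\<close> is linear and passes through the
    finite sum.\<close>
  have "?c A x j = (\<Oplus>\<^bsub>Val (G j) A\<^esub>i\<in>{i \<in> I. x i \<noteq> \<zero>\<^bsub>Val (F i) A\<^esub>}. (\<lambda>j\<in>J. \<Phi> i j A (x i)) j)"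
    unfolding copair_def psum_sel
    by (rule mod_hom_finsum[where M = "dsum J (\<lambda>j. Val (G j) A)" and N = "Val (G j) A" and h = "\<lambda>x. x j" and f = "\<lambda>i. \<lambda>j\<in>J. \<Phi> i j A (x i)",
          OF dsum_proj[OF j] _ psh_module[OF G[OF j] A] fs])
      (use psh_module[OF P A] nat_closed[OF rn A] xi in auto)
  then show "matrix_map I F J G \<Phi> A x j = ?c A x j"
    using j by (simp add: matrix_map_def copair_def)
qed


context linear_site
begin

text \<open>Only finitely many components of an element are nonzero, so the covering sieves that
  witness the kernel and image conditions for them have a common refinement by
  \<open>T_INF\<close>.\<close>

lemma psum_local_iso:
  assumes u: "\<And>i. i \<in> I \<Longrightarrow> local_iso k a T (F i) (F' i) (u i)"
  shows "local_iso k a T (psum I F) (psum I F') (\<lambda>A x. \<lambda>i\<in>I. u i A (x i))"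
proof -
  have F: "presheaf k a (F i)" and F': "presheaf k a (F' i)" and n: "nat_trans k a (F i) (F' i) (u i)"
    and ker: "psh_kernel a (F i) (F' i) (u i) \<le> local_closure a T (F i) (zero_sub a (F i))"
    and im: "psh_all a (F' i) \<le> local_closure a T (F' i) (psh_image a (F i) (u i))" if "i \<in> I" for i
    using u[OF that] unfolding local_iso_def by blast+
  let ?u = "\<lambda>A x. \<lambda>i\<in>I. u i A (x i)"
  note P = psum_presheaf[OF cring_axioms F] and P' = psum_presheaf[OF cring_axioms F']
  have z: "u i A \<zero>\<^bsub>Val (F i) A\<^esub> = \<zero>\<^bsub>Val (F' i) A\<^esub>" if "i \<in> I" "A \<in> Obj a" for i A
    by (rule mod_hom_zero[OF nat_hom[OF n] psh_module[OF F] psh_module[OF F']]) (use that in simp_all)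
  have ucl: "?u A x \<in> carrier (dsum I (\<lambda>i. Val (F' i) A))"
    if A: "A \<in> Obj a" and x: "x \<in> carrier (dsum I (\<lambda>i. Val (F i) A))" for A x
    by (rule dsum_map_closed[OF x]) (use z[OF _ A] x nat_closed[OF n A] in \<open>auto simp: dsum_carrier\<close>)
  have nat: "nat_trans k a (psum I F) (psum I F') ?u"
  proof (rule nat_transI)
    fix A assume A: "A \<in> Obj a"
    show "?u A \<in> mod_hom k (Val (psum I F) A) (Val (psum I F') A)"
      using ucl[OF A] mod_hom_add[OF nat_hom[OF n A]] mod_hom_smult[OF nat_hom[OF n A]]
      by (intro mod_homI) (auto simp: dsum_carrier intro!: restrict_ext)
    show "?u B (Res (psum I F) A B f x) = Res (psum I F') A B f (?u A x)"
      if "B \<in> Obj a" "f \<in> arr a B A" "x \<in> carrier (Val (psum I F) A)" for B f x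
      using that nat_Res[OF n A] by (auto simp: dsum_carrier intro!: restrict_ext)
  qed
  have K: "psh_kernel a (psum I F) (psum I F') ?u \<le> local_closure a T (psum I F) (zero_sub a (psum I F))"
  proof (intro le_funI subsetI)
    fix A x assume "x \<in> psh_kernel a (psum I F) (psum I F') ?u A"
    then have A: "A \<in> Obj a" and x: "x \<in> carrier (Val (psum I F) A)" and ux: "?u A x = (\<lambda>i\<in>I. \<zero>\<^bsub>Val (F' i) A\<^esub>)"
      by (simp_all add: psh_kernel_def psh_all_mem)
    let ?s = "{i \<in> I. x i \<noteq> \<zero>\<^bsub>Val (F i) A\<^esub>}"
    have xi: "\<And>i. i \<in> I \<Longrightarrow> x i \<in> carrier (Val (F i) A)" and fs: "finite ?s"
      using x by (simp_all add: dsum_carrier)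
    have "locus a (F i) A (zero_sub a (F i)) (x i) \<in> T A" if i: "i \<in> I" for i
    proof -
      have "u i A (x i) = \<zero>\<^bsub>Val (F' i) A\<^esub>" using fun_cong[OF ux, of i] i by simp
      then have "x i \<in> psh_kernel a (F i) (F' i) (u i) A" using A xi[OF i] by (simp add: psh_kernel_def psh_all_mem)
      from subD[OF ker[OF i] this] show ?thesis by (simp add: local_closure_def)
    qed
    then obtain Q where Q: "Q \<in> T A" "\<forall>i\<in>?s. Q \<le> locus a (F i) A (zero_sub a (F i)) (x i)"
      using T_INF[OF A fs, of "\<lambda>i. locus a (F i) A (zero_sub a (F i)) (x i)"] by auto
    show "x \<in> local_closure a T (psum I F) (zero_sub a (psum I F)) A"
    proof (rule closureI[OF P zero_sub_sub[OF P] Q(1) x])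
      fix B f assume f: "f \<in> Q B"
      then have B: "B \<in> Obj a" "f \<in> arr a B A" using T_elem[OF Q(1)] by auto
      have "Res (F i) A B f (x i) = \<zero>\<^bsub>Val (F i) B\<^esub>" if i: "i \<in> I" for i
      proof (cases "i \<in> ?s")
        case True
        then have "Q \<le> locus a (F i) A (zero_sub a (F i)) (x i)" using Q(2) by blast
        from subD[OF this f] have "f \<in> locus a (F i) A (zero_sub a (F i)) (x i) B" .
        then show ?thesis using B by (simp add: locus_mem zero_sub_def)
      next
        case False
        then show ?thesis
          using i mod_hom_zero[OF Res_hom[OF F[OF i] A B] psh_module[OF F[OF i] A] psh_module[OF F[OF i] B(1)]] by simp
      qed
      then show "Res (psum I F) A B f x \<in> zero_sub a (psum I F) B"
        using B by (auto simp: zero_sub_def intro!: restrict_ext)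
    qed
  qed
  have S: "psh_all a (psum I F') \<le> local_closure a T (psum I F') (psh_image a (psum I F) ?u)"
  proof (intro le_funI subsetI)
    fix A y assume "y \<in> psh_all a (psum I F') A"
    then have A: "A \<in> Obj a" and y: "y \<in> carrier (Val (psum I F') A)" by (simp_all add: psh_all_mem)
    let ?s = "{i \<in> I. y i \<noteq> \<zero>\<^bsub>Val (F' i) A\<^esub>}"
    have yi: "\<And>i. i \<in> I \<Longrightarrow> y i \<in> carrier (Val (F' i) A)" and fs: "finite ?s"
      using y by (simp_all add: dsum_carrier)
    let ?L = "\<lambda>i. locus a (F' i) A (psh_image a (F i) (u i)) (y i)"
    have "?L i \<in> T A" if i: "i \<in> I" for i
    proof -
      have "y i \<in> psh_all a (F' i) A" using A yi[OF i] by (simp add: psh_all_mem)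
      from subD[OF im[OF i] this] show ?thesis by (simp add: local_closure_def)
    qed
    then obtain Q where Q: "Q \<in> T A" "\<forall>i\<in>?s. Q \<le> ?L i"
      using T_INF[OF A fs, of ?L] by auto
    note ims = sub_img_sub[OF P P' nat psh_all_sub[OF P], folded psh_image_eq]
    show "y \<in> local_closure a T (psum I F') (psh_image a (psum I F) ?u) A"
    proof (rule closureI[OF P' ims Q(1) y])
      fix B f assume f: "f \<in> Q B"
      then have B: "B \<in> Obj a" "f \<in> arr a B A" using T_elem[OF Q(1)] by auto
      \<comment> \<open>Preimages are chosen only on the support of \<open>y\<close>; zero elsewhere
        keeps the support of \<open>x\<close> finite.\<close>
      define x where "x = (\<lambda>i\<in>I. if i \<in> ?s then (SOME v. v \<in> carrier (Val (F i) B) \<and> u i B v = Res (F' i) A B f (y i))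
        else \<zero>\<^bsub>Val (F i) B\<^esub>)"
      have xs: "x i \<in> carrier (Val (F i) B) \<and> u i B (x i) = Res (F' i) A B f (y i)" if i: "i \<in> ?s" for i
      proof -
        have "Q \<le> ?L i" using Q(2) i by blast
        from subD[OF this f] have "f \<in> ?L i B" .
        then have "\<exists>v. v \<in> carrier (Val (F i) B) \<and> u i B v = Res (F' i) A B f (y i)"
          by (auto simp: locus_mem psh_image_def psh_all_mem)
        from someI_ex[OF this] show ?thesis using i by (simp add: x_def)
      qed
      have xn: "x i = \<zero>\<^bsub>Val (F i) B\<^esub>" if "i \<in> I" "i \<notin> ?s" for i using that by (simp add: x_def)
      have xc: "x i \<in> carrier (Val (F i) B)" if i: "i \<in> I" for i
        using xs[of i] xn[of i] i sub_zero[OF psh_all_sub[OF F[OF i]] F[OF i] B(1)]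
        by (cases "i \<in> ?s") (auto simp: psh_all_mem)
      have "finite {i \<in> I. x i \<noteq> \<zero>\<^bsub>Val (F i) B\<^esub>}" by (rule finite_subset[OF _ fs]) (use xn in auto)
      moreover have "x \<in> extensional I" by (simp add: x_def)
      ultimately have X: "x \<in> psh_all a (psum I F) B"
        using xc B by (simp add: psh_all_mem dsum_carrier)
      have "u i B (x i) = Res (F' i) A B f (y i)" if i: "i \<in> I" for i
      proof (cases "i \<in> ?s")
        case False
        then show ?thesis
          using i xn[OF i False] z[OF i B(1)] mod_hom_zero[OF Res_hom[OF F'[OF i] A B] psh_module[OF F'[OF i] A] psh_module[OF F'[OF i] B(1)]]
          by simp
      qed (use xs in simp)
      then have "Res (psum I F') A B f y = ?u B x" by (auto intro!: restrict_ext)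
      then show "Res (psum I F') A B f y \<in> psh_image a (psum I F) ?u B"
        using X by (auto simp: psh_image_def)
    qed
  qed
  show ?thesis unfolding local_iso_def by (intro conjI P P' nat K S)
qed


section \<open>Exactness and local isomorphisms\<close>

lemma sub_img_mono: "H \<le> K \<Longrightarrow> sub_img \<phi> H \<le> sub_img \<phi> K"
  by (auto simp: le_fun_def sub_img_def)

lemma closure_img_closure:
  assumes "presheaf k a F" "presheaf k a G" "nat_trans k a F G \<phi>" "subfunctor k a F H"
  shows "local_closure a T G (sub_img \<phi> (local_closure a T F H)) = local_closure a T G (sub_img \<phi> H)"
proof (rule antisym)
  note i = sub_img_sub[OF assms] and c = closure_sub[OF assms(1,4)]
  show "local_closure a T G (sub_img \<phi> (local_closure a T F H)) \<le> local_closure a T G (sub_img \<phi> H)"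
    by (rule closure_le_closure[OF assms(2) sub_img_sub[OF assms(1-3) c] i img_closure[OF assms]])
  show "local_closure a T G (sub_img \<phi> H) \<le> local_closure a T G (sub_img \<phi> (local_closure a T F H))"
    by (rule closure_mono[OF assms(2) sub_img_sub[OF assms(1-3) c] sub_img_mono[OF closure_inc[OF assms(1,4)]]])
qed

text \<open>\<open>local_iso_preim_closure\<close> recovers the closure of \<open>H\<close> from
  that of its image, so transport along \<open>\<phi>\<close> loses nothing.\<close>

lemma closure_img_eq_iff:
  assumes "local_iso k a T F G \<phi>" "subfunctor k a F H" "subfunctor k a F K"
  shows "local_closure a T G (sub_img \<phi> H) = local_closure a T G (sub_img \<phi> K) \<longleftrightarrow>
    local_closure a T F H = local_closure a T F K"
  using local_iso_preim_closure[OF assms(1,2)] local_iso_preim_closure[OF assms(1,3)]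
    closure_img_closure assms unfolding local_iso_def by metis

text \<open>An element of \<open>H\<close> is locally in the image of \<open>\<phi>\<close>, and its
  local lifts lie in the preimage of \<open>H\<close>. Together with
  \<open>local_iso_preim_closure\<close> this makes closed subfunctors of source and target
  correspond.\<close>

lemma closure_img_preim:
  assumes "local_iso k a T F G \<phi>" "subfunctor k a G H" "local_closure a T G H = H"
  shows "local_closure a T G (sub_img \<phi> (preim a F \<phi> H)) = H"
proof (rule antisym)
  have F: "presheaf k a F" and G: "presheaf k a G" and n: "nat_trans k a F G \<phi>"
    and im: "psh_all a G \<le> local_closure a T G (psh_image a F \<phi>)"
    using assms(1) by (simp_all add: local_iso_def)
  note s = sub_img_sub[OF F G n preim_sub[OF F G n assms(2)]]
  have "sub_img \<phi> (preim a F \<phi> H) \<le> H" by (auto simp: sub_img_def preim_def le_fun_def)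
  from closure_mono[OF G assms(2) this] show "local_closure a T G (sub_img \<phi> (preim a F \<phi> H)) \<le> H"
    by (simp add: assms(3))
  show "H \<le> local_closure a T G (sub_img \<phi> (preim a F \<phi> H))"
  proof (intro le_funI subsetI)
    fix A y assume y: "y \<in> H A"
    note A = sub_ObjD[OF assms(2) y]
    note yc = sub_carrier[OF assms(2) G A y]
    have "y \<in> psh_all a G A" using A yc by (simp add: psh_all_mem)
    then have "y \<in> local_closure a T G (psh_image a F \<phi>) A" by (rule subD[OF im])
    then obtain R where R: "R \<in> T A" "\<And>B f. f \<in> R B \<Longrightarrow> Res G A B f y \<in> psh_image a F \<phi> B"
      by (elim closureE) blast
    show "y \<in> local_closure a T G (sub_img \<phi> (preim a F \<phi> H)) A"
    proof (rule closureI[OF G s R(1) yc])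
      fix B f assume f: "f \<in> R B"
      note B = T_elem[OF R(1) f]
      have "Res G A B f y \<in> H B" using sub_Res[OF assms(2) G A _ _ y] B by simp
      with R(2)[OF f] show "Res G A B f y \<in> sub_img \<phi> (preim a F \<phi> H) B"
        by (auto simp: psh_image_def sub_img_def preim_def)
    qed
  qed
qed

text \<open>\<open>u\<close> is locally surjective, so the image of \<open>\<phi>'\<close> has the
  same closure as the image of the composite of \<open>u\<close> and \<open>\<phi>'\<close>, and the
  square rewrites the latter.\<close>

lemma closure_image_square:
  assumes u: "local_iso k a T P P' u" and Q: "presheaf k a Q'" and m: "nat_trans k a P' Q' \<phi>'"
    and sq: "\<And>A x. \<lbrakk>A \<in> Obj a; x \<in> carrier (Val P A)\<rbrakk> \<Longrightarrow> \<phi>' A (u A x) = v A (\<phi> A x)"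
  shows "local_closure a T Q' (psh_image a P' \<phi>') = local_closure a T Q' (sub_img v (psh_image a P \<phi>))"
proof -
  have P: "presheaf k a P" and P': "presheaf k a P'" and n: "nat_trans k a P P' u"
    and im: "psh_all a P' \<le> local_closure a T P' (sub_img u (psh_all a P))"
    using u by (simp_all add: local_iso_def psh_image_eq)
  have e: "sub_img \<phi>' (sub_img u (psh_all a P)) = sub_img v (psh_image a P \<phi>)"
    unfolding fun_eq_iff
  proof
    fix A
    have "\<phi>' A ` u A ` psh_all a P A = v A ` \<phi> A ` psh_all a P A"
      unfolding image_image by (rule image_cong) (auto simp: psh_all_mem sq)
    then show "sub_img \<phi>' (sub_img u (psh_all a P)) A = sub_img v (psh_image a P \<phi>) A"
      by (simp add: sub_img_def psh_image_def)
  qed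
  have uP: "subfunctor k a P' (sub_img u (psh_all a P))"
    by (rule sub_img_sub[OF P P' n psh_all_sub[OF P]])
  have "local_closure a T P' (sub_img u (psh_all a P)) = psh_all a P'"
    using im sub_le_all[OF P' closure_sub[OF P' uP]] by (rule antisym[rotated])
  then show ?thesis
    using closure_img_closure[OF P' Q m uP] unfolding e psh_image_eq[of a P'] by simp
qed

text \<open>The kernel and the images of the sheaf morphisms are the closures of the transported kernel
  and images of the presheaf morphisms.\<close>

lemma sh_right_exact_iff:
  assumes u: "local_iso k a T P P' u" and v: "local_iso k a T Q Q' v" and w: "local_iso k a T W W' w"
    and Q': "sheaf k a T Q'" and W': "sheaf k a T W'"
    and f: "nat_trans k a P Q \<phi>" and g: "nat_trans k a Q W \<psi>"
    and f': "nat_trans k a P' Q' \<phi>'" and g': "nat_trans k a Q' W' \<psi>'"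
    and sf: "\<And>A x. \<lbrakk>A \<in> Obj a; x \<in> carrier (Val P A)\<rbrakk> \<Longrightarrow> \<phi>' A (u A x) = v A (\<phi> A x)"
    and sg: "\<And>A x. \<lbrakk>A \<in> Obj a; x \<in> carrier (Val Q A)\<rbrakk> \<Longrightarrow> \<psi>' A (v A x) = w A (\<psi> A x)"
    and z: "psh_image a P \<phi> \<le> psh_kernel a Q W \<psi>"
  shows "sh_right_exact k a T P' Q' W' \<phi>' \<psi>' \<longleftrightarrow>
    psh_kernel a Q W \<psi> \<le> local_closure a T Q (psh_image a P \<phi>) \<and>
    psh_all a W \<le> local_closure a T W (psh_image a Q \<psi>)"
proof -
  have pP: "presheaf k a P" "presheaf k a P'" and pQ: "presheaf k a Q" "presheaf k a Q'"
    and pW: "presheaf k a W" "presheaf k a W'"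
    and vn: "nat_trans k a Q Q' v" and wn: "nat_trans k a W W' w"
    and wi: "psh_all a W' \<le> local_closure a T W' (sub_img w (psh_all a W))"
    using u v w by (simp_all add: local_iso_def psh_image_eq)
  note zW = zero_sub_sub[OF pW(1)] and zW' = zero_sub_sub[OF pW(2)]
  have kerS: "subfunctor k a Q (psh_kernel a Q W \<psi>)"
    unfolding psh_kernel_eq by (rule preim_sub[OF pQ(1) pW(1) g zW])
  have imf: "subfunctor k a Q (psh_image a P \<phi>)"
    unfolding psh_image_eq by (rule sub_img_sub[OF pP(1) pQ(1) f psh_all_sub[OF pP(1)]])
  have img: "subfunctor k a W (psh_image a Q \<psi>)"
    unfolding psh_image_eq by (rule sub_img_sub[OF pQ(1) pW(1) g psh_all_sub[OF pQ(1)]])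
  \<comment> \<open>In the sheaf \<open>W'\<close> zero is closed, so the kernel of
    \<open>\<psi>'\<close> is closed and can be recovered from its preimage by
    \<open>closure_img_preim\<close>.\<close>
  have kc: "local_closure a T Q' (psh_kernel a Q' W' \<psi>') = psh_kernel a Q' W' \<psi>'"
    unfolding psh_kernel_eq
    using preim_closure[OF pQ(2) pW(2) g' zW'] separated_closure_zero[OF pW(2) sheaf_separated[OF W']] by simp
  have kS': "subfunctor k a Q' (psh_kernel a Q' W' \<psi>')"
    unfolding psh_kernel_eq by (rule preim_sub[OF pQ(2) pW(2) g' zW'])
  have w0: "sub_img w (zero_sub a W) = zero_sub a W'"
    using mod_hom_zero[OF nat_hom[OF wn] psh_module[OF pW(1)] psh_module[OF pW(2)]]
    by (auto simp: sub_img_def zero_sub_def fun_eq_iff)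
  \<comment> \<open>The preimage of the sheaf kernel under \<open>v\<close> is the preimage under
    \<open>\<psi>\<close> of the kernel of \<open>w\<close>. The latter is the closure of zero, so
    the result is the closure of the presheaf kernel.\<close>
  have "preim a Q v (psh_kernel a Q' W' \<psi>') = preim a Q \<psi> (preim a W w (zero_sub a W'))"
    using nat_closed[OF vn] nat_closed[OF g] sg
    by (auto simp: preim_def psh_kernel_def psh_all_mem zero_sub_def fun_eq_iff)
  also have "preim a W w (zero_sub a W') = local_closure a T W (zero_sub a W)"
    using local_iso_preim_closure[OF w zW] separated_closure_zero[OF pW(2) sheaf_separated[OF W']] by (simp add: w0)
  also have "preim a Q \<psi> \<dots> = local_closure a T Q (psh_kernel a Q W \<psi>)"
    unfolding psh_kernel_eq by (rule preim_closure[OF pQ(1) pW(1) g zW])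
  finally have pk: "preim a Q v (psh_kernel a Q' W' \<psi>') = local_closure a T Q (psh_kernel a Q W \<psi>)" .
  have ker: "psh_kernel a Q' W' \<psi>' = local_closure a T Q' (sub_img v (psh_kernel a Q W \<psi>))"
    using closure_img_preim[OF v kS' kc] closure_img_closure[OF pQ vn kerS] unfolding pk by simp
  have wS: "subfunctor k a W' (sub_img w (psh_all a W))" by (rule sub_img_sub[OF pW wn psh_all_sub[OF pW(1)]])
  have all: "psh_all a W' = local_closure a T W' (sub_img w (psh_all a W))"
    using wi sub_le_all[OF pW(2) closure_sub[OF pW(2) wS]] by (rule antisym)
  have sqf: "local_closure a T Q' (psh_image a P' \<phi>') = local_closure a T Q' (sub_img v (psh_image a P \<phi>))"
    by (rule closure_image_square[OF u pQ(2) f']) (rule sf)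
  have sqg: "local_closure a T W' (psh_image a Q' \<psi>') = local_closure a T W' (sub_img w (psh_image a Q \<psi>))"
    by (rule closure_image_square[OF v pW(2) g']) (rule sg)
  have "sh_right_exact k a T P' Q' W' \<phi>' \<psi>' \<longleftrightarrow>
      local_closure a T Q' (sub_img v (psh_image a P \<phi>)) = local_closure a T Q' (sub_img v (psh_kernel a Q W \<psi>)) \<and>
      local_closure a T W' (sub_img w (psh_image a Q \<psi>)) = local_closure a T W' (sub_img w (psh_all a W))"
    unfolding sh_right_exact_def sh_image_eq[OF pP(2) Q' f'] sh_image_eq[OF pQ(2) W' g'] ker all
      sqf sqg by simp
  also have "\<dots> \<longleftrightarrow> local_closure a T Q (psh_image a P \<phi>) = local_closure a T Q (psh_kernel a Q W \<psi>) \<and>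
      local_closure a T W (psh_image a Q \<psi>) = local_closure a T W (psh_all a W)"
    by (simp add: closure_img_eq_iff[OF v imf kerS] closure_img_eq_iff[OF w img psh_all_sub[OF pW(1)]])
  \<comment> \<open>By assumption \<open>z\<close> the image lies in the kernel, so equality of
    closures amounts to one inclusion.\<close>
  also have "local_closure a T Q (psh_image a P \<phi>) = local_closure a T Q (psh_kernel a Q W \<psi>) \<longleftrightarrow>
      psh_kernel a Q W \<psi> \<le> local_closure a T Q (psh_image a P \<phi>)"
    using closure_inc[OF pQ(1) kerS] closure_mono[OF pQ(1) kerS z] closure_le_closure[OF pQ(1) kerS imf]
    by (metis antisym)
  also have "local_closure a T W (psh_image a Q \<psi>) = local_closure a T W (psh_all a W) \<longleftrightarrow>
      psh_all a W \<le> local_closure a T W (psh_image a Q \<psi>)"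
    using closure_inc[OF pW(1) psh_all_sub[OF pW(1)]] sub_le_all[OF pW(1) closure_sub[OF pW(1) img]]
      sub_le_all[OF pW(1) closure_sub[OF pW(1) psh_all_sub[OF pW(1)]]] by (metis antisym)
  finally show ?thesis .
qed

text \<open>The image of \<open>\<phi>'\<close> lies in the closure of the image of the composite
  with \<open>u\<close>, which is zero, and zero is closed in a separated presheaf.\<close>

lemma nat_zero_of_local_iso:
  assumes u: "local_iso k a T P P' u" and Q: "presheaf k a Q'" "separated a T Q'" and m: "nat_trans k a P' Q' \<phi>'"
    and z: "\<And>A x. \<lbrakk>A \<in> Obj a; x \<in> carrier (Val P A)\<rbrakk> \<Longrightarrow> \<phi>' A (u A x) = \<zero>\<^bsub>Val Q' A\<^esub>"
    and A: "A \<in> Obj a" and y: "y \<in> carrier (Val P' A)"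
  shows "\<phi>' A y = \<zero>\<^bsub>Val Q' A\<^esub>"
proof -
  have P': "presheaf k a P'" using u by (simp add: local_iso_def)
  have "local_closure a T Q' (psh_image a P' \<phi>') =
      local_closure a T Q' (sub_img (\<lambda>A x. x) (psh_image a P (\<lambda>A x. \<zero>\<^bsub>Val Q' A\<^esub>)))"
    by (rule closure_image_square[OF u Q(1) m]) (rule z)
  also have "\<dots> \<le> local_closure a T Q' (zero_sub a Q')"
    by (rule closure_mono[OF Q(1) zero_sub_sub[OF Q(1)]])
      (auto simp: le_fun_def sub_img_def psh_image_def zero_sub_def psh_all_mem)
  also have "\<dots> = zero_sub a Q'" by (rule separated_closure_zero[OF Q])
  finally have le: "local_closure a T Q' (psh_image a P' \<phi>') \<le> zero_sub a Q'" .
  have "\<phi>' A y \<in> psh_image a P' \<phi>' A" using A y by (auto simp: psh_image_def psh_all_mem)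
  then have "\<phi>' A y \<in> zero_sub a Q' A"
    using subD[OF le] subD[OF closure_inc[OF Q(1) sub_img_sub[OF P' Q(1) m psh_all_sub[OF P'], folded psh_image_eq]]] by blast
  then show ?thesis using A by (simp add: zero_sub_def)
qed

end


section \<open>Formal sequences\<close>

text \<open>Weaker than \<open>formal_morphism\<close>: iterated composites are never compared with other formal
  morphisms, so that extensionality is not required.\<close>

definition cone :: "('k, 'o, 'm) lincat \<Rightarrow> ('i, unit, 'o, 'm) fmor \<Rightarrow> 'o \<Rightarrow> bool" where
  "cone a v X \<longleftrightarrow> X \<in> Obj a \<and> Cod v = one_fam X \<and>
     (\<forall>\<alpha>\<in>Ix (Dom v). At (Dom v) \<alpha> \<in> Obj a \<and> Ent v \<alpha> () \<in> arr a (At (Dom v) \<alpha>) X)"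

definition fam_psh :: "('k, 'o, 'm) lincat \<Rightarrow> ('i, 'o) fam \<Rightarrow> ('k, 'o, 'm, 'i \<Rightarrow> 'm) psh" where
  "fam_psh a D = psum (Ix D) (\<lambda>\<beta>. yoneda a (At D \<beta>))"

text \<open>With \<open>fmor_map\<close> below, the arrows \<open>\<psi>\<close> and
  \<open>\<phi>\<close> of \<open>pre'_of\<close> for a sequence, where
  \<open>Cod p = Dom q\<close>.\<close>

definition cone_map :: "('k, 'o, 'm) lincat \<Rightarrow> ('i, unit, 'o, 'm) fmor \<Rightarrow> 'o \<Rightarrow> ('i \<Rightarrow> 'm) \<Rightarrow> 'm" where
  "cone_map a q = copair (Ix (Dom q)) (\<lambda>\<beta>. yoneda a (At (Dom q) \<beta>)) (yoneda a (At (Cod q) ()))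
     (\<lambda>\<beta>. Ymap a (At (Dom q) \<beta>) (At (Cod q) ()) (Ent q \<beta> ()))"

definition fmor_map :: "('k, 'o, 'm) lincat \<Rightarrow> ('i, 'j, 'o, 'm) fmor \<Rightarrow> 'o \<Rightarrow> ('i \<Rightarrow> 'm) \<Rightarrow> 'j \<Rightarrow> 'm" where
  "fmor_map a p = matrix_map (Ix (Dom p)) (\<lambda>\<gamma>. yoneda a (At (Dom p) \<gamma>))
     (Ix (Cod p)) (\<lambda>\<beta>. yoneda a (At (Cod p) \<beta>))
     (\<lambda>\<gamma> \<beta>. Ymap a (At (Dom p) \<gamma>) (At (Cod p) \<beta>) (Ent p \<gamma> \<beta>))"

lemma one_fam_sel [simp]: "Ix (one_fam A) = {()}" "At (one_fam A) u = A"
  by (simp_all add: one_fam_def)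

lemma one_fam_inject [simp]: "one_fam A = one_fam B \<longleftrightarrow> A = B"
  by (auto simp: one_fam_def fun_eq_iff)

lemma Val_fam_psh: "Val (fam_psh a D) A = dsum (Ix D) (\<lambda>\<beta>. Hom a A (At D \<beta>))"
  by (simp add: fam_psh_def)

lemma Res_fam_psh: "Res (fam_psh a D) A B f x = (\<lambda>\<beta>\<in>Ix D. Cmp a B A (At D \<beta>) (x \<beta>) f)"
  by (simp add: fam_psh_def)

lemma family_Obj: "\<lbrakk>family a D; \<beta> \<in> Ix D\<rbrakk> \<Longrightarrow> At D \<beta> \<in> Obj a"
  by (auto simp: family_def)

lemma formal_morphism_row:
  "\<lbrakk>formal_morphism a p; \<gamma> \<in> Ix (Dom p)\<rbrakk> \<Longrightarrow> Ent p \<gamma> \<in> carrier (Val (fam_psh a (Cod p)) (At (Dom p) \<gamma>))"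
  unfolding formal_morphism_def Val_fam_psh by (metis PiE_mem)

lemma formal_morphism_cone:
  assumes "formal_morphism a q" "Cod q = one_fam X" "X \<in> Obj a"
  shows "cone a q X"
  unfolding cone_def
proof (intro conjI ballI)
  fix \<alpha> assume \<alpha>: "\<alpha> \<in> Ix (Dom q)"
  show "At (Dom q) \<alpha> \<in> Obj a"
    using assms(1) \<alpha> by (auto simp: formal_morphism_def intro: family_Obj)
  show "Ent q \<alpha> () \<in> arr a (At (Dom q) \<alpha>) X"
    using formal_morphism_row[OF assms(1) \<alpha>] by (simp add: Val_fam_psh dsum_carrier assms(2))
qed (use assms in auto)


section \<open>Generated sieves and images of formal morphisms\<close>

context linear_category
begin

text \<open>\<open>LEAST\<close> is realised by the intersection of all sieves that contain the
  components. The maximal sieve is one of them, so the intersection stays within the arrows into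
  \<open>X\<close>.\<close>

lemma
  assumes "cone a v X"
  shows gen_sieve_sieve: "sieve k a X (gen_sieve k a v)"
    and gen_sieve_comp: "\<alpha> \<in> Ix (Dom v) \<Longrightarrow> Ent v \<alpha> () \<in> gen_sieve k a v (At (Dom v) \<alpha>)"
    and gen_sieve_least: "\<lbrakk>sieve k a X R; \<And>\<alpha>. \<alpha> \<in> Ix (Dom v) \<Longrightarrow> Ent v \<alpha> () \<in> R (At (Dom v) \<alpha>)\<rbrakk>
      \<Longrightarrow> gen_sieve k a v \<le> R"
proof -
  have X: "X \<in> Obj a" and C: "At (Cod v) () = X" using assms by (auto simp: cone_def)
  let ?S = "{R. sieve k a X R \<and> (\<forall>\<alpha>\<in>Ix (Dom v). Ent v \<alpha> () \<in> R (At (Dom v) \<alpha>))}"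
  let ?G = "\<lambda>B. \<Inter>R\<in>?S. R B"
  have "max_sieve a X \<in> ?S"
    using assms max_sieve_sieve[OF X] by (auto simp: cone_def max_sieve_mem)
  then have ne: "?S \<noteq> {}" by blast
  have "sieve k a X ?G"
  proof (rule sieve_iff[OF X, THEN iffD2], intro conjI ballI allI impI)
    fix B assume "B \<in> Obj a"
    show "?G B \<subseteq> arr a B X" using ne sieve_arr[OF X] by blast
    show "\<zero>\<^bsub>Hom a B X\<^esub> \<in> ?G B" using sieve_zero[OF X _ \<open>B \<in> Obj a\<close>] by blast
    fix x assume x: "x \<in> ?G B"
    show "x \<oplus>\<^bsub>Hom a B X\<^esub> y \<in> ?G B" if "y \<in> ?G B" for y
      using x that sieve_add[OF X] by blast
    show "r \<odot>\<^bsub>Hom a B X\<^esub> x \<in> ?G B" if "r \<in> carrier k" for r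
      using x that sieve_smult[OF X] by blast
    show "Cmp a C B X x f \<in> ?G C" if "C \<in> Obj a" "f \<in> arr a C B" for C f
      using x that sieve_comp[OF X] by blast
  next
    show "?G B = {}" if "B \<notin> Obj a" for B using that ne sieve_Obj[OF X] by blast
  qed
  then have "gen_sieve k a v = ?G"
    unfolding gen_sieve_def C by (intro Least_equality) (auto simp: le_fun_def)
  then show "sieve k a X (gen_sieve k a v)"
    and "\<alpha> \<in> Ix (Dom v) \<Longrightarrow> Ent v \<alpha> () \<in> gen_sieve k a v (At (Dom v) \<alpha>)"
    and "\<lbrakk>sieve k a X R; \<And>\<alpha>. \<alpha> \<in> Ix (Dom v) \<Longrightarrow> Ent v \<alpha> () \<in> R (At (Dom v) \<alpha>)\<rbrakk> \<Longrightarrow> gen_sieve k a v \<le> R"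
    using \<open>sieve k a X ?G\<close> by (auto simp: le_fun_def)
qed

lemma gen_sieve_le_iff:
  assumes "cone a v X" "sieve k a X R"
  shows "gen_sieve k a v \<le> R \<longleftrightarrow> (\<forall>\<alpha>\<in>Ix (Dom v). Ent v \<alpha> () \<in> R (At (Dom v) \<alpha>))"
  using gen_sieve_least[OF assms] gen_sieve_comp[OF assms(1)] by (auto simp: le_fun_def)


text \<open>A morphism from a sum of representables is given by its values on the identities, and its
  image is the subfunctor that they generate.\<close>

context
  fixes G :: "('k, 'o, 'm, 'v) psh" and I :: "'i set" and Y :: "'i \<Rightarrow> 'o" and e :: "'i \<Rightarrow> 'v"
  assumes G: "presheaf k a G" and Y: "\<And>i. i \<in> I \<Longrightarrow> Y i \<in> Obj a"
    and e: "\<And>i. i \<in> I \<Longrightarrow> e i \<in> carrier (Val G (Y i))"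
begin

lemma rep_presheaf: "i \<in> I \<Longrightarrow> presheaf k a (yoneda a (Y i))"
  using yoneda_presheaf Y by blast

lemma rep_copair_nat:
  "nat_trans k a (psum I (\<lambda>i. yoneda a (Y i))) G (copair I (\<lambda>i. yoneda a (Y i)) G (\<lambda>i A f. Res G (Y i) A f (e i)))"
  by (rule copair_nat[OF cring_axioms G rep_presheaf yoneda_nat[OF G Y e]])

lemma rep_image_le:
  assumes K: "subfunctor k a G K" and eK: "\<And>i. i \<in> I \<Longrightarrow> e i \<in> K (Y i)"
  shows "psh_image a (psum I (\<lambda>i. yoneda a (Y i))) (copair I (\<lambda>i. yoneda a (Y i)) G (\<lambda>i A f. Res G (Y i) A f (e i))) \<le> K"
proof (intro le_funI subsetI)
  fix A z assume "z \<in> psh_image a (psum I (\<lambda>i. yoneda a (Y i))) (copair I (\<lambda>i. yoneda a (Y i)) G (\<lambda>i A f. Res G (Y i) A f (e i))) A"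
  then obtain x where A: "A \<in> Obj a" and x: "x \<in> carrier (dsum I (\<lambda>i. Hom a A (Y i)))"
    and z: "z = copair I (\<lambda>i. yoneda a (Y i)) G (\<lambda>i A f. Res G (Y i) A f (e i)) A x"
    by (auto simp: psh_image_def psh_all_mem)
  show "z \<in> K A"
    unfolding z copair_def yoneda_sel
  proof (rule sub_finsum[OF K G A])
    show "finite {i \<in> I. x i \<noteq> \<zero>\<^bsub>Hom a A (Y i)\<^esub>}" using x by (simp add: dsum_carrier)
    fix i assume "i \<in> {i \<in> I. x i \<noteq> \<zero>\<^bsub>Hom a A (Y i)\<^esub>}"
    then have i: "i \<in> I" by simp
    then have "x i \<in> arr a A (Y i)" using x by (simp add: dsum_carrier)
    from sub_Res[OF K G Y[OF i] A this eK[OF i]] show "Res G (Y i) A (x i) (e i) \<in> K A" .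
  qed
qed

lemma rep_image_mem:
  assumes i: "i \<in> I"
  shows "e i \<in> psh_image a (psum I (\<lambda>i. yoneda a (Y i))) (copair I (\<lambda>i. yoneda a (Y i)) G (\<lambda>i A f. Res G (Y i) A f (e i))) (Y i)"
proof -
  \<comment> \<open>The identity of \<open>Y i\<close>, placed in the summand \<open>i\<close>, is
    mapped to \<open>e i\<close>.\<close>
  let ?x = "\<lambda>j\<in>I. if j = i then Idt a (Y i) else \<zero>\<^bsub>Hom a (Y i) (Y j)\<^esub>"
  have z: "\<zero>\<^bsub>Hom a (Y i) (Y j)\<^esub> \<in> arr a (Y i) (Y j)" if "j \<in> I" for j
    using sieve_zero[OF Y[OF that] max_sieve_sieve[OF Y[OF that]] Y[OF i]] by (simp add: max_sieve_mem)
  have s: "{j \<in> I. ?x j \<noteq> \<zero>\<^bsub>Hom a (Y i) (Y j)\<^esub>} \<subseteq> {i}" by auto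
  then have "finite {j \<in> I. ?x j \<noteq> \<zero>\<^bsub>Hom a (Y i) (Y j)\<^esub>}" by (rule finite_subset) simp
  then have x: "?x \<in> carrier (Val (psum I (\<lambda>i. yoneda a (Y i))) (Y i))"
    unfolding psum_sel dsum_carrier using z id_closed[OF Y[OF i]] by auto
  interpret V: module k "Val G (Y i)" by (rule psh_module[OF G Y[OF i]])
  have "copair I (\<lambda>i. yoneda a (Y i)) G (\<lambda>i A f. Res G (Y i) A f (e i)) (Y i) ?x =
      (\<Oplus>\<^bsub>Val G (Y i)\<^esub>j\<in>{i}. Res G (Y j) (Y i) (?x j) (e j))"
    by (rule copair_eq[OF G rep_presheaf yoneda_nat[OF G Y e] Y[OF i] x]) (use s i in auto)
  also have "\<dots> = e i"
    using i Res_id[OF G Y[OF i] e[OF i]] e[OF i] by simp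
  finally show ?thesis using x Y[OF i] by (auto simp: psh_image_def psh_all_mem intro: rev_image_eqI)
qed

end

lemma fam_psh_presheaf: "family a D \<Longrightarrow> presheaf k a (fam_psh a D)"
  unfolding fam_psh_def by (intro psum_presheaf[OF cring_axioms] yoneda_presheaf family_Obj)

lemma cone_map_eq: "cone_map a q = copair (Ix (Dom q)) (\<lambda>\<beta>. yoneda a (At (Dom q) \<beta>)) (yoneda a (At (Cod q) ()))
    (\<lambda>\<beta> A f. Res (yoneda a (At (Cod q) ())) (At (Dom q) \<beta>) A f (Ent q \<beta> ()))"
  by (simp add: cone_map_def Ymap_def)

lemma cone_map_nat:
  assumes "cone a q X"
  shows "nat_trans k a (fam_psh a (Dom q)) (yoneda a X) (cone_map a q)"
  unfolding cone_map_eq fam_psh_def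
  using assms rep_copair_nat[OF yoneda_presheaf[of X], where I = "Ix (Dom q)" and Y = "At (Dom q)" and e = "\<lambda>\<beta>. Ent q \<beta> ()"]
  by (simp add: cone_def)

text \<open>The image is a sieve containing the components of \<open>q\<close> by
  \<open>rep_image_mem\<close>, and it lies in the generated sieve by \<open>rep_image_le\<close>.
  The covering condition of \<open>pre'_of\<close> thus concerns \<open>gen_sieve\<close>.\<close>

lemma cone_image:
  assumes "cone a q X"
  shows "psh_image a (fam_psh a (Dom q)) (cone_map a q) = gen_sieve k a q"
proof (rule antisym)
  have X: "X \<in> Obj a" and C: "At (Cod q) () = X" using assms by (auto simp: cone_def)
  have Y: "At (Dom q) \<beta> \<in> Obj a" and e: "Ent q \<beta> () \<in> carrier (Val (yoneda a X) (At (Dom q) \<beta>))" if "\<beta> \<in> Ix (Dom q)" for \<beta>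
    using assms that by (auto simp: cone_def)
  have P: "presheaf k a (fam_psh a (Dom q))"
    unfolding fam_psh_def by (rule psum_presheaf[OF cring_axioms yoneda_presheaf[OF Y]])
  show "psh_image a (fam_psh a (Dom q)) (cone_map a q) \<le> gen_sieve k a q"
    unfolding cone_map_eq fam_psh_def C
    by (rule rep_image_le[OF yoneda_presheaf[OF X]])
      (use Y e gen_sieve_comp[OF assms] gen_sieve_sieve[OF assms] in \<open>auto simp: sieve_def\<close>)
  show "gen_sieve k a q \<le> psh_image a (fam_psh a (Dom q)) (cone_map a q)"
  proof (rule gen_sieve_least[OF assms])
    show "sieve k a X (psh_image a (fam_psh a (Dom q)) (cone_map a q))"
      unfolding sieve_def psh_image_eq
      by (rule sub_img_sub[OF P yoneda_presheaf[OF X] cone_map_nat[OF assms] psh_all_sub[OF P]])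
    fix \<alpha> assume "\<alpha> \<in> Ix (Dom q)"
    from rep_image_mem[OF yoneda_presheaf[OF X] Y e this]
    show "Ent q \<alpha> () \<in> psh_image a (fam_psh a (Dom q)) (cone_map a q) (At (Dom q) \<alpha>)"
      by (simp add: cone_map_eq fam_psh_def C)
  qed
qed

context
  fixes p :: "('i, 'j, 'o, 'm) fmor"
  assumes p: "formal_morphism a p"
begin

lemma fmor_family: "family a (Dom p)" "family a (Cod p)"
  using p by (auto simp: formal_morphism_def)

lemma fmor_map_eq:
  assumes "A \<in> Obj a" "x \<in> carrier (Val (fam_psh a (Dom p)) A)"
  shows "fmor_map a p A x = copair (Ix (Dom p)) (\<lambda>\<gamma>. yoneda a (At (Dom p) \<gamma>)) (fam_psh a (Cod p))
    (\<lambda>\<gamma> A f. Res (fam_psh a (Cod p)) (At (Dom p) \<gamma>) A f (Ent p \<gamma>)) A x"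
proof -
  note fP = fam_psh_presheaf[OF fmor_family(2)]
  have row: "Ent p \<gamma> \<beta> \<in> arr a (At (Dom p) \<gamma>) (At (Cod p) \<beta>)" if "\<gamma> \<in> Ix (Dom p)" "\<beta> \<in> Ix (Cod p)" for \<gamma> \<beta>
    using formal_morphism_row[OF p that(1)] that(2) by (simp add: Val_fam_psh dsum_carrier)
  \<comment> \<open>A row of \<open>p\<close> is an element of the direct sum, and so is its
    restriction along \<open>y\<close>; hence only finitely many entries survive.\<close>
  have fin: "finite {\<beta> \<in> Ix (Cod p). Cmp a A (At (Dom p) \<gamma>) (At (Cod p) \<beta>) (Ent p \<gamma> \<beta>) y \<noteq> \<zero>\<^bsub>Hom a A (At (Cod p) \<beta>)\<^esub>}"
    if "\<gamma> \<in> Ix (Dom p)" "A \<in> Obj a" "y \<in> arr a A (At (Dom p) \<gamma>)" for \<gamma> A y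
  proof -
    have "Res (fam_psh a (Cod p)) (At (Dom p) \<gamma>) A y (Ent p \<gamma>) \<in> carrier (Val (fam_psh a (Cod p)) A)"
      by (rule Res_closed[OF fP family_Obj[OF fmor_family(1) that(1)] that(2,3) formal_morphism_row[OF p that(1)]])
    then have "finite {\<beta> \<in> Ix (Cod p). Res (fam_psh a (Cod p)) (At (Dom p) \<gamma>) A y (Ent p \<gamma>) \<beta> \<noteq> \<zero>\<^bsub>Hom a A (At (Cod p) \<beta>)\<^esub>}"
      unfolding Val_fam_psh dsum_carrier by blast
    then show ?thesis by (rule rev_finite_subset) (auto simp: Res_fam_psh)
  qed
  have nt: "nat_trans k a (yoneda a (At (Dom p) \<gamma>)) (yoneda a (At (Cod p) \<beta>)) (\<lambda>A f. Cmp a A (At (Dom p) \<gamma>) (At (Cod p) \<beta>) (Ent p \<gamma> \<beta>) f)"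
    if "\<gamma> \<in> Ix (Dom p)" "\<beta> \<in> Ix (Cod p)" for \<gamma> \<beta>
    using yoneda_nat[OF yoneda_presheaf[OF family_Obj[OF fmor_family(2) that(2)]] family_Obj[OF fmor_family(1) that(1)], of "Ent p \<gamma> \<beta>"]
      row[OF that] by simp
  show ?thesis
    unfolding fmor_map_def Ymap_def fam_psh_def
    by (subst matrix_map_eq_copair[OF cring_axioms yoneda_presheaf[OF family_Obj[OF fmor_family(1)]]
          yoneda_presheaf[OF family_Obj[OF fmor_family(2)]] nt _ assms(1)])
      (use fin assms(2) in \<open>auto simp: fam_psh_def\<close>)
qed

lemma fmor_map_nat: "nat_trans k a (fam_psh a (Dom p)) (fam_psh a (Cod p)) (fmor_map a p)"
proof -
  let ?c = "copair (Ix (Dom p)) (\<lambda>\<gamma>. yoneda a (At (Dom p) \<gamma>)) (fam_psh a (Cod p))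
    (\<lambda>\<gamma> A f. Res (fam_psh a (Cod p)) (At (Dom p) \<gamma>) A f (Ent p \<gamma>))"
  note fD = fam_psh_presheaf[OF fmor_family(1)]
  have c: "nat_trans k a (fam_psh a (Dom p)) (fam_psh a (Cod p)) ?c"
    using rep_copair_nat[OF fam_psh_presheaf[OF fmor_family(2)] family_Obj[OF fmor_family(1)] formal_morphism_row[OF p]]
    by (simp add: fam_psh_def)
  show ?thesis
  proof (rule nat_transI)
    fix A assume A: "A \<in> Obj a"
    show "fmor_map a p A \<in> mod_hom k (Val (fam_psh a (Dom p)) A) (Val (fam_psh a (Cod p)) A)"
      by (rule mod_hom_cong[OF nat_hom[OF c A] psh_module[OF fD A]]) (rule fmor_map_eq[OF A])
    show "fmor_map a p B (Res (fam_psh a (Dom p)) A B f x) = Res (fam_psh a (Cod p)) A B f (fmor_map a p A x)"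
      if "B \<in> Obj a" "f \<in> arr a B A" "x \<in> carrier (Val (fam_psh a (Dom p)) A)" for B f x
      unfolding fmor_map_eq[OF A that(3)] fmor_map_eq[OF that(1) Res_closed[OF fD A that]]
      by (rule nat_Res[OF c A that])
  qed
qed

lemma fmor_image_eq: "psh_image a (fam_psh a (Dom p)) (fmor_map a p) =
  psh_image a (psum (Ix (Dom p)) (\<lambda>\<gamma>. yoneda a (At (Dom p) \<gamma>)))
    (copair (Ix (Dom p)) (\<lambda>\<gamma>. yoneda a (At (Dom p) \<gamma>)) (fam_psh a (Cod p))
      (\<lambda>\<gamma> A f. Res (fam_psh a (Cod p)) (At (Dom p) \<gamma>) A f (Ent p \<gamma>)))"
  unfolding fun_eq_iff psh_image_def
  using fmor_map_eq by (auto simp: psh_all_mem fam_psh_def intro!: image_cong)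

lemma fmor_image_sub: "subfunctor k a (fam_psh a (Cod p)) (psh_image a (fam_psh a (Dom p)) (fmor_map a p))"
  unfolding psh_image_eq
  by (rule sub_img_sub[OF _ _ fmor_map_nat]) (intro fam_psh_presheaf fmor_family psh_all_sub)+

lemma fmor_image_le:
  assumes "subfunctor k a (fam_psh a (Cod p)) K" "\<And>\<gamma>. \<gamma> \<in> Ix (Dom p) \<Longrightarrow> Ent p \<gamma> \<in> K (At (Dom p) \<gamma>)"
  shows "psh_image a (fam_psh a (Dom p)) (fmor_map a p) \<le> K"
  unfolding fmor_image_eq
  by (rule rep_image_le[OF fam_psh_presheaf[OF fmor_family(2)] family_Obj[OF fmor_family(1)] formal_morphism_row[OF p] assms])

lemma fmor_image_mem:
  "\<gamma> \<in> Ix (Dom p) \<Longrightarrow> Ent p \<gamma> \<in> psh_image a (fam_psh a (Dom p)) (fmor_map a p) (At (Dom p) \<gamma>)"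
  unfolding fmor_image_eq
  by (rule rep_image_mem[OF fam_psh_presheaf[OF fmor_family(2)] family_Obj[OF fmor_family(1)] formal_morphism_row[OF p]])

end

lemma cone_kernel_sub:
  assumes "cone a q X" "family a (Dom q)"
  shows "subfunctor k a (fam_psh a (Dom q)) (psh_kernel a (fam_psh a (Dom q)) (yoneda a X) (cone_map a q))"
proof -
  have X: "X \<in> Obj a" using assms(1) by (simp add: cone_def)
  show ?thesis
    unfolding psh_kernel_eq
    by (rule preim_sub[OF fam_psh_presheaf[OF assms(2)] yoneda_presheaf[OF X] cone_map_nat[OF assms(1)]
          zero_sub_sub[OF yoneda_presheaf[OF X]]])
qed

subsection \<open>Composition of formal morphisms\<close>

text \<open>Both sides unfold to the same sum over the support of the row
  \<open>Ent f \<alpha>\<close>. This bridges formal composition and morphisms of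
  presheaves.\<close>

lemma fcomp_cone_Ent:
  assumes "Cod f = Dom q" "Cod q = one_fam X" "\<alpha> \<in> Ix (Dom f)"
  shows "Ent (fcomp a q f) \<alpha> () = cone_map a q (At (Dom f) \<alpha>) (Ent f \<alpha>)"
  using assms by (simp add: fcomp_def cone_map_def copair_def Ymap_def)

text \<open>A formal morphism is its family of rows, each an element of the direct sum at its
  source. A vanishing composite is thus a condition on single elements.\<close>

lemma fcomp_cone_zero_iff:
  assumes q: "cone a q X" and f: "formal_morphism a f" "Cod f = Dom q"
  shows "fcomp a q f = zero_fmor a (Dom f) (Cod q) \<longleftrightarrow>
    (\<forall>\<alpha>\<in>Ix (Dom f). Ent f \<alpha> \<in> psh_kernel a (fam_psh a (Dom q)) (yoneda a X) (cone_map a q) (At (Dom f) \<alpha>))"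
proof -
  have C: "Cod q = one_fam X" using q by (simp add: cone_def)
  have "fcomp a q f = zero_fmor a (Dom f) (Cod q) \<longleftrightarrow>
      (\<forall>\<alpha>\<in>Ix (Dom f). Ent (fcomp a q f) \<alpha> () = \<zero>\<^bsub>Hom a (At (Dom f) \<alpha>) X\<^esub>)"
    by (auto simp: fcomp_def zero_fmor_def C restrict_def fun_eq_iff)
  also have "\<dots> \<longleftrightarrow> (\<forall>\<alpha>\<in>Ix (Dom f). cone_map a q (At (Dom f) \<alpha>) (Ent f \<alpha>) = \<zero>\<^bsub>Hom a (At (Dom f) \<alpha>) X\<^esub>)"
    by (simp add: fcomp_cone_Ent[OF f(2) C])
  also have "\<dots> \<longleftrightarrow> (\<forall>\<alpha>\<in>Ix (Dom f). Ent f \<alpha> \<in> psh_kernel a (fam_psh a (Dom q)) (yoneda a X) (cone_map a q) (At (Dom f) \<alpha>))"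
    using formal_morphism_row[OF f(1)] family_Obj[OF fmor_family(1)[OF f(1)]]
    by (intro ball_cong) (auto simp: psh_kernel_def psh_all_mem f(2))
  finally show ?thesis .
qed

text \<open>\<open>fcomp\<close> sums over the support, which is empty when the only entry is zero.
  The value is then zero as well, so no case distinction is left.\<close>

lemma single_sum:
  assumes M: "module k M" and c: "h x \<in> carrier M" and z: "x = z \<Longrightarrow> h x = \<zero>\<^bsub>M\<^esub>"
  shows "(\<Oplus>\<^bsub>M\<^esub>u\<in>{u. u = () \<and> x \<noteq> z}. h x) = h x"
proof -
  interpret V: module k M by fact
  show ?thesis
  proof (cases "x = z")
    case False
    then have "{u. u = () \<and> x \<noteq> z} = {()}" by auto
    then show ?thesis using c by simp
  qed (use z in simp)
qed

lemma fcomp_obj_Ent: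
  assumes q': "cone a q' A" and X: "X \<in> Obj a" "f \<in> arr a A X" and \<alpha>: "\<alpha> \<in> Ix (Dom q')"
  shows "Ent (fcomp a (obj_fmor A X f) q') \<alpha> () = Cmp a (At (Dom q') \<alpha>) A X f (Ent q' \<alpha> ())"
proof -
  have A: "A \<in> Obj a" and B: "At (Dom q') \<alpha> \<in> Obj a" and e: "Ent q' \<alpha> () \<in> arr a (At (Dom q') \<alpha>) A"
    using q' \<alpha> by (auto simp: cone_def)
  note h = comp_linear_right[OF B A X]
  show ?thesis
    using \<alpha> single_sum[OF hom_module[OF B X(1)], of "\<lambda>g. Cmp a (At (Dom q') \<alpha>) A X f g" "Ent q' \<alpha> ()" "\<zero>\<^bsub>Hom a (At (Dom q') \<alpha>) A\<^esub>"]
      mod_hom_closed[OF h e] mod_hom_zero[OF h hom_module[OF B A] hom_module[OF B X(1)]]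
    by (simp add: fcomp_def obj_fmor_def)
qed

text \<open>A row of the lift \<open>f'\<close> is an element that \<open>cone_map\<close> sends to
  the prescribed composite. Such an element exists iff the composite lies in the image, which is the
  generated sieve. (PTa) thus becomes a condition on sieves.\<close>

lemma PTa_lift_iff:
  assumes q: "cone a q X" "family a (Dom q)" and q': "cone a q' A" "family a (Dom q')" and f: "f \<in> arr a A X"
  shows "(\<exists>f'. formal_morphism a f' \<and> Dom f' = Dom q' \<and> Cod f' = Dom q \<and>
      fcomp a q f' = fcomp a (obj_fmor A X f) q') \<longleftrightarrow>
    (\<forall>\<alpha>\<in>Ix (Dom q'). Cmp a (At (Dom q') \<alpha>) A X f (Ent q' \<alpha> ()) \<in> gen_sieve k a q (At (Dom q') \<alpha>))"
    (is "?L \<longleftrightarrow> ?R")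
proof -
  have X: "X \<in> Obj a" and C: "Cod q = one_fam X" using q by (auto simp: cone_def)
  note ent = fcomp_obj_Ent[OF q'(1) X f]
  show ?thesis
  proof
    assume ?L
    then obtain f' where f': "formal_morphism a f'" "Dom f' = Dom q'" "Cod f' = Dom q"
      and eq: "fcomp a q f' = fcomp a (obj_fmor A X f) q'" by blast
    show ?R
    proof
      fix \<alpha> assume \<alpha>: "\<alpha> \<in> Ix (Dom q')"
      have "Cmp a (At (Dom q') \<alpha>) A X f (Ent q' \<alpha> ()) = cone_map a q (At (Dom q') \<alpha>) (Ent f' \<alpha>)"
        using ent[OF \<alpha>] fcomp_cone_Ent[OF f'(3) C, of \<alpha>] \<alpha> f'(2) by (simp flip: eq)
      moreover have "Ent f' \<alpha> \<in> psh_all a (fam_psh a (Dom q)) (At (Dom q') \<alpha>)"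
        using formal_morphism_row[OF f'(1), of \<alpha>] family_Obj[OF q'(2) \<alpha>] \<alpha> f' by (simp add: psh_all_mem)
      ultimately show "Cmp a (At (Dom q') \<alpha>) A X f (Ent q' \<alpha> ()) \<in> gen_sieve k a q (At (Dom q') \<alpha>)"
        unfolding cone_image[OF q(1), symmetric] by (simp add: psh_image_def)
    qed
  next
    assume R: ?R
    \<comment> \<open>The rows of \<open>f'\<close> are chosen independently for each source of
      \<open>q'\<close>.\<close>
    define x where "x \<alpha> = (SOME x. x \<in> carrier (Val (fam_psh a (Dom q)) (At (Dom q') \<alpha>)) \<and>
      cone_map a q (At (Dom q') \<alpha>) x = Cmp a (At (Dom q') \<alpha>) A X f (Ent q' \<alpha> ()))" for \<alpha>
    have x: "x \<alpha> \<in> carrier (Val (fam_psh a (Dom q)) (At (Dom q') \<alpha>))"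
      "cone_map a q (At (Dom q') \<alpha>) (x \<alpha>) = Cmp a (At (Dom q') \<alpha>) A X f (Ent q' \<alpha> ())"
      if "\<alpha> \<in> Ix (Dom q')" for \<alpha>
    proof -
      have "\<exists>x. x \<in> carrier (Val (fam_psh a (Dom q)) (At (Dom q') \<alpha>)) \<and>
          cone_map a q (At (Dom q') \<alpha>) x = Cmp a (At (Dom q') \<alpha>) A X f (Ent q' \<alpha> ())"
        using R that unfolding cone_image[OF q(1), symmetric] by (fastforce simp: psh_image_def psh_all_mem)
      from someI_ex[OF this]
      show "x \<alpha> \<in> carrier (Val (fam_psh a (Dom q)) (At (Dom q') \<alpha>))"
        "cone_map a q (At (Dom q') \<alpha>) (x \<alpha>) = Cmp a (At (Dom q') \<alpha>) A X f (Ent q' \<alpha> ())"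
        by (simp_all add: x_def)
    qed
    let ?f = "\<lparr>Dom = Dom q', Cod = Dom q, Ent = (\<lambda>\<alpha>\<in>Ix (Dom q'). x \<alpha>)\<rparr>"
    have fm: "formal_morphism a ?f"
      using x(1) q'(2) q(2) by (auto simp: formal_morphism_def Val_fam_psh)
    moreover have "fcomp a q ?f = fcomp a (obj_fmor A X f) q'"
    proof -
      have "Ent (fcomp a q ?f) \<alpha> () = Ent (fcomp a (obj_fmor A X f) q') \<alpha> ()" if "\<alpha> \<in> Ix (Dom q')" for \<alpha>
        using ent[OF that] fcomp_cone_Ent[of ?f q X \<alpha>, OF _ C] x(2)[OF that] that by simp
      then have "Ent (fcomp a q ?f) = Ent (fcomp a (obj_fmor A X f) q')"
        by (simp add: fcomp_def C obj_fmor_def fun_eq_iff restrict_def)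
      then show ?thesis by (simp add: fcomp_def C obj_fmor_def)
    qed
    ultimately show ?L by (intro exI[of _ ?f]) simp
  qed
qed

text \<open>As for (PTa), the rows of the lift are chosen one by one, here as preimages under
  \<open>fmor_map a p\<close> of the restrictions of \<open>f\<close>.\<close>

lemma PTb_lift:
  assumes p: "formal_morphism a p" and f: "formal_morphism a f" "Dom f = one_fam A" "Cod f = Cod p" and A: "A \<in> Obj a"
    and q': "cone a q' A" "family a (Dom q')"
    and R: "\<And>\<alpha>. \<alpha> \<in> Ix (Dom q') \<Longrightarrow> Res (fam_psh a (Cod p)) A (At (Dom q') \<alpha>) (Ent q' \<alpha> ()) (Ent f ())
      \<in> psh_image a (fam_psh a (Dom p)) (fmor_map a p) (At (Dom q') \<alpha>)"
  shows "\<exists>f'. formal_morphism a f' \<and> Dom f' = Dom q' \<and> Cod f' = Dom p \<and> fcomp a p f' = fcomp a f q'"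
proof -
  define x where "x \<alpha> = (SOME x. x \<in> carrier (Val (fam_psh a (Dom p)) (At (Dom q') \<alpha>)) \<and>
    fmor_map a p (At (Dom q') \<alpha>) x = Res (fam_psh a (Cod p)) A (At (Dom q') \<alpha>) (Ent q' \<alpha> ()) (Ent f ()))" for \<alpha>
  have x: "x \<alpha> \<in> carrier (Val (fam_psh a (Dom p)) (At (Dom q') \<alpha>))"
    "fmor_map a p (At (Dom q') \<alpha>) (x \<alpha>) = Res (fam_psh a (Cod p)) A (At (Dom q') \<alpha>) (Ent q' \<alpha> ()) (Ent f ())"
    if "\<alpha> \<in> Ix (Dom q')" for \<alpha>
  proof -
    have "\<exists>x. x \<in> carrier (Val (fam_psh a (Dom p)) (At (Dom q') \<alpha>)) \<and>
        fmor_map a p (At (Dom q') \<alpha>) x = Res (fam_psh a (Cod p)) A (At (Dom q') \<alpha>) (Ent q' \<alpha> ()) (Ent f ())"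
      using R[OF that] by (fastforce simp: psh_image_def psh_all_mem)
    from someI_ex[OF this]
    show "x \<alpha> \<in> carrier (Val (fam_psh a (Dom p)) (At (Dom q') \<alpha>))"
      "fmor_map a p (At (Dom q') \<alpha>) (x \<alpha>) = Res (fam_psh a (Cod p)) A (At (Dom q') \<alpha>) (Ent q' \<alpha> ()) (Ent f ())"
      by (simp_all add: x_def)
  qed
  let ?f = "\<lparr>Dom = Dom q', Cod = Dom p, Ent = (\<lambda>\<alpha>\<in>Ix (Dom q'). x \<alpha>)\<rparr>"
  have fm: "formal_morphism a ?f"
    using x(1) q'(2) fmor_family[OF p] by (auto simp: formal_morphism_def Val_fam_psh)
  have Cq: "Cod q' = one_fam A" using q' by (simp add: cone_def)
  have "Ent (fcomp a p ?f) \<alpha> \<beta> = Ent (fcomp a f q') \<alpha> \<beta>" if \<alpha>: "\<alpha> \<in> Ix (Dom q')" and \<beta>: "\<beta> \<in> Ix (Cod p)" for \<alpha> \<beta>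
  proof -
    have B: "At (Dom q') \<alpha> \<in> Obj a" and e: "Ent q' \<alpha> () \<in> arr a (At (Dom q') \<alpha>) A"
      using q'(1) \<alpha> by (auto simp: cone_def)
    have Y: "At (Cod p) \<beta> \<in> Obj a" using family_Obj[OF fmor_family(2)[OF p] \<beta>] .
    have fe: "Ent f () \<beta> \<in> arr a A (At (Cod p) \<beta>)"
      using formal_morphism_row[OF f(1), of "()"] f \<beta> by (simp add: Val_fam_psh dsum_carrier)
    note h = comp_linear_right[OF B A Y fe]
    have "Ent (fcomp a p ?f) \<alpha> \<beta> = fmor_map a p (At (Dom q') \<alpha>) (x \<alpha>) \<beta>"
      using \<alpha> \<beta> by (simp add: fcomp_def fmor_map_def matrix_map_def copair_def Ymap_def)
    also have "\<dots> = Cmp a (At (Dom q') \<alpha>) A (At (Cod p) \<beta>) (Ent f () \<beta>) (Ent q' \<alpha> ())"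
      using x(2)[OF \<alpha>] \<beta> by (simp add: Res_fam_psh)
    also have "\<dots> = Ent (fcomp a f q') \<alpha> \<beta>"
      using \<alpha> \<beta> single_sum[OF hom_module[OF B Y], of "\<lambda>g. Cmp a (At (Dom q') \<alpha>) A (At (Cod p) \<beta>) (Ent f () \<beta>) g" "Ent q' \<alpha> ()" "\<zero>\<^bsub>Hom a (At (Dom q') \<alpha>) A\<^esub>"]
        mod_hom_closed[OF h e] mod_hom_zero[OF h hom_module[OF B A] hom_module[OF B Y]]
      by (simp add: fcomp_def f)
    finally show ?thesis .
  qed
  then have "Ent (fcomp a p ?f) = Ent (fcomp a f q')"
    by (auto simp: fcomp_def f fun_eq_iff restrict_def)
  then have "fcomp a p ?f = fcomp a f q'" by (simp add: fcomp_def f)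
  then show ?thesis using fm by (intro exI[of _ ?f]) simp
qed

lemma sequenceE:
  assumes "sequence a (p, q)"
  obtains X where "formal_morphism a p" "formal_morphism a q" "Cod p = Dom q" "X \<in> Obj a" "Cod q = one_fam X"
    "cone a q X" "family a (Dom q)"
    "psh_image a (fam_psh a (Dom p)) (fmor_map a p) \<le> psh_kernel a (fam_psh a (Dom q)) (yoneda a X) (cone_map a q)"
proof -
  from assms obtain X where s: "formal_morphism a p" "formal_morphism a q" "Cod p = Dom q" "X \<in> Obj a" "Cod q = one_fam X"
    and z: "fcomp a q p = zero_fmor a (Dom p) (Cod q)" by (auto simp: sequence_def)
  note c = formal_morphism_cone[OF s(2,5,4)] and fd = fmor_family(1)[OF s(2)]
  have "psh_image a (fam_psh a (Dom p)) (fmor_map a p) \<le> psh_kernel a (fam_psh a (Dom q)) (yoneda a X) (cone_map a q)"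
    by (rule fmor_image_le[OF s(1)])
      (use z cone_kernel_sub[OF c fd] fcomp_cone_zero_iff[OF c s(1,3)] s(3) in auto)
  then show ?thesis using that s c fd by blast
qed

end


section \<open>The pretopologies of a topology\<close>

abbreviation sheafify_unit_map :: "'k ring \<Rightarrow> ('k, 'o, 'm) lincat \<Rightarrow> ('o, 'm) cov \<Rightarrow> ('k, 'o, 'm, 'v) psh
    \<Rightarrow> 'o \<Rightarrow> 'v \<Rightarrow> ('o, 'm, 'v) shv" where
  "sheafify_unit_map k a T F \<equiv> \<lambda>A x. plus_unit k a T (plus k a T F) A (plus_unit k a T F A x)"

lemma matrix_map_nat:
  assumes k: "cring k" and F: "\<And>i. i \<in> I \<Longrightarrow> presheaf k a (F i)" and G: "\<And>j. j \<in> J \<Longrightarrow> presheaf k a (G j)"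
    and n: "\<And>i j. \<lbrakk>i \<in> I; j \<in> J\<rbrakk> \<Longrightarrow> nat_trans k a (F i) (G j) (\<Phi> i j)"
    and fin: "\<And>i A y. \<lbrakk>i \<in> I; A \<in> Obj a; y \<in> carrier (Val (F i) A)\<rbrakk> \<Longrightarrow> finite {j \<in> J. \<Phi> i j A y \<noteq> \<zero>\<^bsub>Val (G j) A\<^esub>}"
  shows "nat_trans k a (psum I F) (psum J G) (matrix_map I F J G \<Phi>)"
proof -
  let ?c = "copair I F (psum J G) (\<lambda>i A y. \<lambda>j\<in>J. \<Phi> i j A y)"
  have P: "presheaf k a (psum I F)" by (rule psum_presheaf[OF k F])
  have Q: "presheaf k a (psum J G)" by (rule psum_presheaf[OF k G])
  have rn: "nat_trans k a (F i) (psum J G) (\<lambda>A y. \<lambda>j\<in>J. \<Phi> i j A y)" if "i \<in> I" for i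
    by (rule row_nat) (use n fin that in auto)
  have c: "nat_trans k a (psum I F) (psum J G) ?c" by (rule copair_nat[OF k Q F rn])
  have eq: "matrix_map I F J G \<Phi> A x = ?c A x" if "A \<in> Obj a" "x \<in> carrier (Val (psum I F) A)" for A x
    by (rule matrix_map_eq_copair[OF k F G n fin that])
  show ?thesis
  proof (rule nat_transI)
    fix A assume A: "A \<in> Obj a"
    show "matrix_map I F J G \<Phi> A \<in> mod_hom k (Val (psum I F) A) (Val (psum J G) A)"
      by (rule mod_hom_cong[OF nat_hom[OF c A] psh_module[OF P A]]) (rule eq[OF A])
    show "matrix_map I F J G \<Phi> B (Res (psum I F) A B f x) = Res (psum J G) A B f (matrix_map I F J G \<Phi> A x)"
      if "B \<in> Obj a" "f \<in> arr a B A" "x \<in> carrier (Val (psum I F) A)" for B f x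
      unfolding eq[OF A that(3)] eq[OF that(1) Res_closed[OF P A that]]
      by (rule nat_Res[OF c A that])
  qed
qed

context linear_site
begin

text \<open>The locus of an arrow for the generated sieve is the pullback of that sieve. (T2) gives
  one direction; the other is the case of the identity, whose pullback is the sieve itself.\<close>

lemma gen_sieve_T_iff:
  assumes q: "cone a q X"
  shows "gen_sieve k a q \<in> T X \<longleftrightarrow>
    psh_all a (yoneda a X) \<le> local_closure a T (yoneda a X) (gen_sieve k a q)"
proof
  have X: "X \<in> Obj a" using q by (simp add: cone_def)
  note R = gen_sieve_sieve[OF q]
  show "psh_all a (yoneda a X) \<le> local_closure a T (yoneda a X) (gen_sieve k a q)" if "gen_sieve k a q \<in> T X"
  proof (intro le_funI subsetI)
    fix A f assume f: "f \<in> psh_all a (yoneda a X) A"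
    then have "pull a X (gen_sieve k a q) A f \<in> T A" using T_pull[OF X _ that, of A f] by (simp add: psh_all_mem)
    with f show "f \<in> local_closure a T (yoneda a X) (gen_sieve k a q) A"
      by (simp add: local_closure_def pull_eq_locus)
  qed
  show "gen_sieve k a q \<in> T X" if le: "psh_all a (yoneda a X) \<le> local_closure a T (yoneda a X) (gen_sieve k a q)"
  proof -
    have "Idt a X \<in> psh_all a (yoneda a X) X" using id_closed[OF X] X by (simp add: psh_all_mem)
    from subD[OF le this] have "pull a X (gen_sieve k a q) X (Idt a X) \<in> T X"
      by (simp add: local_closure_def pull_eq_locus)
    then show ?thesis using pull_id[OF X R] by simp
  qed
qed

section \<open>Sheafified representables and the two classes of sequences\<close>

lemma Zobj_presheaf: "A \<in> Obj a \<Longrightarrow> presheaf k a (Zobj k a T A)"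
  unfolding Zobj_def by (intro sheaf_presheaf sheafify_sheaf yoneda_presheaf)

lemma Ymap_nat: "\<lbrakk>A \<in> Obj a; B \<in> Obj a; f \<in> arr a A B\<rbrakk> \<Longrightarrow> nat_trans k a (yoneda a A) (yoneda a B) (Ymap a A B f)"
  using yoneda_nat[OF yoneda_presheaf[of B], of A f] by (simp add: Ymap_def)

lemma Zmap_nat: "\<lbrakk>A \<in> Obj a; B \<in> Obj a; f \<in> arr a A B\<rbrakk> \<Longrightarrow> nat_trans k a (Zobj k a T A) (Zobj k a T B) (Zmap k a T A B f)"
  unfolding Zobj_def Zmap_def by (intro sheafify_map_nat yoneda_presheaf Ymap_nat)

lemma Zunit: "A \<in> Obj a \<Longrightarrow> local_iso k a T (yoneda a A) (Zobj k a T A) (sheafify_unit_map k a T (yoneda a A))"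
  unfolding Zobj_def by (intro sheafify_unit yoneda_presheaf)

lemma Zmap_unit:
  assumes "A \<in> Obj a" "B \<in> Obj a" "f \<in> arr a A B" "C \<in> Obj a" "g \<in> arr a C A"
  shows "Zmap k a T A B f C (sheafify_unit_map k a T (yoneda a A) C g) =
    sheafify_unit_map k a T (yoneda a B) C (Cmp a C A B f g)"
  unfolding Zmap_def
  using sheafify_map_unit[OF yoneda_presheaf[OF assms(1)] yoneda_presheaf[OF assms(2)] Ymap_nat[OF assms(1-3)] assms(4), of g] assms(5)
  by (simp add: Ymap_def)

text \<open>The map vanishes on the image of the unit, and its target is separated. This makes the
  rows of a matrix of \<open>Zmap\<close>s finite.\<close>

lemma Zmap_zero:
  assumes "A \<in> Obj a" "B \<in> Obj a" "C \<in> Obj a" "z \<in> carrier (Val (Zobj k a T A) C)"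
  shows "Zmap k a T A B \<zero>\<^bsub>Hom a A B\<^esub> C z = \<zero>\<^bsub>Val (Zobj k a T B) C\<^esub>"
proof (rule nat_zero_of_local_iso[OF Zunit[OF assms(1)] Zobj_presheaf[OF assms(2)] _ _ _ assms(3,4)])
  have zc: "\<zero>\<^bsub>Hom a A B\<^esub> \<in> arr a A B"
    using sieve_zero[OF assms(2) max_sieve_sieve[OF assms(2)] assms(1)] by (simp add: max_sieve_mem)
  show "separated a T (Zobj k a T B)"
    unfolding Zobj_def by (intro sheaf_separated sheafify_sheaf yoneda_presheaf assms)
  show "nat_trans k a (Zobj k a T A) (Zobj k a T B) (Zmap k a T A B \<zero>\<^bsub>Hom a A B\<^esub>)"
    by (rule Zmap_nat[OF assms(1,2) zc])
  fix C g assume C: "C \<in> Obj a" and "g \<in> carrier (Val (yoneda a A) C)"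
  then have g: "g \<in> arr a C A" by simp
  note u = Zunit[OF assms(2), unfolded local_iso_def]
  have "Cmp a C A B \<zero>\<^bsub>Hom a A B\<^esub> g = \<zero>\<^bsub>Hom a C B\<^esub>"
    by (rule mod_hom_zero[OF comp_linear_left[OF C assms(1,2) g] hom_module[OF assms(1,2)] hom_module[OF C assms(2)]])
  moreover have "sheafify_unit_map k a T (yoneda a B) C \<zero>\<^bsub>Hom a C B\<^esub> = \<zero>\<^bsub>Val (Zobj k a T B) C\<^esub>"
    using mod_hom_zero[OF nat_hom[OF u[THEN conjunct2, THEN conjunct2, THEN conjunct1] C] hom_module[OF C assms(2), folded yoneda_sel(1)[of a B C]]
        psh_module[OF Zobj_presheaf[OF assms(2)] C]] by simp
  ultimately show "Zmap k a T A B \<zero>\<^bsub>Hom a A B\<^esub> C (sheafify_unit_map k a T (yoneda a A) C g) = \<zero>\<^bsub>Val (Zobj k a T B) C\<^esub>"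
    using Zmap_unit[OF assms(1,2) zc C g] by simp
qed

lemma pre'_of_iff:
  "(p, q) \<in> pre'_of a T \<longleftrightarrow> sequence a (p, q) \<and>
    psh_image a (fam_psh a (Dom p)) (fmor_map a p) = psh_kernel a (fam_psh a (Dom q)) (yoneda a (At (Cod q) ())) (cone_map a q) \<and>
    gen_sieve k a q \<in> T (At (Cod q) ())"
proof (cases "sequence a (p, q)")
  case True
  then obtain X where "Cod p = Dom q" "Cod q = one_fam X" and c: "cone a q X"
    by (elim sequenceE) blast
  with True show ?thesis
    unfolding cone_image[OF c, symmetric]
    by (simp add: pre'_of_def Let_def fam_psh_def fmor_map_def cone_map_def)
qed (simp add: pre'_of_def)

text \<open>The units of the representables, summed in the first two terms and followed by the unit
  of the outer sheafification, are local isomorphisms onto the sheaves in the definition. They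
  commute with the arrows of both sequences, so \<open>sh_right_exact_iff\<close> brings exactness
  down to presheaves.\<close>

lemma pre_of_iff:
  "(p, q) \<in> pre_of k a T \<longleftrightarrow> sequence a (p, q) \<and>
    psh_kernel a (fam_psh a (Dom q)) (yoneda a (At (Cod q) ())) (cone_map a q) \<le>
      local_closure a T (fam_psh a (Dom q)) (psh_image a (fam_psh a (Dom p)) (fmor_map a p)) \<and>
    gen_sieve k a q \<in> T (At (Cod q) ())"
proof (cases "sequence a (p, q)")
  case True
  then obtain X where p: "formal_morphism a p" and q: "formal_morphism a q" and pq: "Cod p = Dom q"
    and X: "X \<in> Obj a" "Cod q = one_fam X" and c: "cone a q X" and fD: "family a (Dom q)"
    and z: "psh_image a (fam_psh a (Dom p)) (fmor_map a p) \<le> psh_kernel a (fam_psh a (Dom q)) (yoneda a X) (cone_map a q)"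
    by (elim sequenceE) blast
  define I J Z Y where "I = Ix (Dom p)" and "J = Ix (Dom q)" and "Z = At (Dom p)" and "Y = At (Dom q)"
  note defs = I_def J_def Z_def Y_def
  have ZO: "Z \<gamma> \<in> Obj a" if "\<gamma> \<in> I" for \<gamma>
    using family_Obj[OF fmor_family(1)[OF p]] that by (simp add: defs)
  have YO: "Y \<beta> \<in> Obj a" if "\<beta> \<in> J" for \<beta> using family_Obj[OF fD] that by (simp add: defs)
  have pe: "Ent p \<gamma> \<beta> \<in> arr a (Z \<gamma>) (Y \<beta>)" if "\<gamma> \<in> I" "\<beta> \<in> J" for \<gamma> \<beta>
    using formal_morphism_row[OF p, of \<gamma>] that by (simp add: Val_fam_psh dsum_carrier pq defs)
  have pf: "finite {\<beta> \<in> J. Ent p \<gamma> \<beta> \<noteq> \<zero>\<^bsub>Hom a (Z \<gamma>) (Y \<beta>)\<^esub>}" if "\<gamma> \<in> I" for \<gamma>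
    using formal_morphism_row[OF p, of \<gamma>] that by (simp add: Val_fam_psh dsum_carrier pq defs)
  have qe: "Ent q \<beta> () \<in> arr a (Y \<beta>) X" if "\<beta> \<in> J" for \<beta> using c that by (simp add: cone_def defs)
  let ?ZF = "psum I (\<lambda>\<gamma>. Zobj k a T (Z \<gamma>))" and ?ZG = "psum J (\<lambda>\<beta>. Zobj k a T (Y \<beta>))"
  let ?\<Phi> = "\<lambda>\<gamma> \<beta>. Zmap k a T (Z \<gamma>) (Y \<beta>) (Ent p \<gamma> \<beta>)"
  let ?f = "matrix_map I (\<lambda>\<gamma>. Zobj k a T (Z \<gamma>)) J (\<lambda>\<beta>. Zobj k a T (Y \<beta>)) ?\<Phi>"
  let ?g = "copair J (\<lambda>\<beta>. Zobj k a T (Y \<beta>)) (Zobj k a T X) (\<lambda>\<beta>. Zmap k a T (Y \<beta>) X (Ent q \<beta> ()))"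
  let ?y = "\<lambda>A. sheafify_unit_map k a T (yoneda a A)"
  have pZF: "presheaf k a ?ZF" by (rule psum_presheaf[OF cring_axioms Zobj_presheaf[OF ZO]])
  have pZG: "presheaf k a ?ZG" by (rule psum_presheaf[OF cring_axioms Zobj_presheaf[OF YO]])
  have yn: "nat_trans k a (yoneda a A) (Zobj k a T A) (?y A)" if "A \<in> Obj a" for A
    using Zunit[OF that] by (simp add: local_iso_def)
  have \<Phi>n: "nat_trans k a (Zobj k a T (Z \<gamma>)) (Zobj k a T (Y \<beta>)) (?\<Phi> \<gamma> \<beta>)" if "\<gamma> \<in> I" "\<beta> \<in> J" for \<gamma> \<beta>
    by (rule Zmap_nat[OF ZO[OF that(1)] YO[OF that(2)] pe[OF that]])
  \<comment> \<open>Zero entries of \<open>p\<close> act as zero by \<open>Zmap_zero\<close>, so the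
    finite row supports of \<open>p\<close> bound those of the matrix of sheaf morphisms.\<close>
  have fn: "nat_trans k a ?ZF ?ZG ?f"
  proof (rule matrix_map_nat[OF cring_axioms Zobj_presheaf[OF ZO] Zobj_presheaf[OF YO] \<Phi>n])
    fix \<gamma> A y assume g: "\<gamma> \<in> I" and A: "A \<in> Obj a" and y: "y \<in> carrier (Val (Zobj k a T (Z \<gamma>)) A)"
    show "finite {\<beta> \<in> J. ?\<Phi> \<gamma> \<beta> A y \<noteq> \<zero>\<^bsub>Val (Zobj k a T (Y \<beta>)) A\<^esub>}"
      by (rule finite_subset[OF _ pf[OF g]]) (use Zmap_zero[OF ZO[OF g] YO A y] in auto)
  qed
  have gn: "nat_trans k a ?ZG (Zobj k a T X) ?g"
    by (rule copair_nat[OF cring_axioms Zobj_presheaf[OF X(1)] Zobj_presheaf[OF YO] Zmap_nat[OF YO X(1) qe]])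
  let ?u = "\<lambda>A x. sheafify_unit_map k a T ?ZF A (\<lambda>\<gamma>\<in>I. ?y (Z \<gamma>) A (x \<gamma>))"
  let ?v = "\<lambda>A x. sheafify_unit_map k a T ?ZG A (\<lambda>\<beta>\<in>J. ?y (Y \<beta>) A (x \<beta>))"
  let ?w = "\<lambda>A x. sheafify_unit_map k a T (Zobj k a T X) A (?y X A x)"
  have pd: "fam_psh a (Dom p) = psum I (\<lambda>\<gamma>. yoneda a (Z \<gamma>))" and qd: "fam_psh a (Dom q) = psum J (\<lambda>\<beta>. yoneda a (Y \<beta>))"
    by (simp_all add: fam_psh_def defs)
  have u0: "local_iso k a T (fam_psh a (Dom p)) ?ZF (\<lambda>A x. \<lambda>\<gamma>\<in>I. ?y (Z \<gamma>) A (x \<gamma>))"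
    unfolding pd by (rule psum_local_iso[OF Zunit[OF ZO]])
  have v0: "local_iso k a T (fam_psh a (Dom q)) ?ZG (\<lambda>A x. \<lambda>\<beta>\<in>J. ?y (Y \<beta>) A (x \<beta>))"
    unfolding qd by (rule psum_local_iso[OF Zunit[OF YO]])
  have u: "local_iso k a T (fam_psh a (Dom p)) (sheafify k a T ?ZF) ?u"
    by (rule local_iso_comp[OF u0 sheafify_unit[OF pZF]])
  have v: "local_iso k a T (fam_psh a (Dom q)) (sheafify k a T ?ZG) ?v"
    by (rule local_iso_comp[OF v0 sheafify_unit[OF pZG]])
  have w: "local_iso k a T (yoneda a X) (sheafify k a T (Zobj k a T X)) ?w"
    by (rule local_iso_comp[OF Zunit[OF X(1)] sheafify_unit[OF Zobj_presheaf[OF X(1)]]])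
  have sf: "sheafify_map k a T ?ZG ?f A (?u A x) = ?v A (fmor_map a p A x)"
    if A: "A \<in> Obj a" and x: "x \<in> carrier (Val (fam_psh a (Dom p)) A)" for A x
  proof -
    have ux: "(\<lambda>\<gamma>\<in>I. ?y (Z \<gamma>) A (x \<gamma>)) \<in> carrier (Val ?ZF A)"
      using u0 nat_closed[OF _ A x] unfolding local_iso_def by blast
    have "copair I (\<lambda>\<gamma>. Zobj k a T (Z \<gamma>)) (Zobj k a T (Y \<beta>)) (\<lambda>\<gamma>. ?\<Phi> \<gamma> \<beta>) A (\<lambda>\<gamma>\<in>I. ?y (Z \<gamma>) A (x \<gamma>)) =
        ?y (Y \<beta>) A (copair I (\<lambda>\<gamma>. yoneda a (Z \<gamma>)) (yoneda a (Y \<beta>)) (\<lambda>\<gamma>. Ymap a (Z \<gamma>) (Y \<beta>) (Ent p \<gamma> \<beta>)) A x)"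
      if b: "\<beta> \<in> J" for \<beta>
    proof (rule copair_square[OF yoneda_presheaf[OF ZO] Zobj_presheaf[OF ZO] yoneda_presheaf[OF YO[OF b]]
          Zobj_presheaf[OF YO[OF b]] yn[OF ZO] yn[OF YO[OF b]] Ymap_nat[OF ZO YO[OF b] pe[OF _ b]] \<Phi>n[OF _ b] _ A])
      show "x \<in> carrier (Val (psum I (\<lambda>\<gamma>. yoneda a (Z \<gamma>))) A)" using x by (simp add: pd)
      show "?\<Phi> \<gamma> \<beta> A (?y (Z \<gamma>) A y) = ?y (Y \<beta>) A (Ymap a (Z \<gamma>) (Y \<beta>) (Ent p \<gamma> \<beta>) A y)"
        if "\<gamma> \<in> I" "y \<in> carrier (Val (yoneda a (Z \<gamma>)) A)" for \<gamma> y
        using Zmap_unit[OF ZO[OF that(1)] YO[OF b] pe[OF that(1) b] A, of y] that(2) by (simp add: Ymap_def)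
    qed
    then have e: "?f A (\<lambda>\<gamma>\<in>I. ?y (Z \<gamma>) A (x \<gamma>)) = (\<lambda>\<beta>\<in>J. ?y (Y \<beta>) A (fmor_map a p A x \<beta>))"
      by (auto simp: matrix_map_def fmor_map_def pq defs intro!: restrict_ext)
    show ?thesis unfolding sheafify_map_unit[OF pZF pZG fn A ux] e ..
  qed
  have sg: "sheafify_map k a T (Zobj k a T X) ?g A (?v A x) = ?w A (cone_map a q A x)"
    if A: "A \<in> Obj a" and x: "x \<in> carrier (Val (fam_psh a (Dom q)) A)" for A x
  proof -
    have vx: "(\<lambda>\<beta>\<in>J. ?y (Y \<beta>) A (x \<beta>)) \<in> carrier (Val ?ZG A)"
      using v0 nat_closed[OF _ A x] unfolding local_iso_def by blast
    have "?g A (\<lambda>\<beta>\<in>J. ?y (Y \<beta>) A (x \<beta>)) =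
        ?y X A (copair J (\<lambda>\<beta>. yoneda a (Y \<beta>)) (yoneda a X) (\<lambda>\<beta>. Ymap a (Y \<beta>) X (Ent q \<beta> ())) A x)"
    proof (rule copair_square[OF yoneda_presheaf[OF YO] Zobj_presheaf[OF YO] yoneda_presheaf[OF X(1)]
          Zobj_presheaf[OF X(1)] yn[OF YO] yn[OF X(1)] Ymap_nat[OF YO X(1) qe] Zmap_nat[OF YO X(1) qe] _ A])
      show "x \<in> carrier (Val (psum J (\<lambda>\<beta>. yoneda a (Y \<beta>))) A)" using x by (simp add: qd)
      show "Zmap k a T (Y \<beta>) X (Ent q \<beta> ()) A (?y (Y \<beta>) A y) = ?y X A (Ymap a (Y \<beta>) X (Ent q \<beta> ()) A y)"
        if "\<beta> \<in> J" "y \<in> carrier (Val (yoneda a (Y \<beta>)) A)" for \<beta> y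
        using Zmap_unit[OF YO[OF that(1)] X(1) qe[OF that(1)] A, of y] that(2) by (simp add: Ymap_def)
    qed
    also have "copair J (\<lambda>\<beta>. yoneda a (Y \<beta>)) (yoneda a X) (\<lambda>\<beta>. Ymap a (Y \<beta>) X (Ent q \<beta> ())) A x = cone_map a q A x"
      by (simp add: cone_map_def X(2) defs)
    finally have e: "?g A (\<lambda>\<beta>\<in>J. ?y (Y \<beta>) A (x \<beta>)) = ?y X A (cone_map a q A x)" .
    show ?thesis unfolding sheafify_map_unit[OF pZG Zobj_presheaf[OF X(1)] gn A vx] e ..
  qed
  have "(p, q) \<in> pre_of k a T \<longleftrightarrow>
    sh_right_exact k a T (sheafify k a T ?ZF) (sheafify k a T ?ZG) (sheafify k a T (Zobj k a T X))
      (sheafify_map k a T ?ZG ?f) (sheafify_map k a T (Zobj k a T X) ?g)"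
    using True X(2) by (simp add: pre_of_def Let_def defs)
  also have "\<dots> \<longleftrightarrow>
    psh_kernel a (fam_psh a (Dom q)) (yoneda a X) (cone_map a q) \<le>
      local_closure a T (fam_psh a (Dom q)) (psh_image a (fam_psh a (Dom p)) (fmor_map a p)) \<and>
    psh_all a (yoneda a X) \<le> local_closure a T (yoneda a X) (psh_image a (fam_psh a (Dom q)) (cone_map a q))"
  proof (rule sh_right_exact_iff[OF u v w])
    show "sheaf k a T (sheafify k a T ?ZG)" by (rule sheafify_sheaf[OF pZG])
    show "sheaf k a T (sheafify k a T (Zobj k a T X))" by (rule sheafify_sheaf[OF Zobj_presheaf[OF X(1)]])
    show "nat_trans k a (fam_psh a (Dom p)) (fam_psh a (Dom q)) (fmor_map a p)"
      by (rule fmor_map_nat[OF p, unfolded pq])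
    show "nat_trans k a (fam_psh a (Dom q)) (yoneda a X) (cone_map a q)" by (rule cone_map_nat[OF c])
    show "nat_trans k a (sheafify k a T ?ZF) (sheafify k a T ?ZG) (sheafify_map k a T ?ZG ?f)"
      by (rule sheafify_map_nat[OF pZF pZG fn])
    show "nat_trans k a (sheafify k a T ?ZG) (sheafify k a T (Zobj k a T X)) (sheafify_map k a T (Zobj k a T X) ?g)"
      by (rule sheafify_map_nat[OF pZG Zobj_presheaf[OF X(1)] gn])
    show "sheafify_map k a T ?ZG ?f A (?u A x) = ?v A (fmor_map a p A x)"
      if "A \<in> Obj a" "x \<in> carrier (Val (fam_psh a (Dom p)) A)" for A x by (rule sf[OF that])
    show "sheafify_map k a T (Zobj k a T X) ?g A (?v A x) = ?w A (cone_map a q A x)"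
      if "A \<in> Obj a" "x \<in> carrier (Val (fam_psh a (Dom q)) A)" for A x by (rule sg[OF that])
  qed (rule z)
  finally show ?thesis
    using True X(2) gen_sieve_T_iff[OF c] cone_image[OF c] by simp
qed (simp add: pre_of_def)

text \<open>For a sequence exact in presheaves the kernel equals the image, hence lies in its
  closure.\<close>

lemma pre'_of_subset_pre_of: "pre'_of a T \<subseteq> pre_of k a T"
proof (clarify)
  fix p q assume pq: "(p, q) \<in> pre'_of a T"
  then have s: "sequence a (p, q)" by (simp add: pre'_of_iff)
  then obtain X where p: "formal_morphism a p" "formal_morphism a q" "Cod p = Dom q" by (elim sequenceE) blast
  have "psh_image a (fam_psh a (Dom p)) (fmor_map a p) \<le>
    local_closure a T (fam_psh a (Dom q)) (psh_image a (fam_psh a (Dom p)) (fmor_map a p))"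
    using closure_inc[OF fam_psh_presheaf[OF fmor_family(2)[OF p(1)]] fmor_image_sub[OF p(1)]] p(3) by simp
  then show "(p, q) \<in> pre_of k a T" using pq by (simp add: pre'_of_iff pre_of_iff)
qed

end


section \<open>Small generating families\<close>

text \<open>An infinite set is equipotent with its square, so an infinite index type can absorb
  pairs.\<close>

lemma lepoll_square:
  assumes "infinite (UNIV :: 'i set)" "A \<lesssim> (UNIV :: ('i \<times> 'i) set)"
  shows "A \<lesssim> (UNIV :: 'i set)"
proof -
  have "(UNIV :: ('i \<times> 'i) set) \<lesssim> (UNIV :: 'i set)"
    using Times_same_infinite_bij_betw_types[OF assms(1)] by (auto simp: lepoll_def bij_betw_def)
  then show ?thesis using assms(2) lepoll_trans by blast
qed

lemma lepoll_Sigma: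
  assumes "infinite (UNIV :: 'i set)" "A \<lesssim> (UNIV :: 'i set)" "\<And>x. x \<in> A \<Longrightarrow> B x \<lesssim> (UNIV :: 'i set)"
  shows "Sigma A B \<lesssim> (UNIV :: 'i set)"
proof -
  have "Sigma A B \<lesssim> A \<times> (UNIV :: 'i set)" by (rule Sigma_lepoll_mono) (use assms in auto)
  also have "A \<times> (UNIV :: 'i set) \<lesssim> (UNIV :: 'i set) \<times> (UNIV :: 'i set)"
    by (rule times_lepoll_mono[OF assms(2) lepoll_refl])
  finally show ?thesis by (intro lepoll_square[OF assms(1)]) simp
qed

text \<open>An element is coded by the finite set of pairs of an index and the code of the nonzero
  component there. An infinite set has as many finite subsets as elements.\<close>

lemma lepoll_dsum:
  assumes inf: "infinite (UNIV :: 'i set)" and M: "\<And>j. j \<in> (J :: 'i set) \<Longrightarrow> carrier (M j) \<lesssim> (UNIV :: 'i set)"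
  shows "carrier (dsum J M) \<lesssim> (UNIV :: 'i set)"
proof -
  have "\<forall>j\<in>J. \<exists>h :: _ \<Rightarrow> 'i. inj_on h (carrier (M j))" using M by (auto simp: lepoll_def)
  then obtain h :: "'i \<Rightarrow> _ \<Rightarrow> 'i" where h: "\<And>j. j \<in> J \<Longrightarrow> inj_on (h j) (carrier (M j))" by metis
  let ?g = "\<lambda>x. (\<lambda>j. (j, h j (x j))) ` {j \<in> J. x j \<noteq> \<zero>\<^bsub>M j\<^esub>}"
  have "inj_on ?g (carrier (dsum J M))"
  proof (rule inj_onI)
    fix x y assume x: "x \<in> carrier (dsum J M)" and y: "y \<in> carrier (dsum J M)" and e: "?g x = ?g y"
    have "x j = y j" if j: "j \<in> J" for j
    proof -
      have "(j, i) \<in> ?g x \<longleftrightarrow> x j \<noteq> \<zero>\<^bsub>M j\<^esub> \<and> i = h j (x j)" "(j, i) \<in> ?g y \<longleftrightarrow> y j \<noteq> \<zero>\<^bsub>M j\<^esub> \<and> i = h j (y j)" for i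
        using j by auto
      then have "(x j \<noteq> \<zero>\<^bsub>M j\<^esub> \<and> i = h j (x j)) \<longleftrightarrow> (y j \<noteq> \<zero>\<^bsub>M j\<^esub> \<and> i = h j (y j))" for i
        unfolding e by blast
      then have "(x j = \<zero>\<^bsub>M j\<^esub> \<and> y j = \<zero>\<^bsub>M j\<^esub>) \<or> h j (x j) = h j (y j)" by metis
      then show ?thesis using inj_onD[OF h[OF j]] x y j by (auto simp: dsum_carrier)
    qed
    then show "x = y" using x y by (auto simp: dsum_carrier intro!: extensionalityI[of _ J])
  qed
  moreover have "?g ` carrier (dsum J M) \<subseteq> Fpow UNIV" by (auto simp: Fpow_def dsum_carrier)
  ultimately have "carrier (dsum J M) \<lesssim> Fpow (UNIV :: ('i \<times> 'i) set)" unfolding lepoll_def by blast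
  also have "Fpow (UNIV :: ('i \<times> 'i) set) \<lesssim> (UNIV :: ('i \<times> 'i) set)"
    using eqpoll_Fpow[of "UNIV :: ('i \<times> 'i) set"] inf
    by (auto simp: finite_prod intro: eqpoll_imp_lepoll)
  finally show ?thesis by (rule lepoll_square[OF inf])
qed

context linear_category
begin

text \<open>The elements of \<open>H\<close> over a small set of representative objects are small in
  number. They generate, because every object is isomorphic to a representative.\<close>

lemma small_generators:
  fixes F :: "('k, 'o, 'm, 'v) psh"
  assumes inf: "infinite (UNIV :: 'i set)" and es: "essentially_small TYPE('i) a"
    and F: "presheaf k a F" and H: "subfunctor k a F H"
    and small: "\<And>B. B \<in> Obj a \<Longrightarrow> carrier (Val F B) \<lesssim> (UNIV :: 'i set)"
  shows "\<exists>(I :: 'i set) Y e. (\<forall>i\<in>I. Y i \<in> Obj a \<and> e i \<in> H (Y i)) \<and>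
    (\<forall>K. subfunctor k a F K \<and> (\<forall>i\<in>I. e i \<in> K (Y i)) \<longrightarrow> H \<le> K)"
proof -
  obtain Ob0 where O: "Ob0 \<subseteq> Obj a" "Ob0 \<lesssim> (UNIV :: 'i set)" "\<forall>A\<in>Obj a. \<exists>B\<in>Ob0. iso_obj a A B"
    using es unfolding essentially_small_def by blast
  let ?S = "Sigma Ob0 H"
  have HB: "H B \<lesssim> (UNIV :: 'i set)" if "B \<in> Ob0" for B
  proof -
    have B: "B \<in> Obj a" using that O(1) by blast
    have "H B \<subseteq> carrier (Val F B)" using sub_carrier[OF H F B] by blast
    then show ?thesis by (rule lepoll_trans[OF subset_imp_lepoll small[OF B]])
  qed
  have "?S \<lesssim> (UNIV :: 'i set)" by (rule lepoll_Sigma[OF inf O(2) HB])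
  then obtain h :: "_ \<Rightarrow> 'i" where h: "inj_on h ?S" unfolding lepoll_def by blast
  let ?Y = "\<lambda>i. fst (inv_into ?S h i)" and ?e = "\<lambda>i. snd (inv_into ?S h i)"
  have inv: "inv_into ?S h i \<in> ?S" if "i \<in> h ` ?S" for i by (rule inv_into_into[OF that])
  have "\<forall>i\<in>h ` ?S. ?Y i \<in> Obj a \<and> ?e i \<in> H (?Y i)"
    using inv O(1) by (metis (no_types, lifting) SigmaE2 prod.collapse subsetD)
  moreover have "H \<le> K" if K: "subfunctor k a F K" and eK: "\<forall>i\<in>h ` ?S. ?e i \<in> K (?Y i)" for K
  proof (intro le_funI subsetI)
    fix C y assume y: "y \<in> H C"
    note C = sub_ObjD[OF H y]
    obtain B where B0: "B \<in> Ob0" and iso: "iso_obj a C B" using O(3) C by blast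
    then obtain f g where f: "f \<in> arr a C B" and g: "g \<in> arr a B C" and gf: "Cmp a C B C g f = Idt a C"
      unfolding iso_obj_def by blast
    have B: "B \<in> Obj a" using B0 O(1) by blast
    \<comment> \<open>The element is moved to the representative \<open>B\<close>, where it is a
      generator, and back along \<open>f\<close>.\<close>
    have "Res F C B g y \<in> H B" by (rule sub_Res[OF H F C B g y])
    then have "(B, Res F C B g y) \<in> ?S" using B0 by simp
    then have "Res F C B g y \<in> K B"
      using eK inv_into_f_f[OF h] by fastforce
    then have "Res F B C f (Res F C B g y) \<in> K C" by (rule sub_Res[OF K F B C f])
    moreover have "Res F B C f (Res F C B g y) = y"
      using Res_comp[OF F C B C g f sub_carrier[OF H F C y]] Res_id[OF F C sub_carrier[OF H F C y]] gf by simp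
    ultimately show "y \<in> K C" by simp
  qed
  ultimately show ?thesis
    by (intro exI[of _ "h ` ?S"] exI[of _ ?Y] exI[of _ ?e]) blast
qed

lemma hom_small: "\<lbrakk>essentially_small TYPE('i) a; A \<in> Obj a; B \<in> Obj a\<rbrakk> \<Longrightarrow> arr a A B \<lesssim> (UNIV :: 'i set)"
  by (simp add: essentially_small_def)

lemma generating_cone:
  assumes inf: "infinite (UNIV :: 'i set)" and es: "essentially_small TYPE('i) a"
    and A: "A \<in> Obj a" and R: "sieve k a A R"
  shows "\<exists>q :: ('i, unit, 'o, 'm) fmor. formal_morphism a q \<and> Cod q = one_fam A \<and> gen_sieve k a q = R"
proof -
  note Y = yoneda_presheaf[OF A]
  have Rs: "subfunctor k a (yoneda a A) R" using R by (simp add: sieve_def)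
  have sm: "carrier (Val (yoneda a A) B) \<lesssim> (UNIV :: 'i set)" if "B \<in> Obj a" for B
    using hom_small[OF es that A] by simp
  obtain I :: "'i set" and Z e where g: "\<forall>i\<in>I. Z i \<in> Obj a \<and> e i \<in> R (Z i)"
    and le: "\<And>K. \<lbrakk>subfunctor k a (yoneda a A) K; \<forall>i\<in>I. e i \<in> K (Z i)\<rbrakk> \<Longrightarrow> R \<le> K"
    using small_generators[OF inf es Y Rs sm] by metis
  let ?q = "\<lparr>Dom = \<lparr>Ix = I, At = (\<lambda>i\<in>I. Z i)\<rparr>, Cod = one_fam A, Ent = (\<lambda>i\<in>I. \<lambda>_ :: unit. e i)\<rparr>"
  \<comment> \<open>Rows of \<open>q\<close> must be extensional on the single index of the target,
    which any function on \<open>unit\<close> is.\<close>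
  have "extensional {()} = (UNIV :: (unit \<Rightarrow> 'm) set)" by (auto simp: extensional_def)
  then have fm: "formal_morphism a ?q"
    using g A sieve_arr[OF A R] by (auto simp: formal_morphism_def family_def one_fam_def dsum_carrier)
  then have c: "cone a ?q A" by (rule formal_morphism_cone) (simp_all add: A)
  have "gen_sieve k a ?q = R"
  proof (rule antisym)
    show "gen_sieve k a ?q \<le> R" by (rule gen_sieve_least[OF c R]) (use g in auto)
    have "e i \<in> gen_sieve k a ?q (Z i)" if "i \<in> I" for i using gen_sieve_comp[OF c, of i] that by simp
    then show "R \<le> gen_sieve k a ?q"
      by (intro le) (use gen_sieve_sieve[OF c] in \<open>auto simp: sieve_def\<close>)
  qed
  then show ?thesis using fm by (intro exI[of _ ?q]) simp
qed

lemma generating_fmor: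
  fixes D :: "('i, 'o) fam"
  assumes inf: "infinite (UNIV :: 'i set)" and es: "essentially_small TYPE('i) a"
    and D: "family a D" and K: "subfunctor k a (fam_psh a D) K"
  shows "\<exists>p :: ('i, 'i, 'o, 'm) fmor. formal_morphism a p \<and> Cod p = D \<and>
    psh_image a (fam_psh a (Dom p)) (fmor_map a p) = K"
proof -
  note P = fam_psh_presheaf[OF D]
  have sm: "carrier (Val (fam_psh a D) B) \<lesssim> (UNIV :: 'i set)" if "B \<in> Obj a" for B
    unfolding Val_fam_psh by (rule lepoll_dsum[OF inf hom_small[OF es that family_Obj[OF D]]])
  obtain I :: "'i set" and Z e where g: "\<forall>i\<in>I. Z i \<in> Obj a \<and> e i \<in> K (Z i)"
    and le: "\<And>L. \<lbrakk>subfunctor k a (fam_psh a D) L; \<forall>i\<in>I. e i \<in> L (Z i)\<rbrakk> \<Longrightarrow> K \<le> L"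
    using small_generators[OF inf es P K sm] by metis
  let ?p = "\<lparr>Dom = \<lparr>Ix = I, At = (\<lambda>i\<in>I. Z i)\<rparr>, Cod = D, Ent = (\<lambda>i\<in>I. e i)\<rparr>"
  have "e i \<in> carrier (dsum (Ix D) (\<lambda>\<beta>. Hom a (Z i) (At D \<beta>)))" if "i \<in> I" for i
    using sub_carrier[OF K P, of "Z i" "e i"] g that by (simp add: Val_fam_psh)
  then have fm: "formal_morphism a ?p"
    using g D by (auto simp: formal_morphism_def family_def)
  have "psh_image a (fam_psh a (Dom ?p)) (fmor_map a ?p) = K"
  proof (rule antisym)
    show "psh_image a (fam_psh a (Dom ?p)) (fmor_map a ?p) \<le> K"
      by (rule fmor_image_le[OF fm]) (use g K in auto)
    have "e i \<in> psh_image a (fam_psh a (Dom ?p)) (fmor_map a ?p) (Z i)" if "i \<in> I" for i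
      using fmor_image_mem[OF fm, of i] that by simp
    then show "K \<le> psh_image a (fam_psh a (Dom ?p)) (fmor_map a ?p)"
      by (intro le) (use fmor_image_sub[OF fm] in auto)
  qed
  then show ?thesis using fm by (intro exI[of _ ?p]) simp
qed

end

text \<open>A presentation of \<open>R\<close>: \<open>q\<close> collects generators, and
  \<open>p\<close> generates the relations among them, so exactness holds already in
  presheaves.\<close>

lemma (in linear_site) generating_pre':
  assumes inf: "infinite (UNIV :: 'i set)" and es: "essentially_small TYPE('i) a" and R: "R \<in> T A"
  shows "\<exists>(p :: ('i, 'i, 'o, 'm) fmor) q. (p, q) \<in> pre'_of a T \<and> Cod q = one_fam A \<and> gen_sieve k a q = R"
proof -
  note A = T_Obj[OF R]
  obtain q :: "('i, unit, 'o, 'm) fmor" where q: "formal_morphism a q" "Cod q = one_fam A" "gen_sieve k a q = R"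
    using generating_cone[OF inf es A T_sieve[OF A R]] by blast
  note c = formal_morphism_cone[OF q(1,2) A] and D = fmor_family(1)[OF q(1)]
  note K = cone_kernel_sub[OF c D]
  obtain p :: "('i, 'i, 'o, 'm) fmor" where p: "formal_morphism a p" "Cod p = Dom q"
    and im: "psh_image a (fam_psh a (Dom p)) (fmor_map a p) = psh_kernel a (fam_psh a (Dom q)) (yoneda a A) (cone_map a q)"
    using generating_fmor[OF inf es D K] by blast
  have "Ent p \<gamma> \<in> psh_kernel a (fam_psh a (Dom q)) (yoneda a A) (cone_map a q) (At (Dom p) \<gamma>)" if "\<gamma> \<in> Ix (Dom p)" for \<gamma>
    using fmor_image_mem[OF p(1) that] im by simp
  then have "fcomp a q p = zero_fmor a (Dom p) (Cod q)"
    using fcomp_cone_zero_iff[OF c p(1,2)] by blast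
  then have "sequence a (p, q)" using p q A by (simp add: sequence_def)
  then show ?thesis using im q R by (intro exI[of _ p] exI[of _ q]) (simp add: pre'_of_iff)
qed


section \<open>Iterated coverings\<close>

lemma relabel_Cod [simp]: "Cod (relabel h v) = Cod v"
  by (simp add: relabel_def)

lemma
  assumes "inj h"
  shows relabel_Ix: "Ix (Dom (relabel h v)) = h ` Ix (Dom v)"
    and relabel_At: "\<alpha> \<in> Ix (Dom v) \<Longrightarrow> At (Dom (relabel h v)) (h \<alpha>) = At (Dom v) \<alpha>"
    and relabel_Ent: "\<alpha> \<in> Ix (Dom v) \<Longrightarrow> Ent (relabel h v) (h \<alpha>) = Ent v \<alpha>"
  using inv_into_f_f[OF inj_on_subset[OF assms subset_UNIV]] by (auto simp: relabel_def)

lemma relabel_cone: "\<lbrakk>inj h; cone a v X\<rbrakk> \<Longrightarrow> cone a (relabel h v) X"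
  by (auto simp: cone_def relabel_Ix relabel_At relabel_Ent)

text \<open>\<open>relabel\<close> restricts \<open>At\<close> to the new index set, which supplies
  the extensionality that \<open>cone\<close> does not ask for.\<close>

lemma relabel_family:
  assumes "inj h" "cone a v X"
  shows "family a (Dom (relabel h v))"
proof -
  have "At (Dom (relabel h v)) \<in> extensional (Ix (Dom (relabel h v)))" by (simp add: relabel_def)
  then show ?thesis
    using relabel_cone[OF assms] by (auto simp: family_def cone_def PiE_def)
qed

lemma
  shows fam_comp_Cod [simp]: "Cod (fam_comp a v w) = Cod v"
    and fam_comp_Ix: "Ix (Dom (fam_comp a v w)) = (SIGMA \<alpha>:Ix (Dom v). Ix (Dom (w \<alpha>)))"
    and fam_comp_At: "\<lbrakk>\<alpha> \<in> Ix (Dom v); \<delta> \<in> Ix (Dom (w \<alpha>))\<rbrakk> \<Longrightarrow> At (Dom (fam_comp a v w)) (\<alpha>, \<delta>) = At (Dom (w \<alpha>)) \<delta>"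
    and fam_comp_Ent: "\<lbrakk>\<alpha> \<in> Ix (Dom v); \<delta> \<in> Ix (Dom (w \<alpha>))\<rbrakk> \<Longrightarrow> Ent (fam_comp a v w) (\<alpha>, \<delta>) u =
      Cmp a (At (Dom (w \<alpha>)) \<delta>) (At (Dom v) \<alpha>) (At (Cod v) ()) (Ent v \<alpha> ()) (Ent (w \<alpha>) \<delta> ())"
  by (simp_all add: fam_comp_def Let_def)

lemma inj_Cons: "inj (\<lambda>(\<beta>, l). \<beta> # l)"
  and inj_snoc: "inj (\<lambda>(\<alpha>, \<delta>). \<alpha> @ [\<delta>])"
  and inj_singleton: "inj (\<lambda>\<beta>. [\<beta>])"
  and inj_unit: "inj (h :: unit \<Rightarrow> _)"
  by (auto simp: inj_on_def)

text \<open>For cones this means that \<open>R\<close> contains the generated sieve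
  (\<open>gen_sieve_le_cone_in\<close>). In this form it is easily followed through renaming and
  composition.\<close>

definition cone_in :: "('i, unit, 'o, 'm) fmor \<Rightarrow> ('o, 'm) sieve \<Rightarrow> bool" where
  "cone_in v R \<longleftrightarrow> (\<forall>\<alpha>\<in>Ix (Dom v). Ent v \<alpha> () \<in> R (At (Dom v) \<alpha>))"

lemma cone_in_relabel: "inj h \<Longrightarrow> cone_in (relabel h v) R \<longleftrightarrow> cone_in v R"
  by (auto simp: cone_in_def relabel_Ix relabel_At relabel_Ent)

text \<open>The sieves that contain the composites of some well-founded tree of coverings, described
  without reference to the tree.\<close>

inductive tree_covering :: "'k ring \<Rightarrow> ('k, 'o, 'm) lincat \<Rightarrow> ('i, 'o, 'm) seqn set \<Rightarrow> 'o \<Rightarrow> ('o, 'm) sieve \<Rightarrow> bool"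
  for k :: "'k ring" and a :: "('k, 'o, 'm) lincat" and S :: "('i, 'o, 'm) seqn set" where
  leaf: "X \<in> Obj a \<Longrightarrow> tree_covering k a S X (max_sieve a X)"
| node: "\<lbrakk>q \<in> Co S; Cod q = one_fam X; X \<in> Obj a; sieve k a X R;
    \<And>\<beta>. \<beta> \<in> Ix (Dom q) \<Longrightarrow> tree_covering k a S (At (Dom q) \<beta>) (pull a X R (At (Dom q) \<beta>) (Ent q \<beta> ()))\<rbrakk>
    \<Longrightarrow> tree_covering k a S X R"

section \<open>Monotonicity and unions of pretopologies\<close>

lemma Co_iter_mono: "S1 \<subseteq> S2 \<Longrightarrow> Co_iter a S1 n \<subseteq> Co_iter a S2 n"
proof (induction a S1 n rule: Co_iter.induct)
  case (3 a S1 n)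
  have "Co S1 \<subseteq> Co S2" using 3(2) by (auto simp: Co_def)
  then show ?case using 3(1)[OF 3(2)] unfolding Co_iter.simps by blast
qed (auto simp: Co_def)

lemma Co_tilde_mono: "S1 \<subseteq> S2 \<Longrightarrow> Co_tilde a S1 \<subseteq> Co_tilde a S2"
  unfolding Co_tilde_def by (intro UN_mono Co_iter_mono) auto

lemma Co_closure_mono:
  assumes "S1 \<subseteq> S2"
  shows "Co_closure a S1 \<subseteq> Co_closure a S2"
proof
  fix r assume "r \<in> Co_closure a S1"
  then show "r \<in> Co_closure a S2"
  proof (induction)
    case (comp q w)
    then show ?case using assms by (intro Co_closure.comp) (auto simp: Co_def)
  qed (rule Co_closure.ident)
qed

lemma top_of_mono: "S1 \<subseteq> S2 \<Longrightarrow> top_of k a S1 \<le> top_of k a S2"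
  using Co_closure_mono[of S1 S2 a] unfolding top_of_def sieves_over_def le_fun_def by blast

lemma top_fin_mono: "S1 \<subseteq> S2 \<Longrightarrow> top_fin k a S1 \<le> top_fin k a S2"
  using Co_tilde_mono[of S1 S2 a] unfolding top_fin_def sieves_over_def le_fun_def by blast

text \<open>Each sequence of the union satisfies the axioms inside its own member, whose iterated
  coverings are among those of the union.\<close>

lemma pretopology_UN:
  assumes "\<And>i. i \<in> I \<Longrightarrow> pretopology a (SS i)"
  shows "pretopology a (\<Union>i\<in>I. SS i)"
proof -
  have t: "Co_tilde a (SS i) \<subseteq> Co_tilde a (\<Union>i\<in>I. SS i)" if "i \<in> I" for i
    using that by (intro Co_tilde_mono) blast
  have "PTa a (\<Union>i\<in>I. SS i)"
    unfolding PTa_def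
  proof (intro ballI impI)
    fix q X A f assume q: "q \<in> Co (\<Union>i\<in>I. SS i)" and r: "X \<in> Obj a" "Cod q = one_fam X" "A \<in> Obj a" "f \<in> arr a A X"
    from q obtain i where i: "i \<in> I" and qi: "q \<in> Co (SS i)" by (auto simp: Co_def)
    have "PTa a (SS i)" using assms[OF i] by (simp add: pretopology_def)
    then obtain q' where "q' \<in> Co_tilde a (SS i)" "Cod q' = one_fam A"
      "\<exists>f'. formal_morphism a f' \<and> Dom f' = Dom q' \<and> Cod f' = Dom q \<and> fcomp a q f' = fcomp a (obj_fmor A X f) q'"
      using qi r unfolding PTa_def by blast
    then show "\<exists>q'\<in>Co_tilde a (\<Union>i\<in>I. SS i). Cod q' = one_fam A \<and>
        (\<exists>f'. formal_morphism a f' \<and> Dom f' = Dom q' \<and> Cod f' = Dom q \<and> fcomp a q f' = fcomp a (obj_fmor A X f) q')"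
      using t[OF i] by blast
  qed
  moreover have "PTb a (\<Union>i\<in>I. SS i)"
    unfolding PTb_def
  proof (clarify)
    fix i p q A f assume i: "i \<in> I" and pq: "(p, q) \<in> SS i" and r: "A \<in> Obj a" "formal_morphism a f" "Dom f = one_fam A"
      "Cod f = Dom q" "fcomp a q f = zero_fmor a (Dom f) (Cod q)"
    have "PTb a (SS i)" using assms[OF i] by (simp add: pretopology_def)
    then obtain q' where "q' \<in> Co_tilde a (SS i)" "Cod q' = one_fam A"
      "\<exists>f'. formal_morphism a f' \<and> Dom f' = Dom q' \<and> Cod f' = Dom p \<and> fcomp a p f' = fcomp a f q'"
      using pq r unfolding PTb_def by blast
    then show "\<exists>q'\<in>Co_tilde a (\<Union>i\<in>I. SS i). Cod q' = one_fam A \<and>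
        (\<exists>f'. formal_morphism a f' \<and> Dom f' = Dom q' \<and> Cod f' = Dom p \<and> fcomp a p f' = fcomp a f q')"
      using t[OF i] by blast
  qed
  moreover have "\<forall>s\<in>(\<Union>i\<in>I. SS i). sequence a s" using assms by (auto simp: pretopology_def)
  ultimately show ?thesis by (simp add: pretopology_def)
qed

section \<open>Iterated coverings and trees\<close>

context linear_category
begin

lemma fam_comp_cone:
  assumes v: "cone a v X" and w: "\<And>\<alpha>. \<alpha> \<in> Ix (Dom v) \<Longrightarrow> cone a (w \<alpha>) (At (Dom v) \<alpha>)"
  shows "cone a (fam_comp a v w) X"
  unfolding cone_def
proof (intro conjI ballI)
  have X: "X \<in> Obj a" "Cod v = one_fam X" using v by (auto simp: cone_def)
  show "X \<in> Obj a" "Cod (fam_comp a v w) = one_fam X" using X by simp_all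
  fix \<gamma> assume "\<gamma> \<in> Ix (Dom (fam_comp a v w))"
  then obtain \<alpha> \<delta> where g: "\<gamma> = (\<alpha>, \<delta>)" and \<alpha>: "\<alpha> \<in> Ix (Dom v)" and \<delta>: "\<delta> \<in> Ix (Dom (w \<alpha>))"
    by (auto simp: fam_comp_Ix)
  have V: "At (Dom v) \<alpha> \<in> Obj a" "Ent v \<alpha> () \<in> arr a (At (Dom v) \<alpha>) X" using v \<alpha> by (auto simp: cone_def)
  have W: "At (Dom (w \<alpha>)) \<delta> \<in> Obj a" "Ent (w \<alpha>) \<delta> () \<in> arr a (At (Dom (w \<alpha>)) \<delta>) (At (Dom v) \<alpha>)"
    using w[OF \<alpha>] \<delta> by (auto simp: cone_def)
  show "At (Dom (fam_comp a v w)) \<gamma> \<in> Obj a" by (simp add: g fam_comp_At[where w = w, OF \<alpha> \<delta>] W)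
  show "Ent (fam_comp a v w) \<gamma> () \<in> arr a (At (Dom (fam_comp a v w)) \<gamma>) X"
    by (simp add: g fam_comp_At[where w = w, OF \<alpha> \<delta>] fam_comp_Ent[where w = w, OF \<alpha> \<delta>] X comp_closed[OF W(1) V(1) X(1) W(2) V(2)])
qed

text \<open>A composite with \<open>v\<close> at \<open>\<alpha>\<close> lies in \<open>R\<close>
  iff the inner arrow lies in the pullback of \<open>R\<close>. Composition of families thus becomes
  iterated pullback, which is the recursion of \<open>tree_covering\<close>.\<close>

lemma cone_in_fam_comp:
  assumes v: "cone a v X" and w: "\<And>\<alpha>. \<alpha> \<in> Ix (Dom v) \<Longrightarrow> cone a (w \<alpha>) (At (Dom v) \<alpha>)"
  shows "cone_in (fam_comp a v w) R \<longleftrightarrow>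
    (\<forall>\<alpha>\<in>Ix (Dom v). cone_in (w \<alpha>) (pull a X R (At (Dom v) \<alpha>) (Ent v \<alpha> ())))"
proof -
  have C: "At (Cod v) () = X" using v by (simp add: cone_def)
  have W: "At (Dom (w \<alpha>)) \<delta> \<in> Obj a" "Ent (w \<alpha>) \<delta> () \<in> arr a (At (Dom (w \<alpha>)) \<delta>) (At (Dom v) \<alpha>)"
    if "\<alpha> \<in> Ix (Dom v)" "\<delta> \<in> Ix (Dom (w \<alpha>))" for \<alpha> \<delta>
    using w[OF that(1)] that(2) by (auto simp: cone_def)
  show ?thesis
    using W by (auto simp: cone_in_def fam_comp_Ix fam_comp_At fam_comp_Ent pull_mem C)
qed

lemma ident_cone: "X \<in> Obj a \<Longrightarrow> cone a (ident_fmor a X) X"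
  unfolding ident_fmor_def
  by (rule relabel_cone[OF inj_unit]) (simp add: cone_def obj_fmor_def id_closed)

lemma cone_in_ident: "cone_in (ident_fmor a X) R \<longleftrightarrow> Idt a X \<in> R X"
  unfolding ident_fmor_def cone_in_relabel[OF inj_unit]
  by (simp add: cone_in_def obj_fmor_def)

lemma gen_sieve_le_cone_in:
  "\<lbrakk>cone a v X; sieve k a X R\<rbrakk> \<Longrightarrow> gen_sieve k a v \<le> R \<longleftrightarrow> cone_in v R"
  by (simp add: gen_sieve_le_iff cone_in_def)

context
  fixes S :: "('i, 'o, 'm) seqn set"
  assumes seq: "\<forall>s\<in>S. sequence a s"
begin

lemma Co_cone:
  assumes "q \<in> Co S" "Cod q = one_fam X"
  shows "cone a q X"
proof -
  obtain p where "sequence a (p, q)" using assms(1) seq by (auto simp: Co_def)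
  then obtain Y where "cone a q Y" "Cod q = one_fam Y" by (elim sequenceE) blast
  then show ?thesis using assms(2) by simp
qed

lemma Co_family:
  assumes "q \<in> Co S"
  shows "family a (Dom q)"
proof -
  obtain p where "sequence a (p, q)" using assms(1) seq by (auto simp: Co_def)
  then show ?thesis by (elim sequenceE)
qed

lemma tree_covering_sieve: "tree_covering k a S X R \<Longrightarrow> X \<in> Obj a \<and> sieve k a X R"
  by (induction rule: tree_covering.induct) (auto simp: max_sieve_sieve)

text \<open>Trees for the pullbacks of \<open>Q\<close> are grafted onto the leaves of the tree for
  \<open>R\<close>. At a leaf the hypothesis for the identity is the claim; at a node it passes to
  the pullbacks along the components by \<open>pull_pull\<close>.\<close>

lemma tree_covering_trans:
  assumes "tree_covering k a S X R" "sieve k a X Q" "\<And>B f. f \<in> R B \<Longrightarrow> tree_covering k a S B (pull a X Q B f)"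
  shows "tree_covering k a S X Q"
  using assms
proof (induction arbitrary: Q rule: tree_covering.induct)
  case (leaf X)
  have "Idt a X \<in> max_sieve a X X" using leaf(1) id_closed by (simp add: max_sieve_mem)
  from leaf(3)[OF this] show ?case using pull_id[OF leaf(1,2)] by simp
next
  case (node q X R)
  note c = Co_cone[OF node.hyps(1,2)]
  show ?case
  proof (rule tree_covering.node[OF node.hyps(1-3) node.prems(1)])
    fix \<beta> assume \<beta>: "\<beta> \<in> Ix (Dom q)"
    have Y: "At (Dom q) \<beta> \<in> Obj a" "Ent q \<beta> () \<in> arr a (At (Dom q) \<beta>) X" using c \<beta> by (auto simp: cone_def)
    show "tree_covering k a S (At (Dom q) \<beta>) (pull a X Q (At (Dom q) \<beta>) (Ent q \<beta> ()))"
    proof (rule node.IH[OF \<beta> pull_sieve[OF node.hyps(3) Y(1) node.prems(1) Y(2)]])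
      fix B f assume "f \<in> pull a X R (At (Dom q) \<beta>) (Ent q \<beta> ()) B"
      then have B: "B \<in> Obj a" "f \<in> arr a B (At (Dom q) \<beta>)" and f: "Cmp a B (At (Dom q) \<beta>) X (Ent q \<beta> ()) f \<in> R B"
        by (simp_all add: pull_mem)
      show "tree_covering k a S B (pull a (At (Dom q) \<beta>) (pull a X Q (At (Dom q) \<beta>) (Ent q \<beta> ())) B f)"
        unfolding pull_pull[OF node.hyps(3) Y B] by (rule node.prems(2)[OF f])
    qed
  qed
qed

text \<open>Along an arrow of \<open>R\<close> the pullback of \<open>Q\<close> is maximal, hence a
  leaf.\<close>

lemma tree_covering_mono:
  assumes "tree_covering k a S X R" "sieve k a X Q" "R \<le> Q"
  shows "tree_covering k a S X Q"
proof (rule tree_covering_trans[OF assms(1,2)])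
  fix B f assume f: "f \<in> R B"
  note X = tree_covering_sieve[OF assms(1)]
  have B: "B \<in> Obj a" using sieve_Obj[OF X[THEN conjunct1] X[THEN conjunct2] f] .
  have "pull a X Q B f = max_sieve a B"
    by (rule pull_max[OF X[THEN conjunct1] assms(2) subD[OF assms(3) f]])
  then show "tree_covering k a S B (pull a X Q B f)" using tree_covering.leaf[OF B] by simp
qed

text \<open>An iterated covering grows at its sources, a tree is built from its root. The induction
  therefore carries an arbitrary tree over each source of \<open>r\<close> and absorbs the last
  layer of coverings into these trees. The cone and family properties are proved along for
  \<open>PTa_lift_iff\<close> and \<open>PTb_lift\<close>.\<close>

lemma Co_iter_tree:
  assumes "r \<in> Co_iter a S n" "Cod r = one_fam X"
  shows "cone a r X \<and> family a (Dom r) \<and> (\<forall>R. sieve k a X R \<longrightarrow>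
    (\<forall>\<alpha>\<in>Ix (Dom r). tree_covering k a S (At (Dom r) \<alpha>) (pull a X R (At (Dom r) \<alpha>) (Ent r \<alpha> ()))) \<longrightarrow>
    tree_covering k a S X R)"
proof -
  \<comment> \<open>The induction starts at depth one, where the recursion of \<open>Co_iter\<close>
    starts as well.\<close>
  have "\<forall>r X. r \<in> Co_iter a S (Suc n) \<longrightarrow> Cod r = one_fam X \<longrightarrow> cone a r X \<and> family a (Dom r) \<and> (\<forall>R. sieve k a X R \<longrightarrow>
    (\<forall>\<alpha>\<in>Ix (Dom r). tree_covering k a S (At (Dom r) \<alpha>) (pull a X R (At (Dom r) \<alpha>) (Ent r \<alpha> ()))) \<longrightarrow>
    tree_covering k a S X R)" for n
  proof (induction n)
    case 0
    show ?case
    proof (intro allI impI)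
      fix r :: "('i list, unit, 'o, 'm) fmor" and X
      assume "r \<in> Co_iter a S (Suc 0)" and C: "Cod r = one_fam X"
      then obtain q where q: "q \<in> Co S" and r: "r = relabel (\<lambda>\<beta>. [\<beta>]) q" by auto
      have Cq: "Cod q = one_fam X" using C r by simp
      note c = Co_cone[OF q Cq]
      have "tree_covering k a S X R"
        if "sieve k a X R" "\<forall>\<alpha>\<in>Ix (Dom r). tree_covering k a S (At (Dom r) \<alpha>) (pull a X R (At (Dom r) \<alpha>) (Ent r \<alpha> ()))" for R
        using that c
        by (intro tree_covering.node[OF q Cq _ that(1)])
          (auto simp: r relabel_Ix[OF inj_singleton] relabel_At[OF inj_singleton] relabel_Ent[OF inj_singleton] cone_def)
      then show "cone a r X \<and> family a (Dom r) \<and> (\<forall>R. sieve k a X R \<longrightarrow>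
          (\<forall>\<alpha>\<in>Ix (Dom r). tree_covering k a S (At (Dom r) \<alpha>) (pull a X R (At (Dom r) \<alpha>) (Ent r \<alpha> ()))) \<longrightarrow>
          tree_covering k a S X R)"
        using relabel_cone[OF inj_singleton c] relabel_family[OF inj_singleton c] r by blast
    qed
  next
    case (Suc n)
    show ?case
    proof (intro allI impI)
      fix r :: "('i list, unit, 'o, 'm) fmor" and X
      assume "r \<in> Co_iter a S (Suc (Suc n))" and C: "Cod r = one_fam X"
      then obtain v w where r: "r = relabel (\<lambda>(\<alpha>, \<delta>). \<alpha> @ [\<delta>]) (fam_comp a v w)" and v: "v \<in> Co_iter a S (Suc n)"
        and w: "\<And>\<alpha>. \<alpha> \<in> Ix (Dom v) \<Longrightarrow> w \<alpha> \<in> Co S" "\<And>\<alpha>. \<alpha> \<in> Ix (Dom v) \<Longrightarrow> Cod (w \<alpha>) = one_fam (At (Dom v) \<alpha>)" by auto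
      have Cv: "Cod v = one_fam X" using C r by simp
      have vc: "cone a v X" and vt: "\<And>R. \<lbrakk>sieve k a X R;
          \<forall>\<alpha>\<in>Ix (Dom v). tree_covering k a S (At (Dom v) \<alpha>) (pull a X R (At (Dom v) \<alpha>) (Ent v \<alpha> ()))\<rbrakk> \<Longrightarrow> tree_covering k a S X R"
        using Suc.IH v Cv by blast+
      have X: "X \<in> Obj a" using vc by (simp add: cone_def)
      have wc: "cone a (w \<alpha>) (At (Dom v) \<alpha>)" if "\<alpha> \<in> Ix (Dom v)" for \<alpha> by (rule Co_cone[OF w[OF that]])
      note fc = fam_comp_cone[OF vc wc]
      have "tree_covering k a S X R"
        if R: "sieve k a X R" and t: "\<forall>\<alpha>\<in>Ix (Dom r). tree_covering k a S (At (Dom r) \<alpha>) (pull a X R (At (Dom r) \<alpha>) (Ent r \<alpha> ()))" for R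
      \<comment> \<open>Over the source \<open>\<alpha>\<close> of \<open>v\<close> a node with
        covering \<open>w \<alpha>\<close> is placed; its subtrees are the given ones over the
        sources of \<open>r\<close>.\<close>
      proof (rule vt[OF R], rule ballI)
        fix \<alpha> assume \<alpha>: "\<alpha> \<in> Ix (Dom v)"
        have V: "At (Dom v) \<alpha> \<in> Obj a" "Ent v \<alpha> () \<in> arr a (At (Dom v) \<alpha>) X" using vc \<alpha> by (auto simp: cone_def)
        show "tree_covering k a S (At (Dom v) \<alpha>) (pull a X R (At (Dom v) \<alpha>) (Ent v \<alpha> ()))"
        proof (rule tree_covering.node[OF w[OF \<alpha>] V(1) pull_sieve[OF X V(1) R V(2)]])
          fix \<delta> assume \<delta>: "\<delta> \<in> Ix (Dom (w \<alpha>))"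
          have W: "At (Dom (w \<alpha>)) \<delta> \<in> Obj a" "Ent (w \<alpha>) \<delta> () \<in> arr a (At (Dom (w \<alpha>)) \<delta>) (At (Dom v) \<alpha>)"
            using wc[OF \<alpha>] \<delta> by (auto simp: cone_def)
          have i: "(\<alpha>, \<delta>) \<in> Ix (Dom (fam_comp a v w))" using \<alpha> \<delta> by (simp add: fam_comp_Ix)
          have "\<alpha> @ [\<delta>] \<in> Ix (Dom r)" using i by (force simp: r relabel_Ix[OF inj_snoc])
          moreover have "At (Dom r) (\<alpha> @ [\<delta>]) = At (Dom (w \<alpha>)) \<delta>"
            using relabel_At[OF inj_snoc i] fam_comp_At[where w = w, OF \<alpha> \<delta>] by (simp add: r)
          moreover have "Ent r (\<alpha> @ [\<delta>]) () = Cmp a (At (Dom (w \<alpha>)) \<delta>) (At (Dom v) \<alpha>) X (Ent v \<alpha> ()) (Ent (w \<alpha>) \<delta> ())"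
            using relabel_Ent[OF inj_snoc i] fam_comp_Ent[where w = w, OF \<alpha> \<delta>] Cv by (simp add: r)
          ultimately show "tree_covering k a S (At (Dom (w \<alpha>)) \<delta>)
              (pull a (At (Dom v) \<alpha>) (pull a X R (At (Dom v) \<alpha>) (Ent v \<alpha> ())) (At (Dom (w \<alpha>)) \<delta>) (Ent (w \<alpha>) \<delta> ()))"
            unfolding pull_pull[OF X V W] using t by metis
        qed
      qed
      then show "cone a r X \<and> family a (Dom r) \<and> (\<forall>R. sieve k a X R \<longrightarrow>
          (\<forall>\<alpha>\<in>Ix (Dom r). tree_covering k a S (At (Dom r) \<alpha>) (pull a X R (At (Dom r) \<alpha>) (Ent r \<alpha> ()))) \<longrightarrow>
          tree_covering k a S X R)"
        using relabel_cone[OF inj_snoc fc] relabel_family[OF inj_snoc fc] r by blast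
    qed
  qed
  note step = this
  show ?thesis
  proof (cases n)
    case 0
    then have r: "r = ident_fmor a X" and X: "X \<in> Obj a"
      using assms by (auto simp: ident_fmor_def obj_fmor_def)
    have "tree_covering k a S X R"
      if R: "sieve k a X R" and t: "\<forall>\<alpha>\<in>Ix (Dom r). tree_covering k a S (At (Dom r) \<alpha>) (pull a X R (At (Dom r) \<alpha>) (Ent r \<alpha> ()))" for R
    proof -
      let ?v = "obj_fmor X X (Idt a X)"
      have i: "() \<in> Ix (Dom ?v)" by (simp add: obj_fmor_def)
      \<comment> \<open>The identity is indexed by the empty list, and pulling back along it gives
        \<open>R\<close> itself.\<close>
      have "[] \<in> Ix (Dom r)" by (simp add: r ident_fmor_def relabel_Ix[OF inj_unit] obj_fmor_def)
      then have "tree_covering k a S X (pull a X R X (Idt a X))"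
        using t relabel_At[OF inj_unit i, of "\<lambda>_. []"] relabel_Ent[OF inj_unit i, of "\<lambda>_. []"]
        by (metis fmor.select_convs(1,3) obj_fmor_def one_fam_sel(2) ident_fmor_def r)
      then show ?thesis using pull_id[OF X R] by simp
    qed
    moreover have "family a (Dom r)"
      unfolding r ident_fmor_def
      by (rule relabel_family[OF inj_unit, of a _ X]) (simp add: cone_def obj_fmor_def id_closed X)
    ultimately show ?thesis using ident_cone[OF X] r by blast
  next
    case (Suc m)
    then show ?thesis using step[of m] assms by blast
  qed
qed

lemma Co_tilde_tree:
  assumes "r \<in> Co_tilde a S" "Cod r = one_fam X"
  shows "cone a r X" "family a (Dom r)"
    and "\<lbrakk>sieve k a X R; \<And>\<alpha>. \<alpha> \<in> Ix (Dom r) \<Longrightarrow>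
      tree_covering k a S (At (Dom r) \<alpha>) (pull a X R (At (Dom r) \<alpha>) (Ent r \<alpha> ()))\<rbrakk> \<Longrightarrow> tree_covering k a S X R"
  using assms Co_iter_tree unfolding Co_tilde_def by blast+

text \<open>The components of \<open>r\<close> lie in \<open>R\<close>, so the pullbacks along them
  are maximal and every source carries a leaf.\<close>

lemma Co_tilde_covering:
  assumes "r \<in> Co_tilde a S" "Cod r = one_fam X" "sieve k a X R" "cone_in r R"
  shows "tree_covering k a S X R"
proof (rule Co_tilde_tree(3)[OF assms(1-3)])
  fix \<alpha> assume \<alpha>: "\<alpha> \<in> Ix (Dom r)"
  have X: "X \<in> Obj a" and A: "At (Dom r) \<alpha> \<in> Obj a"
    using Co_tilde_tree(1)[OF assms(1,2)] \<alpha> by (auto simp: cone_def)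
  have "pull a X R (At (Dom r) \<alpha>) (Ent r \<alpha> ()) = max_sieve a (At (Dom r) \<alpha>)"
    using pull_max[OF X assms(3)] assms(4) \<alpha> by (simp add: cone_in_def)
  then show "tree_covering k a S (At (Dom r) \<alpha>) (pull a X R (At (Dom r) \<alpha>) (Ent r \<alpha> ()))"
    using tree_covering.leaf[OF A] by simp
qed

lemma Co_closure_covering:
  assumes "r \<in> Co_closure a S" "Cod r = one_fam X"
  shows "cone a r X \<and> (\<forall>R. sieve k a X R \<longrightarrow> cone_in r R \<longrightarrow> tree_covering k a S X R)"
  using assms
proof (induction arbitrary: X rule: Co_closure.induct)
  case (ident Y)
  then have X: "X \<in> Obj a" "Y = X" by (auto simp: ident_fmor_def obj_fmor_def)
  have "tree_covering k a S X R" if "sieve k a X R" "cone_in (ident_fmor a X :: ('i list, unit, 'o, 'm) fmor) R" for R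
    using sieve_eq_max[OF X(1) that(1)] that(2) tree_covering.leaf[OF X(1)] by (simp add: cone_in_ident)
  then show ?case using ident_cone[OF X(1)] X(2) by blast
next
  case (comp q w)
  have Cq: "Cod q = one_fam X" using comp.prems by simp
  note c = Co_cone[OF comp.hyps(1) Cq]
  have X: "X \<in> Obj a" using c by (simp add: cone_def)
  have wc: "cone a (w \<beta>) (At (Dom q) \<beta>)" if "\<beta> \<in> Ix (Dom q)" for \<beta>
    using comp.IH[OF that comp.hyps(3)[OF that]] by blast
  have "tree_covering k a S X R"
    if R: "sieve k a X R" and i: "cone_in (relabel (\<lambda>(\<beta>, l). \<beta> # l) (fam_comp a q w)) R" for R
  proof (rule tree_covering.node[OF comp.hyps(1) Cq X R])
    fix \<beta> assume \<beta>: "\<beta> \<in> Ix (Dom q)"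
    have Y: "At (Dom q) \<beta> \<in> Obj a" "Ent q \<beta> () \<in> arr a (At (Dom q) \<beta>) X" using c \<beta> by (auto simp: cone_def)
    have "cone_in (w \<beta>) (pull a X R (At (Dom q) \<beta>) (Ent q \<beta> ()))"
      using i cone_in_fam_comp[OF c wc] \<beta> by (simp add: cone_in_relabel[OF inj_Cons])
    then show "tree_covering k a S (At (Dom q) \<beta>) (pull a X R (At (Dom q) \<beta>) (Ent q \<beta> ()))"
      using comp.IH[OF \<beta> comp.hyps(3)[OF \<beta>]] pull_sieve[OF X Y(1) R Y(2)] by blast
  qed
  then show ?case using relabel_cone[OF inj_Cons fam_comp_cone[OF c wc]] by blast
qed

text \<open>Below each component of \<open>q\<close> a composite is chosen by the axiom of choice,
  and its index lists are prefixed by the index of the component.\<close>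

lemma tree_covering_Co_closure:
  assumes "tree_covering k a S X R"
  shows "\<exists>r\<in>Co_closure a S. Cod r = one_fam X \<and> cone_in r R"
  using assms
proof (induction rule: tree_covering.induct)
  case (leaf X)
  have "cone_in (ident_fmor a X :: ('i list, unit, 'o, 'm) fmor) (max_sieve a X)"
    using id_closed[OF leaf] leaf by (simp add: cone_in_ident max_sieve_mem)
  moreover have "Cod (ident_fmor a X :: ('i list, unit, 'o, 'm) fmor) = one_fam X"
    by (simp add: ident_fmor_def obj_fmor_def)
  ultimately show ?case using Co_closure.ident[OF leaf] by blast
next
  case (node q X R)
  note c = Co_cone[OF node.hyps(1,2)]
  have "\<forall>\<beta>\<in>Ix (Dom q). \<exists>r. r \<in> Co_closure a S \<and> Cod r = one_fam (At (Dom q) \<beta>) \<and>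
      cone_in r (pull a X R (At (Dom q) \<beta>) (Ent q \<beta> ()))"
    using node.IH by blast
  from bchoice[OF this] obtain w where w: "\<forall>\<beta>\<in>Ix (Dom q). w \<beta> \<in> Co_closure a S \<and> Cod (w \<beta>) = one_fam (At (Dom q) \<beta>) \<and>
      cone_in (w \<beta>) (pull a X R (At (Dom q) \<beta>) (Ent q \<beta> ()))" by blast
  have wc: "cone a (w \<beta>) (At (Dom q) \<beta>)" if "\<beta> \<in> Ix (Dom q)" for \<beta>
    using Co_closure_covering w that by blast
  show ?case
  proof (intro bexI conjI)
    show "relabel (\<lambda>(\<beta>, l). \<beta> # l) (fam_comp a q w) \<in> Co_closure a S"
      by (rule Co_closure.comp[OF node.hyps(1)]) (use w in blast)+
    show "Cod (relabel (\<lambda>(\<beta>, l). \<beta> # l) (fam_comp a q w)) = one_fam X" using node.hyps(2) by simp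
    show "cone_in (relabel (\<lambda>(\<beta>, l). \<beta> # l) (fam_comp a q w)) R"
      unfolding cone_in_relabel[OF inj_Cons]
      by (rule cone_in_fam_comp[OF c, THEN iffD2]) (use w wc in auto)
  qed
qed

text \<open>Trees involve no index lists and no chosen composite, so the topology axioms can be
  proved for \<open>tree_covering\<close> instead.\<close>

lemma top_of_iff: "R \<in> top_of k a S X \<longleftrightarrow> tree_covering k a S X R"
proof
  assume "R \<in> top_of k a S X"
  then obtain r where R: "sieve k a X R" and r: "r \<in> Co_closure a S" "Cod r = one_fam X" "gen_sieve k a r \<le> R"
    by (auto simp: top_of_def sieves_over_def)
  then show "tree_covering k a S X R"
    using Co_closure_covering[OF r(1,2)] gen_sieve_le_cone_in[OF _ R] by blast
next
  assume t: "tree_covering k a S X R"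
  note X = tree_covering_sieve[OF t]
  obtain r where r: "r \<in> Co_closure a S" "Cod r = one_fam X" "cone_in r R"
    using tree_covering_Co_closure[OF t] by blast
  have "gen_sieve k a r \<le> R"
    using Co_closure_covering[OF r(1,2)] gen_sieve_le_cone_in X r(3) by blast
  then show "R \<in> top_of k a S X" using X r by (auto simp: top_of_def sieves_over_def)
qed

lemma top_fin_le_top_of: "top_fin k a S \<le> top_of k a S"
proof (intro le_funI subsetI)
  fix X R assume "R \<in> top_fin k a S X"
  then obtain r where R: "sieve k a X R" and r: "r \<in> Co_tilde a S" "Cod r = one_fam X" "gen_sieve k a r \<le> R"
    by (auto simp: top_fin_def sieves_over_def)
  then have "cone_in r R" using gen_sieve_le_cone_in[OF Co_tilde_tree(1)[OF r(1,2)] R] by simp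
  then show "R \<in> top_of k a S X" using Co_tilde_covering[OF r(1,2) R] by (simp add: top_of_iff)
qed

text \<open>The arrows along which all pullbacks of \<open>R\<close> are covering form a sieve, so that it suffices
  to cover the sources of the components of \<open>q\<close>.\<close>

lemma tree_covering_pull:
  assumes PT: "PTa a S" and "tree_covering k a S X R" "A \<in> Obj a" "f \<in> arr a A X"
  shows "tree_covering k a S A (pull a X R A f)"
  using assms(2-4)
proof (induction arbitrary: A f rule: tree_covering.induct)
  case (leaf X)
  have "pull a X (max_sieve a X) A f = max_sieve a A"
    by (rule pull_max[OF leaf(1) max_sieve_sieve[OF leaf(1)]]) (use leaf in \<open>simp add: max_sieve_mem\<close>)
  then show ?case using tree_covering.leaf[OF leaf(2)] by simp
next
  case (node q X R)
  note c = Co_cone[OF node.hyps(1,2)] and X = node.hyps(3) and R = node.hyps(4)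
  \<comment> \<open>Quantifying over all composites with \<open>h\<close>, rather than only asking
    for \<open>h\<close> itself, makes \<open>N\<close> closed under precomposition and provides the
    stronger hypothesis needed for sums.\<close>
  define N where "N B = (if B \<in> Obj a then {h \<in> arr a B X. \<forall>C\<in>Obj a. \<forall>g\<in>arr a C B.
    tree_covering k a S C (pull a X R C (Cmp a C B X h g))} else {})" for B
  \<comment> \<open>Transitivity along the pullback of \<open>R\<close> by \<open>x\<close>: if the
    composite of \<open>x\<close> and \<open>e\<close> lies in \<open>R\<close>, the pullback along
    the composite of \<open>x\<close> plus \<open>y\<close> with \<open>e\<close> contains the
    pullback along that of \<open>y\<close>, which is covering.\<close>
  have sum: "tree_covering k a S C (pull a X R C (x \<oplus>\<^bsub>Hom a C X\<^esub> y))"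
    if C: "C \<in> Obj a" and x: "x \<in> arr a C X" and y: "y \<in> arr a C X" and tx: "tree_covering k a S C (pull a X R C x)"
      and ty: "\<And>D e. \<lbrakk>D \<in> Obj a; e \<in> arr a D C\<rbrakk> \<Longrightarrow> tree_covering k a S D (pull a X R D (Cmp a D C X y e))" for C x y
  proof -
    interpret H: module k "Hom a C X" by (rule hom_module[OF C X])
    have xy: "x \<oplus>\<^bsub>Hom a C X\<^esub> y \<in> arr a C X" using x y by simp
    show ?thesis
    proof (rule tree_covering_trans[OF tx pull_sieve[OF X C R xy]])
      fix D e assume e: "e \<in> pull a X R C x D"
      then have D: "D \<in> Obj a" "e \<in> arr a D C" and xe: "Cmp a D C X x e \<in> R D" by (simp_all add: pull_mem)
      have eq: "Cmp a D C X (x \<oplus>\<^bsub>Hom a C X\<^esub> y) e = Cmp a D C X x e \<oplus>\<^bsub>Hom a D X\<^esub> Cmp a D C X y e"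
        by (rule mod_hom_add[OF comp_linear_left[OF D(1) C X D(2)] x y])
      have ye: "Cmp a D C X y e \<in> arr a D X" by (rule comp_closed[OF D(1) C X D(2) y])
      have xya: "Cmp a D C X (x \<oplus>\<^bsub>Hom a C X\<^esub> y) e \<in> arr a D X" by (rule comp_closed[OF D(1) C X D(2) xy])
      have "tree_covering k a S D (pull a X R D (Cmp a D C X (x \<oplus>\<^bsub>Hom a C X\<^esub> y) e))"
      proof (rule tree_covering_mono[OF ty[OF D] pull_sieve[OF X D(1) R xya]], intro le_funI subsetI)
        fix E g assume "g \<in> pull a X R D (Cmp a D C X y e) E"
        then have E: "E \<in> Obj a" "g \<in> arr a E D" and yg: "Cmp a E D X (Cmp a D C X y e) g \<in> R E" by (simp_all add: pull_mem)
        have "Cmp a E D X (Cmp a D C X (x \<oplus>\<^bsub>Hom a C X\<^esub> y) e) g =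
            Cmp a E D X (Cmp a D C X x e) g \<oplus>\<^bsub>Hom a E X\<^esub> Cmp a E D X (Cmp a D C X y e) g"
          unfolding eq by (rule mod_hom_add[OF comp_linear_left[OF E(1) D(1) X E(2)] sieve_arr[OF X R xe] ye])
        then show "g \<in> pull a X R D (Cmp a D C X (x \<oplus>\<^bsub>Hom a C X\<^esub> y) e) E"
          using E sieve_add[OF X R sieve_comp[OF X R xe E] yg] by (simp add: pull_mem)
      qed
      then show "tree_covering k a S D (pull a C (pull a X R C (x \<oplus>\<^bsub>Hom a C X\<^esub> y)) D e)"
        unfolding pull_pull[OF X C xy D] .
    qed
  qed
  have N: "sieve k a X N"
  proof (rule sieve_iff[OF X, THEN iffD2], intro conjI ballI allI impI)
    fix B assume B: "B \<in> Obj a"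
    interpret H: module k "Hom a B X" by (rule hom_module[OF B X])
    show "N B \<subseteq> arr a B X" by (auto simp: N_def)
    show "\<zero>\<^bsub>Hom a B X\<^esub> \<in> N B"
    proof -
      have "tree_covering k a S C (pull a X R C (Cmp a C B X \<zero>\<^bsub>Hom a B X\<^esub> g))" if C: "C \<in> Obj a" "g \<in> arr a C B" for C g
      proof -
        have "Cmp a C B X \<zero>\<^bsub>Hom a B X\<^esub> g = \<zero>\<^bsub>Hom a C X\<^esub>"
          by (rule mod_hom_zero[OF comp_linear_left[OF C(1) B X C(2)] hom_module[OF B X] hom_module[OF C(1) X]])
        then have "pull a X R C (Cmp a C B X \<zero>\<^bsub>Hom a B X\<^esub> g) = max_sieve a C"
          using pull_max[OF X R sieve_zero[OF X R C(1)]] by simp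
        then show ?thesis using tree_covering.leaf[OF C(1)] by simp
      qed
      then show ?thesis using B by (simp add: N_def)
    qed
    fix x assume x: "x \<in> N B"
    then have xa: "x \<in> arr a B X" and xt: "\<And>C g. \<lbrakk>C \<in> Obj a; g \<in> arr a C B\<rbrakk> \<Longrightarrow> tree_covering k a S C (pull a X R C (Cmp a C B X x g))"
      using B by (simp_all add: N_def)
    show "x \<oplus>\<^bsub>Hom a B X\<^esub> y \<in> N B" if y: "y \<in> N B" for y
    proof -
      have ya: "y \<in> arr a B X" and yt: "\<And>C g. \<lbrakk>C \<in> Obj a; g \<in> arr a C B\<rbrakk> \<Longrightarrow> tree_covering k a S C (pull a X R C (Cmp a C B X y g))"
        using y B by (simp_all add: N_def)
      have "tree_covering k a S C (pull a X R C (Cmp a C B X (x \<oplus>\<^bsub>Hom a B X\<^esub> y) g))" if C: "C \<in> Obj a" "g \<in> arr a C B" for C g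
        unfolding mod_hom_add[OF comp_linear_left[OF C(1) B X C(2)] xa ya]
      proof (rule sum[OF C(1) comp_closed[OF C(1) B X C(2) xa] comp_closed[OF C(1) B X C(2) ya] xt[OF C]])
        fix D e assume D: "D \<in> Obj a" "e \<in> arr a D C"
        show "tree_covering k a S D (pull a X R D (Cmp a D C X (Cmp a C B X y g) e))"
          using yt[OF D(1) comp_closed[OF D(1) C(1) B D(2) C(2)]] comp_assoc[OF D(1) C(1) B X D(2) C(2) ya] by simp
      qed
      then show ?thesis using B xa ya by (simp add: N_def)
    qed
    show "r \<odot>\<^bsub>Hom a B X\<^esub> x \<in> N B" if r: "r \<in> carrier k" for r
    proof -
      have rx: "r \<odot>\<^bsub>Hom a B X\<^esub> x \<in> arr a B X" using r xa by simp
      have "tree_covering k a S C (pull a X R C (Cmp a C B X (r \<odot>\<^bsub>Hom a B X\<^esub> x) g))" if C: "C \<in> Obj a" "g \<in> arr a C B" for C g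
      proof (rule tree_covering_mono[OF xt[OF C] pull_sieve[OF X C(1) R comp_closed[OF C(1) B X C(2) rx]]], intro le_funI subsetI)
        fix D e assume "e \<in> pull a X R C (Cmp a C B X x g) D"
        then have D: "D \<in> Obj a" "e \<in> arr a D C" and xe: "Cmp a D C X (Cmp a C B X x g) e \<in> R D" by (simp_all add: pull_mem)
        have "Cmp a D C X (Cmp a C B X (r \<odot>\<^bsub>Hom a B X\<^esub> x) g) e = r \<odot>\<^bsub>Hom a D X\<^esub> Cmp a D C X (Cmp a C B X x g) e"
          unfolding mod_hom_smult[OF comp_linear_left[OF C(1) B X C(2)] r xa]
          by (rule mod_hom_smult[OF comp_linear_left[OF D(1) C(1) X D(2)] r comp_closed[OF C(1) B X C(2) xa]])
        then show "e \<in> pull a X R C (Cmp a C B X (r \<odot>\<^bsub>Hom a B X\<^esub> x) g) D"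
          using D sieve_smult[OF X R r xe] by (simp add: pull_mem)
      qed
      then show ?thesis using B rx by (simp add: N_def)
    qed
    show "Cmp a C B X x g \<in> N C" if C: "C \<in> Obj a" "g \<in> arr a C B" for C g
    proof -
      have "tree_covering k a S D (pull a X R D (Cmp a D C X (Cmp a C B X x g) e))" if D: "D \<in> Obj a" "e \<in> arr a D C" for D e
        using xt[OF D(1) comp_closed[OF D(1) C(1) B D(2) C(2)]] comp_assoc[OF D(1) C(1) B X D(2) C(2) xa] by simp
      then show ?thesis using C comp_closed[OF C(1) B X C(2) xa] by (simp add: N_def)
    qed
  qed (simp add: N_def)
  \<comment> \<open>The induction hypothesis, for all arrows into a source of \<open>q\<close>, is
    membership of the component in \<open>N\<close>.\<close>
  have "cone_in q N"
    unfolding cone_in_def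
  proof
    fix \<beta> assume \<beta>: "\<beta> \<in> Ix (Dom q)"
    have Y: "At (Dom q) \<beta> \<in> Obj a" "Ent q \<beta> () \<in> arr a (At (Dom q) \<beta>) X" using c \<beta> by (auto simp: cone_def)
    have "tree_covering k a S C (pull a X R C (Cmp a C (At (Dom q) \<beta>) X (Ent q \<beta> ()) g))"
      if C: "C \<in> Obj a" "g \<in> arr a C (At (Dom q) \<beta>)" for C g
      using node.IH[OF \<beta> C] unfolding pull_pull[OF X Y C] .
    then show "Ent q \<beta> () \<in> N (At (Dom q) \<beta>)" using Y by (simp add: N_def)
  qed
  then have gN: "gen_sieve k a q \<le> N" using gen_sieve_le_cone_in[OF c N] by simp
  note A = node.prems
  have "\<exists>q'\<in>Co_tilde a S. Cod q' = one_fam A \<and>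
      (\<exists>f'. formal_morphism a f' \<and> Dom f' = Dom q' \<and> Cod f' = Dom q \<and> fcomp a q f' = fcomp a (obj_fmor A X f) q')"
    using PT[unfolded PTa_def, rule_format, OF node.hyps(1) X node.hyps(2) A] .
  then obtain q' where q': "q' \<in> Co_tilde a S" "Cod q' = one_fam A"
    and l: "\<exists>f'. formal_morphism a f' \<and> Dom f' = Dom q' \<and> Cod f' = Dom q \<and> fcomp a q f' = fcomp a (obj_fmor A X f) q'"
    by blast
  note qc = Co_tilde_tree(1,2)[OF q']
  \<comment> \<open>These composites lie in the sieve generated by \<open>q\<close>, as finite sums
    of arrows through its sources; since \<open>N\<close> is a sieve, they lie in
    \<open>N\<close>.\<close>
  have l': "\<forall>\<alpha>\<in>Ix (Dom q'). Cmp a (At (Dom q') \<alpha>) A X f (Ent q' \<alpha> ()) \<in> gen_sieve k a q (At (Dom q') \<alpha>)"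
    using l PTa_lift_iff[OF c Co_family[OF node.hyps(1)] qc A(2)] by simp
  show ?case
  proof (rule Co_tilde_tree(3)[OF q' pull_sieve[OF X A(1) R A(2)]])
    fix \<alpha> assume \<alpha>: "\<alpha> \<in> Ix (Dom q')"
    have B: "At (Dom q') \<alpha> \<in> Obj a" "Ent q' \<alpha> () \<in> arr a (At (Dom q') \<alpha>) A" using qc \<alpha> by (auto simp: cone_def)
    let ?h = "Cmp a (At (Dom q') \<alpha>) A X f (Ent q' \<alpha> ())"
    have h: "?h \<in> N (At (Dom q') \<alpha>)" using l' \<alpha> by (intro subD[OF gN]) simp
    \<comment> \<open>Membership in \<open>N\<close> is used at the identity.\<close>
    then have "tree_covering k a S (At (Dom q') \<alpha>) (pull a X R (At (Dom q') \<alpha>) (Cmp a (At (Dom q') \<alpha>) (At (Dom q') \<alpha>) X ?h (Idt a (At (Dom q') \<alpha>))))"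
      using id_closed[OF B(1)] B(1) by (simp add: N_def)
    then show "tree_covering k a S (At (Dom q') \<alpha>) (pull a A (pull a X R A f) (At (Dom q') \<alpha>) (Ent q' \<alpha> ()))"
      unfolding pull_pull[OF X A B] using id_right[OF B(1) X sieve_arr[OF X N h]] by simp
  qed
qed

lemma top_of_topology:
  assumes "PTa a S"
  shows "topology k a (top_of k a S)"
  unfolding topology_def covering_system_def top_of_iff
proof (intro conjI ballI allI impI)
  show "sieve k a A R" if "R \<in> top_of k a S A" for A R using that tree_covering_sieve by (simp add: top_of_iff)
  show "top_of k a S A = {}" if "A \<notin> Obj a" for A using that by (simp add: top_of_def sieves_over_def)
  show "tree_covering k a S A (max_sieve a A)" if "A \<in> Obj a" for A by (rule tree_covering.leaf[OF that])
  show "tree_covering k a S B (pull a A R B f)" if "R \<in> top_of k a S A" "B \<in> Obj a" "f \<in> arr a B A" for A B R f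
    using tree_covering_pull[OF assms _ that(2,3)] that(1) by (simp add: top_of_iff)
  show "tree_covering k a S A Q"
    if "A \<in> Obj a" "sieve k a A Q \<and> tree_covering k a S A R \<and> (\<forall>B\<in>Obj a. \<forall>f\<in>R B. tree_covering k a S B (pull a A Q B f))" for A Q R
  proof (rule tree_covering_trans[of A R])
    show "tree_covering k a S A R" "sieve k a A Q" using that by auto
    fix B f assume f: "f \<in> R B"
    then have "B \<in> Obj a" using tree_covering_sieve that sieve_Obj by blast
    then show "tree_covering k a S B (pull a A Q B f)" using that f by blast
  qed
qed

text \<open>By induction on trees. The arrows along which the pullback of \<open>R\<close> lies in
  \<open>J\<close> form the local closure of \<open>R\<close> in the representable presheaf, hence a
  sieve. It contains the components of \<open>q\<close>, so all of \<open>gen_sieve k a q\<close>,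
  and (T3) applies.\<close>

lemma top_of_least:
  assumes J: "topology k a J" and g: "\<And>q X. \<lbrakk>q \<in> Co S; Cod q = one_fam X\<rbrakk> \<Longrightarrow> gen_sieve k a q \<in> J X"
  shows "top_of k a S \<le> J"
proof (intro le_funI subsetI)
  interpret J: linear_site k a J by unfold_locales (rule J)
  fix X R assume "R \<in> top_of k a S X"
  then have "tree_covering k a S X R" by (simp add: top_of_iff)
  then show "R \<in> J X"
  proof (induction rule: tree_covering.induct)
    case (leaf X)
    then show ?case by (rule J.T_max)
  next
    case (node q X R)
    note c = Co_cone[OF node.hyps(1,2)] and X = node.hyps(3) and R = node.hyps(4)
    let ?L = "local_closure a J (yoneda a X) R"
    have L: "sieve k a X ?L"
      using J.closure_sub[OF yoneda_presheaf[OF X]] R by (simp add: sieve_def)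
    have "cone_in q ?L"
      using c node.IH by (auto simp: cone_in_def cone_def local_closure_def psh_all_mem pull_eq_locus)
    then have le: "gen_sieve k a q \<le> ?L" using gen_sieve_le_cone_in[OF c L] by simp
    show ?case
    proof (rule J.T_trans[OF X R g[OF node.hyps(1,2)]])
      fix B f assume "f \<in> gen_sieve k a q B"
      from subD[OF le this] show "pull a X R B f \<in> J B" by (simp add: local_closure_def pull_eq_locus)
    qed
  qed
qed

lemma gen_sieve_in_top_of:
  assumes q: "q \<in> Co S" "Cod q = one_fam X"
  shows "gen_sieve k a q \<in> top_of k a S X"
proof -
  note c = Co_cone[OF q]
  have "relabel (\<lambda>\<beta>. [\<beta>]) q \<in> Co_iter a S (Suc 0)" using q by auto
  then have r: "relabel (\<lambda>\<beta>. [\<beta>]) q \<in> Co_tilde a S" unfolding Co_tilde_def by blast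
  have "cone_in (relabel (\<lambda>\<beta>. [\<beta>]) q) (gen_sieve k a q)"
    unfolding cone_in_relabel[OF inj_singleton] using gen_sieve_comp[OF c] by (simp add: cone_in_def)
  then show ?thesis
    using Co_tilde_covering[OF r _ gen_sieve_sieve[OF c]] q(2) by (simp add: top_of_iff)
qed

end

text \<open>The union is a pretopology, so it gives a topology above all members. Each right-hand
  morphism of the union comes from some \<open>SS i\<close>, so its sieve lies in every upper bound,
  and \<open>top_of_least\<close> applies.\<close>

lemma top_join_eq:
  assumes S: "\<And>i. i \<in> I \<Longrightarrow> pretopology a (SS i)"
  shows "top_join k a I (\<lambda>i. top_of k a (SS i)) = top_of k a (\<Union>i\<in>I. SS i)"
  unfolding top_join_def
proof (rule Least_equality)
  have "pretopology a (\<Union>i\<in>I. SS i)" by (rule pretopology_UN[OF S])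
  then have s: "\<forall>s\<in>(\<Union>i\<in>I. SS i). sequence a s" and P: "PTa a (\<Union>i\<in>I. SS i)" by (auto simp: pretopology_def)
  show "topology k a (top_of k a (\<Union>i\<in>I. SS i)) \<and> (\<forall>i\<in>I. top_of k a (SS i) \<le> top_of k a (\<Union>i\<in>I. SS i))"
    using top_of_topology[OF s P] top_of_mono[of "SS _" "\<Union>i\<in>I. SS i" k a] by blast
  fix J assume J: "topology k a J \<and> (\<forall>i\<in>I. top_of k a (SS i) \<le> J)"
  show "top_of k a (\<Union>i\<in>I. SS i) \<le> J"
  proof (rule top_of_least[OF s])
    show "topology k a J" using J by simp
    fix q X assume q: "q \<in> Co (\<Union>i\<in>I. SS i)" "Cod q = one_fam X"
    then obtain i where i: "i \<in> I" "q \<in> Co (SS i)" by (auto simp: Co_def)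
    have "\<forall>s\<in>SS i. sequence a s" using S[OF i(1)] by (simp add: pretopology_def)
    note g = gen_sieve_in_top_of[OF this i(2) q(2)]
    have "top_of k a (SS i) \<le> J" using J i(1) by blast
    from subD[OF this g] show "gen_sieve k a q \<in> J X" .
  qed
qed

end

section \<open>Classes of sequences between \<open>pre'(T)\<close> and \<open>pre(T)\<close>\<close>

context linear_site
begin

text \<open>Stated for all intermediate classes, so that one argument serves both ends. The smaller
  class supplies the coverings, the larger one the conditions on kernels and generated
  sieves.\<close>

lemma between_pre_pretopology:
  fixes S :: "('i, 'o, 'm) seqn set"
  assumes inf: "infinite (UNIV :: 'i set)" and es: "essentially_small TYPE('i) a"
    and S: "pre'_of a T \<subseteq> S" "S \<subseteq> pre_of k a T"
  shows "pretopology a S" and "top_of k a S = T" and "top_fin k a S = T"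
proof -
  have seq: "\<forall>s\<in>S. sequence a s" using S(2) by (fastforce simp: pre_of_iff)
  \<comment> \<open>Depth one suffices: by \<open>generating_pre'\<close> each covering sieve is
    generated by one right-hand morphism.\<close>
  have cov: "\<exists>q\<in>Co_tilde a S. Cod q = one_fam A \<and> cone_in q R" if R: "R \<in> T A" for A R
  proof -
    obtain p :: "('i, 'i, 'o, 'm) fmor" and q where pq: "(p, q) \<in> pre'_of a T" "Cod q = one_fam A" "gen_sieve k a q = R"
      using generating_pre'[OF inf es R] by blast
    have q: "q \<in> Co S" using pq(1) S(1) by (force simp: Co_def)
    note c = Co_cone[OF seq q pq(2)]
    have "relabel (\<lambda>\<beta>. [\<beta>]) q \<in> Co_iter a S (Suc 0)" using q by auto
    then have "relabel (\<lambda>\<beta>. [\<beta>]) q \<in> Co_tilde a S" unfolding Co_tilde_def by blast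
    moreover have "cone_in (relabel (\<lambda>\<beta>. [\<beta>]) q) R"
      unfolding cone_in_relabel[OF inj_singleton] using gen_sieve_comp[OF c] pq(3) by (simp add: cone_in_def)
    ultimately show ?thesis using pq(2) by (intro bexI[of _ "relabel (\<lambda>\<beta>. [\<beta>]) q"]) auto
  qed
  have gT: "gen_sieve k a q \<in> T X" if q: "q \<in> Co S" "Cod q = one_fam X" for q X
    using q S(2) by (force simp: Co_def pre_of_iff)
  have "PTa a S"
    unfolding PTa_def
  proof (intro ballI impI)
    fix q X A f assume q: "q \<in> Co S" and X: "X \<in> Obj a" "Cod q = one_fam X" and A: "A \<in> Obj a" "f \<in> arr a A X"
    note c = Co_cone[OF seq q X(2)]
    \<comment> \<open>The pullback of the sieve of \<open>q\<close> covers by (T2), and a covering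
      inside it is what (PTa) asks for.\<close>
    obtain q' where q': "q' \<in> Co_tilde a S" "Cod q' = one_fam A" and i: "cone_in q' (pull a X (gen_sieve k a q) A f)"
      using cov[OF T_pull[OF X(1) A(1) gT[OF q X(2)] A(2)]] by blast
    have "\<forall>\<alpha>\<in>Ix (Dom q'). Cmp a (At (Dom q') \<alpha>) A X f (Ent q' \<alpha> ()) \<in> gen_sieve k a q (At (Dom q') \<alpha>)"
      using i by (simp add: cone_in_def pull_mem)
    then show "\<exists>q'\<in>Co_tilde a S. Cod q' = one_fam A \<and>
        (\<exists>f'. formal_morphism a f' \<and> Dom f' = Dom q' \<and> Cod f' = Dom q \<and> fcomp a q f' = fcomp a (obj_fmor A X f) q')"
      using PTa_lift_iff[OF c Co_family[OF seq q] Co_tilde_tree(1,2)[OF seq q'] A(2)] q' by blast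
  qed
  moreover have "PTb a S"
    unfolding PTb_def
  proof (clarify)
    fix p q A f assume pq: "(p, q) \<in> S" and A: "A \<in> Obj a" and f: "formal_morphism a f" "Dom f = one_fam A" "Cod f = Dom q"
      and z: "fcomp a q f = zero_fmor a (Dom f) (Cod q)"
    have "sequence a (p, q)" using seq pq by blast
    then obtain X where p: "formal_morphism a p" "Cod p = Dom q" and X: "Cod q = one_fam X" and c: "cone a q X"
      by (elim sequenceE) blast
    have "Ent f () \<in> psh_kernel a (fam_psh a (Dom q)) (yoneda a X) (cone_map a q) A"
      using fcomp_cone_zero_iff[OF c f(1,3)] z f(2) by simp
    moreover have "psh_kernel a (fam_psh a (Dom q)) (yoneda a X) (cone_map a q) \<le>
        local_closure a T (fam_psh a (Dom q)) (psh_image a (fam_psh a (Dom p)) (fmor_map a p))"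
      using pq S(2) X by (auto simp: pre_of_iff)
    ultimately have "Ent f () \<in> local_closure a T (fam_psh a (Dom q)) (psh_image a (fam_psh a (Dom p)) (fmor_map a p)) A"
      by (rule subD[rotated])
    \<comment> \<open>The kernel condition says that \<open>f\<close> lies locally in the image of
      \<open>p\<close>; a covering inside the witnessing sieve yields the lift.\<close>
    then obtain R where R: "R \<in> T A" and im: "\<And>B g. g \<in> R B \<Longrightarrow>
        Res (fam_psh a (Dom q)) A B g (Ent f ()) \<in> psh_image a (fam_psh a (Dom p)) (fmor_map a p) B"
      by (elim closureE) blast
    obtain q' where q': "q' \<in> Co_tilde a S" "Cod q' = one_fam A" and i: "cone_in q' R" using cov[OF R] by blast
    note c' = Co_tilde_tree(1,2)[OF seq q']
    have "\<exists>f'. formal_morphism a f' \<and> Dom f' = Dom q' \<and> Cod f' = Dom p \<and> fcomp a p f' = fcomp a f q'"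
    proof (rule PTb_lift[OF p(1) f(1,2) _ A c'])
      show "Cod f = Cod p" using f(3) p(2) by simp
      show "Res (fam_psh a (Cod p)) A (At (Dom q') \<alpha>) (Ent q' \<alpha> ()) (Ent f ())
          \<in> psh_image a (fam_psh a (Dom p)) (fmor_map a p) (At (Dom q') \<alpha>)" if "\<alpha> \<in> Ix (Dom q')" for \<alpha>
        using im i that p(2) by (simp add: cone_in_def)
    qed
    then show "\<exists>q'\<in>Co_tilde a S. Cod q' = one_fam A \<and>
        (\<exists>f'. formal_morphism a f' \<and> Dom f' = Dom q' \<and> Cod f' = Dom p \<and> fcomp a p f' = fcomp a f q')"
      using q' by blast
  qed
  ultimately show "pretopology a S" using seq by (simp add: pretopology_def)
  have 1: "T \<le> top_fin k a S"
  proof (intro le_funI subsetI)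
    fix A R assume R: "R \<in> T A"
    note A = T_Obj[OF R]
    note Rs = T_sieve[OF A R]
    obtain q where q: "q \<in> Co_tilde a S" "Cod q = one_fam A" "cone_in q R" using cov[OF R] by blast
    have "gen_sieve k a q \<le> R" using gen_sieve_le_cone_in[OF Co_tilde_tree(1)[OF seq q(1,2)] Rs] q(3) by simp
    then show "R \<in> top_fin k a S A" using q A Rs by (auto simp: top_fin_def sieves_over_def)
  qed
  have 2: "top_fin k a S \<le> top_of k a S" by (rule top_fin_le_top_of[OF seq])
  have 3: "top_of k a S \<le> T" by (rule top_of_least[OF seq topology gT])
  \<comment> \<open>The chain from \<open>T\<close> through \<open>top_fin\<close> and
    \<open>top_of\<close> back to \<open>T\<close> forces equality.\<close>
  show "top_of k a S = T" "top_fin k a S = T" using 1 2 3 by (meson antisym order_trans)+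
qed

end

text \<open>Presheaf exactness does not mention the topology, so only the covering condition can
  change.\<close>

lemma pre'_of_mono:
  assumes "linear_category k a" "topology k a T1" "topology k a T2" "T1 \<le> T2"
  shows "pre'_of a T1 \<subseteq> pre'_of a T2"
proof (clarify)
  fix p q assume "(p, q) \<in> pre'_of a T1"
  moreover have "linear_site k a T1" "linear_site k a T2"
    using assms by (auto simp: linear_site_def linear_site_axioms_def)
  ultimately show "(p, q) \<in> pre'_of a T2"
    using subD[OF assms(4)] by (auto simp: linear_site.pre'_of_iff)
qed


theorem theorem2p2p5:
  fixes k :: "'k ring" and a :: "('k, 'o, 'm) lincat"
    and T :: "('o, 'm) cov" and S :: "('i, 'o, 'm) seqn set"
  assumes "linear_category k a"
    and "infinite (UNIV :: 'i set)"
    and "essentially_small TYPE('i) a"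
    and "topology k a T"
    and "pretopology a S"
  shows
    "(pretopology a (pre_of k a T :: ('i, 'o, 'm) seqn set) \<and>
      pretopology a (pre'_of a T :: ('i, 'o, 'm) seqn set)) \<and>
     topology k a (top_of k a S) \<and>
     (top_of k a (pre'_of a T :: ('i, 'o, 'm) seqn set) = T \<and>
      T = top_of k a (pre_of k a T :: ('i, 'o, 'm) seqn set) \<and>
      top_fin k a (pre'_of a T :: ('i, 'o, 'm) seqn set) = T \<and>
      T = top_fin k a (pre_of k a T :: ('i, 'o, 'm) seqn set)) \<and>
     ((\<forall>T1 T2. topology k a T1 \<and> topology k a T2 \<and> T1 \<le> T2 \<longrightarrow>
        (pre'_of a T1 :: ('i, 'o, 'm) seqn set) \<subseteq> pre'_of a T2) \<and>
      (\<forall>S1 S2 :: ('i, 'o, 'm) seqn set. pretopology a S1 \<and> pretopology a S2 \<and> S1 \<subseteq> S2 \<longrightarrow>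
        top_of k a S1 \<le> top_of k a S2 \<and> top_fin k a S1 \<le> top_fin k a S2)) \<and>
     (\<forall>(I :: 'j set) (SS :: 'j \<Rightarrow> ('i, 'o, 'm) seqn set). (\<forall>i\<in>I. pretopology a (SS i)) \<longrightarrow>
        (let TT = (\<lambda>i. top_of k a (SS i)) in
          top_join k a I TT = top_of k a (\<Union>i\<in>I. SS i) \<and>
          top_join k a I TT = top_of k a (\<Union>i\<in>I. pre_of k a (TT i) :: ('i, 'o, 'm) seqn set)))"
proof -
  interpret linear_site k a T
    using assms(1,4) by (simp add: linear_site_def linear_site_axioms_def)
  note inf = assms(2) and es = assms(3)
  have site: "linear_site k a J" if "topology k a J" for J
    using assms(1) that by (simp add: linear_site_def linear_site_axioms_def)
  note pre = between_pre_pretopology[OF inf es pre'_of_subset_pre_of subset_refl]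
  note pre' = between_pre_pretopology[OF inf es subset_refl pre'_of_subset_pre_of]
  have top: "topology k a (top_of k a S')" if "pretopology a S'" for S' :: "('i, 'o, 'm) seqn set"
    using that by (intro top_of_topology) (simp_all add: pretopology_def)
  have join: "let TT = (\<lambda>i. top_of k a (SS i)) in
      top_join k a I TT = top_of k a (\<Union>i\<in>I. SS i) \<and>
      top_join k a I TT = top_of k a (\<Union>i\<in>I. pre_of k a (TT i) :: ('i, 'o, 'm) seqn set)"
    if SS: "\<forall>i\<in>I. pretopology a (SS i)" for I :: "'j set" and SS :: "'j \<Rightarrow> ('i, 'o, 'm) seqn set"
  proof -
    let ?P = "\<lambda>i. pre_of k a (top_of k a (SS i)) :: ('i, 'o, 'm) seqn set"
    have P: "pretopology a (?P i)" "top_of k a (?P i) = top_of k a (SS i)" if "i \<in> I" for i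
    proof -
      interpret i: linear_site k a "top_of k a (SS i)"
        using site top SS that by blast
      show "pretopology a (?P i)" "top_of k a (?P i) = top_of k a (SS i)"
        by (rule i.between_pre_pretopology[OF inf es i.pre'_of_subset_pre_of subset_refl])+
    qed
    \<comment> \<open>The join depends on the topologies alone, and \<open>?P i\<close> induces the
      same one as \<open>SS i\<close>.\<close>
    have "top_join k a I (\<lambda>i. top_of k a (SS i)) = top_join k a I (\<lambda>i. top_of k a (?P i))"
      using P(2) by (simp add: top_join_def)
    also have "\<dots> = top_of k a (\<Union>i\<in>I. ?P i)" by (rule top_join_eq[OF P(1)])
    finally show ?thesis using top_join_eq[of I SS] SS by (simp add: Let_def)
  qed
  show ?thesis
  proof (intro conjI allI impI)
    show "pretopology a (pre_of k a T :: ('i, 'o, 'm) seqn set)" by (rule pre(1))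
    show "pretopology a (pre'_of a T :: ('i, 'o, 'm) seqn set)" by (rule pre'(1))
    show "topology k a (top_of k a S)" by (rule top[OF assms(5)])
    show "top_of k a (pre'_of a T :: ('i, 'o, 'm) seqn set) = T" by (rule pre'(2))
    show "T = top_of k a (pre_of k a T :: ('i, 'o, 'm) seqn set)" by (rule pre(2)[symmetric])
    show "top_fin k a (pre'_of a T :: ('i, 'o, 'm) seqn set) = T" by (rule pre'(3))
    show "T = top_fin k a (pre_of k a T :: ('i, 'o, 'm) seqn set)" by (rule pre(3)[symmetric])
  next
    fix T1 T2 assume "topology k a T1 \<and> topology k a T2 \<and> T1 \<le> T2"
    then show "(pre'_of a T1 :: ('i, 'o, 'm) seqn set) \<subseteq> pre'_of a T2"
      by (intro pre'_of_mono[OF assms(1)]) auto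
  next
    fix S1 S2 :: "('i, 'o, 'm) seqn set" assume "pretopology a S1 \<and> pretopology a S2 \<and> S1 \<subseteq> S2"
    then show "top_of k a S1 \<le> top_of k a S2" "top_fin k a S1 \<le> top_fin k a S2"
      by (simp_all add: top_of_mono top_fin_mono)
  next
    fix I :: "'j set" and SS :: "'j \<Rightarrow> ('i, 'o, 'm) seqn set"
    assume "\<forall>i\<in>I. pretopology a (SS i)"
    then show "let TT = (\<lambda>i. top_of k a (SS i)) in
          top_join k a I TT = top_of k a (\<Union>i\<in>I. SS i) \<and>
          top_join k a I TT = top_of k a (\<Union>i\<in>I. pre_of k a (TT i) :: ('i, 'o, 'm) seqn set)"
      by (rule join)
  qed
qed

end
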